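(* Let $(M,D,g)$ be a compact Hesse soliton, that is, a compact Hessian manifold for which there exist a vector field $X$ on $M$ and $\lambda\in\mathbb{R}$ with $\beta-\frac12\mathcal{L}_Xg=\lambda g$, where $\beta$ is the second Koszul form. Then: (1) The soliton cannot be shrinking; that is, there exist no compact shrinking Hesse solitons ($\lambda<0$). (2) If the soliton is steady ($\lambda=0$), then it is non proper (i.e. $D=\nabla$, the Levi-Civita connection of $g$) and trivial (i.e. $(M,D,g)$ is Hesse-Einstein).
   Context: All manifolds are smooth, without boundary, of dimension $n\ge 1$. A connection $D$ on $TM$ is flat if it is torsion free and its curvature tensor vanishes. A Hessian manifold $(M,D,g)$ is a manifold $M$ with a flat connection $D$ and a Riemannian metric $g$ that is locally of the form $g=Dd\varphi$ for a smooth function $\varphi$, i.e. $g_{ij}=\partial_i\partial_j\varphi$ in affine coordinates (local coordinates with $D_{\partial_i}\partial_j=0$). $\nabla$ denotes the Levi-Civita connection of $g$. With $v_g$ the (local) volume form of $g$, the first Koszul form $\alpha$ and second Koszul form $\beta$ are defined by $D_Xv_g=\alpha(X)v_g$ and $\beta=D\alpha$. The Hessian manifold is proper if $D\neq\nabla$, and non proper if $D=\nabla$. It is Hesse-Einstein if $\beta=\lambda g$ for some constant $\lambda\in\mathbb{R}$. A Hesse soliton is a Hessian manifold $(M,D,g)$ for which there exist a vector field $X$ and $\lambda\in\mathbb{R}$ with $\beta-\frac12\mathcal{L}_Xg=\lambda g$, where $\mathcal{L}_X$ is the Lie derivative. It is called expanding, steady or shrinking if $\lambda>0$, $\lambda=0$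 or $\lambda<0$, respectively. It is called trivial if $(M,D,g)$ is Hesse-Einstein. *)

theory Defs
  imports "HOL-Analysis.Analysis"
begin

section \<open>Smooth functions on open subsets of Euclidean space\<close>

text \<open>Class \<open>C\<^sup>k\<close> through continuity of iterated partial derivatives; meaningful for open \<open>S\<close>.\<close>

definition partial_deriv :: "'n::finite \<Rightarrow> (real ^ 'n \<Rightarrow> 'b::real_normed_vector) \<Rightarrow> real ^ 'n \<Rightarrow> 'b"
  where "partial_deriv i f x = frechet_derivative f (at x) (axis i 1)"

primrec Ck_on :: "nat \<Rightarrow> (real ^ 'n) set \<Rightarrow> (real ^ 'n \<Rightarrow> 'b::real_normed_vector) \<Rightarrow> bool"
  where
    "Ck_on 0 S f \<longleftrightarrow> continuous_on S f"
  | "Ck_on (Suc k) S f \<longleftrightarrow> f differentiable_on S \<and> (\<forall>i. Ck_on k S (partial_deriv i f))"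

definition smooth_on :: "(real ^ 'n::finite) set \<Rightarrow> (real ^ 'n \<Rightarrow> 'b::real_normed_vector) \<Rightarrow> bool"
  where "smooth_on S f \<longleftrightarrow> (\<forall>k. Ck_on k S f)"


section \<open>Smooth manifolds\<close>

text \<open>A chart is a pair of a domain and a coordinate map; the values of the coordinate map outside
  the domain are irrelevant. The dimension is \<open>CARD('n) \<ge> 1\<close>.\<close>

type_synonym ('a, 'n) chart = "'a set \<times> ('a \<Rightarrow> real ^ 'n)"

definition chart_inv :: "('a, 'n::finite) chart \<Rightarrow> real ^ 'n \<Rightarrow> 'a"
  where "chart_inv c = inv_into (fst c) (snd c)"

definition is_chart :: "'a topology \<Rightarrow> ('a, 'n::finite) chart \<Rightarrow> bool"
  where "is_chart M c \<longleftrightarrow> openin M (fst c) \<and> open (snd c ` fst c) \<and>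
    homeomorphic_map (subtopology M (fst c)) (top_of_set (snd c ` fst c)) (snd c)"

text \<open>The atlas need not be maximal, and the manifold need not be connected. The empty space is
  excluded: on it, every tensor equation holds vacuously.\<close>

definition smooth_manifold :: "'a topology \<Rightarrow> ('a, 'n::finite) chart set \<Rightarrow> bool"
  where "smooth_manifold M A \<longleftrightarrow>
    topspace M \<noteq> {} \<and> Hausdorff_space M \<and> second_countable M \<and>
    (\<forall>c\<in>A. is_chart M c) \<and> (\<Union>c\<in>A. fst c) = topspace M \<and>
    (\<forall>c\<in>A. \<forall>d\<in>A. smooth_on (snd c ` (fst c \<inter> fst d)) (snd d \<circ> chart_inv c))"

definition smooth_fun :: "('a, 'n::finite) chart set \<Rightarrow> 'a set \<Rightarrow> ('a \<Rightarrow> real) \<Rightarrow> bool"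
  where "smooth_fun A W f \<longleftrightarrow> (\<forall>c\<in>A. smooth_on (snd c ` (fst c \<inter> W)) (f \<circ> chart_inv c))"

text \<open>Tangent vectors at \<open>p\<close> are represented by their components in a preferred chart
  \<open>chart_at A p\<close> around \<open>p\<close>. The components in another chart \<open>c\<close> (that is, the values
  of the coordinate differentials) are obtained by applying the derivative of the transition map.\<close>

definition chart_at :: "('a, 'n::finite) chart set \<Rightarrow> 'a \<Rightarrow> ('a, 'n) chart"
  where "chart_at A p = (SOME c. c \<in> A \<and> p \<in> fst c)"

definition components ::
    "('a, 'n::finite) chart set \<Rightarrow> ('a, 'n) chart \<Rightarrow> 'a \<Rightarrow> real ^ 'n \<Rightarrow> real ^ 'n"
  where "components A c p =
    frechet_derivative (snd c \<circ> chart_inv (chart_at A p)) (at (snd (chart_at A p) p))"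

definition coord_vector :: "('a, 'n::finite) chart set \<Rightarrow> ('a, 'n) chart \<Rightarrow> 'n \<Rightarrow> 'a \<Rightarrow> real ^ 'n"
  where "coord_vector A c i p =
    frechet_derivative (snd (chart_at A p) \<circ> chart_inv c) (at (snd c p)) (axis i 1)"

type_synonym ('a, 'n) vfield = "'a \<Rightarrow> real ^ 'n"

definition local_rep ::
    "('a, 'n::finite) chart set \<Rightarrow> ('a, 'n) chart \<Rightarrow> ('a, 'n) vfield \<Rightarrow> real ^ 'n \<Rightarrow> real ^ 'n"
  where "local_rep A c X x = components A c (chart_inv c x) (X (chart_inv c x))"

text \<open>The smooth vector fields on an open set \<open>W\<close>; values outside \<open>W\<close> are irrelevant.\<close>

definition vfields :: "('a, 'n::finite) chart set \<Rightarrow> 'a set \<Rightarrow> ('a, 'n) vfield set"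
  where "vfields A W = {X. \<forall>c\<in>A. smooth_on (snd c ` (fst c \<inter> W)) (local_rep A c X)}"

text \<open>\<open>differential A f p (X p)\<close> is the derivative \<open>X f\<close> at \<open>p\<close>.\<close>

definition differential :: "('a, 'n::finite) chart set \<Rightarrow> ('a \<Rightarrow> real) \<Rightarrow> 'a \<Rightarrow> real ^ 'n \<Rightarrow> real"
  where "differential A f p =
    frechet_derivative (f \<circ> chart_inv (chart_at A p)) (at (snd (chart_at A p) p))"

text \<open>\<open>[X,Y]\<^sup>i = X\<^sup>j \<partial>\<^sub>j Y\<^sup>i - Y\<^sup>j \<partial>\<^sub>j X\<^sup>i\<close>, computed in the preferred chart.\<close>

definition lie_bracket ::
    "('a, 'n::finite) chart set \<Rightarrow> ('a, 'n) vfield \<Rightarrow> ('a, 'n) vfield \<Rightarrow> ('a, 'n) vfield"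
  where "lie_bracket A X Y p =
    frechet_derivative (local_rep A (chart_at A p) Y) (at (snd (chart_at A p) p)) (X p) -
    frechet_derivative (local_rep A (chart_at A p) X) (at (snd (chart_at A p) p)) (Y p)"


section \<open>Connections\<close>

text \<open>A connection acts on the smooth vector fields of every open set, compatibly with restriction:
  this is the last conjunct, which also makes the values of \<open>D\<close> insensitive to the
  irrelevant part of its arguments.\<close>

type_synonym ('a, 'n) conn = "('a, 'n) vfield \<Rightarrow> ('a, 'n) vfield \<Rightarrow> ('a, 'n) vfield"

definition connection :: "'a topology \<Rightarrow> ('a, 'n::finite) chart set \<Rightarrow> ('a, 'n) conn \<Rightarrow> bool"
  where "connection M A D \<longleftrightarrow>
    (\<forall>W. openin M W \<longrightarrow> (\<forall>X\<in>vfields A W. \<forall>Y\<in>vfields A W.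
      D X Y \<in> vfields A W \<and>
      (\<forall>X'\<in>vfields A W. \<forall>p\<in>W. D (\<lambda>q. X q + X' q) Y p = D X Y p + D X' Y p) \<and>
      (\<forall>Y'\<in>vfields A W. \<forall>p\<in>W. D X (\<lambda>q. Y q + Y' q) p = D X Y p + D X Y' p) \<and>
      (\<forall>f. smooth_fun A W f \<longrightarrow> (\<forall>p\<in>W. D (\<lambda>q. f q *\<^sub>R X q) Y p = f p *\<^sub>R D X Y p)) \<and>
      (\<forall>f. smooth_fun A W f \<longrightarrow> (\<forall>p\<in>W. D X (\<lambda>q. f q *\<^sub>R Y q) p =
        differential A f p (X p) *\<^sub>R Y p + f p *\<^sub>R D X Y p)) \<and>
      (\<forall>X' Y'. (\<forall>p\<in>W. X' p = X p \<and> Y' p = Y p) \<longrightarrow> (\<forall>p\<in>W. D X' Y' p = D X Y p))))"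

definition same_connection ::
    "'a topology \<Rightarrow> ('a, 'n::finite) chart set \<Rightarrow> ('a, 'n) conn \<Rightarrow> ('a, 'n) conn \<Rightarrow> bool"
  where "same_connection M A D D' \<longleftrightarrow>
    (\<forall>W. openin M W \<longrightarrow> (\<forall>X\<in>vfields A W. \<forall>Y\<in>vfields A W. \<forall>p\<in>W. D X Y p = D' X Y p))"

definition torsion_free :: "'a topology \<Rightarrow> ('a, 'n::finite) chart set \<Rightarrow> ('a, 'n) conn \<Rightarrow> bool"
  where "torsion_free M A D \<longleftrightarrow>
    (\<forall>W. openin M W \<longrightarrow> (\<forall>X\<in>vfields A W. \<forall>Y\<in>vfields A W. \<forall>p\<in>W.
      D X Y p - D Y X p - lie_bracket A X Y p = 0))"

definition curvature ::
    "('a, 'n::finite) chart set \<Rightarrow> ('a, 'n) conn \<Rightarrow> ('a, 'n) vfield \<Rightarrow> ('a, 'n) vfield \<Rightarrow>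
      ('a, 'n) vfield \<Rightarrow> ('a, 'n) vfield"
  where "curvature A D X Y Z p = D X (D Y Z) p - D Y (D X Z) p - D (lie_bracket A X Y) Z p"

definition flat_connection :: "'a topology \<Rightarrow> ('a, 'n::finite) chart set \<Rightarrow> ('a, 'n) conn \<Rightarrow> bool"
  where "flat_connection M A D \<longleftrightarrow> connection M A D \<and> torsion_free M A D \<and>
    (\<forall>W. openin M W \<longrightarrow> (\<forall>X\<in>vfields A W. \<forall>Y\<in>vfields A W. \<forall>Z\<in>vfields A W. \<forall>p\<in>W.
      curvature A D X Y Z p = 0))"

text \<open>\<open>(D\<omega>)(X,Y) = (D\<^sub>X \<omega>)(Y) = X(\<omega>(Y)) - \<omega>(D\<^sub>X Y)\<close> for a one-form \<open>\<omega>\<close>.\<close>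

definition cov_form ::
    "('a, 'n::finite) chart set \<Rightarrow> ('a, 'n) conn \<Rightarrow> ('a \<Rightarrow> real ^ 'n \<Rightarrow> real) \<Rightarrow>
      ('a, 'n) vfield \<Rightarrow> ('a, 'n) vfield \<Rightarrow> 'a \<Rightarrow> real"
  where "cov_form A D \<omega> X Y p = differential A (\<lambda>q. \<omega> q (Y q)) p (X p) - \<omega> p (D X Y p)"

text \<open>\<open>(D\<^sub>X \<omega>)(Y\<^sub>1,\<dots>,Y\<^sub>n) = X(\<omega>(Y\<^sub>1,\<dots>,Y\<^sub>n)) - \<Sum>\<^sub>i \<omega>(Y\<^sub>1,\<dots>,D\<^sub>X Y\<^sub>i,\<dots>,Y\<^sub>n)\<close> for an \<open>n\<close>-form \<open>\<omega>\<close>.\<close>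

definition cov_top_form ::
    "('a, 'n::finite) chart set \<Rightarrow> ('a, 'n) conn \<Rightarrow> ('a \<Rightarrow> ('n \<Rightarrow> real ^ 'n) \<Rightarrow> real) \<Rightarrow>
      ('a, 'n) vfield \<Rightarrow> ('n \<Rightarrow> ('a, 'n) vfield) \<Rightarrow> 'a \<Rightarrow> real"
  where "cov_top_form A D \<omega> X Y p =
    differential A (\<lambda>q. \<omega> q (\<lambda>j. Y j q)) p (X p) -
    (\<Sum>i\<in>UNIV. \<omega> p (\<lambda>j. (Y(i := D X (Y i))) j p))"


section \<open>Riemannian metrics\<close>

type_synonym ('a, 'n) metric = "'a \<Rightarrow> real ^ 'n \<Rightarrow> real ^ 'n \<Rightarrow> real"

definition riemannian_metric :: "'a topology \<Rightarrow> ('a, 'n::finite) chart set \<Rightarrow> ('a, 'n) metric \<Rightarrow> bool"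
  where "riemannian_metric M A g \<longleftrightarrow>
    (\<forall>p\<in>topspace M. bilinear (g p) \<and> (\<forall>u v. g p u v = g p v u) \<and> (\<forall>v. v \<noteq> 0 \<longrightarrow> g p v v > 0)) \<and>
    (\<forall>W. openin M W \<longrightarrow> (\<forall>X\<in>vfields A W. \<forall>Y\<in>vfields A W.
      smooth_fun A W (\<lambda>p. g p (X p) (Y p))))"

definition levi_civita ::
    "'a topology \<Rightarrow> ('a, 'n::finite) chart set \<Rightarrow> ('a, 'n) metric \<Rightarrow> ('a, 'n) conn \<Rightarrow> bool"
  where "levi_civita M A g N \<longleftrightarrow> connection M A N \<and> torsion_free M A N \<and>
    (\<forall>W. openin M W \<longrightarrow> (\<forall>X\<in>vfields A W. \<forall>Y\<in>vfields A W. \<forall>Z\<in>vfields A W. \<forall>p\<in>W.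
      differential A (\<lambda>q. g q (Y q) (Z q)) p (X p) = g p (N X Y p) (Z p) + g p (Y p) (N X Z p)))"

text \<open>\<open>(L\<^sub>Z g)(X,Y) = Z(g(X,Y)) - g([Z,X],Y) - g(X,[Z,Y])\<close>.\<close>

definition lie_deriv_metric ::
    "('a, 'n::finite) chart set \<Rightarrow> ('a, 'n) vfield \<Rightarrow> ('a, 'n) metric \<Rightarrow>
      ('a, 'n) vfield \<Rightarrow> ('a, 'n) vfield \<Rightarrow> 'a \<Rightarrow> real"
  where "lie_deriv_metric A Z g X Y p =
    differential A (\<lambda>q. g q (X q) (Y q)) p (Z p) -
    g p (lie_bracket A Z X p) (Y p) - g p (X p) (lie_bracket A Z Y p)"

text \<open>The local volume form \<open>\<surd>(det (g\<^sub>i\<^sub>j)) dx\<^sup>1 \<and> \<dots> \<and> dx\<^sup>n\<close> on the domain of the chart \<open>c\<close>, for the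
  orientation given by \<open>c\<close>.\<close>

definition volume_form ::
    "('a, 'n::finite) chart set \<Rightarrow> ('a, 'n) metric \<Rightarrow> ('a, 'n) chart \<Rightarrow> 'a \<Rightarrow> ('n \<Rightarrow> real ^ 'n) \<Rightarrow> real"
  where "volume_form A g c p v =
    sqrt (det (\<chi> i j. g p (coord_vector A c i p) (coord_vector A c j p))) *
    det (\<chi> i j. components A c p (v j) $ i)"


section \<open>Hessian manifolds and Hesse solitons\<close>

definition hessian_manifold ::
    "'a topology \<Rightarrow> ('a, 'n::finite) chart set \<Rightarrow> ('a, 'n) conn \<Rightarrow> ('a, 'n) metric \<Rightarrow> bool"
  where "hessian_manifold M A D g \<longleftrightarrow>
    smooth_manifold M A \<and> flat_connection M A D \<and> riemannian_metric M A g \<and>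
    (\<forall>p\<in>topspace M. \<exists>W \<phi>. openin M W \<and> p \<in> W \<and> smooth_fun A W \<phi> \<and>
      (\<forall>X\<in>vfields A W. \<forall>Y\<in>vfields A W. \<forall>q\<in>W.
        g q (X q) (Y q) = cov_form A D (differential A \<phi>) X Y q))"

text \<open>\<open>\<alpha>\<close> is characterized by \<open>D\<^sub>X v\<^sub>g = \<alpha>(X) v\<^sub>g\<close>; since \<open>v\<^sub>g\<close> is determined up to sign, the choice of
  the chart is immaterial.\<close>

definition koszul1 ::
    "('a, 'n::finite) chart set \<Rightarrow> ('a, 'n) conn \<Rightarrow> ('a, 'n) metric \<Rightarrow> 'a \<Rightarrow> real ^ 'n \<Rightarrow> real"
  where "koszul1 A D g p u = (THE a. \<forall>c\<in>A. p \<in> fst c \<longrightarrow>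
    (\<forall>X Y. X \<in> vfields A (fst c) \<and> X p = u \<and> (\<forall>i. Y i \<in> vfields A (fst c)) \<longrightarrow>
      cov_top_form A D (volume_form A g c) X Y p = a * volume_form A g c p (\<lambda>i. Y i p)))"

definition koszul2 ::
    "('a, 'n::finite) chart set \<Rightarrow> ('a, 'n) conn \<Rightarrow> ('a, 'n) metric \<Rightarrow>
      ('a, 'n) vfield \<Rightarrow> ('a, 'n) vfield \<Rightarrow> 'a \<Rightarrow> real"
  where "koszul2 A D g = cov_form A D (koszul1 A D g)"

definition hesse_einstein ::
    "'a topology \<Rightarrow> ('a, 'n::finite) chart set \<Rightarrow> ('a, 'n) conn \<Rightarrow> ('a, 'n) metric \<Rightarrow> bool"
  where "hesse_einstein M A D g \<longleftrightarrow> hessian_manifold M A D g \<and>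
    (\<exists>l. \<forall>W. openin M W \<longrightarrow> (\<forall>X\<in>vfields A W. \<forall>Y\<in>vfields A W. \<forall>p\<in>W.
      koszul2 A D g X Y p = l * g p (X p) (Y p)))"

definition non_proper ::
    "'a topology \<Rightarrow> ('a, 'n::finite) chart set \<Rightarrow> ('a, 'n) conn \<Rightarrow> ('a, 'n) metric \<Rightarrow> bool"
  where "non_proper M A D g \<longleftrightarrow> (\<exists>N. levi_civita M A g N \<and> same_connection M A D N)"

definition hesse_soliton ::
    "'a topology \<Rightarrow> ('a, 'n::finite) chart set \<Rightarrow> ('a, 'n) conn \<Rightarrow> ('a, 'n) metric \<Rightarrow>
      ('a, 'n) vfield \<Rightarrow> real \<Rightarrow> bool"
  where "hesse_soliton M A D g X l \<longleftrightarrow>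
    hessian_manifold M A D g \<and> X \<in> vfields A (topspace M) \<and>
    (\<forall>W. openin M W \<longrightarrow> (\<forall>Y\<in>vfields A W. \<forall>Z\<in>vfields A W. \<forall>p\<in>W.
      koszul2 A D g Y Z p - 1 / 2 * lie_deriv_metric A X g Y Z p = l * g p (Y p) (Z p)))"

end

theory Submission
  imports Defs
begin

text \<open>Tracing the soliton equation and integrating over \<open>M\<close> gives \<open>\<integral> |\<alpha>|\<^sup>2 = \<lambda> n vol M\<close>, because the
  divergence of the field \<open>\<alpha>\<^sup>\<sharp> - X\<close> equals \<open>\<lambda> n - |\<alpha>|\<^sup>2\<close>. So \<open>\<lambda> \<ge> 0\<close>, and \<open>\<alpha> = 0\<close> if \<open>\<lambda> = 0\<close>.

  If \<open>\<alpha> = 0\<close>, then \<open>log det (g\<^sub>i\<^sub>j)\<close> is constant in affine coordinates, and an argument of Calabi type applies: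
  let \<open>m\<close> be the maximum of the cubic form \<open>D g\<close> over the unit vectors, attained at \<open>e\<close>, and let \<open>S = D\<^sub>e g\<close>. The
  second-order conditions along the fields \<open>E + s w\<close>, with \<open>E\<close> the parallel extension of \<open>e\<close>, \<open>s\<close> a
  coordinate function and \<open>w = - S e\<^sub>k / 2\<close>, summed over an orthonormal basis \<open>e\<^sub>k\<close>, together with those in
  the fibre, give \<open>m |S|\<^sup>2 \<le> 0\<close>, hence \<open>m = 0\<close>. Then \<open>D g = 0\<close>, so \<open>D\<close> is the Levi-Civita connection.\<close>

section \<open>Calculus of smooth functions\<close>

text \<open>The field w is dictated by the Levi-Civita connection. Since D g is totally symmetric,
  the Levi-Civita derivative of a D-parallel field E along \<open>e_k\<close> is
  \<open>S e_k / 2\<close> at the maximum; thus E + s w is Levi-Civita parallel there in this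
  direction and keeps unit length to first order. Summation over k produces traces of the second and
  third derivatives of g, which the condition \<alpha> = 0 expresses through S. The terms that pair
  S with second derivatives of g cancel, and only an inequality between m |S|^2 and tr S^3 is left,
  with a constant that contradicts the conditions in the fibre unless m = 0.

  Affine coordinates are not part of the data. D-parallel frames replace them: these exist because
  the curvature vanishes and commute because the torsion vanishes, so derivatives along them obey
  the rules of partial derivatives. Nor is an orientation part of the data: integration uses the
  density of the metric, and \<alpha> is computed from the square of the volume form, which carries
  no sign.\<close>

lemma Ck_on_cong:
  fixes f :: "real ^ 'n::finite \<Rightarrow> 'b::real_normed_vector"
  assumes "open S" "Ck_on k S f" "\<And>x. x \<in> S \<Longrightarrow> f x = g x"
  shows "Ck_on k S g"
  using assms(2,3)
proof (induction k arbitrary: f g)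
  case 0
  then show ?case using continuous_on_cong by (metis Ck_on.simps(1))
next
  case (Suc k)
  have fd: "f differentiable_on S" using Suc by simp
  have hd: "(g has_derivative frechet_derivative f (at x)) (at x)" if "x \<in> S" for x
  proof -
    have "(f has_derivative frechet_derivative f (at x)) (at x)"
      using fd that assms(1) by (meson differentiable_on_eq_differentiable_at frechet_derivative_works)
    then show ?thesis
      by (rule has_derivative_transform_within_open[OF _ assms(1) that]) (use Suc in auto)
  qed
  have "g differentiable_on S"
    using hd by (meson differentiable_at_imp_differentiable_on differentiable_def)
  moreover have "Ck_on k S (partial_deriv i g)" for i
  proof (rule Suc.IH[of "partial_deriv i f"])
    show "Ck_on k S (partial_deriv i f)" using Suc by simp
    show "partial_deriv i f x = partial_deriv i g x" if "x \<in> S" for x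
      unfolding partial_deriv_def using frechet_derivative_at[OF hd[OF that]] by simp
  qed
  ultimately show ?case by simp
qed

lemma Ck_on_subset: "Ck_on k S f \<Longrightarrow> T \<subseteq> S \<Longrightarrow> Ck_on k T f"
  by (induction k arbitrary: f) (auto intro: continuous_on_subset differentiable_on_subset)

lemma Ck_on_Suc_D: "Ck_on (Suc k) S f \<Longrightarrow> Ck_on k S f"
  by (induction k arbitrary: f) (auto intro: differentiable_imp_continuous_on)

text \<open>The derivative enters as an explicit candidate \<open>f'\<close>, so that each closure
  property below reduces to a differentiation rule and the induction hypothesis for the resulting
  formula.\<close>

lemma Ck_on_SucI:
  assumes "open S" "\<And>x. x \<in> S \<Longrightarrow> (f has_derivative f' x) (at x)"
    and "\<And>i. Ck_on k S (\<lambda>x. f' x (axis i 1))"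
  shows "Ck_on (Suc k) S f"
proof -
  have "f differentiable_on S"
    using assms(2) by (meson differentiable_at_imp_differentiable_on differentiable_def)
  moreover have "Ck_on k S (partial_deriv i f)" for i
    by (rule Ck_on_cong[OF assms(1) assms(3)[of i]])
      (simp add: partial_deriv_def frechet_derivative_at[OF assms(2), symmetric])
  ultimately show ?thesis by simp
qed

lemma Ck_on_has_derivative:
  assumes "open S" "Ck_on (Suc k) S f" "x \<in> S"
  shows "(f has_derivative frechet_derivative f (at x)) (at x)"
  using assms by (auto simp: differentiable_on_eq_differentiable_at frechet_derivative_works[symmetric])

lemma Ck_on_const: "open S \<Longrightarrow> Ck_on k S (\<lambda>x. c)"
proof (induction k arbitrary: c)
  case (Suc k)
  show ?case by (rule Ck_on_SucI[where f' = "\<lambda>x h. 0"]) (use Suc in auto)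
qed auto

lemma Ck_on_linear_image:
  assumes "bounded_linear L" "open S"
  shows "Ck_on k S f \<Longrightarrow> Ck_on k S (\<lambda>x. L (f x))"
proof (induction k arbitrary: f)
  case 0
  then show ?case using assms bounded_linear.continuous_on by auto
next
  case (Suc k)
  show ?case
  proof (rule Ck_on_SucI[OF assms(2)])
    show "((\<lambda>x. L (f x)) has_derivative (\<lambda>h. L (frechet_derivative f (at x) h))) (at x)" if "x \<in> S" for x
      using bounded_linear.has_derivative[OF assms(1) Ck_on_has_derivative[OF assms(2) Suc.prems that]] .
    show "Ck_on k S (\<lambda>x. L (frechet_derivative f (at x) (axis i 1)))" for i
      unfolding partial_deriv_def[symmetric] using Suc.IH[of "partial_deriv i f"] Suc.prems by auto
  qed
qed

lemma Ck_on_add: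
  assumes "open S"
  shows "Ck_on k S f \<Longrightarrow> Ck_on k S g \<Longrightarrow> Ck_on k S (\<lambda>x. f x + g x)"
proof (induction k arbitrary: f g)
  case 0
  then show ?case by (auto intro: continuous_intros)
next
  case (Suc k)
  show ?case
  proof (rule Ck_on_SucI[OF assms])
    show "((\<lambda>x. f x + g x) has_derivative
        (\<lambda>h. frechet_derivative f (at x) h + frechet_derivative g (at x) h)) (at x)" if "x \<in> S" for x
      using Ck_on_has_derivative[OF assms _ that] Suc.prems by (blast intro: has_derivative_add)
    show "Ck_on k S (\<lambda>x. frechet_derivative f (at x) (axis i 1) + frechet_derivative g (at x) (axis i 1))" for i
      unfolding partial_deriv_def[symmetric]
      using Suc.IH[of "partial_deriv i f" "partial_deriv i g"] Suc.prems by auto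
  qed
qed

lemma Ck_on_sum:
  assumes "open S" "\<And>i. i \<in> I \<Longrightarrow> Ck_on k S (f i)"
  shows "Ck_on k S (\<lambda>x. \<Sum>i\<in>I. f i x)"
  using assms(2) by (induction I rule: infinite_finite_induct) (auto intro: Ck_on_const Ck_on_add assms(1))

lemma Ck_on_bilinear:
  assumes "bounded_bilinear B" "open S"
  shows "Ck_on k S f \<Longrightarrow> Ck_on k S g \<Longrightarrow> Ck_on k S (\<lambda>x. B (f x) (g x))"
proof (induction k arbitrary: f g)
  case 0
  then show ?case using bounded_bilinear.continuous_on[OF assms(1)] by auto
next
  case (Suc k)
  show ?case
  proof (rule Ck_on_SucI[OF assms(2)])
    show "((\<lambda>x. B (f x) (g x)) has_derivative
        (\<lambda>h. B (f x) (frechet_derivative g (at x) h) + B (frechet_derivative f (at x) h) (g x))) (at x)"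
      if "x \<in> S" for x
      by (rule bounded_bilinear.FDERIV[OF assms(1)])
        (use Ck_on_has_derivative[OF assms(2) _ that] Suc.prems in blast)+
    show "Ck_on k S (\<lambda>x. B (f x) (frechet_derivative g (at x) (axis i 1)) +
        B (frechet_derivative f (at x) (axis i 1)) (g x))" for i
      unfolding partial_deriv_def[symmetric]
      using Suc.IH[of "f" "partial_deriv i g"] Suc.IH[of "partial_deriv i f" "g"] Suc.prems
        Ck_on_Suc_D[of k S f] Ck_on_Suc_D[of k S g]
      by (intro Ck_on_add assms(2)) auto
  qed
qed

lemma Ck_on_vec_iff:
  fixes f :: "real ^ 'n::finite \<Rightarrow> real ^ 'm::finite"
  assumes "open S"
  shows "Ck_on k S f \<longleftrightarrow> (\<forall>i. Ck_on k S (\<lambda>x. f x $ i))"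
proof
  assume "Ck_on k S f"
  then show "\<forall>i. Ck_on k S (\<lambda>x. f x $ i)"
    using Ck_on_linear_image[OF bounded_linear_vec_nth assms] by blast
next
  assume *: "\<forall>i. Ck_on k S (\<lambda>x. f x $ i)"
  have "Ck_on k S (\<lambda>x. \<Sum>i\<in>UNIV. f x $ i *\<^sub>R axis i 1)"
    using * by (intro Ck_on_sum Ck_on_bilinear[OF bounded_bilinear_scaleR] assms Ck_on_const) auto
  then show "Ck_on k S f"
    by (rule Ck_on_cong[OF assms]) (simp add: vec_eq_iff axis_def if_distrib cong: if_cong)
qed

lemma has_derivative_partial_expand:
  fixes f :: "real ^ 'n::finite \<Rightarrow> 'b::real_normed_vector"
  assumes "(f has_derivative f') (at x)"
  shows "f' h = (\<Sum>i\<in>UNIV. h $ i *\<^sub>R f' (axis i 1))"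
proof -
  have l: "linear f'" using assms has_derivative_linear by blast
  have "f' (\<Sum>i\<in>UNIV. h $ i *\<^sub>R axis i 1) = (\<Sum>i\<in>UNIV. h $ i *\<^sub>R f' (axis i 1))"
    by (simp add: linear_sum[OF l] linear_cmul[OF l])
  moreover have "(\<Sum>i\<in>UNIV. h $ i *\<^sub>R axis i 1) = h"
    by (simp add: vec_eq_iff axis_def if_distrib cong: if_cong)
  ultimately show ?thesis by simp
qed

text \<open>The chain rule gives a sum of products of a partial derivative of \<open>g\<close> with
  a partial derivative of \<open>f\<close> composed with the same \<open>g\<close>. The induction
  therefore varies \<open>f\<close> and keeps \<open>g\<close>.\<close>

lemma Ck_on_compose:
  fixes f :: "real ^ 'm::finite \<Rightarrow> 'b::real_normed_vector" and g :: "real ^ 'n::finite \<Rightarrow> real ^ 'm"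
  assumes "open S" "open T" "g ` S \<subseteq> T"
  shows "Ck_on k T f \<Longrightarrow> Ck_on k S g \<Longrightarrow> Ck_on k S (\<lambda>x. f (g x))"
proof (induction k arbitrary: f)
  case 0
  then show ?case using assms(3) by (auto intro: continuous_on_compose2)
next
  case (Suc k)
  have hdg: "(g has_derivative frechet_derivative g (at x)) (at x)" if "x \<in> S" for x
    using Ck_on_has_derivative[OF assms(1) Suc.prems(2) that] .
  have hdf: "(f has_derivative frechet_derivative f (at (g x))) (at (g x))" if "x \<in> S" for x
    using Ck_on_has_derivative[OF assms(2) Suc.prems(1)] that assms(3) by blast
  have hd: "((\<lambda>x. f (g x)) has_derivative
      (\<lambda>h. \<Sum>j\<in>UNIV. (frechet_derivative g (at x) h) $ j *\<^sub>R partial_deriv j f (g x))) (at x)"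
    if "x \<in> S" for x
    using has_derivative_compose[OF hdg[OF that] hdf[OF that]]
    unfolding has_derivative_partial_expand[OF hdf[OF that], of "frechet_derivative g (at x) _"]
    by (simp add: partial_deriv_def)
  show ?case
  proof (rule Ck_on_SucI[OF assms(1) hd])
    fix i
    have a: "Ck_on k S (\<lambda>x. partial_deriv i g x $ j)" for j
      using Suc.prems(2) Ck_on_vec_iff[OF assms(1)] by (metis Ck_on.simps(2))
    have b: "Ck_on k S (\<lambda>x. partial_deriv j f (g x))" for j
      using Suc.IH[of "partial_deriv j f"] Suc.prems Ck_on_Suc_D by auto
    show "Ck_on k S (\<lambda>x. \<Sum>j\<in>UNIV. frechet_derivative g (at x) (axis i 1) $ j *\<^sub>R partial_deriv j f (g x))"
      using a b unfolding partial_deriv_def[symmetric]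
      by (intro Ck_on_sum Ck_on_bilinear[OF bounded_bilinear_scaleR] assms) auto
  qed
qed

text \<open>The derivative of 1/f contains 1/f again, but with one order of differentiability less
  to prove; the induction on \<open>k\<close> closes on this. The square root below is treated in
  the same way.\<close>

lemma Ck_on_inverse:
  fixes f :: "real ^ 'n::finite \<Rightarrow> real"
  assumes "open S" "\<And>x. x \<in> S \<Longrightarrow> f x \<noteq> 0"
  shows "Ck_on k S f \<Longrightarrow> Ck_on k S (\<lambda>x. inverse (f x))"
proof (induction k)
  case 0
  then show ?case using assms(2) by (auto intro: continuous_intros)
next
  case (Suc k)
  have k: "Ck_on k S (\<lambda>x. inverse (f x))" using Suc Ck_on_Suc_D by blast
  show ?case
  proof (rule Ck_on_SucI[OF assms(1)])
    show "((\<lambda>x. inverse (f x)) has_derivative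
       (\<lambda>h. - (inverse (f x) * frechet_derivative f (at x) h * inverse (f x)))) (at x)" if "x \<in> S" for x
      by (intro Deriv.has_derivative_inverse Ck_on_has_derivative[OF assms(1) Suc.prems that] assms(2)[OF that])
    show "Ck_on k S (\<lambda>x. - (inverse (f x) * frechet_derivative f (at x) (axis i 1) * inverse (f x)))" for i
      using k Suc.prems unfolding partial_deriv_def[symmetric]
      by (intro Ck_on_linear_image[OF bounded_linear_minus[OF bounded_linear_ident]]
          Ck_on_bilinear[OF bounded_bilinear_mult] assms) auto
  qed
qed

lemma Ck_on_sqrt:
  fixes f :: "real ^ 'n::finite \<Rightarrow> real"
  assumes "open S" "\<And>x. x \<in> S \<Longrightarrow> f x > 0"
  shows "Ck_on k S f \<Longrightarrow> Ck_on k S (\<lambda>x. sqrt (f x))"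
proof (induction k)
  case 0
  then show ?case by (auto intro: continuous_intros)
next
  case (Suc k)
  have k: "Ck_on k S (\<lambda>x. sqrt (f x))" using Suc Ck_on_Suc_D by blast
  have k2: "Ck_on k S (\<lambda>x. inverse (sqrt (f x)))"
    by (rule Ck_on_inverse[OF assms(1) _ k]) (use assms(2) in force)
  show ?case
  proof (rule Ck_on_SucI[OF assms(1)])
    show "((\<lambda>x. sqrt (f x)) has_derivative
       (\<lambda>h. (1/2) * (inverse (sqrt (f x)) * frechet_derivative f (at x) h))) (at x)" if "x \<in> S" for x
      by (rule derivative_eq_intros Ck_on_has_derivative[OF assms(1) Suc.prems that] assms(2)[OF that])+
        (simp add: field_simps)
    show "Ck_on k S (\<lambda>x. (1/2) * (inverse (sqrt (f x)) * frechet_derivative f (at x) (axis i 1)))" for i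
      using k2 Suc.prems unfolding partial_deriv_def[symmetric]
      by (intro Ck_on_bilinear[OF bounded_bilinear_mult] assms Ck_on_const) auto
  qed
qed

section \<open>Closure properties of smooth functions\<close>

lemma smooth_on_cong:
  "open S \<Longrightarrow> smooth_on S f \<Longrightarrow> (\<And>x. x \<in> S \<Longrightarrow> f x = g x) \<Longrightarrow> smooth_on S g"
  unfolding smooth_on_def using Ck_on_cong by blast

lemma smooth_on_subset: "smooth_on S f \<Longrightarrow> T \<subseteq> S \<Longrightarrow> smooth_on T f"
  unfolding smooth_on_def using Ck_on_subset by blast

lemma smooth_on_const: "open S \<Longrightarrow> smooth_on S (\<lambda>x. c)"
  unfolding smooth_on_def using Ck_on_const by blast

lemma smooth_on_linear_image: "bounded_linear L \<Longrightarrow> open S \<Longrightarrow> smooth_on S f \<Longrightarrow> smooth_on S (\<lambda>x. L (f x))"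
  unfolding smooth_on_def using Ck_on_linear_image by blast

lemma smooth_on_add: "open S \<Longrightarrow> smooth_on S f \<Longrightarrow> smooth_on S g \<Longrightarrow> smooth_on S (\<lambda>x. f x + g x)"
  unfolding smooth_on_def using Ck_on_add by blast

lemma smooth_on_minus: "open S \<Longrightarrow> smooth_on S f \<Longrightarrow> smooth_on S (\<lambda>x. - f x)"
  using smooth_on_linear_image[OF bounded_linear_minus[OF bounded_linear_ident]] .

lemma smooth_on_diff: "open S \<Longrightarrow> smooth_on S f \<Longrightarrow> smooth_on S g \<Longrightarrow> smooth_on S (\<lambda>x. f x - g x)"
  using smooth_on_add[of S f "\<lambda>x. - g x"] smooth_on_minus by auto

lemma smooth_on_sum: "open S \<Longrightarrow> (\<And>i. i \<in> I \<Longrightarrow> smooth_on S (f i)) \<Longrightarrow> smooth_on S (\<lambda>x. \<Sum>i\<in>I. f i x)"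
  unfolding smooth_on_def by (auto intro: Ck_on_sum)

lemma smooth_on_scaleR: "open S \<Longrightarrow> smooth_on S f \<Longrightarrow> smooth_on S g \<Longrightarrow> smooth_on S (\<lambda>x. f x *\<^sub>R g x)"
  unfolding smooth_on_def using Ck_on_bilinear[OF bounded_bilinear_scaleR] by blast

lemma smooth_on_mult:
  fixes f g :: "real ^ 'n::finite \<Rightarrow> real"
  shows "open S \<Longrightarrow> smooth_on S f \<Longrightarrow> smooth_on S g \<Longrightarrow> smooth_on S (\<lambda>x. f x * g x)"
  unfolding smooth_on_def using Ck_on_bilinear[OF bounded_bilinear_mult] by blast

lemma smooth_on_prod:
  fixes f :: "'i \<Rightarrow> real ^ 'n::finite \<Rightarrow> real"
  assumes "open S" "\<And>i. i \<in> I \<Longrightarrow> smooth_on S (f i)"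
  shows "smooth_on S (\<lambda>x. \<Prod>i\<in>I. f i x)"
  using assms(2) by (induction I rule: infinite_finite_induct) (auto intro: smooth_on_const smooth_on_mult assms(1))

lemma smooth_on_vec_iff:
  fixes f :: "real ^ 'n::finite \<Rightarrow> real ^ 'm::finite"
  shows "open S \<Longrightarrow> smooth_on S f \<longleftrightarrow> (\<forall>i. smooth_on S (\<lambda>x. f x $ i))"
  unfolding smooth_on_def using Ck_on_vec_iff by blast

lemma smooth_on_compose:
  fixes f :: "real ^ 'm::finite \<Rightarrow> 'b::real_normed_vector" and g :: "real ^ 'n::finite \<Rightarrow> real ^ 'm"
  shows "open S \<Longrightarrow> open T \<Longrightarrow> g ` S \<subseteq> T \<Longrightarrow> smooth_on T f \<Longrightarrow> smooth_on S g \<Longrightarrow> smooth_on S (\<lambda>x. f (g x))"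
  unfolding smooth_on_def using Ck_on_compose by blast

lemma smooth_on_inverse:
  fixes f :: "real ^ 'n::finite \<Rightarrow> real"
  shows "open S \<Longrightarrow> (\<And>x. x \<in> S \<Longrightarrow> f x \<noteq> 0) \<Longrightarrow> smooth_on S f \<Longrightarrow> smooth_on S (\<lambda>x. inverse (f x))"
  unfolding smooth_on_def by (auto intro: Ck_on_inverse)

lemma smooth_on_sqrt:
  fixes f :: "real ^ 'n::finite \<Rightarrow> real"
  shows "open S \<Longrightarrow> (\<And>x. x \<in> S \<Longrightarrow> f x > 0) \<Longrightarrow> smooth_on S f \<Longrightarrow> smooth_on S (\<lambda>x. sqrt (f x))"
  unfolding smooth_on_def by (auto intro: Ck_on_sqrt)

lemma smooth_on_det:
  fixes f :: "'m::finite \<Rightarrow> 'm \<Rightarrow> real ^ 'n::finite \<Rightarrow> real"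
  assumes "open S" "\<And>i j. smooth_on S (f i j)"
  shows "smooth_on S (\<lambda>x. det (\<chi> i j. f i j x))"
  unfolding det_def by (simp, intro smooth_on_sum smooth_on_mult smooth_on_const smooth_on_prod assms)

lemma smooth_on_ident: "open S \<Longrightarrow> smooth_on S (\<lambda>x::real ^ 'n::finite. x)"
  unfolding smooth_on_def
proof
  fix k assume "open S"
  show "Ck_on k S (\<lambda>x::real ^ 'n::finite. x)"
  proof (cases k)
    case (Suc m)
    show ?thesis unfolding Suc
      by (rule Ck_on_SucI[where f' = "\<lambda>x h. h"]) (use \<open>open S\<close> in \<open>auto intro: Ck_on_const derivative_intros\<close>)
  qed auto
qed

lemma smooth_on_imp_continuous_on: "smooth_on S f \<Longrightarrow> continuous_on S f"
  unfolding smooth_on_def by (metis Ck_on.simps(1))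

lemma smooth_on_has_derivative:
  "open S \<Longrightarrow> smooth_on S f \<Longrightarrow> x \<in> S \<Longrightarrow> (f has_derivative frechet_derivative f (at x)) (at x)"
  unfolding smooth_on_def using Ck_on_has_derivative by blast

lemma smooth_on_derivative:
  fixes f :: "real ^ 'n::finite \<Rightarrow> 'b::real_normed_vector"
  assumes "open S" "smooth_on S f" "smooth_on S V"
  shows "smooth_on S (\<lambda>x. frechet_derivative f (at x) (V x))"
proof -
  have "smooth_on S (\<lambda>x. \<Sum>i\<in>UNIV. V x $ i *\<^sub>R partial_deriv i f x)"
  proof (intro smooth_on_sum smooth_on_scaleR assms(1))
    show "smooth_on S (\<lambda>x. V x $ i)" for i using smooth_on_vec_iff assms by blast
    show "smooth_on S (partial_deriv i f)" for i
      using assms unfolding smooth_on_def by (metis Ck_on.simps(2))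
  qed
  then show ?thesis
    by (rule smooth_on_cong[OF assms(1)])
      (use has_derivative_partial_expand[OF smooth_on_has_derivative[OF assms(1,2)]] in \<open>auto simp: partial_deriv_def\<close>)
qed

lemma smooth_on_partial_deriv:
  "open S \<Longrightarrow> smooth_on S f \<Longrightarrow> smooth_on S (partial_deriv i f)"
  unfolding smooth_on_def by (metis Ck_on.simps(2))

text \<open>Smoothness is local on open sets. This is what allows cut-off functions and fields to be
  pieced together.\<close>

lemma smooth_on_Union:
  fixes g :: "real ^ 'n::finite \<Rightarrow> 'b::real_normed_vector"
  assumes "\<forall>V\<in>\<V>. open V \<and> smooth_on V g"
  shows "smooth_on (\<Union>\<V>) g"
proof -
  have "Ck_on k (\<Union>\<V>) g" if "\<forall>V\<in>\<V>. open V \<and> Ck_on k V g" for k and g :: "real ^ 'n \<Rightarrow> 'b"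
    using that
  proof (induction k arbitrary: g)
    case 0
    then show ?case by (auto intro: continuous_on_open_Union)
  next
    case (Suc k)
    then show ?case by (auto simp: differentiable_on_eq_differentiable_at open_Union)
  qed
  then show ?thesis using assms unfolding smooth_on_def by blast
qed

text \<open>If \<open>f\<close> is of class C^k, so is the right-hand side of the equation, and
  \<open>f\<close> is of class C^(k+1). A differentiable solution of the parallel transport equation
  is smooth by this argument.\<close>

lemma smooth_on_bootstrap:
  fixes f :: "real ^ 'n::finite \<Rightarrow> real ^ 'm::finite"
  assumes "open S" "\<And>x. x \<in> S \<Longrightarrow> (f has_derivative (\<lambda>h. \<Sum>i\<in>UNIV. \<Sum>j\<in>UNIV. (h $ i * f x $ j) *\<^sub>R b i j x)) (at x)"
    and "\<And>i j. smooth_on S (b i j)"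
  shows "smooth_on S f"
  unfolding smooth_on_def
proof
  fix k show "Ck_on k S f"
  proof (induction k)
    case 0
    then show ?case
      using assms(2) by (auto intro!: continuous_at_imp_continuous_on has_derivative_continuous)
  next
    case (Suc k)
    show ?case
    proof (rule Ck_on_SucI[OF assms(1) assms(2)])
      fix l
      have "Ck_on k S (\<lambda>x. f x $ j)" for j using Suc Ck_on_vec_iff[OF assms(1)] by blast
      then show "Ck_on k S (\<lambda>x. \<Sum>i\<in>UNIV. \<Sum>j\<in>UNIV. (axis l 1 $ i * f x $ j) *\<^sub>R b i j x)"
        using assms(3) unfolding smooth_on_def
        by (intro Ck_on_sum Ck_on_bilinear[OF bounded_bilinear_scaleR] Ck_on_bilinear[OF bounded_bilinear_mult]
            Ck_on_const assms(1)) auto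
    qed
  qed
qed

text \<open>The mean value theorem is applied to the increment in direction \<open>j\<close>,
  regarded as a function of the step in direction \<open>i\<close>, and then once more in direction
  \<open>j\<close>. The left-hand side is symmetric in \<open>i\<close> and \<open>j\<close>; the
  right-hand side is not visibly so.\<close>

lemma second_difference_mean_value:
  fixes f :: "real ^ 'n::finite \<Rightarrow> real"
  assumes S: "open S" "smooth_on S f" "cball x r \<subseteq> S" and s: "0 < s" "2 * s < r"
  shows "\<exists>y. dist x y < 2 * s \<and>
    f (x + s *\<^sub>R axis i 1 + s *\<^sub>R axis j 1) - f (x + s *\<^sub>R axis i 1) - f (x + s *\<^sub>R axis j 1) + f x
      = s * s * partial_deriv j (partial_deriv i f) y"
proof -
  have dn: "dist x (x + v + w) = norm (v + w)" for v w
    by (metis add.assoc add_diff_cancel_left' dist_commute dist_norm)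
  have inS: "x + a *\<^sub>R axis i 1 + b *\<^sub>R axis j 1 \<in> S" if "\<bar>a\<bar> \<le> s" "\<bar>b\<bar> \<le> s" for a b
  proof -
    have "norm (a *\<^sub>R axis i (1::real) + b *\<^sub>R axis j 1) \<le> \<bar>a\<bar> + \<bar>b\<bar>"
      by (rule norm_triangle_le) auto
    then have "dist x (x + a *\<^sub>R axis i 1 + b *\<^sub>R axis j 1) \<le> r"
      using that s by (simp add: dn)
    then show ?thesis using S(3) by auto
  qed
  have d: "((\<lambda>t. h (y + t *\<^sub>R axis k 1)) has_real_derivative partial_deriv k h (y + t *\<^sub>R axis k 1)) (at t)"
    if "smooth_on S h" "y + t *\<^sub>R axis k 1 \<in> S" for h :: "real ^ 'n \<Rightarrow> real" and y t k
  proof -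
    have *: "((\<lambda>t. y + t *\<^sub>R axis k (1::real)) has_derivative (\<lambda>d. d *\<^sub>R axis k 1)) (at t)"
      by (auto intro!: derivative_eq_intros)
    have hd: "(h has_derivative frechet_derivative h (at (y + t *\<^sub>R axis k 1))) (at (y + t *\<^sub>R axis k 1))"
      using smooth_on_has_derivative[OF S(1) that] .
    have "frechet_derivative h (at (y + t *\<^sub>R axis k 1)) (d *\<^sub>R axis k 1)
        = d * partial_deriv k h (y + t *\<^sub>R axis k 1)" for d
      using has_derivative_linear[OF hd] by (simp add: partial_deriv_def linear_cmul)
    then show ?thesis
      using has_derivative_compose[OF * hd] by (simp add: has_field_derivative_def mult.commute[of _ "partial_deriv k h _"])
  qed
  define u where "u a = f (x + a *\<^sub>R axis i 1 + s *\<^sub>R axis j 1) - f (x + a *\<^sub>R axis i 1)" for a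
  have du: "(u has_real_derivative partial_deriv i f (x + a *\<^sub>R axis i 1 + s *\<^sub>R axis j 1)
      - partial_deriv i f (x + a *\<^sub>R axis i 1)) (at a)" if "0 \<le> a" "a \<le> s" for a
    using d[OF S(2), of "x + s *\<^sub>R axis j 1" a i] d[OF S(2), of x a i] inS[of a s] inS[of a 0] that
    unfolding u_def by (auto intro!: DERIV_diff simp: algebra_simps)
  obtain a where a: "0 < a" "a < s" "u s - u 0 = s * (partial_deriv i f (x + a *\<^sub>R axis i 1 + s *\<^sub>R axis j 1)
      - partial_deriv i f (x + a *\<^sub>R axis i 1))"
    using MVT2[OF s(1) du] by auto
  have sm: "smooth_on S (partial_deriv i f)" using smooth_on_partial_deriv S by blast
  have dv: "((\<lambda>b. partial_deriv i f (x + a *\<^sub>R axis i 1 + b *\<^sub>R axis j 1)) has_real_derivative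
      partial_deriv j (partial_deriv i f) (x + a *\<^sub>R axis i 1 + b *\<^sub>R axis j 1)) (at b)" if "0 \<le> b" "b \<le> s" for b
    using d[OF sm, of "x + a *\<^sub>R axis i 1" b j] inS[of a b] a that by simp
  obtain b where b: "0 < b" "b < s" "partial_deriv i f (x + a *\<^sub>R axis i 1 + s *\<^sub>R axis j 1)
      - partial_deriv i f (x + a *\<^sub>R axis i 1) =
      s * partial_deriv j (partial_deriv i f) (x + a *\<^sub>R axis i 1 + b *\<^sub>R axis j 1)"
    using MVT2[OF s(1) dv] by auto
  have "norm (a *\<^sub>R axis i (1::real) + b *\<^sub>R axis j 1) \<le> \<bar>a\<bar> + \<bar>b\<bar>"
    by (rule norm_triangle_le) auto
  then have "dist x (x + a *\<^sub>R axis i 1 + b *\<^sub>R axis j 1) < 2 * s"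
    using a b by (simp add: dn)
  then show ?thesis using a b by (intro exI conjI) (auto simp: u_def algebra_simps)
qed

text \<open>The symmetric second difference equals \<open>s * s\<close> times either mixed
  derivative, taken at two points near \<open>x\<close>; continuity brings both points to
  \<open>x\<close>.\<close>

lemma partial_deriv_commute_real:
  fixes f :: "real ^ 'n::finite \<Rightarrow> real"
  assumes S: "open S" "smooth_on S f" "x \<in> S"
  shows "partial_deriv i (partial_deriv j f) x = partial_deriv j (partial_deriv i f) x"
proof (rule ccontr)
  let ?a = "partial_deriv i (partial_deriv j f)" and ?b = "partial_deriv j (partial_deriv i f)"
  assume ne: "?a x \<noteq> ?b x"
  \<comment> \<open>Half the distance: two values within \<open>e\<close> of \<open>?a x\<close> and
    of \<open>?b x\<close> cannot coincide.\<close>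
  define e where "e = dist (?a x) (?b x) / 2"
  have e: "e > 0" using ne by (simp add: e_def)
  have "isCont ?a x" "isCont ?b x"
    using smooth_on_imp_continuous_on[OF smooth_on_partial_deriv[OF S(1) smooth_on_partial_deriv[OF S(1,2)]]]
      S continuous_on_eq_continuous_at by blast+
  then obtain d1 d2 where d: "d1 > 0" "d2 > 0" "\<And>y. dist y x < d1 \<Longrightarrow> dist (?a y) (?a x) < e"
      "\<And>y. dist y x < d2 \<Longrightarrow> dist (?b y) (?b x) < e"
    using e unfolding continuous_at_eps_delta by metis
  obtain r where r: "r > 0" "cball x r \<subseteq> S" using S open_contains_cball by blast
  define s where "s = min (min d1 d2) r / 3"
  have s: "s > 0" "2 * s < r" "2 * s < d1" "2 * s < d2" using d r by (auto simp: s_def min_def)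
  obtain y where y: "dist x y < 2 * s" "f (x + s *\<^sub>R axis i 1 + s *\<^sub>R axis j 1) - f (x + s *\<^sub>R axis i 1)
      - f (x + s *\<^sub>R axis j 1) + f x = s * s * ?b y"
    using second_difference_mean_value[OF S(1,2) r(2) s(1,2)] by blast
  obtain z where z: "dist x z < 2 * s" "f (x + s *\<^sub>R axis j 1 + s *\<^sub>R axis i 1) - f (x + s *\<^sub>R axis j 1)
      - f (x + s *\<^sub>R axis i 1) + f x = s * s * ?a z"
    using second_difference_mean_value[OF S(1,2) r(2) s(1,2)] by blast
  have "s * s * ?a z = s * s * ?b y" unfolding y(2)[symmetric] z(2)[symmetric] by (simp add: algebra_simps)
  then have "?a z = ?b y" using s by auto
  moreover have "dist (?a z) (?a x) < e"
    by (rule d(3)) (use s(3) z(1) in \<open>simp add: dist_commute\<close>)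
  moreover have "dist (?b y) (?b x) < e"
    by (rule d(4)) (use s(4) y(1) in \<open>simp add: dist_commute\<close>)
  ultimately show False unfolding e_def dist_real_def by argo
qed

section \<open>Parallel sections of flat linear connections\<close>

text \<open>Differentiation under the integral asks for a derivative that is continuous as a map
  into bounded linear maps. In finite dimension this follows from continuity in each fixed direction
  \<open>h\<close>, which is the form available below.\<close>

lemma leibniz_unit_interval:
  fixes F :: "real ^ 'n::finite \<Rightarrow> real \<Rightarrow> real ^ 'm::finite"
  assumes S: "open S" "convex S"
    and d: "\<And>x t. x \<in> S \<Longrightarrow> t \<in> {0..1} \<Longrightarrow> ((\<lambda>x. F x t) has_derivative F' x t) (at x)"
    and c: "\<And>x. x \<in> S \<Longrightarrow> continuous_on {0..1} (F x)"
    and c': "\<And>h. continuous_on (S \<times> {0..1}) (\<lambda>(x, t). F' x t h)"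
  shows "x \<in> S \<Longrightarrow> ((\<lambda>x. integral {0..1} (F x)) has_derivative (\<lambda>h. integral {0..1} (\<lambda>t. F' x t h))) (at x)"
    and "continuous_on S (\<lambda>x. integral {0..1} (\<lambda>t. F' x t h))"
proof -
  show "continuous_on S (\<lambda>x. integral {0..1} (\<lambda>t. F' x t h))"
    using integral_continuous_on_param[of S 0 1 "\<lambda>x t. F' x t h"] c' by simp
  assume x: "x \<in> S"
  define G where "G x t = Blinfun (F' x t)" for x t
  have G: "blinfun_apply (G x t) = F' x t" if "x \<in> S" "t \<in> {0..1}" for x t
    unfolding G_def using d[OF that] has_derivative_bounded_linear bounded_linear_Blinfun_apply by blast
  have cG: "continuous_on (S \<times> {0..1}) (\<lambda>(x, t). G x t)"
  proof (rule continuous_on_blinfun_componentwise)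
    show "continuous_on (S \<times> {0..1}) (\<lambda>z. blinfun_apply (case z of (x, t) \<Rightarrow> G x t) i)" for i
      using c'[of i] by (rule continuous_on_eq) (auto simp: G)
  qed
  have "((\<lambda>x. integral (cbox 0 1) (F x)) has_derivative blinfun_apply (integral (cbox 0 1) (G x))) (at x within S)"
  proof (rule leibniz_rule)
    show "((\<lambda>x. F x t) has_derivative blinfun_apply (G x t)) (at x within S)" if "x \<in> S" "t \<in> cbox 0 1" for x t
      using d[of x t] that G[of x t] by (auto intro: has_derivative_at_withinI)
    show "F x integrable_on cbox 0 1" if "x \<in> S" for x
      using c[OF that] integrable_continuous_interval by auto
  qed (use cG x S in auto)
  moreover have "blinfun_apply (integral {0..1} (G x)) h = integral {0..1} (\<lambda>t. F' x t h)" for h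
  proof -
    have "continuous_on {0..1} (G x)"
      by (rule continuous_on_compose2[OF cG, of _ "\<lambda>t. (x, t)", simplified]) (use x in \<open>auto intro: continuous_intros\<close>)
    then have "G x integrable_on {0..1}" by (rule integrable_continuous_interval)
    from integral_linear[OF this blinfun.bounded_linear_left[of h]]
    have "blinfun_apply (integral {0..1} (G x)) h = integral {0..1} (\<lambda>t. blinfun_apply (G x t) h)"
      by (simp add: o_def)
    also have "\<dots> = integral {0..1} (\<lambda>t. F' x t h)"
      by (rule integral_cong) (use x G in auto)
    finally show ?thesis .
  qed
  then have "blinfun_apply (integral {0..1} (G x)) = (\<lambda>h. integral {0..1} (\<lambda>t. F' x t h))" by blast
  ultimately show "((\<lambda>x. integral {0..1} (F x)) has_derivative (\<lambda>h. integral {0..1} (\<lambda>t. F' x t h))) (at x)"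
    using at_within_open[OF x S(1)] by simp
qed

lemma geometric_tail:
  fixes f :: "nat \<Rightarrow> 'a::banach"
  assumes "\<And>n. norm (f n) \<le> M / 2 ^ n"
  shows "summable f" "norm (sum f {..<n} - suminf f) \<le> 2 * M / 2 ^ n"
proof -
  have g: "(\<lambda>k. c * (1 / 2) ^ k) sums (2 * c)" for c :: real
    using sums_mult[OF geometric_sums[of "1/2::real"], of c] by (simp add: mult.commute)
  have M: "norm (f n) \<le> M * (1 / 2) ^ n" for n using assms[of n] by (simp add: power_divide)
  show s: "summable f"
    by (rule summable_comparison_test[OF _ sums_summable[OF g[of M]]]) (use M in auto)
  have "suminf f = (\<Sum>k. f (k + n)) + sum f {..<n}" by (rule suminf_split_initial_segment[OF s])
  then have "norm (sum f {..<n} - suminf f) = norm (\<Sum>k. f (k + n))" by simp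
  also have "\<dots> \<le> (\<Sum>k. M / 2 ^ n * (1 / 2) ^ k)"
    by (rule norm_suminf_le[OF _ sums_summable[OF g]]) (use M[of "_ + n"] in \<open>simp add: power_add power_divide mult.commute\<close>)
  also have "\<dots> = 2 * M / 2 ^ n" using sums_unique[OF g[of "M / 2 ^ n"]] by simp
  finally show "norm (sum f {..<n} - suminf f) \<le> 2 * M / 2 ^ n" .
qed

text \<open>Coefficients of the total differential equation \<open>f' x h = B x h (f x)\<close> near
  the origin: \<open>b i j\<close> is the value of \<open>B\<close> on the \<open>i\<close>-th
  direction of the base and the \<open>j\<close>-th basis vector of the fibre.\<close>

locale flat_system =
  fixes b :: "'n::finite \<Rightarrow> 'm::finite \<Rightarrow> real ^ 'n \<Rightarrow> real ^ 'm" and U :: "(real ^ 'n) set"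
  assumes openU: "open U" and zeroU: "0 \<in> U" and smb: "\<And>i j. smooth_on U (b i j)"
begin

definition B :: "real ^ 'n \<Rightarrow> real ^ 'n \<Rightarrow> real ^ 'm \<Rightarrow> real ^ 'm"
  where "B x h v = (\<Sum>i\<in>UNIV. \<Sum>j\<in>UNIV. (h $ i * v $ j) *\<^sub>R b i j x)"

text \<open>The derivative of \<open>B\<close> with respect to the base point, in the direction
  \<open>k\<close>. The curvature condition is an identity between \<open>B'\<close> and products of
  \<open>B\<close>.\<close>

definition B' :: "real ^ 'n \<Rightarrow> real ^ 'n \<Rightarrow> real ^ 'n \<Rightarrow> real ^ 'm \<Rightarrow> real ^ 'm"
  where "B' x k h v = (\<Sum>i\<in>UNIV. \<Sum>j\<in>UNIV. (h $ i * v $ j) *\<^sub>R (\<Sum>l\<in>UNIV. k $ l *\<^sub>R partial_deriv l (b i j) x))"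

lemma B_linear:
  "B x (h + h') v = B x h v + B x h' v" "B x (c *\<^sub>R h) v = c *\<^sub>R B x h v"
  "B x h (v + v') = B x h v + B x h v'" "B x h (c *\<^sub>R v) = c *\<^sub>R B x h v"
  "B x h (v - v') = B x h v - B x h v'" "B x h 0 = 0" "B x 0 v = 0"
  by (simp_all add: B_def distrib_left distrib_right right_diff_distrib left_diff_distrib scaleR_add_left
      scaleR_diff_left sum.distrib sum_subtractf scaleR_sum_right ac_simps)

lemma B'_linear:
  "B' x k (c *\<^sub>R h) v = c *\<^sub>R B' x k h v" "B' x (c *\<^sub>R k) h v = c *\<^sub>R B' x k h v"
  "B' x k h (v - v') = B' x k h v - B' x k h v'"
  by (simp_all add: B'_def right_diff_distrib scaleR_diff_left sum_subtractf scaleR_sum_right ac_simps)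

lemma has_derivative_b:
  "x \<in> U \<Longrightarrow> (b i j has_derivative (\<lambda>k. \<Sum>l\<in>UNIV. k $ l *\<^sub>R partial_deriv l (b i j) x)) (at x)"
proof -
  assume x: "x \<in> U"
  have d: "(b i j has_derivative frechet_derivative (b i j) (at x)) (at x)"
    using smooth_on_has_derivative[OF openU smb x] .
  have "frechet_derivative (b i j) (at x) = (\<lambda>k. \<Sum>l\<in>UNIV. k $ l *\<^sub>R partial_deriv l (b i j) x)"
    unfolding partial_deriv_def by (rule ext) (rule has_derivative_partial_expand[OF d])
  then show ?thesis using d by simp
qed

lemma continuous_B:
  assumes "continuous_on S X" "continuous_on S H" "continuous_on S V" "X ` S \<subseteq> U"
  shows "continuous_on S (\<lambda>z. B (X z) (H z) (V z))"
  unfolding B_def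
  by (intro continuous_intros continuous_on_compose2[OF smooth_on_imp_continuous_on[OF smb]] assms)

lemma continuous_B':
  assumes "continuous_on S X" "continuous_on S K" "continuous_on S H" "continuous_on S V" "X ` S \<subseteq> U"
  shows "continuous_on S (\<lambda>z. B' (X z) (K z) (H z) (V z))"
  unfolding B'_def
  by (intro continuous_intros
      continuous_on_compose2[OF smooth_on_imp_continuous_on[OF smooth_on_partial_deriv[OF openU smb]]] assms)

lemma has_derivative_B:
  assumes "(X has_derivative X') (at y)" "(H has_derivative H') (at y)" "(V has_derivative V') (at y)" "X y \<in> U"
  shows "((\<lambda>y. B (X y) (H y) (V y)) has_derivative
    (\<lambda>k. B' (X y) (X' k) (H y) (V y) + B (X y) (H' k) (V y) + B (X y) (H y) (V' k))) (at y)"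
proof -
  note d = has_derivative_compose[OF assms(1) has_derivative_b[OF assms(4)]]
    bounded_linear.has_derivative[OF bounded_linear_vec_nth assms(2)]
    bounded_linear.has_derivative[OF bounded_linear_vec_nth assms(3)]
  show ?thesis unfolding B_def B'_def
    by (rule has_derivative_eq_rhs, (rule has_derivative_sum has_derivative_scaleR has_derivative_mult d)+)
      (simp add: scaleR_add_left sum.distrib algebra_simps)
qed

text \<open>Along a ray the equation becomes an ordinary differential equation for
  \<open>f (t *\<^sub>R x)\<close> in \<open>t\<close>, with right-hand side
  \<open>B (t *\<^sub>R x) x (f (t *\<^sub>R x))\<close>. Its integrated form is
  \<open>f x = f 0 + K f x\<close>.\<close>

definition K :: "(real ^ 'n \<Rightarrow> real ^ 'm) \<Rightarrow> real ^ 'n \<Rightarrow> real ^ 'm"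
  where "K f x = integral {0..1} (\<lambda>t. B (t *\<^sub>R x) x (f (t *\<^sub>R x)))"

text \<open>What differentiation under the integral gives for \<open>K f\<close> when
  \<open>f'\<close> is the derivative of \<open>f\<close>; the factors \<open>t\<close> come from
  the inner function \<open>t *\<^sub>R x\<close>.\<close>

definition K' :: "(real ^ 'n \<Rightarrow> real ^ 'm) \<Rightarrow> (real ^ 'n \<Rightarrow> real ^ 'n \<Rightarrow> real ^ 'm) \<Rightarrow> real ^ 'n \<Rightarrow> real ^ 'n \<Rightarrow> real ^ 'm"
  where "K' f f' x h = integral {0..1} (\<lambda>t. t *\<^sub>R B' (t *\<^sub>R x) h x (f (t *\<^sub>R x)) + B (t *\<^sub>R x) h (f (t *\<^sub>R x))
    + t *\<^sub>R B (t *\<^sub>R x) x (f' (t *\<^sub>R x) h))"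

text \<open>The derivative is carried along as a second function because iteration and passage to
  the limit have to control \<open>f\<close> and \<open>f'\<close> together.\<close>

definition C1_pair :: "real \<Rightarrow> (real ^ 'n \<Rightarrow> real ^ 'm) \<Rightarrow> (real ^ 'n \<Rightarrow> real ^ 'n \<Rightarrow> real ^ 'm) \<Rightarrow> bool"
  where "C1_pair r f f' \<longleftrightarrow> (\<forall>x\<in>ball 0 r. (f has_derivative f' x) (at x)) \<and> (\<forall>h. continuous_on (ball 0 r) (\<lambda>x. f' x h))"

lemma C1_pair_continuous: "C1_pair r f f' \<Longrightarrow> continuous_on (ball 0 r) f"
  unfolding C1_pair_def by (meson continuous_at_imp_continuous_on has_derivative_continuous)

lemma scaleR_in_ball: "x \<in> ball 0 r \<Longrightarrow> t \<in> {0..1} \<Longrightarrow> t *\<^sub>R x \<in> ball (0::real^'n) r"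
proof -
  assume a: "x \<in> ball 0 r" "t \<in> {0..1}"
  have "\<bar>t\<bar> * norm x \<le> 1 * norm x" using a by (intro mult_right_mono) auto
  then show ?thesis using a by simp
qed

lemma K_integrand_continuous:
  assumes "ball 0 r \<subseteq> U" "continuous_on (ball 0 r) f" "x \<in> ball 0 r"
  shows "continuous_on {0..1} (\<lambda>t. B (t *\<^sub>R x) x (f (t *\<^sub>R x)))"
proof -
  have im: "(\<lambda>t. t *\<^sub>R x) ` {0..1} \<subseteq> ball 0 r" using scaleR_in_ball[OF assms(3)] by blast
  have sc: "continuous_on {0..1} (\<lambda>t. t *\<^sub>R x)" by (intro continuous_intros)
  show ?thesis
    by (intro continuous_B continuous_on_const sc continuous_on_compose2[OF assms(2) sc im] order_trans[OF im assms(1)])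
qed

lemma K'_integrand_continuous:
  assumes "ball 0 r \<subseteq> U" "C1_pair r f f'"
  shows "continuous_on (ball 0 r \<times> {0..1}) (\<lambda>(x, t). t *\<^sub>R B' (t *\<^sub>R x) h x (f (t *\<^sub>R x))
    + B (t *\<^sub>R x) h (f (t *\<^sub>R x)) + t *\<^sub>R B (t *\<^sub>R x) x (f' (t *\<^sub>R x) h))"
proof -
  have im: "(\<lambda>z. snd z *\<^sub>R fst z) ` (ball (0::real^'n) r \<times> {0..1}) \<subseteq> ball 0 r"
    using scaleR_in_ball by auto
  have c: "continuous_on (ball 0 r) (\<lambda>x. f' x h)" using assms unfolding C1_pair_def by blast
  have sc: "continuous_on (ball (0::real^'n) r \<times> {0..1}) (\<lambda>z. snd z *\<^sub>R fst z)" by (intro continuous_intros)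
  show ?thesis unfolding case_prod_unfold
    by (intro continuous_on_add continuous_on_scaleR continuous_B continuous_B' sc
        continuous_on_compose2[OF C1_pair_continuous[OF assms(2)] sc im]
        continuous_on_compose2[OF c sc im] continuous_on_fst continuous_on_snd continuous_on_id continuous_on_const
        order_trans[OF im assms(1)])
qed

lemma K_C1_pair:
  assumes "ball 0 r \<subseteq> U" "C1_pair r f f'"
  shows "C1_pair r (K f) (K' f f')"
proof -
  have f: "(f has_derivative f' x) (at x)" if "x \<in> ball 0 r" for x
    using assms that unfolding C1_pair_def by blast
  have d: "((\<lambda>x. B (t *\<^sub>R x) x (f (t *\<^sub>R x))) has_derivative (\<lambda>h. t *\<^sub>R B' (t *\<^sub>R x) h x (f (t *\<^sub>R x))
    + B (t *\<^sub>R x) h (f (t *\<^sub>R x)) + t *\<^sub>R B (t *\<^sub>R x) x (f' (t *\<^sub>R x) h))) (at x)"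
    if x: "x \<in> ball 0 r" and t: "t \<in> {0..1}" for x t
  proof -
    have s: "((\<lambda>x. t *\<^sub>R x) has_derivative (\<lambda>h. t *\<^sub>R h)) (at x)" by (auto intro!: derivative_eq_intros)
    have tx: "t *\<^sub>R x \<in> ball 0 r" using scaleR_in_ball x t by blast
    then have txU: "t *\<^sub>R x \<in> U" using assms(1) by blast
    have l: "f' (t *\<^sub>R x) (t *\<^sub>R h) = t *\<^sub>R f' (t *\<^sub>R x) h" for h
      using has_derivative_linear[OF f[OF tx]] linear_cmul by blast
    show ?thesis
      using has_derivative_B[OF s has_derivative_ident has_derivative_compose[OF s f[OF tx]] txU]
      by (simp add: l B_linear B'_linear)
  qed
  note L = leibniz_unit_interval[OF open_ball convex_ball d
      K_integrand_continuous[OF assms(1) C1_pair_continuous[OF assms(2)]] K'_integrand_continuous[OF assms]]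
  show ?thesis
    unfolding C1_pair_def
  proof (intro conjI ballI allI)
    show "(K f has_derivative K' f f' x) (at x)" if "x \<in> ball 0 r" for x
      using L(1)[OF _ _ _ that] by (simp add: K_def[abs_def] K'_def[abs_def])
    show "continuous_on (ball 0 r) (\<lambda>x. K' f f' x h)" for h
      using L(2) by (simp add: K'_def)
  qed
qed

text \<open>The derivative is measured in units of \<open>m * L\<close>, with \<open>m\<close> the
  bound of \<open>f\<close> itself. In the bound for \<open>K'\<close> the term \<open>2 * a\<close>
  does not become small with \<open>r\<close>; a large \<open>L\<close> absorbs it, and both bounds
  can then contract by the same factor.\<close>

lemma C1_pair_bound:
  assumes "ball 0 r \<subseteq> U" "C1_pair r f f'"
    and a: "\<And>x h v. x \<in> ball 0 r \<Longrightarrow> norm (B x h v) \<le> a * norm h * norm v"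
      "\<And>x k h v. x \<in> ball 0 r \<Longrightarrow> norm (B' x k h v) \<le> a * norm k * norm h * norm v"
    and a0: "0 \<le> a" and L0: "0 \<le> L" and r1: "r \<le> 1"
    and m: "\<And>x. x \<in> ball 0 r \<Longrightarrow> norm (f x) \<le> m" "\<And>x h. x \<in> ball 0 r \<Longrightarrow> norm (f' x h) \<le> m * L * norm h"
    and x: "x \<in> ball 0 r"
  shows "norm (K f x) \<le> a * r * m" "norm (K' f f' x h) \<le> (2 * a + a * r * L) * m * norm h"
proof -
  have m0: "0 \<le> m" using m(1)[OF x] norm_ge_zero order_trans by blast
  have xr: "norm x \<le> r" using x by simp
  have r0: "0 \<le> r" using xr norm_ge_zero[of x] by linarith
  have x1: "norm x \<le> 1" using xr r1 by linarith
  have fm: "norm (f (t *\<^sub>R x)) \<le> m" "norm (f' (t *\<^sub>R x) h) \<le> m * L * norm h" if "t \<in> {0..1}" for t h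
    using m(1)[OF scaleR_in_ball[OF x that]] m(2)[OF scaleR_in_ball[OF x that]] .
  have "norm (K f x) \<le> a * r * m * (1 - 0)"
    unfolding K_def
  proof (rule integral_bound)
    fix t :: real assume t: "t \<in> {0..1}"
    have tx: "t *\<^sub>R x \<in> ball 0 r" using scaleR_in_ball x t by blast
    have "norm (B (t *\<^sub>R x) x (f (t *\<^sub>R x))) \<le> a * norm x * norm (f (t *\<^sub>R x))" using a(1)[OF tx] .
    also have "\<dots> \<le> a * r * m" using fm[OF t] xr a0 m0 r0 by (intro mult_mono) auto
    finally show "norm (B (t *\<^sub>R x) x (f (t *\<^sub>R x))) \<le> a * r * m" .
  qed (use K_integrand_continuous[OF assms(1) C1_pair_continuous[OF assms(2)] x] in auto)
  then show "norm (K f x) \<le> a * r * m" by simp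
  have "norm (K' f f' x h) \<le> (2 * a + a * r * L) * m * norm h * (1 - 0)"
    unfolding K'_def
  proof (rule integral_bound)
    show "continuous_on {0..1} (\<lambda>t. t *\<^sub>R B' (t *\<^sub>R x) h x (f (t *\<^sub>R x)) + B (t *\<^sub>R x) h (f (t *\<^sub>R x))
        + t *\<^sub>R B (t *\<^sub>R x) x (f' (t *\<^sub>R x) h))"
      using continuous_on_compose2[OF K'_integrand_continuous[OF assms(1,2)],
          of "{0..1}" "\<lambda>t. (x, t)" h] x
      by (simp add: continuous_on_Pair image_subset_iff)
    fix t :: real assume t: "t \<in> {0..1}"
    have tx: "t *\<^sub>R x \<in> ball 0 r" using scaleR_in_ball x t by blast
    let ?y = "t *\<^sub>R x"
    have sc: "norm (t *\<^sub>R w) \<le> norm w" for w :: "real ^ 'm"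
      using t by (simp add: mult_left_le_one_le)
    have 1: "norm (B' ?y h x (f ?y)) \<le> a * norm h * 1 * m"
      by (rule order_trans[OF a(2)[OF tx]]) (use fm[OF t] x1 a0 m0 r0 in \<open>intro mult_mono\<close>, auto)
    have 2: "norm (B ?y h (f ?y)) \<le> a * norm h * m"
      by (rule order_trans[OF a(1)[OF tx]]) (use fm[OF t] a0 m0 r0 in \<open>intro mult_mono\<close>, auto)
    have 3: "norm (B ?y x (f' ?y h)) \<le> a * r * (m * L * norm h)"
      by (rule order_trans[OF a(1)[OF tx]]) (use fm[OF t] xr a0 m0 r0 in \<open>intro mult_mono\<close>, auto)
    have "norm (t *\<^sub>R B' ?y h x (f ?y) + B ?y h (f ?y) + t *\<^sub>R B ?y x (f' ?y h))
        \<le> norm (t *\<^sub>R B' ?y h x (f ?y)) + norm (B ?y h (f ?y)) + norm (t *\<^sub>R B ?y x (f' ?y h))"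
      by (intro norm_triangle_le add_right_mono norm_triangle_ineq)
    also have "\<dots> \<le> a * norm h * 1 * m + a * norm h * m + a * r * (m * L * norm h)"
      by (intro add_mono order_trans[OF sc 1] order_trans[OF sc 3] 2)
    also have "\<dots> = (2 * a + a * r * L) * m * norm h" by (simp add: algebra_simps)
    finally show "norm (t *\<^sub>R B' ?y h x (f ?y) + B ?y h (f ?y) + t *\<^sub>R B ?y x (f' ?y h))
      \<le> (2 * a + a * r * L) * m * norm h" .
  qed simp
  then show "norm (K' f f' x h) \<le> (2 * a + a * r * L) * m * norm h" by simp
qed

lemma coefficient_bounds:
  obtains r a where "0 < r" "0 \<le> a" "cball 0 r \<subseteq> U"
    "\<And>x h v. x \<in> cball 0 r \<Longrightarrow> norm (B x h v) \<le> a * norm h * norm v"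
    "\<And>x k h v. x \<in> cball 0 r \<Longrightarrow> norm (B' x k h v) \<le> a * norm k * norm h * norm v"
proof -
  obtain r where r: "r > 0" "cball 0 r \<subseteq> U" using openU zeroU open_contains_cball by blast
  have "\<exists>M. \<forall>x\<in>cball 0 r. norm (f x) \<le> M" if "smooth_on U f" for f :: "real ^ 'n \<Rightarrow> real ^ 'm"
    using compact_imp_bounded[OF compact_continuous_image[OF continuous_on_subset[OF
        smooth_on_imp_continuous_on[OF that] r(2)] compact_cball]] by (auto simp: bounded_iff)
  then have "\<forall>f :: real ^ 'n \<Rightarrow> real ^ 'm. \<exists>M. smooth_on U f \<longrightarrow> (\<forall>x\<in>cball 0 r. norm (f x) \<le> M)" by blast
  then obtain M where M: "\<And>(f :: real ^ 'n \<Rightarrow> real ^ 'm) x. smooth_on U f \<Longrightarrow> x \<in> cball 0 r \<Longrightarrow> norm (f x) \<le> M f" by metis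
  define M1 where "M1 = (\<Sum>i\<in>UNIV. \<Sum>j\<in>UNIV. M (b i j))"
  define M2 where "M2 = (\<Sum>i\<in>UNIV. \<Sum>j\<in>UNIV. \<Sum>l\<in>UNIV. M (partial_deriv l (b i j)))"
  have p: "smooth_on U (partial_deriv l (b i j))" for l i j using smooth_on_partial_deriv[OF openU smb] .
  have z: "0 \<in> cball (0::real^'n) r" using r by simp
  have M0: "0 \<le> M (b i j)" "0 \<le> M (partial_deriv l (b i j))" for i j l
    using M[OF smb z, of i j] M[OF p z, of l i j] norm_ge_zero order_trans by blast+
  have hv: "norm (h $ i * v $ j) \<le> norm h * norm v" for h :: "real ^ 'n" and v :: "real ^ 'm" and i j
    unfolding norm_mult using component_le_norm_cart[of h i] component_le_norm_cart[of v j] by (intro mult_mono) auto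
  have 1: "norm (B x h v) \<le> M1 * norm h * norm v" if "x \<in> cball 0 r" for x h v
  proof -
    have "norm (B x h v) \<le> (\<Sum>i\<in>UNIV. \<Sum>j\<in>UNIV. (norm h * norm v) * M (b i j))"
      unfolding B_def
    proof (intro order_trans[OF norm_sum] sum_mono order_trans[OF norm_sum], unfold norm_scaleR)
      fix i j
      show "\<bar>h $ i * v $ j\<bar> * norm (b i j x) \<le> (norm h * norm v) * M (b i j)"
        using hv[of h i v j] M[OF smb that, of i j] by (intro mult_mono) auto
    qed
    then show ?thesis by (simp add: M1_def sum_distrib_left sum_distrib_right mult_ac)
  qed
  have 2: "norm (B' x k h v) \<le> M2 * norm k * norm h * norm v" if "x \<in> cball 0 r" for x k h v
  proof -
    have "norm (B' x k h v) \<le> (\<Sum>i\<in>UNIV. \<Sum>j\<in>UNIV. (norm h * norm v) * (\<Sum>l\<in>UNIV. norm k * M (partial_deriv l (b i j))))"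
      unfolding B'_def
    proof (intro order_trans[OF norm_sum] sum_mono order_trans[OF norm_sum], unfold norm_scaleR)
      fix i j
      have "norm (\<Sum>l\<in>UNIV. k $ l *\<^sub>R partial_deriv l (b i j) x) \<le> (\<Sum>l\<in>UNIV. norm k * M (partial_deriv l (b i j)))"
      proof (intro order_trans[OF norm_sum] sum_mono, unfold norm_scaleR)
        fix l
        show "\<bar>k $ l\<bar> * norm (partial_deriv l (b i j) x) \<le> norm k * M (partial_deriv l (b i j))"
          using component_le_norm_cart[of k l] M[OF p that, of l i j] by (intro mult_mono) auto
      qed
      then show "\<bar>h $ i * v $ j\<bar> * norm (\<Sum>l\<in>UNIV. k $ l *\<^sub>R partial_deriv l (b i j) x)
          \<le> (norm h * norm v) * (\<Sum>l\<in>UNIV. norm k * M (partial_deriv l (b i j)))"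
        using hv[of h i v j] by (intro mult_mono) auto
    qed
    then show ?thesis by (simp add: M2_def sum_distrib_left sum_distrib_right mult_ac)
  qed
  have "0 \<le> M1" "0 \<le> M2" using M0 by (auto simp: M1_def M2_def intro!: sum_nonneg)
  moreover have "norm (B x h v) \<le> (M1 + M2) * norm h * norm v" if "x \<in> cball 0 r" for x h v
    by (rule order_trans[OF 1[OF that]]) (use \<open>0 \<le> M2\<close> in \<open>auto intro!: mult_right_mono\<close>)
  moreover have "norm (B' x k h v) \<le> (M1 + M2) * norm k * norm h * norm v" if "x \<in> cball 0 r" for x k h v
    by (rule order_trans[OF 2[OF that]]) (use \<open>0 \<le> M1\<close> in \<open>auto intro!: mult_right_mono\<close>)
  ultimately show thesis using r by (intro that[of r "M1 + M2"]) auto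
qed

lemma C1_pair_add:
  "C1_pair r f f' \<Longrightarrow> C1_pair r g g' \<Longrightarrow> C1_pair r (\<lambda>x. f x + g x) (\<lambda>x h. f' x h + g' x h)"
  unfolding C1_pair_def by (auto intro: has_derivative_add continuous_on_add)

lemma C1_pair_diff:
  "C1_pair r f f' \<Longrightarrow> C1_pair r g g' \<Longrightarrow> C1_pair r (\<lambda>x. f x - g x) (\<lambda>x h. f' x h - g' x h)"
  unfolding C1_pair_def by (auto intro: has_derivative_diff continuous_on_diff)

lemma C1_pair_const: "C1_pair r (\<lambda>x. c) (\<lambda>x h. 0)"
  unfolding C1_pair_def by auto

lemma C1_pair_sum:
  fixes n :: nat
  shows "(\<And>m. C1_pair r (f m) (f' m)) \<Longrightarrow> C1_pair r (\<lambda>x. \<Sum>m<n. f m x) (\<lambda>x h. \<Sum>m<n. f' m x h)"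
  by (induction n) (auto intro: C1_pair_add C1_pair_const)

lemma K_diff:
  assumes "ball 0 r \<subseteq> U" "C1_pair r f f'" "C1_pair r g g'" "x \<in> ball 0 r"
  shows "K (\<lambda>y. f y - g y) x = K f x - K g x"
  unfolding K_def B_linear
  using assms by (intro integral_diff integrable_continuous_interval K_integrand_continuous C1_pair_continuous)

lemma K_sum:
  fixes n :: nat
  assumes "ball 0 r \<subseteq> U" "\<And>m. C1_pair r (f m) (f' m)" "x \<in> ball 0 r"
  shows "K (\<lambda>y. \<Sum>m<n. f m y) x = (\<Sum>m<n. K (f m) x)"
proof (induction n)
  case 0
  then show ?case by (simp add: K_def B_linear)
next
  case (Suc n)
  have "K (\<lambda>y. \<Sum>m<n. f m y) x = K (\<lambda>y. (\<Sum>m<Suc n. f m y) - f n y) x" by simp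
  also have "\<dots> = K (\<lambda>y. \<Sum>m<Suc n. f m y) x - K (f n) x"
    by (rule K_diff[OF assms(1) C1_pair_sum[OF assms(2)] assms(2,3)])
  finally show ?case using Suc by simp
qed

text \<open>The terms of a Neumann series, the \<open>n\<close>-th being the \<open>n\<close>-fold
  application of \<open>K\<close> to the constant \<open>c\<close>, together with its derivative.
  The solution is the sum of the series, not the limit of these terms.\<close>

primrec picard :: "real ^ 'm \<Rightarrow> nat \<Rightarrow> (real ^ 'n \<Rightarrow> real ^ 'm) \<times> (real ^ 'n \<Rightarrow> real ^ 'n \<Rightarrow> real ^ 'm)"
  where
    "picard c 0 = (\<lambda>x. c, \<lambda>x h. 0)"
  | "picard c (Suc n) = (K (fst (picard c n)), K' (fst (picard c n)) (snd (picard c n)))"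

text \<open>The smallness of \<open>a * r\<close> makes the terms and their derivatives decrease
  geometrically, so that the series may be differentiated term by term. Applying \<open>K\<close>
  shifts the series by one place, which is the integral equation.\<close>

lemma radial_solution_exists:
  assumes rU: "0 < r" "ball 0 r \<subseteq> U"
    and a: "\<And>x h v. x \<in> ball 0 r \<Longrightarrow> norm (B x h v) \<le> a * norm h * norm v"
      "\<And>x k h v. x \<in> ball 0 r \<Longrightarrow> norm (B' x k h v) \<le> a * norm k * norm h * norm v"
    and a0: "0 \<le> a" and r1: "r \<le> 1" and ar: "a * r \<le> 1 / 8"
  shows "\<exists>f f'. C1_pair r f f' \<and> (\<forall>x\<in>ball 0 r. f x = c + K f x)"
proof -
  \<comment> \<open>Chosen so that \<open>2 * a + a * r * L\<close> is at most \<open>L / 2\<close>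
    as soon as \<open>a * r\<close> is at most 1/8.\<close>
  define L where "L = 8 * (a + 1)"
  define M where "M = norm c"
  define f where "f n = fst (picard c n)" for n
  define f' where "f' n = snd (picard c n)" for n
  have fs: "f 0 = (\<lambda>x. c)" "f' 0 = (\<lambda>x h. 0)" "f (Suc n) = K (f n)" "f' (Suc n) = K' (f n) (f' n)" for n
    by (simp_all add: f_def f'_def)
  have L0: "0 \<le> L" using a0 by (simp add: L_def)
  have C: "C1_pair r (f n) (f' n)" for n :: nat
    by (induction n) (auto simp: fs intro: K_C1_pair[OF rU(2)] C1_pair_const)
  have bnd: "(\<forall>x\<in>ball 0 r. norm (f n x) \<le> M / 2 ^ n \<and> (\<forall>h. norm (f' n x h) \<le> (M / 2 ^ n) * L * norm h))" for n :: nat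
  proof (induction n)
    case 0
    then show ?case using L0 by (auto simp: fs M_def)
  next
    case (Suc n)
    have m0: "0 \<le> M / 2 ^ n" by (simp add: M_def)
    show ?case
    proof (intro ballI conjI allI)
      fix x h assume x: "x \<in> ball (0::real^'n) r"
      note b = C1_pair_bound[OF rU(2) C[of n] a a0 L0 r1 _ _ x, of "M / 2 ^ n"]
      have "norm (f (Suc n) x) \<le> a * r * (M / 2 ^ n)" unfolding fs using b(1) Suc by blast
      also have "\<dots> \<le> (1 / 2) * (M / 2 ^ n)" using ar m0 by (intro mult_right_mono) auto
      finally show "norm (f (Suc n) x) \<le> M / 2 ^ Suc n" by simp
      have "norm (f' (Suc n) x h) \<le> (2 * a + a * r * L) * (M / 2 ^ n) * norm h" unfolding fs using b(2) Suc by blast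
      also have "\<dots> \<le> (L / 2) * (M / 2 ^ n) * norm h"
      proof -
        have "a * r * L \<le> 1 / 8 * L" using ar L0 by (rule mult_right_mono)
        moreover have "2 * a + 1 / 8 * L \<le> L / 2" using a0 by (simp add: L_def)
        ultimately have "2 * a + a * r * L \<le> L / 2" by linarith
        then show ?thesis using m0 by (intro mult_right_mono) auto
      qed
      finally show "norm (f' (Suc n) x h) \<le> (M / 2 ^ Suc n) * L * norm h" by (simp add: mult_ac)
    qed
  qed
  define f_lim where "f_lim x = (\<Sum>n. f n x)" for x
  define f_lim' where "f_lim' x h = (\<Sum>n. f' n x h)" for x h
  have tail: "summable (\<lambda>n. f n x)" "norm ((\<Sum>m<n. f m x) - f_lim x) \<le> 2 * M / 2 ^ n" if "x \<in> ball 0 r" for x n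
    unfolding f_lim_def using geometric_tail[of "\<lambda>n. f n x" M] bnd that by blast+
  have tail': "norm ((\<Sum>m<n. f' m x h) - f_lim' x h) \<le> (2 * M / 2 ^ n) * L * norm h" if "x \<in> ball 0 r" for x n h
  proof -
    have "norm (f' m x h) \<le> M * L * norm h / 2 ^ m" for m using bnd[of m] that by (simp add: mult_ac)
    from geometric_tail(2)[OF this, of n] show ?thesis unfolding f_lim'_def by (simp add: mult_ac)
  qed
  have lim0: "(\<lambda>n. (2 * M / 2 ^ n) * w) \<longlonglongrightarrow> 0" for w :: real
  proof -
    have "(\<lambda>n. (2 * M * w) * (1 / 2) ^ n) \<longlonglongrightarrow> (2 * M * w) * 0"
      by (intro tendsto_mult tendsto_const LIMSEQ_realpow_zero) auto
    then show ?thesis by (simp add: power_divide mult_ac)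
  qed
  have ev: "\<forall>\<^sub>F n in sequentially. (2 * M / 2 ^ n) * w < e" if "e > 0" for w e :: real
    using order_tendstoD(2)[OF lim0 that] .
  have "\<exists>g. \<forall>x\<in>ball 0 r. (\<lambda>n. f n x) sums g x \<and> (g has_derivative f_lim' x) (at x within ball 0 r)"
  proof (rule has_derivative_series[where x = 0 and l = "f_lim 0"])
    show "(f n has_derivative f' n x) (at x within ball 0 r)" if "x \<in> ball 0 r" for n x
      using C[of n] that unfolding C1_pair_def by (blast intro: has_derivative_at_withinI)
    fix e :: real assume e: "e > 0"
    show "\<forall>\<^sub>F n in sequentially. \<forall>x\<in>ball 0 r. \<forall>h. norm ((\<Sum>i<n. f' i x h) - f_lim' x h) \<le> e * norm h"
      using ev[OF e, of L]
    proof (eventually_elim, intro ballI allI)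
      fix n x and h :: "real ^ 'n" assume n: "2 * M / 2 ^ n * L < e" and x: "x \<in> ball (0::real^'n) r"
      have "2 * M / 2 ^ n * L * norm h \<le> e * norm h" using n by (intro mult_right_mono) auto
      then show "norm ((\<Sum>i<n. f' i x h) - f_lim' x h) \<le> e * norm h" using tail'[OF x, of h n] by linarith
    qed
  next
    show "(0::real^'n) \<in> ball 0 r" using rU by simp
    show "(\<lambda>n. f n 0) sums f_lim 0" unfolding f_lim_def using tail(1)[of 0] rU by (intro summable_sums) auto
  qed auto
  then obtain g where g: "\<And>x. x \<in> ball 0 r \<Longrightarrow> (\<lambda>n. f n x) sums g x"
    "\<And>x. x \<in> ball 0 r \<Longrightarrow> (g has_derivative f_lim' x) (at x within ball 0 r)" by blast
  have gf: "g x = f_lim x" if "x \<in> ball 0 r" for x unfolding f_lim_def using sums_unique[OF g(1)[OF that]] .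
  have df: "(f_lim has_derivative f_lim' x) (at x)" if x: "x \<in> ball 0 r" for x
  proof (rule has_derivative_transform_within_open[OF _ open_ball x gf])
    show "(g has_derivative f_lim' x) (at x)" using g(2)[OF x] unfolding at_within_open[OF x open_ball] .
  qed
  have cf: "continuous_on (ball 0 r) (\<lambda>x. f_lim' x h)" for h
  proof (rule uniform_limit_theorem)
    show "\<forall>\<^sub>F n in sequentially. continuous_on (ball 0 r) (\<lambda>x. \<Sum>i<n. f' i x h)"
      using C unfolding C1_pair_def by (intro always_eventually allI continuous_on_sum) auto
    show "uniform_limit (ball 0 r) (\<lambda>n x. \<Sum>i<n. f' i x h) (\<lambda>x. f_lim' x h) sequentially"
    proof (rule uniform_limitI)
      fix e :: real assume e: "e > 0"
      show "\<forall>\<^sub>F n in sequentially. \<forall>x\<in>ball 0 r. dist (\<Sum>i<n. f' i x h) (f_lim' x h) < e"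
        using ev[OF e, of "L * norm h"]
      proof (eventually_elim, intro ballI)
        fix n x assume n: "2 * M / 2 ^ n * (L * norm h) < e" and x: "x \<in> ball (0::real^'n) r"
        show "dist (\<Sum>i<n. f' i x h) (f_lim' x h) < e"
          using tail'[OF x, of h n] n by (simp add: dist_norm mult.assoc)
      qed
    qed
  qed auto
  have Cl: "C1_pair r f_lim f_lim'" unfolding C1_pair_def using df cf by blast
  have "f_lim x = c + K f_lim x" if x: "x \<in> ball 0 r" for x
  proof -
    \<comment> \<open>A shift by one: the \<open>K\<close>-image of a partial sum is the next
      partial sum without its first term \<open>c\<close>.\<close>
    have s: "K (\<lambda>y. \<Sum>m<n. f m y) x = (\<Sum>m<Suc n. f m x) - c" for n
    proof -
      have "K (\<lambda>y. \<Sum>m<n. f m y) x = (\<Sum>m<n. f (Suc m) x)" using K_sum[OF rU(2) C x] fs by simp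
      also have "\<dots> = (\<Sum>m<Suc n. f m x) - c" unfolding sum.lessThan_Suc_shift by (simp add: fs)
      finally show ?thesis .
    qed
    have "norm (((\<Sum>m<Suc n. f m x) - c) - K f_lim x) \<le> (2 * M / 2 ^ n) * (a * r)" for n
    proof -
      note D = C1_pair_diff[OF C1_pair_sum[where n = n, OF C] Cl]
      have "norm (K (\<lambda>y. (\<Sum>m<n. f m y) - f_lim y) x) \<le> a * r * (2 * M / 2 ^ n)"
        by (rule C1_pair_bound(1)[OF rU(2) D a a0 L0 r1 tail(2) tail' x])
      then show ?thesis unfolding K_diff[OF rU(2) C1_pair_sum[OF C] Cl x] s by (simp add: mult_ac)
    qed
    then have "(\<lambda>n. ((\<Sum>m<Suc n. f m x) - c) - K f_lim x) \<longlonglongrightarrow> 0"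
      by (intro Lim_null_comparison[OF always_eventually lim0[of "a * r"]] allI)
    moreover have "(\<lambda>n. ((\<Sum>m<Suc n. f m x) - c) - K f_lim x) \<longlonglongrightarrow> (f_lim x - c) - K f_lim x"
      using summable_sums[OF tail(1)[OF x]] unfolding sums_def f_lim_def[symmetric]
      by (intro tendsto_diff tendsto_const LIMSEQ_Suc)
    ultimately have "(f_lim x - c) - K f_lim x = 0" using LIMSEQ_unique by blast
    then show ?thesis by (simp add: algebra_simps)
  qed
  then show ?thesis using Cl by blast
qed

text \<open>The defect \<open>e x h = f' x h - B x h (f x)\<close> of a radial solution satisfies a homogeneous integral
  equation, because differentiating \<open>t B (t x) h (f (t x))\<close> along the ray produces all curvature
  terms; hence it vanishes near the centre.\<close>

lemma radial_solution_parallel: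
  assumes rU: "0 < r" "ball 0 r \<subseteq> U"
    and a: "\<And>x h v. x \<in> ball 0 r \<Longrightarrow> norm (B x h v) \<le> a * norm h * norm v"
    and a0: "0 \<le> a" and r1: "r \<le> 1" and ar: "a * r \<le> 1 / 8"
    and flat: "\<And>x h k v. x \<in> U \<Longrightarrow> B' x h k v - B' x k h v + B x k (B x h v) - B x h (B x k v) = 0"
    and C: "C1_pair r f f'" and fp: "\<And>x. x \<in> ball 0 r \<Longrightarrow> f x = c + K f x" and x: "x \<in> ball 0 r"
  shows "f' x h = B x h (f x)"
proof -
  define e where "e x h = f' x h - B x h (f x)" for x h
  have df: "(f has_derivative f' y) (at y)" if "y \<in> ball 0 r" for y using C that unfolding C1_pair_def by blast
  have f'K: "f' y = K' f f' y" if y: "y \<in> ball 0 r" for y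
  proof -
    have "(K f has_derivative K' f f' y) (at y)" using K_C1_pair[OF rU(2) C] y unfolding C1_pair_def by blast
    from has_derivative_add[OF has_derivative_const this, of c]
    have "((\<lambda>x. c + K f x) has_derivative K' f f' y) (at y)" by simp
    then have "(f has_derivative K' f f' y) (at y)"
      by (rule has_derivative_transform_within_open[OF _ open_ball y]) (use fp in auto)
    then show ?thesis using df[OF y] has_derivative_unique by blast
  qed
  have e_eq: "e y h = integral {0..1} (\<lambda>t. t *\<^sub>R (B (t *\<^sub>R y) y (e (t *\<^sub>R y) h) - B (t *\<^sub>R y) h (e (t *\<^sub>R y) y)))"
    if y: "y \<in> ball 0 r" for y h
  proof -
    let ?G = "\<lambda>t. B (t *\<^sub>R y) h (f (t *\<^sub>R y)) + t *\<^sub>R (B' (t *\<^sub>R y) y h (f (t *\<^sub>R y)) + B (t *\<^sub>R y) h (f' (t *\<^sub>R y) y))"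
    let ?H = "\<lambda>t. t *\<^sub>R B' (t *\<^sub>R y) h y (f (t *\<^sub>R y)) + B (t *\<^sub>R y) h (f (t *\<^sub>R y))
        + t *\<^sub>R B (t *\<^sub>R y) y (f' (t *\<^sub>R y) h)"
    have ty: "t *\<^sub>R y \<in> ball 0 r" "t *\<^sub>R y \<in> U" if "t \<in> {0..1}" for t
      using scaleR_in_ball[OF y that] rU(2) by blast+
    have "(?G has_integral 1 *\<^sub>R B (1 *\<^sub>R y) h (f (1 *\<^sub>R y)) - 0 *\<^sub>R B (0 *\<^sub>R y) h (f (0 *\<^sub>R y))) {0..1}"
    proof (rule fundamental_theorem_of_calculus)
      fix t :: real assume t: "t \<in> {0..1}"
      have s: "((\<lambda>t. t *\<^sub>R y) has_derivative (\<lambda>d. d *\<^sub>R y)) (at t)" by (auto intro!: derivative_eq_intros)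
      have l: "f' (t *\<^sub>R y) (d *\<^sub>R y) = d *\<^sub>R f' (t *\<^sub>R y) y" for d
        using has_derivative_linear[OF df[OF ty(1)[OF t]]] linear_cmul by blast
      have "((\<lambda>t. B (t *\<^sub>R y) h (f (t *\<^sub>R y))) has_derivative
          (\<lambda>d. d *\<^sub>R (B' (t *\<^sub>R y) y h (f (t *\<^sub>R y)) + B (t *\<^sub>R y) h (f' (t *\<^sub>R y) y)))) (at t)"
        using has_derivative_B[OF s has_derivative_const has_derivative_compose[OF s df[OF ty(1)[OF t]]] ty(2)[OF t], of h]
        by (simp add: l B_linear B'_linear scaleR_add_right)
      then have "((\<lambda>t. t *\<^sub>R B (t *\<^sub>R y) h (f (t *\<^sub>R y))) has_derivative (\<lambda>d. d *\<^sub>R ?G t)) (at t)"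
        by (auto intro!: derivative_eq_intros simp: scaleR_add_right mult.commute)
      then show "((\<lambda>t. t *\<^sub>R B (t *\<^sub>R y) h (f (t *\<^sub>R y))) has_vector_derivative ?G t) (at t within {0..1})"
        unfolding has_vector_derivative_def by (rule has_derivative_at_withinI)
    qed simp
    then have G: "(?G has_integral B y h (f y)) {0..1}" by simp
    have "continuous_on {0..1} ?H"
      using continuous_on_compose2[OF K'_integrand_continuous[OF rU(2) C], of "{0..1}" "\<lambda>t. (y, t)" h] y
      by (simp add: continuous_on_Pair image_subset_iff)
    then have H: "(?H has_integral f' y h) {0..1}"
      unfolding f'K[OF y] K'_def by (intro integrable_integral integrable_continuous_interval)
    have eq: "?H t - ?G t = t *\<^sub>R (B (t *\<^sub>R y) y (e (t *\<^sub>R y) h) - B (t *\<^sub>R y) h (e (t *\<^sub>R y) y))"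
      if t: "t \<in> {0..1}" for t
    proof -
      let ?z = "t *\<^sub>R y"
      \<comment> \<open>The flatness identity exchanges the directions \<open>h\<close> and
        \<open>y\<close> in \<open>B'\<close>; after that all terms combine into values of the
        defect \<open>e\<close>.\<close>
      have fl: "B' ?z h y (f ?z) = B' ?z y h (f ?z) - B ?z y (B ?z h (f ?z)) + B ?z h (B ?z y (f ?z))"
        using flat[OF ty(2)[OF t], of h y "f ?z"] by (simp add: algebra_simps)
      show ?thesis unfolding e_def B_linear fl by (simp add: algebra_simps)
    qed
    have "((\<lambda>t. ?H t - ?G t) has_integral e y h) {0..1}" using has_integral_diff[OF H G] unfolding e_def .
    then have "((\<lambda>t. t *\<^sub>R (B (t *\<^sub>R y) y (e (t *\<^sub>R y) h) - B (t *\<^sub>R y) h (e (t *\<^sub>R y) y))) has_integral e y h) {0..1}"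
      by (rule has_integral_eq[rotated]) (use eq in auto)
    then show ?thesis by (rule integral_unique[symmetric])
  qed
  have ce: "continuous_on {0..1} (\<lambda>t. t *\<^sub>R (B (t *\<^sub>R y) y (e (t *\<^sub>R y) h) - B (t *\<^sub>R y) h (e (t *\<^sub>R y) y)))"
    if y: "y \<in> ball 0 r" for y h
  proof -
    have im: "(\<lambda>t. t *\<^sub>R y) ` {0..1} \<subseteq> ball 0 r" using scaleR_in_ball[OF y] by blast
    have sc: "continuous_on {0..1} (\<lambda>t. t *\<^sub>R y)" by (intro continuous_intros)
    have f': "continuous_on {0..1} (\<lambda>t. f' (t *\<^sub>R y) w)" for w
      using C unfolding C1_pair_def by (intro continuous_on_compose2[OF _ sc im]) blast
    show ?thesis unfolding e_def
      by (intro continuous_on_scaleR continuous_on_diff continuous_B continuous_on_const continuous_on_id sc f'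
          continuous_on_compose2[OF C1_pair_continuous[OF C] sc im] order_trans[OF im rU(2)])
  qed
  \<comment> \<open>On the open ball the defect may be unbounded. The closed ball through
    \<open>x\<close> is compact and invariant under multiplication by \<open>t\<close> in the unit
    interval, so the integral equation can be iterated on it.\<close>
  obtain M where M: "\<And>y h. y \<in> cball 0 (norm x) \<Longrightarrow> norm (e y h) \<le> M * norm h"
  proof -
    have sub: "cball (0::real^'n) (norm x) \<subseteq> ball 0 r" using x by auto
    have "\<exists>M. \<forall>y\<in>cball 0 (norm x). norm (e y h) \<le> M" for h
    proof -
      have "continuous_on (ball 0 r) (\<lambda>y. f' y h)" using C unfolding C1_pair_def by blast
      then have "continuous_on (cball 0 (norm x)) (\<lambda>y. e y h)" unfolding e_def
        by (intro continuous_on_diff continuous_B continuous_on_const continuous_on_id)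
          (use sub rU(2) C1_pair_continuous[OF C] in \<open>auto intro: continuous_on_subset\<close>)
      from compact_imp_bounded[OF compact_continuous_image[OF this compact_cball]] show ?thesis
        by (auto simp: bounded_iff)
    qed
    then obtain N where N: "\<And>h y. y \<in> cball 0 (norm x) \<Longrightarrow> norm (e y h) \<le> N h" by metis
    have "norm (e y h) \<le> (\<Sum>i\<in>UNIV. N (axis i 1)) * norm h" if y: "y \<in> cball 0 (norm x)" for y h
    proof -
      have "linear (f' y)" using has_derivative_linear[OF df] y sub by blast
      then have "linear (e y)" unfolding e_def
        by (intro linear_compose_sub) (auto intro!: linearI simp: B_linear)
      then have "e y (\<Sum>i\<in>UNIV. h $ i *\<^sub>R axis i 1) = (\<Sum>i\<in>UNIV. h $ i *\<^sub>R e y (axis i 1))"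
        by (simp add: linear_sum linear_cmul)
      moreover have "(\<Sum>i\<in>UNIV. h $ i *\<^sub>R axis i 1) = h"
        by (simp add: vec_eq_iff axis_def if_distrib cong: if_cong)
      ultimately have "norm (e y h) \<le> (\<Sum>i\<in>UNIV. norm (h $ i *\<^sub>R e y (axis i 1)))"
        using norm_sum[of "\<lambda>i. h $ i *\<^sub>R e y (axis i 1)" UNIV] by simp
      also have "\<dots> \<le> (\<Sum>i\<in>UNIV. norm h * N (axis i 1))"
        by (intro sum_mono, unfold norm_scaleR real_norm_def) (intro mult_mono N[OF y] component_le_norm_cart, auto)
      finally show ?thesis by (simp add: sum_distrib_left mult.commute)
    qed
    then show thesis using that by blast
  qed
  have M0: "0 \<le> M"
    using order_trans[OF norm_ge_zero M[of 0 "axis undefined 1"]] by simp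
  \<comment> \<open>Each substitution into the integral equation gains the factor
    \<open>2 * (a * r)\<close>, which is at most 1/4; a halving is all that is recorded.\<close>
  have "\<forall>y\<in>cball 0 (norm x). \<forall>h. norm (e y h) \<le> M / 2 ^ n * norm h" for n
  proof (induction n)
    case 0
    then show ?case using M by simp
  next
    case (Suc n)
    show ?case
    proof (intro ballI allI)
      fix y h assume y: "y \<in> cball (0::real^'n) (norm x)"
      have yb: "y \<in> ball 0 r" "norm y \<le> r" using y x by auto
      let ?m = "M / 2 ^ n"
      have m0: "0 \<le> ?m" using M0 by simp
      have "norm (e y h) \<le> (2 * (a * r) * ?m * norm h) * (1 - 0)"
        unfolding e_eq[OF yb(1)]
      proof (rule integral_bound)
        fix t :: real assume t: "t \<in> {0..1}"
        have ty: "t *\<^sub>R y \<in> ball 0 r" using scaleR_in_ball[OF yb(1) t] .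
        have "\<bar>t\<bar> * norm y \<le> 1 * norm y" using t by (intro mult_right_mono) auto
        then have ty': "t *\<^sub>R y \<in> cball 0 (norm x)" using y by simp
        have "norm (B (t *\<^sub>R y) y (e (t *\<^sub>R y) h)) \<le> a * r * (?m * norm h)"
          by (rule order_trans[OF a[OF ty]]) (use Suc ty' a0 yb rU(1) in \<open>intro mult_mono, auto\<close>)
        moreover have "norm (B (t *\<^sub>R y) h (e (t *\<^sub>R y) y)) \<le> a * norm h * (?m * r)"
        proof (rule order_trans[OF a[OF ty]])
          have "norm (e (t *\<^sub>R y) y) \<le> ?m * norm y" using Suc ty' by blast
          also have "\<dots> \<le> ?m * r" using yb m0 by (intro mult_left_mono) auto
          finally show "a * norm h * norm (e (t *\<^sub>R y) y) \<le> a * norm h * (?m * r)"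
            using a0 by (intro mult_left_mono) auto
        qed
        moreover have "a * norm h * (?m * r) = a * r * (?m * norm h)" by (simp add: mult_ac)
        ultimately have "norm (B (t *\<^sub>R y) y (e (t *\<^sub>R y) h) - B (t *\<^sub>R y) h (e (t *\<^sub>R y) y)) \<le> 2 * (a * r * (?m * norm h))"
          using norm_triangle_ineq4[of "B (t *\<^sub>R y) y (e (t *\<^sub>R y) h)" "B (t *\<^sub>R y) h (e (t *\<^sub>R y) y)"]
          by linarith
        also have "\<dots> = 2 * (a * r) * ?m * norm h" by (simp only: mult_ac)
        finally have "norm (B (t *\<^sub>R y) y (e (t *\<^sub>R y) h) - B (t *\<^sub>R y) h (e (t *\<^sub>R y) y)) \<le> 2 * (a * r) * ?m * norm h" .
        moreover have "norm (t *\<^sub>R w) \<le> norm w" for w :: "real ^ 'm" using t by (simp add: mult_left_le_one_le)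
        ultimately show "norm (t *\<^sub>R (B (t *\<^sub>R y) y (e (t *\<^sub>R y) h) - B (t *\<^sub>R y) h (e (t *\<^sub>R y) y))) \<le> 2 * (a * r) * ?m * norm h"
          using order_trans by blast
      qed (use ce[OF yb(1)] in auto)
      also have "\<dots> \<le> (1 / 2 * ?m) * norm h"
        using ar m0 unfolding mult_1_right diff_0_right by (intro mult_right_mono) auto
      finally show "norm (e y h) \<le> M / 2 ^ Suc n * norm h" by simp
    qed
  qed
  then have le: "norm (e x h) \<le> M * norm h * (1 / 2) ^ n" for n
    by (simp add: power_divide mult_ac)
  have "(\<lambda>n. M * norm h * (1 / 2) ^ n) \<longlonglongrightarrow> M * norm h * 0"
    by (intro tendsto_mult tendsto_const LIMSEQ_realpow_zero) auto
  then have "norm (e x h) \<le> M * norm h * 0" by (rule LIMSEQ_le_const) (use le in auto)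
  then show ?thesis by (simp add: e_def)
qed

text \<open>The assumption is the vanishing of the curvature of the connection d - B. The radius
  depends on bounds for the coefficients and not on \<open>c\<close>, so the solutions for a whole
  basis of initial values share one neighbourhood.\<close>

theorem parallel_section_exists:
  assumes flat: "\<And>x h k v. x \<in> U \<Longrightarrow> B' x h k v - B' x k h v + B x k (B x h v) - B x h (B x k v) = 0"
  shows "\<exists>r>0. ball 0 r \<subseteq> U \<and> (\<forall>c. \<exists>f. f 0 = c \<and> smooth_on (ball 0 r) f \<and>
    (\<forall>x\<in>ball 0 r. (f has_derivative (\<lambda>h. B x h (f x))) (at x)))"
proof -
  obtain r0 a where r0: "0 < r0" "0 \<le> a" "cball 0 r0 \<subseteq> U"
    and a: "\<And>x h v. x \<in> cball 0 r0 \<Longrightarrow> norm (B x h v) \<le> a * norm h * norm v"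
    "\<And>x k h v. x \<in> cball 0 r0 \<Longrightarrow> norm (B' x k h v) \<le> a * norm k * norm h * norm v"
    using coefficient_bounds by blast
  \<comment> \<open>As \<open>a\<close> is nonnegative, this gives both \<open>r \<le> 1\<close> and
    \<open>a * r \<le> 1 / 8\<close>.\<close>
  define r where "r = min r0 (1 / (8 * (a + 1)))"
  have r: "0 < r" "r \<le> r0" "r \<le> 1 / (8 * (a + 1))" using r0 by (auto simp: r_def)
  have "a * r \<le> a * (1 / (8 * (a + 1)))" using r r0 by (intro mult_left_mono)
  also have "\<dots> \<le> 1 / 8" using r0 by (simp add: field_simps)
  finally have ar: "a * r \<le> 1 / 8" .
  have "1 / (8 * (a + 1)) \<le> 1" using r0 by (simp add: field_simps)
  then have r1: "r \<le> 1" using r by linarith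
  have sub: "ball (0::real^'n) r \<subseteq> cball 0 r0" using r by auto
  then have rU: "ball 0 r \<subseteq> U" using r0 by blast
  have "\<exists>f. f 0 = c \<and> smooth_on (ball 0 r) f \<and> (\<forall>x\<in>ball 0 r. (f has_derivative (\<lambda>h. B x h (f x))) (at x))" for c
  proof -
    obtain f f' where f: "C1_pair r f f'" "\<And>x. x \<in> ball 0 r \<Longrightarrow> f x = c + K f x"
      using radial_solution_exists[OF r(1) rU _ _ r0(2) r1 ar, of c] a sub by blast
    have "f' x h = B x h (f x)" if "x \<in> ball 0 r" for x h
      by (rule radial_solution_parallel[OF r(1) rU _ r0(2) r1 ar flat f that]) (use a sub in blast)+
    then have "f' x = (\<lambda>h. B x h (f x))" if "x \<in> ball 0 r" for x using that by blast
    then have d: "(f has_derivative (\<lambda>h. B x h (f x))) (at x)" if "x \<in> ball 0 r" for x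
      using f(1) that unfolding C1_pair_def by metis
    moreover have "smooth_on (ball 0 r) f"
      by (rule smooth_on_bootstrap[OF open_ball d[unfolded B_def] smooth_on_subset[OF smb rU]])
    moreover have "f 0 = c" using f(2)[of 0] r(1) by (simp add: K_def B_linear)
    ultimately show ?thesis by blast
  qed
  then show ?thesis using r(1) rU by blast
qed

end

lemma has_derivative_partial_deriv:
  fixes f :: "real ^ 'n::finite \<Rightarrow> 'b::real_normed_vector"
  assumes "(f has_derivative f') (at x)"
  shows "f' h = (\<Sum>i\<in>UNIV. h $ i *\<^sub>R partial_deriv i f x)"
  unfolding partial_deriv_def frechet_derivative_at[OF assms, symmetric]
  by (rule has_derivative_partial_expand[OF assms])

section \<open>Charts, vector fields and differentials\<close>

text \<open>\<open>components\<close> and \<open>coord_vector\<close> are the cases in which one of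
  the two charts is the preferred one; the symmetric notion makes one chain rule available for
  both.\<close>

definition transition_deriv :: "('a, 'n::finite) chart \<Rightarrow> ('a, 'n) chart \<Rightarrow> 'a \<Rightarrow> real ^ 'n \<Rightarrow> real ^ 'n"
  where "transition_deriv c d q = frechet_derivative (snd d \<circ> chart_inv c) (at (snd c q))"

text \<open>The tangent vector at \<open>q\<close> with the components \<open>w\<close> in the chart \<open>c\<close>.\<close>

definition tangent_vec :: "('a, 'n::finite) chart set \<Rightarrow> ('a, 'n) chart \<Rightarrow> 'a \<Rightarrow> real ^ 'n \<Rightarrow> real ^ 'n"
  where "tangent_vec A c q = transition_deriv c (chart_at A q) q"

lemma components_transition: "components A c q = transition_deriv (chart_at A q) c q"
  by (simp add: components_def transition_deriv_def)

lemma coord_vector_tangent: "coord_vector A c i q = tangent_vec A c q (axis i 1)"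
  by (simp add: coord_vector_def tangent_vec_def transition_deriv_def)

section \<open>Charts and tangent vectors\<close>

locale smooth_mfd =
  fixes M :: "'a topology" and A :: "('a, 'n::finite) chart set"
  assumes mfd: "smooth_manifold M A"
begin

lemma chart: "c \<in> A \<Longrightarrow> is_chart M c" using mfd by (simp add: smooth_manifold_def)

lemma chart_openin: "c \<in> A \<Longrightarrow> openin M (fst c)" using chart by (simp add: is_chart_def)

lemma chart_inj: "c \<in> A \<Longrightarrow> inj_on (snd c) (fst c)"
  using chart[of c] homeomorphic_imp_injective_map[of "subtopology M (fst c)"] openin_subset[of M "fst c"]
  by (auto simp: is_chart_def topspace_subtopology Int_absorb1)

lemma chart_inv_left [simp]: "c \<in> A \<Longrightarrow> q \<in> fst c \<Longrightarrow> chart_inv c (snd c q) = q"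
  using chart_inj by (simp add: chart_inv_def)

lemma chart_inv_right: "x \<in> snd c ` fst c \<Longrightarrow> snd c (chart_inv c x) = x" "x \<in> snd c ` fst c \<Longrightarrow> chart_inv c x \<in> fst c"
  by (simp_all add: chart_inv_def f_inv_into_f inv_into_into)

lemma open_chart_image: 
  assumes "c \<in> A" "openin M W"
  shows "open (snd c ` (fst c \<inter> W))"
proof -
  have "open_map (subtopology M (fst c)) (top_of_set (snd c ` fst c)) (snd c)"
    using chart[OF assms(1)] homeomorphic_imp_open_map by (auto simp: is_chart_def)
  moreover have "openin (subtopology M (fst c)) (fst c \<inter> W)" using assms(2) by (auto simp: openin_subtopology)
  ultimately have "openin (top_of_set (snd c ` fst c)) (snd c ` (fst c \<inter> W))" unfolding open_map_def by blast
  moreover have "open (snd c ` fst c)" using chart[OF assms(1)] by (simp add: is_chart_def)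
  ultimately show ?thesis using openin_open_trans by blast
qed

lemma chart_preimage_open:
  assumes "c \<in> A" "open S"
  shows "openin M {q \<in> fst c. snd c q \<in> S}"
proof -
  have "continuous_map (subtopology M (fst c)) (top_of_set (snd c ` fst c)) (snd c)"
    using chart[OF assms(1)] homeomorphic_imp_continuous_map by (auto simp: is_chart_def)
  moreover have "openin (top_of_set (snd c ` fst c)) (snd c ` fst c \<inter> S)" using assms(2) by (auto simp: openin_open)
  ultimately have "openin (subtopology M (fst c)) {q \<in> topspace (subtopology M (fst c)). snd c q \<in> snd c ` fst c \<inter> S}"
    using openin_continuous_map_preimage by blast
  moreover have "{q \<in> topspace (subtopology M (fst c)). snd c q \<in> snd c ` fst c \<inter> S} = {q \<in> fst c. snd c q \<in> S}"
    using openin_subset[OF chart_openin[OF assms(1)]] by auto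
  ultimately show ?thesis using openin_trans_full[OF _ chart_openin[OF assms(1)]] by simp
qed

lemma chart_at: "q \<in> topspace M \<Longrightarrow> chart_at A q \<in> A" "q \<in> topspace M \<Longrightarrow> q \<in> fst (chart_at A q)"
proof -
  assume "q \<in> topspace M"
  then have "\<exists>c. c \<in> A \<and> q \<in> fst c" using mfd unfolding smooth_manifold_def by blast
  from someI_ex[OF this] show "chart_at A q \<in> A" "q \<in> fst (chart_at A q)"
    unfolding chart_at_def by auto
qed

lemma chart_subset: "c \<in> A \<Longrightarrow> q \<in> fst c \<Longrightarrow> q \<in> topspace M"
  using openin_subset[OF chart_openin] by blast

lemma openin_chart_domain: "c \<in> A \<Longrightarrow> openin M W \<Longrightarrow> openin M (fst c \<inter> W)"
  using chart_openin openin_Int by blast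

lemma transition_smooth:
  "c \<in> A \<Longrightarrow> d \<in> A \<Longrightarrow> smooth_on (snd c ` (fst c \<inter> fst d)) (snd d \<circ> chart_inv c)"
  using mfd by (simp add: smooth_manifold_def)

lemma transition_deriv:
  assumes "c \<in> A" "d \<in> A" "q \<in> fst c" "q \<in> fst d"
  shows "((snd d \<circ> chart_inv c) has_derivative transition_deriv c d q) (at (snd c q))"
  unfolding transition_deriv_def
  by (rule smooth_on_has_derivative[OF open_chart_image[OF assms(1) chart_openin[OF assms(2)]] transition_smooth])
    (use assms in auto)

lemma transition_deriv_linear:
  "c \<in> A \<Longrightarrow> d \<in> A \<Longrightarrow> q \<in> fst c \<Longrightarrow> q \<in> fst d \<Longrightarrow> linear (transition_deriv c d q)"
  using transition_deriv has_derivative_linear by blast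

lemma transition_deriv_trans:
  assumes "c \<in> A" "d \<in> A" "e \<in> A" "q \<in> fst c" "q \<in> fst d" "q \<in> fst e"
  shows "transition_deriv d e q (transition_deriv c d q v) = transition_deriv c e q v"
proof -
  have *: "((snd e \<circ> chart_inv d) has_derivative transition_deriv d e q) (at ((snd d \<circ> chart_inv c) (snd c q)))"
    using transition_deriv[of d e q] assms by simp
  have "((\<lambda>x. (snd e \<circ> chart_inv d) ((snd d \<circ> chart_inv c) x)) has_derivative
      (\<lambda>v. transition_deriv d e q (transition_deriv c d q v))) (at (snd c q))"
    using has_derivative_compose[OF transition_deriv[OF assms(1,2,4,5)] *] .
  then have "((snd e \<circ> chart_inv c) has_derivative (\<lambda>v. transition_deriv d e q (transition_deriv c d q v))) (at (snd c q))"
    by (rule has_derivative_transform_within_open[OF _ open_chart_image[OF assms(1) chart_openin[OF assms(2)]]])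
      (use assms in auto)
  from has_derivative_unique[OF this transition_deriv[OF assms(1,3,4,6)]] show ?thesis by metis
qed

lemma transition_deriv_self:
  assumes "c \<in> A" "q \<in> fst c"
  shows "transition_deriv c c q v = v"
proof -
  have "((\<lambda>x. x) has_derivative (\<lambda>v. v)) (at (snd c q))" by simp
  then have "((snd c \<circ> chart_inv c) has_derivative (\<lambda>v. v)) (at (snd c q))"
    by (rule has_derivative_transform_within_open[OF _ open_chart_image[OF assms(1) chart_openin[OF assms(1)]]])
      (use assms in auto)
  from has_derivative_unique[OF this transition_deriv[OF assms(1,1,2,2)]] show ?thesis by metis
qed

context
  fixes c q
  assumes c: "c \<in> A" and q: "q \<in> fst c"
begin

lemma components_linear: "linear (components A c q)"
  unfolding components_transition using chart_at[OF chart_subset[OF c q]] c q by (intro transition_deriv_linear)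

lemma tangent_vec_linear: "linear (tangent_vec A c q)"
  unfolding tangent_vec_def using chart_at[OF chart_subset[OF c q]] c q by (intro transition_deriv_linear)

lemma components_tangent_vec: "components A c q (tangent_vec A c q v) = v"
  unfolding components_transition tangent_vec_def
  using transition_deriv_trans[OF c _ c q _ q] transition_deriv_self[OF c q] chart_at[OF chart_subset[OF c q]] by simp

lemma tangent_vec_components: "tangent_vec A c q (components A c q v) = v"
  unfolding components_transition tangent_vec_def
  using transition_deriv_trans[OF _ c _ _ q] transition_deriv_self chart_at[OF chart_subset[OF c q]] by simp

lemma components_change:
  "d \<in> A \<Longrightarrow> q \<in> fst d \<Longrightarrow> components A d q v = transition_deriv c d q (components A c q v)"
  unfolding components_transition
  using transition_deriv_trans[OF _ c _ _ q] chart_at[OF chart_subset[OF c q]] by simp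

lemma components_eq_iff: "components A c q v = components A c q w \<longleftrightarrow> v = w"
  by (metis tangent_vec_components)

lemma components_eq_0_iff: "components A c q v = 0 \<longleftrightarrow> v = 0"
  using components_eq_iff[of v 0] linear_0[OF components_linear] by simp

lemma components_coord_vector: "components A c q (coord_vector A c i q) = axis i 1"
  unfolding coord_vector_tangent by (rule components_tangent_vec)

lemma coord_expand: "v = (\<Sum>i\<in>UNIV. components A c q v $ i *\<^sub>R coord_vector A c i q)"
proof -
  have "v = tangent_vec A c q (\<Sum>i\<in>UNIV. components A c q v $ i *\<^sub>R axis i 1)"
    using tangent_vec_components[of v] basis_expansion[of "components A c q v"] by (simp add: scalar_mult_eq_scaleR)
  then show ?thesis
    unfolding coord_vector_tangent by (simp add: linear_sum[OF tangent_vec_linear] linear_cmul[OF tangent_vec_linear])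
qed

end

lemma components_chart_at: "q \<in> topspace M \<Longrightarrow> components A (chart_at A q) q v = v"
  unfolding components_transition using transition_deriv_self chart_at by blast

section \<open>Smooth functions and fields in terms of a single chart\<close>

lemma local_rep_chart: "c \<in> A \<Longrightarrow> q \<in> fst c \<Longrightarrow> local_rep A c X (snd c q) = components A c q (X q)"
  by (simp add: local_rep_def)

lemma open_chart_image_sub: "c \<in> A \<Longrightarrow> openin M W \<Longrightarrow> W \<subseteq> fst c \<Longrightarrow> open (snd c ` W)"
  using open_chart_image[of c W] by (simp add: Int_absorb1)

lemma smooth_fun_chart:
  assumes c: "c \<in> A" and W: "openin M W" "W \<subseteq> fst c" and f: "smooth_on (snd c ` W) (f \<circ> chart_inv c)"
  shows "smooth_fun A W f"
  unfolding smooth_fun_def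
proof
  fix d assume d: "d \<in> A"
  have o: "open (snd d ` (fst d \<inter> W))" "open (snd c ` W)"
    using open_chart_image[OF d W(1)] open_chart_image_sub[OF c W] by blast+
  have t: "smooth_on (snd d ` (fst d \<inter> W)) (snd c \<circ> chart_inv d)"
    by (rule smooth_on_subset[OF transition_smooth[OF d c]]) (use W in auto)
  have im: "(snd c \<circ> chart_inv d) ` (snd d ` (fst d \<inter> W)) \<subseteq> snd c ` W" using d by auto
  have "smooth_on (snd d ` (fst d \<inter> W)) (\<lambda>x. (f \<circ> chart_inv c) ((snd c \<circ> chart_inv d) x))"
    by (rule smooth_on_compose[OF o im f t])
  then show "smooth_on (snd d ` (fst d \<inter> W)) (f \<circ> chart_inv d)"
    by (rule smooth_on_cong[OF o(1)]) (use c d W in auto)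
qed

text \<open>The components in \<open>d\<close> arise from those in \<open>c\<close> by the
  derivative of the coordinate change, which itself depends smoothly on the point.\<close>

lemma vfields_chart:
  assumes c: "c \<in> A" and W: "openin M W" "W \<subseteq> fst c" and X: "smooth_on (snd c ` W) (local_rep A c X)"
  shows "X \<in> vfields A W"
  unfolding vfields_def
proof (intro CollectI ballI)
  fix d assume d: "d \<in> A"
  let ?V = "snd d ` (fst d \<inter> W)" and ?V' = "snd c ` (fst d \<inter> W)"
  have o: "open ?V" "open ?V'"
    using open_chart_image[OF d W(1)] open_chart_image_sub[OF c openin_chart_domain[OF d W(1)]] W by blast+
  have t: "smooth_on ?V (snd c \<circ> chart_inv d)"
    by (rule smooth_on_subset[OF transition_smooth[OF d c]]) (use W in auto)
  have t': "smooth_on ?V' (snd d \<circ> chart_inv c)"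
    by (rule smooth_on_subset[OF transition_smooth[OF c d]]) (use W in auto)
  have im: "(snd c \<circ> chart_inv d) ` ?V \<subseteq> ?V'" using d by auto
  have "smooth_on ?V' (\<lambda>y. frechet_derivative (snd d \<circ> chart_inv c) (at y) (local_rep A c X y))"
    by (rule smooth_on_derivative[OF o(2) t' smooth_on_subset[OF X]]) auto
  from smooth_on_compose[OF o im this t]
  show "smooth_on ?V (local_rep A d X)"
  proof (rule smooth_on_cong[OF o(1)])
    fix x assume "x \<in> ?V"
    then obtain q where q: "q \<in> fst d" "q \<in> W" "x = snd d q" by blast
    have qc: "q \<in> fst c" using q W by blast
    show "frechet_derivative (snd d \<circ> chart_inv c) (at ((snd c \<circ> chart_inv d) x))
       (local_rep A c X ((snd c \<circ> chart_inv d) x)) = local_rep A d X x"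
      using components_change[OF c qc d q(1), of "X q"] d q local_rep_chart[OF c qc] local_rep_chart[OF d q(1)]
      by (simp add: transition_deriv_def)
  qed
qed

lemma smooth_fun_subset: "smooth_fun A W f \<Longrightarrow> V \<subseteq> W \<Longrightarrow> smooth_fun A V f"
  unfolding smooth_fun_def by (meson Int_mono image_mono order_refl smooth_on_subset)

lemma vfields_subset: "X \<in> vfields A W \<Longrightarrow> V \<subseteq> W \<Longrightarrow> X \<in> vfields A V"
  unfolding vfields_def mem_Collect_eq by (meson Int_mono image_mono order_refl smooth_on_subset)

lemma smooth_funD: "smooth_fun A W f \<Longrightarrow> c \<in> A \<Longrightarrow> smooth_on (snd c ` (fst c \<inter> W)) (f \<circ> chart_inv c)"
  by (simp add: smooth_fun_def)

lemma vfieldsD: "X \<in> vfields A W \<Longrightarrow> c \<in> A \<Longrightarrow> smooth_on (snd c ` (fst c \<inter> W)) (local_rep A c X)"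
  by (simp add: vfields_def)

lemma smooth_fun_cong:
  assumes "openin M W" "smooth_fun A W f" "\<And>q. q \<in> W \<Longrightarrow> f q = g q"
  shows "smooth_fun A W g"
  unfolding smooth_fun_def
proof
  fix c assume c: "c \<in> A"
  show "smooth_on (snd c ` (fst c \<inter> W)) (g \<circ> chart_inv c)"
    by (rule smooth_on_cong[OF open_chart_image[OF c assms(1)] smooth_funD[OF assms(2) c]]) (use assms(3) c in auto)
qed

lemma vfields_cong:
  assumes "openin M W" "X \<in> vfields A W" "\<And>q. q \<in> W \<Longrightarrow> X q = Y q"
  shows "Y \<in> vfields A W"
  unfolding vfields_def
proof (intro CollectI ballI)
  fix c assume c: "c \<in> A"
  show "smooth_on (snd c ` (fst c \<inter> W)) (local_rep A c Y)"
    by (rule smooth_on_cong[OF open_chart_image[OF c assms(1)] vfieldsD[OF assms(2) c]])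
      (use assms(3) c in \<open>auto simp: local_rep_chart\<close>)
qed

lemma smooth_fun_union:
  assumes "\<And>q. q \<in> W \<Longrightarrow> \<exists>V. openin M V \<and> q \<in> V \<and> smooth_fun A V f" "openin M W"
  shows "smooth_fun A W f"
proof -
  show ?thesis unfolding smooth_fun_def
  proof
    fix c assume c: "c \<in> A"
    let ?\<V> = "{snd c ` (fst c \<inter> (W \<inter> V)) | V. openin M V \<and> smooth_fun A V f}"
    have "smooth_on (\<Union>?\<V>) (f \<circ> chart_inv c)"
    proof (intro smooth_on_Union ballI)
      fix S assume "S \<in> ?\<V>"
      then obtain V where V: "S = snd c ` (fst c \<inter> (W \<inter> V))" "openin M V" "smooth_fun A V f" by blast
      show "open S \<and> smooth_on S (f \<circ> chart_inv c)"
        unfolding V(1) using open_chart_image[OF c openin_Int[OF assms(2) V(2)]]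
          smooth_funD[OF smooth_fun_subset[OF V(3)] c, of "W \<inter> V"] by blast
    qed
    moreover have "\<Union>?\<V> = snd c ` (fst c \<inter> W)" using assms(1) by blast
    ultimately show "smooth_on (snd c ` (fst c \<inter> W)) (f \<circ> chart_inv c)" by simp
  qed
qed

lemma smooth_fun_const: "openin M W \<Longrightarrow> smooth_fun A W (\<lambda>q. k)"
  unfolding smooth_fun_def by (auto simp: o_def intro: smooth_on_const open_chart_image)

lemma smooth_fun_add: "openin M W \<Longrightarrow> smooth_fun A W f \<Longrightarrow> smooth_fun A W g \<Longrightarrow> smooth_fun A W (\<lambda>q. f q + g q)"
  unfolding smooth_fun_def by (auto simp: o_def intro!: smooth_on_add open_chart_image)

lemma smooth_fun_diff: "openin M W \<Longrightarrow> smooth_fun A W f \<Longrightarrow> smooth_fun A W g \<Longrightarrow> smooth_fun A W (\<lambda>q. f q - g q)"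
  unfolding smooth_fun_def by (auto simp: o_def intro!: smooth_on_diff open_chart_image)

lemma smooth_fun_mult: "openin M W \<Longrightarrow> smooth_fun A W f \<Longrightarrow> smooth_fun A W g \<Longrightarrow> smooth_fun A W (\<lambda>q. f q * g q)"
  unfolding smooth_fun_def by (auto simp: o_def intro!: smooth_on_mult open_chart_image)

lemma smooth_fun_sum:
  "openin M W \<Longrightarrow> (\<And>i. i \<in> I \<Longrightarrow> smooth_fun A W (f i)) \<Longrightarrow> smooth_fun A W (\<lambda>q. \<Sum>i\<in>I. f i q)"
  unfolding smooth_fun_def by (auto simp: o_def intro!: smooth_on_sum open_chart_image)

lemma smooth_fun_inverse:
  "openin M W \<Longrightarrow> (\<And>q. q \<in> W \<Longrightarrow> f q \<noteq> 0) \<Longrightarrow> smooth_fun A W f \<Longrightarrow> smooth_fun A W (\<lambda>q. inverse (f q))"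
proof (unfold smooth_fun_def, intro ballI)
  fix c assume *: "openin M W" "\<And>q. q \<in> W \<Longrightarrow> f q \<noteq> 0" "\<forall>c\<in>A. smooth_on (snd c ` (fst c \<inter> W)) (f \<circ> chart_inv c)" "c \<in> A"
  then show "smooth_on (snd c ` (fst c \<inter> W)) ((\<lambda>q. inverse (f q)) \<circ> chart_inv c)"
    unfolding o_def by (intro smooth_on_inverse open_chart_image) auto
qed

lemma smooth_fun_sqrt:
  "openin M W \<Longrightarrow> (\<And>q. q \<in> W \<Longrightarrow> f q > 0) \<Longrightarrow> smooth_fun A W f \<Longrightarrow> smooth_fun A W (\<lambda>q. sqrt (f q))"
proof (unfold smooth_fun_def, intro ballI)
  fix c assume *: "openin M W" "\<And>q. q \<in> W \<Longrightarrow> f q > 0" "\<forall>c\<in>A. smooth_on (snd c ` (fst c \<inter> W)) (f \<circ> chart_inv c)" "c \<in> A"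
  then show "smooth_on (snd c ` (fst c \<inter> W)) ((\<lambda>q. sqrt (f q)) \<circ> chart_inv c)"
    unfolding o_def by (intro smooth_on_sqrt open_chart_image) auto
qed

lemma smooth_fun_det:
  fixes f :: "'m::finite \<Rightarrow> 'm \<Rightarrow> 'a \<Rightarrow> real"
  shows "openin M W \<Longrightarrow> (\<And>i j. smooth_fun A W (f i j)) \<Longrightarrow> smooth_fun A W (\<lambda>q. det (\<chi> i j. f i j q))"
  unfolding smooth_fun_def
  by (auto simp: o_def intro!: open_chart_image smooth_on_det[of _ "\<lambda>i j x. f i j (chart_inv _ x)"])

lemma vfields_add:
  assumes "openin M W" "X \<in> vfields A W" "Y \<in> vfields A W"
  shows "(\<lambda>q. X q + Y q) \<in> vfields A W"
  unfolding vfields_def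
proof (intro CollectI ballI)
  fix c assume c: "c \<in> A"
  show "smooth_on (snd c ` (fst c \<inter> W)) (local_rep A c (\<lambda>q. X q + Y q))"
    by (rule smooth_on_cong[OF open_chart_image[OF c assms(1)] smooth_on_add[OF open_chart_image[OF c assms(1)]
            vfieldsD[OF assms(2) c] vfieldsD[OF assms(3) c]]])
      (use c in \<open>auto simp: local_rep_chart linear_add[OF components_linear[OF c]]\<close>)
qed

lemma vfields_scaleR:
  assumes "openin M W" "smooth_fun A W f" "X \<in> vfields A W"
  shows "(\<lambda>q. f q *\<^sub>R X q) \<in> vfields A W"
  unfolding vfields_def
proof (intro CollectI ballI)
  fix c assume c: "c \<in> A"
  show "smooth_on (snd c ` (fst c \<inter> W)) (local_rep A c (\<lambda>q. f q *\<^sub>R X q))"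
    by (rule smooth_on_cong[OF open_chart_image[OF c assms(1)] smooth_on_scaleR[OF open_chart_image[OF c assms(1)]
            smooth_funD[OF assms(2) c] vfieldsD[OF assms(3) c]]])
      (use c in \<open>auto simp: local_rep_chart linear_cmul[OF components_linear[OF c]]\<close>)
qed

lemma vfields_zero: "openin M W \<Longrightarrow> (\<lambda>q. 0) \<in> vfields A W"
  unfolding vfields_def
proof (intro CollectI ballI)
  fix c assume W: "openin M W" and c: "c \<in> A"
  show "smooth_on (snd c ` (fst c \<inter> W)) (local_rep A c (\<lambda>q. 0))"
    by (rule smooth_on_cong[OF open_chart_image[OF c W] smooth_on_const[OF open_chart_image[OF c W], of 0]])
      (use c in \<open>auto simp: local_rep_chart linear_0[OF components_linear[OF c]]\<close>)
qed

lemma vfields_sum: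
  assumes "openin M W" "finite I" "\<And>i. i \<in> I \<Longrightarrow> X i \<in> vfields A W"
  shows "(\<lambda>q. \<Sum>i\<in>I. X i q) \<in> vfields A W"
  using assms(2,3) by (induction I) (auto intro: vfields_zero vfields_add assms(1))

lemma tangent_field_vfields:
  assumes c: "c \<in> A" and W: "openin M W" "W \<subseteq> fst c" and V: "smooth_on (snd c ` W) V"
  shows "(\<lambda>q. tangent_vec A c q (V (snd c q))) \<in> vfields A W"
proof (rule vfields_chart[OF c W])
  show "smooth_on (snd c ` W) (local_rep A c (\<lambda>q. tangent_vec A c q (V (snd c q))))"
    by (rule smooth_on_cong[OF open_chart_image_sub[OF c W] V])
      (use W c in \<open>auto simp: local_rep_chart components_tangent_vec subset_iff\<close>)
qed

lemma const_field_vfields: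
  assumes c: "c \<in> A" and W: "openin M W" "W \<subseteq> fst c"
  shows "(\<lambda>q. tangent_vec A c q v) \<in> vfields A W"
  using tangent_field_vfields[OF c W smooth_on_const[OF open_chart_image_sub[OF c W], of v]] .

lemma coord_vector_vfields: "c \<in> A \<Longrightarrow> openin M W \<Longrightarrow> W \<subseteq> fst c \<Longrightarrow> coord_vector A c i \<in> vfields A W"
  using const_field_vfields[of c W "axis i 1"] unfolding coord_vector_tangent[symmetric] .

lemma component_smooth:
  assumes "X \<in> vfields A W" "c \<in> A" "openin M W" "W \<subseteq> fst c"
  shows "smooth_fun A W (\<lambda>q. components A c q (X q) $ i)"
proof (rule smooth_fun_chart[OF assms(2-4)])
  have o: "open (snd c ` W)" using open_chart_image_sub assms by blast
  have "smooth_on (snd c ` W) (local_rep A c X)" using vfieldsD[OF assms(1,2)] assms(4) by (simp add: Int_absorb1)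
  then have "smooth_on (snd c ` W) (\<lambda>x. local_rep A c X x $ i)" using smooth_on_vec_iff[OF o] by blast
  then show "smooth_on (snd c ` W) ((\<lambda>q. components A c q (X q) $ i) \<circ> chart_inv c)"
    by (rule smooth_on_cong[OF o]) (auto simp: local_rep_def)
qed

subsection \<open>Differentials\<close>

lemma differential_works:
  assumes "openin M W" "smooth_fun A W f" "q \<in> W"
  shows "((f \<circ> chart_inv (chart_at A q)) has_derivative differential A f q) (at (snd (chart_at A q) q))"
proof -
  have q: "q \<in> topspace M" using assms openin_subset by blast
  show ?thesis unfolding differential_def
    by (rule smooth_on_has_derivative[OF open_chart_image[OF chart_at(1)[OF q] assms(1)] smooth_funD[OF assms(2) chart_at(1)[OF q]]])
      (use chart_at(2)[OF q] assms in auto)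
qed

lemma differential_unique:
  assumes "openin M W" "q \<in> W" "(g has_derivative g') (at (snd (chart_at A q) q))"
    and "\<And>r. r \<in> W \<Longrightarrow> g (snd (chart_at A q) r) = f r"
  shows "differential A f q = g'"
proof -
  have q: "q \<in> topspace M" using assms openin_subset by blast
  have "(f \<circ> chart_inv (chart_at A q) has_derivative g') (at (snd (chart_at A q) q))"
    by (rule has_derivative_transform_within_open[OF assms(3) open_chart_image[OF chart_at(1)[OF q] assms(1)]])
      (use assms chart_at[OF q] in auto)
  then show ?thesis unfolding differential_def by (rule frechet_derivative_at[symmetric])
qed

text \<open>The chain rule links an arbitrary chart to the preferred one in the definition of
  \<open>differential\<close>, so that \<open>f\<close> may be differentiated through any function
  \<open>g\<close> that represents it near \<open>q\<close>.\<close>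

lemma differential_in_chart:
  assumes c: "c \<in> A" "q \<in> fst c" and W: "openin M W" "q \<in> W"
    and g: "(g has_derivative g') (at (snd c q))" "\<And>r. r \<in> W \<Longrightarrow> r \<in> fst c \<Longrightarrow> g (snd c r) = f r"
  shows "differential A f q v = g' (components A c q v)"
proof -
  have q: "q \<in> topspace M" using W openin_subset by blast
  let ?e = "chart_at A q"
  have e: "?e \<in> A" "q \<in> fst ?e" using chart_at[OF q] .
  have "((\<lambda>x. g ((snd c \<circ> chart_inv ?e) x)) has_derivative (\<lambda>v. g' (transition_deriv ?e c q v))) (at (snd ?e q))"
    by (rule has_derivative_compose[OF transition_deriv[OF e(1) c(1) e(2) c(2)]]) (use g e in auto)
  from differential_unique[OF openin_Int[OF W(1) openin_Int[OF chart_openin[OF e(1)] chart_openin[OF c(1)]]] _ this]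
  have "differential A f q = (\<lambda>v. g' (transition_deriv ?e c q v))" using e c W g(2) by auto
  then show ?thesis by (simp add: components_transition)
qed

lemma differential_chart:
  assumes "c \<in> A" "q \<in> fst c" "openin M W" "q \<in> W" "smooth_fun A W f"
  shows "differential A f q v = frechet_derivative (f \<circ> chart_inv c) (at (snd c q)) (components A c q v)"
  by (rule differential_in_chart[OF assms(1-4) smooth_on_has_derivative[OF open_chart_image[OF assms(1,3)] smooth_funD[OF assms(5,1)]]])
    (use assms in auto)

lemma differential_linear:
  "openin M W \<Longrightarrow> smooth_fun A W f \<Longrightarrow> q \<in> W \<Longrightarrow> linear (differential A f q)"
  using differential_works has_derivative_linear by blast

text \<open>Locally equal functions have the same derivatives, if any, so the choice made by
  \<open>frechet_derivative\<close> is the same for both, differentiable or not.\<close>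

lemma differential_cong:
  assumes "openin M W" "q \<in> W" "\<And>r. r \<in> W \<Longrightarrow> f r = g r"
  shows "differential A f q v = differential A g q v"
proof -
  have q: "q \<in> topspace M" using assms openin_subset by blast
  let ?e = "chart_at A q"
  have "((f \<circ> chart_inv ?e) has_derivative h) (at (snd ?e q)) \<longleftrightarrow> ((g \<circ> chart_inv ?e) has_derivative h) (at (snd ?e q))" for h
  proof -
    let ?S = "snd ?e ` (fst ?e \<inter> W)"
    have o: "open ?S" using open_chart_image[OF chart_at(1)[OF q] assms(1)] .
    have x: "snd ?e q \<in> ?S" using chart_at(2)[OF q] assms(2) by blast
    have eq: "(f \<circ> chart_inv ?e) y = (g \<circ> chart_inv ?e) y" if "y \<in> ?S" for y
      using that assms(3) chart_inv_left[OF chart_at(1)[OF q]] by auto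
    show ?thesis
    proof
      show "((g \<circ> chart_inv ?e) has_derivative h) (at (snd ?e q))" if "((f \<circ> chart_inv ?e) has_derivative h) (at (snd ?e q))"
        using that o x by (rule has_derivative_transform_within_open) (use eq in auto)
      show "((f \<circ> chart_inv ?e) has_derivative h) (at (snd ?e q))" if "((g \<circ> chart_inv ?e) has_derivative h) (at (snd ?e q))"
        using that o x by (rule has_derivative_transform_within_open) (use eq in auto)
    qed
  qed
  then show ?thesis unfolding differential_def frechet_derivative_def by presburger
qed

context
  fixes W q
  assumes W: "openin M W" and q: "q \<in> W"
begin

lemma q_chart_at: "chart_inv (chart_at A q) (snd (chart_at A q) q) = q"
  using chart_at[of q] openin_subset[OF W] q by auto

lemma inv_chart_at: "\<And>r. r \<in> W \<inter> fst (chart_at A q) \<Longrightarrow> chart_inv (chart_at A q) (snd (chart_at A q) r) = r"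
  using chart_at[of q] openin_subset[OF W] q by auto

lemma W_chart_at: "openin M (W \<inter> fst (chart_at A q))" "q \<in> W \<inter> fst (chart_at A q)"
proof -
  have "q \<in> topspace M" using openin_subset[OF W] q by blast
  then show "openin M (W \<inter> fst (chart_at A q))" "q \<in> W \<inter> fst (chart_at A q)"
    using openin_Int[OF W chart_openin[OF chart_at(1)]] chart_at(2) q by blast+
qed

lemma differential_const [simp]: "differential A (\<lambda>q. k) q v = 0"
  using differential_unique[OF W q has_derivative_const] by auto

lemma differential_add:
  assumes "smooth_fun A W f" "smooth_fun A W g"
  shows "differential A (\<lambda>q. f q + g q) q v = differential A f q v + differential A g q v"
  using differential_unique[OF W_chart_at has_derivative_add[OF differential_works[OF W assms(1) q] differential_works[OF W assms(2) q]],
      of "\<lambda>q. f q + g q"] inv_chart_at by simp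

lemma differential_diff:
  assumes "smooth_fun A W f" "smooth_fun A W g"
  shows "differential A (\<lambda>q. f q - g q) q v = differential A f q v - differential A g q v"
  using differential_unique[OF W_chart_at has_derivative_diff[OF differential_works[OF W assms(1) q] differential_works[OF W assms(2) q]],
      of "\<lambda>q. f q - g q"] inv_chart_at by simp

lemma differential_mult:
  assumes "smooth_fun A W f" "smooth_fun A W g"
  shows "differential A (\<lambda>q. f q * g q) q v = f q * differential A g q v + differential A f q v * g q"
  using differential_unique[OF W_chart_at has_derivative_mult[OF differential_works[OF W assms(1) q] differential_works[OF W assms(2) q]],
      of "\<lambda>q. f q * g q"] inv_chart_at q_chart_at by simp

lemma differential_sum:
  assumes "\<And>i. i \<in> I \<Longrightarrow> smooth_fun A W (f i)"
  shows "differential A (\<lambda>q. \<Sum>i\<in>I. f i q) q v = (\<Sum>i\<in>I. differential A (f i) q v)"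
  using assms by (induction I rule: infinite_finite_induct) (auto simp: differential_add smooth_fun_sum[OF W])

end

lemma differential_field_smooth:
  assumes "openin M W" "smooth_fun A W f" "X \<in> vfields A W"
  shows "smooth_fun A W (\<lambda>q. differential A f q (X q))"
  unfolding smooth_fun_def
proof
  fix c assume c: "c \<in> A"
  have o: "open (snd c ` (fst c \<inter> W))" using open_chart_image[OF c assms(1)] .
  show "smooth_on (snd c ` (fst c \<inter> W)) ((\<lambda>q. differential A f q (X q)) \<circ> chart_inv c)"
    by (rule smooth_on_cong[OF o smooth_on_derivative[OF o smooth_funD[OF assms(2) c] vfieldsD[OF assms(3) c]]])
      (use c in \<open>auto simp: differential_chart[OF c _ assms(1) _ assms(2)] local_rep_chart\<close>)
qed

text \<open>Second derivatives of \<open>f\<close> drop out by their symmetry, and derivatives of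
  the components of the fields remain. The computation takes place in the preferred chart at
  \<open>q\<close>, where \<open>components\<close> at \<open>q\<close> is the identity and
  \<open>lie_bracket\<close> has its defining form.\<close>

lemma differential_bracket:
  assumes W: "openin M W" and f: "smooth_fun A W f" and X: "X \<in> vfields A W" and Y: "Y \<in> vfields A W" and q: "q \<in> W"
  shows "differential A (\<lambda>q. differential A f q (Y q)) q (X q) - differential A (\<lambda>q. differential A f q (X q)) q (Y q)
    = differential A f q (lie_bracket A X Y q)"
proof -
  have qM: "q \<in> topspace M" using W openin_subset q by blast
  let ?e = "chart_at A q"
  have e: "?e \<in> A" "q \<in> fst ?e" using chart_at[OF qM] .
  let ?S = "snd ?e ` (fst ?e \<inter> W)"
  define F where "F = f \<circ> chart_inv ?e"
  define x where "x = snd ?e q"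
  have o: "open ?S" using open_chart_image[OF e(1) W] .
  have xS: "x \<in> ?S" using e q by (auto simp: x_def)
  have F: "smooth_on ?S F" unfolding F_def using smooth_funD[OF f e(1)] .
  have dF: "(F has_derivative frechet_derivative F (at y)) (at y)" if "y \<in> ?S" for y
    using smooth_on_has_derivative[OF o F that] .
  have d: "differential A (\<lambda>q. differential A f q (Z q)) q v =
      (\<Sum>i\<in>UNIV. Z q $ i *\<^sub>R (\<Sum>j\<in>UNIV. v $ j *\<^sub>R partial_deriv j (partial_deriv i F) x)
        + frechet_derivative (local_rep A ?e Z) (at x) v $ i *\<^sub>R partial_deriv i F x)"
    if Z: "Z \<in> vfields A W" for Z v
  proof -
    have dZ: "((\<lambda>x. local_rep A ?e Z x $ i) has_derivative (\<lambda>v. frechet_derivative (local_rep A ?e Z) (at x) v $ i)) (at x)" for i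
      using bounded_linear.has_derivative[OF bounded_linear_vec_nth smooth_on_has_derivative[OF o vfieldsD[OF Z e(1)] xS]] .
    have dp: "(partial_deriv i F has_derivative frechet_derivative (partial_deriv i F) (at x)) (at x)" for i
      using smooth_on_has_derivative[OF o smooth_on_partial_deriv[OF o F] xS] .
    have p: "frechet_derivative (partial_deriv i F) (at x) v = (\<Sum>j\<in>UNIV. v $ j *\<^sub>R partial_deriv j (partial_deriv i F) x)" for i v
      by (rule has_derivative_partial_deriv[OF dp])
    have g: "((\<lambda>x. \<Sum>i\<in>UNIV. local_rep A ?e Z x $ i *\<^sub>R partial_deriv i F x) has_derivative
      (\<lambda>v. \<Sum>i\<in>UNIV. local_rep A ?e Z x $ i *\<^sub>R frechet_derivative (partial_deriv i F) (at x) v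
        + frechet_derivative (local_rep A ?e Z) (at x) v $ i *\<^sub>R partial_deriv i F x)) (at (snd ?e q))"
      unfolding x_def[symmetric] by (intro has_derivative_sum has_derivative_scaleR dZ dp)
    have "differential A (\<lambda>q. differential A f q (Z q)) q v = (\<Sum>i\<in>UNIV. local_rep A ?e Z x $ i *\<^sub>R frechet_derivative (partial_deriv i F) (at x) (components A ?e q v)
        + frechet_derivative (local_rep A ?e Z) (at x) (components A ?e q v) $ i *\<^sub>R partial_deriv i F x)"
    proof (rule differential_in_chart[OF e W q g])
      fix r assume r: "r \<in> W" "r \<in> fst ?e"
      have "differential A f r (Z r) = frechet_derivative F (at (snd ?e r)) (components A ?e r (Z r))"
        unfolding F_def by (rule differential_chart[OF e(1) r(2) W r(1) f])
      also have "\<dots> = (\<Sum>i\<in>UNIV. components A ?e r (Z r) $ i *\<^sub>R partial_deriv i F (snd ?e r))"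
        by (rule has_derivative_partial_deriv[OF dF]) (use r in blast)
      finally show "(\<Sum>i\<in>UNIV. local_rep A ?e Z (snd ?e r) $ i *\<^sub>R partial_deriv i F (snd ?e r)) = differential A f r (Z r)"
        using local_rep_chart[OF e(1) r(2)] by simp
    qed
    moreover have "local_rep A ?e Z x = Z q"
      unfolding x_def using components_chart_at[OF qM] local_rep_chart[OF e] by simp
    ultimately show ?thesis using components_chart_at[OF qM] by (simp only: p)
  qed
  have s: "(\<Sum>i\<in>UNIV. Y q $ i *\<^sub>R (\<Sum>j\<in>UNIV. X q $ j *\<^sub>R partial_deriv j (partial_deriv i F) x)) =
     (\<Sum>i\<in>UNIV. X q $ i *\<^sub>R (\<Sum>j\<in>UNIV. Y q $ j *\<^sub>R partial_deriv j (partial_deriv i F) x))"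
  proof -
    have "(\<Sum>i\<in>UNIV. Y q $ i *\<^sub>R (\<Sum>j\<in>UNIV. X q $ j *\<^sub>R partial_deriv j (partial_deriv i F) x))
      = (\<Sum>j\<in>UNIV. \<Sum>i\<in>UNIV. Y q $ i *\<^sub>R X q $ j *\<^sub>R partial_deriv j (partial_deriv i F) x)"
      unfolding scaleR_sum_right by (rule sum.swap)
    also have "\<dots> = (\<Sum>i\<in>UNIV. X q $ i *\<^sub>R (\<Sum>j\<in>UNIV. Y q $ j *\<^sub>R partial_deriv j (partial_deriv i F) x))"
      unfolding scaleR_sum_right by (intro sum.cong refl) (simp add: partial_deriv_commute_real[OF o F xS] mult_ac)
    finally show ?thesis .
  qed
  have "differential A f q (lie_bracket A X Y q) = frechet_derivative F (at x) (lie_bracket A X Y q)"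
    using differential_chart[OF e W q f] components_chart_at[OF qM] by (simp add: F_def x_def)
  also have "\<dots> = (\<Sum>i\<in>UNIV. lie_bracket A X Y q $ i *\<^sub>R partial_deriv i F x)"
    by (rule has_derivative_partial_deriv[OF dF[OF xS]])
  finally show ?thesis unfolding d[OF X] d[OF Y] using s
    by (simp add: sum.distrib lie_bracket_def x_def[symmetric] left_diff_distrib sum_subtractf)
qed

end

section \<open>Flat connections and parallel frames\<close>

lemma basis_expansion_scaleR: "(\<Sum>i\<in>UNIV. x $ i *\<^sub>R axis i 1) = (x :: real ^ 'n::finite)"
  by (simp add: vec_eq_iff axis_def if_distrib cong: if_cong)

locale flat_mfd = smooth_mfd M A for M :: "'a topology" and A :: "('a, 'n::finite) chart set" +
  fixes D :: "('a, 'n) conn"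
  assumes flat: "flat_connection M A D"
begin

lemma connection: "connection M A D" using flat by (simp add: flat_connection_def)

context
  fixes W
  assumes W: "openin M W"
begin

context
  fixes X Y
  assumes X: "X \<in> vfields A W" and Y: "Y \<in> vfields A W"
begin

lemmas conn = connection[unfolded connection_def, THEN spec, THEN mp, OF W, THEN bspec, OF X, THEN bspec, OF Y]

lemma D_vfields: "D X Y \<in> vfields A W"
  by (rule conn[THEN conjunct1])

lemma D_add_left: "X' \<in> vfields A W \<Longrightarrow> p \<in> W \<Longrightarrow> D (\<lambda>q. X q + X' q) Y p = D X Y p + D X' Y p"
  by (rule conn[THEN conjunct2, THEN conjunct1, rule_format])

lemma D_add_right: "Y' \<in> vfields A W \<Longrightarrow> p \<in> W \<Longrightarrow> D X (\<lambda>q. Y q + Y' q) p = D X Y p + D X Y' p"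
  by (rule conn[THEN conjunct2, THEN conjunct2, THEN conjunct1, rule_format])

lemma D_scaleR_left: "smooth_fun A W f \<Longrightarrow> p \<in> W \<Longrightarrow> D (\<lambda>q. f q *\<^sub>R X q) Y p = f p *\<^sub>R D X Y p"
  by (rule conn[THEN conjunct2, THEN conjunct2, THEN conjunct2, THEN conjunct1, rule_format])

lemma D_scaleR_right:
  "smooth_fun A W f \<Longrightarrow> p \<in> W \<Longrightarrow>
    D X (\<lambda>q. f q *\<^sub>R Y q) p = differential A f p (X p) *\<^sub>R Y p + f p *\<^sub>R D X Y p"
  by (rule conn[THEN conjunct2, THEN conjunct2, THEN conjunct2, THEN conjunct2, THEN conjunct1, rule_format])

lemma D_cong:
  "p \<in> W \<Longrightarrow> (\<And>q. q \<in> W \<Longrightarrow> X' q = X q) \<Longrightarrow> (\<And>q. q \<in> W \<Longrightarrow> Y' q = Y q) \<Longrightarrow> D X' Y' p = D X Y p"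
  using conn[THEN conjunct2, THEN conjunct2, THEN conjunct2, THEN conjunct2, THEN conjunct2, THEN spec, THEN spec, THEN mp, THEN bspec, of X' Y' p]
  by blast

end

lemma D_zero_left: "Y \<in> vfields A W \<Longrightarrow> p \<in> W \<Longrightarrow> D (\<lambda>q. 0) Y p = 0"
  using D_scaleR_left[OF vfields_zero[OF W] _ smooth_fun_const[OF W], of Y p 0] by simp

lemma D_zero_right: "X \<in> vfields A W \<Longrightarrow> p \<in> W \<Longrightarrow> D X (\<lambda>q. 0) p = 0"
  using D_scaleR_right[OF _ vfields_zero[OF W] smooth_fun_const[OF W], of X p 0] differential_const[OF W] by simp

lemma D_sum_left:
  assumes "finite I" "\<And>i. i \<in> I \<Longrightarrow> smooth_fun A W (f i)" "\<And>i. i \<in> I \<Longrightarrow> X i \<in> vfields A W" "Y \<in> vfields A W" "p \<in> W"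
  shows "D (\<lambda>q. \<Sum>i\<in>I. f i q *\<^sub>R X i q) Y p = (\<Sum>i\<in>I. f i p *\<^sub>R D (X i) Y p)"
  using assms
proof (induction I)
  case empty
  then show ?case by (simp add: D_zero_left)
next
  case (insert i I)
  have "D (\<lambda>q. f i q *\<^sub>R X i q + (\<Sum>i\<in>I. f i q *\<^sub>R X i q)) Y p
      = D (\<lambda>q. f i q *\<^sub>R X i q) Y p + D (\<lambda>q. \<Sum>i\<in>I. f i q *\<^sub>R X i q) Y p"
    using insert.prems insert.hyps by (intro D_add_left vfields_sum vfields_scaleR W) auto
  then show ?case using insert by (simp add: D_scaleR_left)
qed

lemma D_sum_right:
  assumes "finite I" "\<And>i. i \<in> I \<Longrightarrow> smooth_fun A W (f i)" "\<And>i. i \<in> I \<Longrightarrow> Y i \<in> vfields A W" "X \<in> vfields A W" "p \<in> W"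
  shows "D X (\<lambda>q. \<Sum>i\<in>I. f i q *\<^sub>R Y i q) p =
    (\<Sum>i\<in>I. differential A (f i) p (X p) *\<^sub>R Y i p + f i p *\<^sub>R D X (Y i) p)"
  using assms
proof (induction I)
  case empty
  then show ?case by (simp add: D_zero_right)
next
  case (insert i I)
  have "D X (\<lambda>q. f i q *\<^sub>R Y i q + (\<Sum>i\<in>I. f i q *\<^sub>R Y i q)) p
      = D X (\<lambda>q. f i q *\<^sub>R Y i q) p + D X (\<lambda>q. \<Sum>i\<in>I. f i q *\<^sub>R Y i q) p"
    using insert.prems insert.hyps by (intro D_add_right vfields_sum vfields_scaleR W) auto
  then show ?case using insert by (simp add: D_scaleR_right)
qed

end

definition christoffel :: "('a, 'n) chart \<Rightarrow> real ^ 'n \<Rightarrow> real ^ 'n \<Rightarrow> real ^ 'n \<Rightarrow> real ^ 'n"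
  where "christoffel c x h v = (\<Sum>i\<in>UNIV. \<Sum>j\<in>UNIV. (h $ i * v $ j) *\<^sub>R
    local_rep A c (D (coord_vector A c i) (coord_vector A c j)) x)"

text \<open>Both fields are expanded in the coordinate fields on \<open>W\<close>. The compatibility
  with restriction, in the form of \<open>D_cong\<close>, identifies \<open>D\<close> of the fields
  with \<open>D\<close> of their expansions.\<close>

lemma D_in_chart:
  assumes c: "c \<in> A" and W: "openin M W" "W \<subseteq> fst c" and X: "X \<in> vfields A W" and Y: "Y \<in> vfields A W" and q: "q \<in> W"
  shows "components A c q (D X Y q) = frechet_derivative (local_rep A c Y) (at (snd c q)) (components A c q (X q))
    + christoffel c (snd c q) (components A c q (X q)) (components A c q (Y q))"
proof -
  have qc: "q \<in> fst c" using q W by blast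
  note lin = components_linear[OF c qc]
  have cv: "coord_vector A c i \<in> vfields A W" for i using coord_vector_vfields[OF c W] .
  have Dcv: "D X (coord_vector A c j) q = (\<Sum>i\<in>UNIV. components A c q (X q) $ i *\<^sub>R D (coord_vector A c i) (coord_vector A c j) q)" for j
  proof -
    have "D X (coord_vector A c j) q = D (\<lambda>q. \<Sum>i\<in>UNIV. components A c q (X q) $ i *\<^sub>R coord_vector A c i q) (coord_vector A c j) q"
    proof (rule D_cong[OF W(1) _ cv q])
      show "(\<lambda>q. \<Sum>i\<in>UNIV. components A c q (X q) $ i *\<^sub>R coord_vector A c i q) \<in> vfields A W"
        by (intro vfields_sum vfields_scaleR W(1) component_smooth[OF X c W] cv) auto
      show "X q = (\<Sum>i\<in>UNIV. components A c q (X q) $ i *\<^sub>R coord_vector A c i q)" if "q \<in> W" for q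
        using coord_expand[OF c, of q "X q"] W that by blast
    qed simp
    also have "\<dots> = (\<Sum>i\<in>UNIV. components A c q (X q) $ i *\<^sub>R D (coord_vector A c i) (coord_vector A c j) q)"
      by (intro D_sum_left[OF W(1)] component_smooth[OF X c W] cv q) auto
    finally show ?thesis .
  qed
  have dY: "differential A (\<lambda>q. components A c q (Y q) $ j) q (X q) =
      frechet_derivative (local_rep A c Y) (at (snd c q)) (components A c q (X q)) $ j" for j
  proof (rule differential_in_chart[OF c qc W(1) q])
    have "(local_rep A c Y has_derivative frechet_derivative (local_rep A c Y) (at (snd c q))) (at (snd c q))"
      by (rule smooth_on_has_derivative[OF open_chart_image[OF c W(1)] vfieldsD[OF Y c]]) (use q qc in auto)
    then show "((\<lambda>x. local_rep A c Y x $ j) has_derivative (\<lambda>v. frechet_derivative (local_rep A c Y) (at (snd c q)) v $ j)) (at (snd c q))"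
      by (rule bounded_linear.has_derivative[OF bounded_linear_vec_nth])
  qed (simp add: local_rep_chart[OF c])
  have "D X Y q = D X (\<lambda>q. \<Sum>j\<in>UNIV. components A c q (Y q) $ j *\<^sub>R coord_vector A c j q) q"
  proof (rule D_cong[OF W(1) X _ q])
    show "(\<lambda>q. \<Sum>j\<in>UNIV. components A c q (Y q) $ j *\<^sub>R coord_vector A c j q) \<in> vfields A W"
      by (intro vfields_sum vfields_scaleR W(1) component_smooth[OF Y c W] cv) auto
    show "Y q = (\<Sum>i\<in>UNIV. components A c q (Y q) $ i *\<^sub>R coord_vector A c i q)" if "q \<in> W" for q
      using coord_expand[OF c, of q "Y q"] W that by blast
  qed simp
  also have "\<dots> = (\<Sum>j\<in>UNIV. differential A (\<lambda>q. components A c q (Y q) $ j) q (X q) *\<^sub>R coord_vector A c j q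
      + components A c q (Y q) $ j *\<^sub>R D X (coord_vector A c j) q)"
    by (intro D_sum_right[OF W(1)] component_smooth[OF Y c W] cv q X) auto
  finally have "components A c q (D X Y q) =
      (\<Sum>j\<in>UNIV. frechet_derivative (local_rep A c Y) (at (snd c q)) (components A c q (X q)) $ j *\<^sub>R axis j 1)
      + (\<Sum>j\<in>UNIV. \<Sum>i\<in>UNIV. (components A c q (X q) $ i * components A c q (Y q) $ j) *\<^sub>R
        local_rep A c (D (coord_vector A c i) (coord_vector A c j)) (snd c q))"
    by (simp add: linear_sum[OF lin] linear_cmul[OF lin] linear_add[OF lin] sum.distrib dY Dcv
        components_coord_vector[OF c qc] local_rep_chart[OF c qc] scaleR_sum_right mult.commute)
  also have "(\<Sum>j\<in>UNIV. frechet_derivative (local_rep A c Y) (at (snd c q)) (components A c q (X q)) $ j *\<^sub>R axis j 1)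
      = frechet_derivative (local_rep A c Y) (at (snd c q)) (components A c q (X q))"
    by (rule basis_expansion_scaleR)
  finally show ?thesis unfolding christoffel_def by (subst sum.swap) simp
qed

text \<open>A tangent vector that annihilates all coordinate functions is zero, and the derivatives
  of these functions along constant fields are constants. This avoids the preferred chart, in which
  the fields need not be constant.\<close>

lemma const_field_bracket:
  assumes c: "c \<in> A" and q: "q \<in> fst c"
  shows "lie_bracket A (\<lambda>q. tangent_vec A c q h) (\<lambda>q. tangent_vec A c q k) q = 0"
proof -
  note W = chart_openin[OF c]
  note cf = const_field_vfields[OF c W order_refl]
  have f: "smooth_fun A (fst c) (\<lambda>q. snd c q $ l)" for l
  proof (rule smooth_fun_chart[OF c W order_refl])
    have o: "open (snd c ` fst c)" using open_chart_image_sub[OF c W] by blast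
    have "smooth_on (snd c ` fst c) (\<lambda>x. x $ l)" using smooth_on_vec_iff[OF o, THEN iffD1, OF smooth_on_ident[OF o]] by blast
    then show "smooth_on (snd c ` fst c) ((\<lambda>q. snd c q $ l) \<circ> chart_inv c)"
      by (rule smooth_on_cong[OF o]) (simp add: chart_inv_right)
  qed
  have d: "differential A (\<lambda>q. snd c q $ l) r v = components A c r v $ l" if "r \<in> fst c" for l r v
    by (rule differential_in_chart[OF c that W that bounded_linear.has_derivative[OF bounded_linear_vec_nth has_derivative_ident]]) simp
  have dc: "differential A (\<lambda>r. differential A (\<lambda>q. snd c q $ l) r (tangent_vec A c r w)) q v = 0" for l w v
  proof -
    have "differential A (\<lambda>r. differential A (\<lambda>q. snd c q $ l) r (tangent_vec A c r w)) q v = differential A (\<lambda>r. w $ l) q v"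
      by (rule differential_cong[OF W q]) (simp add: d components_tangent_vec[OF c])
    then show ?thesis using differential_const[OF W q] by simp
  qed
  have "components A c q (lie_bracket A (\<lambda>q. tangent_vec A c q h) (\<lambda>q. tangent_vec A c q k) q) $ l = 0" for l
    using differential_bracket[OF W f cf cf q, of l k h] d[OF q] dc by simp
  then have "components A c q (lie_bracket A (\<lambda>q. tangent_vec A c q h) (\<lambda>q. tangent_vec A c q k) q) = 0"
    by (simp add: vec_eq_iff)
  then show ?thesis using components_eq_0_iff[OF c q] by blast
qed

lemma const_field_components:
  assumes c: "c \<in> A"
  shows "q \<in> fst c \<Longrightarrow> components A c q (D (\<lambda>q. tangent_vec A c q h) (\<lambda>q. tangent_vec A c q k) q) = christoffel c (snd c q) h k"
proof -
  assume q: "q \<in> fst c"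
  note W = chart_openin[OF c]
  have o: "open (snd c ` fst c)" using open_chart_image_sub[OF c W] by blast
  have "((\<lambda>x. k) has_derivative (\<lambda>v. 0)) (at (snd c q))" by simp
  then have "(local_rep A c (\<lambda>q. tangent_vec A c q k) has_derivative (\<lambda>v. 0)) (at (snd c q))"
    by (rule has_derivative_transform_within_open[OF _ o]) (use q c in \<open>auto simp: local_rep_chart components_tangent_vec\<close>)
  then have "frechet_derivative (local_rep A c (\<lambda>q. tangent_vec A c q k)) (at (snd c q)) = (\<lambda>v. 0)"
    using frechet_derivative_at by metis
  then show ?thesis
    using D_in_chart[OF c W order_refl const_field_vfields[OF c W order_refl] const_field_vfields[OF c W order_refl] q]
    by (simp add: components_tangent_vec[OF c q])
qed

text \<open>In coordinates, parallelity of E is the total differential equation whose coefficients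
  are the negative Christoffel symbols. One neighbourhood for all initial vectors is what makes a
  parallel frame possible.\<close>

lemma parallel_fields_exist:
  assumes c: "c \<in> A" and p: "p \<in> fst c"
  shows "\<exists>W. openin M W \<and> p \<in> W \<and> W \<subseteq> fst c \<and> (\<forall>u. \<exists>E\<in>vfields A W. E p = u \<and>
    (\<forall>V X q. openin M V \<longrightarrow> V \<subseteq> W \<longrightarrow> X \<in> vfields A V \<longrightarrow> q \<in> V \<longrightarrow> D X E q = 0))"
proof -
  note Wc = chart_openin[OF c]
  define x0 where "x0 = snd c p"
  define S where "S = snd c ` fst c"
  define U where "U = {x. x0 + x \<in> S}"
  define G where "G i j = local_rep A c (D (coord_vector A c i) (coord_vector A c j))" for i j
  \<comment> \<open>Parallelity moves the Christoffel term to the other side, hence the sign; the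
    shift by \<open>x0\<close> brings \<open>p\<close> to the origin, where
    \<open>flat_system\<close> is centred.\<close>
  define b where "b i j x = - G i j (x0 + x)" for i j x
  have oS: "open S" unfolding S_def using open_chart_image_sub[OF c Wc] by blast
  have oU: "open U"
    using open_vimage[OF oS, of "\<lambda>x. x0 + x"] by (simp add: U_def vimage_def continuous_intros)
  have cv: "coord_vector A c i \<in> vfields A (fst c)" for i using coord_vector_vfields[OF c Wc] by blast
  have G: "smooth_on S (G i j)" for i j
    using vfieldsD[OF D_vfields[OF Wc cv cv] c] by (simp add: G_def S_def)
  have sb: "smooth_on U (b i j)" for i j
  proof -
    have "smooth_on U (\<lambda>x. G i j (x0 + x))"
      by (rule smooth_on_compose[OF oU oS _ G]) (auto simp: U_def intro!: smooth_on_add smooth_on_const smooth_on_ident oU[unfolded U_def])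
    then show ?thesis unfolding b_def by (rule smooth_on_minus[OF oU])
  qed
  interpret F: flat_system b U
    by unfold_locales (use oU sb p in \<open>auto simp: U_def S_def x0_def\<close>)
  have B: "F.B x h v = - christoffel c (x0 + x) h v" for x h v
    by (simp add: F.B_def christoffel_def b_def G_def sum_negf)
  define K where "K h q = tangent_vec A c q h" for h q
  have K: "K h \<in> vfields A (fst c)" for h unfolding K_def using const_field_vfields[OF c Wc] by blast
  \<comment> \<open>Curvature is evaluated on constant fields. Their brackets vanish, so flatness
    says that \<open>D (K h)\<close> and \<open>D (K k)\<close> commute on \<open>K v\<close>, which
    in coordinates is the integrability condition of \<open>B\<close>.\<close>
  have flat_B: "F.B' x h k v - F.B' x k h v + F.B x k (F.B x h v) - F.B x h (F.B x k v) = 0"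
    if x: "x \<in> U" for x h k v
  proof -
    obtain q where q: "q \<in> fst c" "x0 + x = snd c q" using x unfolding U_def S_def by blast
    have xq: "x = snd c q - x0" using q(2)[symmetric] by simp
    note q = q(1) xq
    have DD: "components A c q (D (K h) (D (K k) (K v)) q) = - F.B' x h k v + F.B x h (F.B x k v)" for h k v
    proof -
      have s: "((\<lambda>y. y - x0) has_derivative (\<lambda>d. d)) (at (snd c q))" by (auto intro!: derivative_eq_intros)
      have qU: "snd c q - x0 \<in> U" using q x by simp
      have "((\<lambda>y. F.B (y - x0) k v) has_derivative (\<lambda>h. F.B' x h k v)) (at (snd c q))"
        using F.has_derivative_B[OF s has_derivative_const has_derivative_const qU, of k v]
        by (simp add: F.B_linear q)
      then have "((\<lambda>y. - F.B (y - x0) k v) has_derivative (\<lambda>h. - F.B' x h k v)) (at (snd c q))"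
        by (rule has_derivative_minus)
      then have "(local_rep A c (D (K k) (K v)) has_derivative (\<lambda>h. - F.B' x h k v)) (at (snd c q))"
        by (rule has_derivative_transform_within_open[OF _ oS])
          (use q c in \<open>auto simp: S_def B local_rep_chart K_def[abs_def] const_field_components\<close>)
      then have "frechet_derivative (local_rep A c (D (K k) (K v))) (at (snd c q)) = (\<lambda>h. - F.B' x h k v)"
        using frechet_derivative_at by metis
      moreover have "christoffel c (snd c q) h v = - F.B x h v" for h v using B[of x] q by simp
      moreover have "F.B x h (- w) = - F.B x h w" for w using F.B_linear(4)[of x h "-1" w] by simp
      ultimately show ?thesis
        using D_in_chart[OF c Wc order_refl K D_vfields[OF Wc K K] q(1), of h k v] q(1)
        by (simp add: K_def[abs_def] components_tangent_vec[OF c] const_field_components[OF c])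
    qed
    have "D (lie_bracket A (K h) (K k)) (K v) q = D (\<lambda>q. 0) (K v) q"
      by (rule D_cong[OF Wc vfields_zero[OF Wc] K q(1)]) (auto simp: K_def[abs_def] const_field_bracket[OF c])
    then have "D (lie_bracket A (K h) (K k)) (K v) q = 0" using D_zero_left[OF Wc K q(1)] by simp
    moreover have "curvature A D (K h) (K k) (K v) q = 0"
      using flat[unfolded flat_connection_def, THEN conjunct2, THEN conjunct2, THEN spec, THEN mp, OF Wc,
          THEN bspec, OF K, THEN bspec, OF K, THEN bspec, OF K, THEN bspec, OF q(1)] .
    ultimately have "D (K h) (D (K k) (K v)) q = D (K k) (D (K h) (K v)) q" by (simp add: curvature_def)
    then have "- F.B' x h k v + F.B x h (F.B x k v) = - F.B' x k h v + F.B x k (F.B x h v)"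
      using DD by metis
    then show ?thesis by (simp add: algebra_simps)
  qed
  obtain r where r: "r > 0" "ball 0 r \<subseteq> U" and sol: "\<And>u. \<exists>f. f 0 = u \<and> smooth_on (ball 0 r) f \<and>
      (\<forall>x\<in>ball 0 r. (f has_derivative (\<lambda>h. F.B x h (f x))) (at x))"
    using F.parallel_section_exists[OF flat_B] by blast
  define W where "W = {q \<in> fst c. snd c q \<in> ball x0 r}"
  have W: "openin M W" "W \<subseteq> fst c" "p \<in> W"
    using chart_preimage_open[OF c open_ball] p r by (auto simp: W_def x0_def)
  have "\<exists>E\<in>vfields A W. E p = u \<and>
    (\<forall>V X q. openin M V \<longrightarrow> V \<subseteq> W \<longrightarrow> X \<in> vfields A V \<longrightarrow> q \<in> V \<longrightarrow> D X E q = 0)" for u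
  proof -
    obtain f where f: "f 0 = components A c p u" "smooth_on (ball 0 r) f"
      "\<And>x. x \<in> ball 0 r \<Longrightarrow> (f has_derivative (\<lambda>h. F.B x h (f x))) (at x)" using sol by metis
    define E where "E q = tangent_vec A c q (f (snd c q - x0))" for q
    have im: "(\<lambda>x. x - x0) ` (snd c ` W) \<subseteq> ball 0 r" by (auto simp: W_def dist_norm norm_minus_commute)
    have oW: "open (snd c ` W)" using open_chart_image_sub[OF c W(1,2)] .
    have "smooth_on (snd c ` W) (\<lambda>x. f (x - x0))"
      by (rule smooth_on_compose[OF oW open_ball im f(2)]) (intro smooth_on_diff smooth_on_ident smooth_on_const oW)
    then have E: "E \<in> vfields A W" unfolding E_def by (rule tangent_field_vfields[OF c W(1,2)])
    have "D X E q = 0" if V: "openin M V" "V \<subseteq> W" and X: "X \<in> vfields A V" and q: "q \<in> V" for V X q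
    proof -
      have qc: "q \<in> fst c" and Vc: "V \<subseteq> fst c" using V q W by auto
      have qb: "snd c q - x0 \<in> ball 0 r" using im V q by blast
      have s: "((\<lambda>y. y - x0) has_derivative (\<lambda>d. d)) (at (snd c q))" by (auto intro!: derivative_eq_intros)
      let ?x = "snd c q - x0"
      have "((\<lambda>y. f (y - x0)) has_derivative (\<lambda>h. F.B ?x h (f ?x))) (at (snd c q))"
        using has_derivative_compose[OF s f(3)[OF qb]] .
      then have "(local_rep A c E has_derivative (\<lambda>h. F.B ?x h (f ?x))) (at (snd c q))"
        by (rule has_derivative_transform_within_open[OF _ oW])
          (use q V W c in \<open>auto simp: local_rep_chart E_def components_tangent_vec subset_iff\<close>)
      then have "frechet_derivative (local_rep A c E) (at (snd c q)) = (\<lambda>h. F.B ?x h (f ?x))"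
        using frechet_derivative_at by metis
      then have "components A c q (D X E q) = 0"
        using D_in_chart[OF c V(1) Vc X vfields_subset[OF E V(2)] q]
        by (simp add: B E_def components_tangent_vec[OF c qc])
      then show ?thesis using components_eq_0_iff[OF c qc] by blast
    qed
    moreover have "E p = u" using f(1) tangent_vec_components[OF c p] by (simp add: E_def x0_def)
    ultimately show ?thesis using E by blast
  qed
  then show ?thesis using W by blast
qed

end

text \<open>Takes the place of affine coordinates. Parallelity is stated against the fields on every
  open subset of \<open>W\<close>, because \<open>D\<close> is applied on shrunken domains; the
  chart \<open>c\<close> contains \<open>W\<close> and turns independence into a nonzero
  determinant.\<close>

locale par_frame = flat_mfd M A D
  for M :: "'a topology" and A :: "('a, 'n::finite) chart set" and D +
  fixes c W and E :: "'n \<Rightarrow> ('a, 'n) vfield"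
  assumes cA: "c \<in> A" and oW: "openin M W" and Wc: "W \<subseteq> fst c"
    and E: "\<And>i. E i \<in> vfields A W"
    and par: "\<And>V X q i. openin M V \<Longrightarrow> V \<subseteq> W \<Longrightarrow> X \<in> vfields A V \<Longrightarrow> q \<in> V \<Longrightarrow> D X (E i) q = 0"
    and indep: "\<And>q. q \<in> W \<Longrightarrow> det (\<chi> k i. components A c q (E i q) $ k) \<noteq> 0"

text \<open>The parallel extensions of the vectors \<open>u i\<close> stay independent near
  \<open>p\<close>, because their determinant in the chart \<open>c\<close> is continuous and
  nonzero at \<open>p\<close>.\<close>

lemma (in flat_mfd) par_frame_exists:
  assumes c: "c \<in> A" and p: "p \<in> fst c" "p \<in> W0" "openin M W0"
    and u: "det (\<chi> k i. components A c p (u i) $ k) \<noteq> 0"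
  shows "\<exists>W E. par_frame M A D c W E \<and> p \<in> W \<and> W \<subseteq> W0 \<and> (\<forall>i. E i p = u i)"
proof -
  obtain W1 where W1: "openin M W1" "p \<in> W1" "W1 \<subseteq> fst c" and ex: "\<And>u. \<exists>E\<in>vfields A W1. E p = u \<and>
    (\<forall>V X q. openin M V \<longrightarrow> V \<subseteq> W1 \<longrightarrow> X \<in> vfields A V \<longrightarrow> q \<in> V \<longrightarrow> D X E q = 0)"
    using parallel_fields_exist[OF c p(1)] by blast
  have "\<forall>i. \<exists>E. E \<in> vfields A W1 \<and> E p = u i \<and>
    (\<forall>V X q. openin M V \<longrightarrow> V \<subseteq> W1 \<longrightarrow> X \<in> vfields A V \<longrightarrow> q \<in> V \<longrightarrow> D X E q = 0)" using ex by blast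
  from choice[OF this] obtain E where E0: "\<forall>i. E i \<in> vfields A W1 \<and> E i p = u i \<and>
    (\<forall>V X q. openin M V \<longrightarrow> V \<subseteq> W1 \<longrightarrow> X \<in> vfields A V \<longrightarrow> q \<in> V \<longrightarrow> D X (E i) q = 0)" ..
  have E: "E i \<in> vfields A W1" "E i p = u i" for i using E0 by simp_all
  have parE: "D X (E i) q = 0" if "openin M V" "V \<subseteq> W1" "X \<in> vfields A V" "q \<in> V" for i V X q
    using E0 that by simp
  define d where "d q = det (\<chi> k i. components A c q (E i q) $ k)" for q
  have sd: "smooth_fun A W1 d" unfolding d_def
    using smooth_fun_det[OF W1(1), of "\<lambda>k i q. components A c q (E i q) $ k"] component_smooth[OF E(1) c W1(1,3)] by blast
  define S where "S = {x \<in> snd c ` W1. (d \<circ> chart_inv c) x \<noteq> 0}"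
  have o1: "open (snd c ` W1)" using open_chart_image_sub[OF c W1(1,3)] .
  have "continuous_on (snd c ` W1) (d \<circ> chart_inv c)"
    using smooth_on_imp_continuous_on[OF smooth_funD[OF sd c]] W1(3) by (simp add: Int_absorb1)
  then have "open (snd c ` W1 \<inter> (d \<circ> chart_inv c) -` (- {0}))" using continuous_open_preimage o1 by blast
  moreover have "S = snd c ` W1 \<inter> (d \<circ> chart_inv c) -` (- {0})" by (auto simp: S_def)
  ultimately have oS: "open S" by simp
  define W where "W = {q \<in> fst c. snd c q \<in> S} \<inter> W1 \<inter> W0"
  have oW: "openin M W" unfolding W_def using chart_preimage_open[OF c oS] W1 p by blast
  have dW: "d q \<noteq> 0" if "q \<in> W" for q
  proof -
    have "snd c q \<in> S" "q \<in> fst c" using that by (simp_all add: W_def)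
    then show ?thesis using chart_inv_left[OF c] by (simp add: S_def)
  qed
  have "p \<in> W" unfolding W_def S_def using W1 p c u E(2) by (auto simp: d_def)
  moreover have "par_frame M A D c W E"
  proof
    show "c \<in> A" "openin M W" "W \<subseteq> fst c" using c oW by (auto simp: W_def)
    show "E i \<in> vfields A W" for i by (rule vfields_subset[OF E(1)]) (auto simp: W_def)
    show "D X (E i) q = 0" if "openin M V" "V \<subseteq> W" "X \<in> vfields A V" "q \<in> V" for V X q i
      using parE[of V X q i] that by (auto simp: W_def)
    show "det (\<chi> k i. components A c q (E i q) $ k) \<noteq> 0" if "q \<in> W" for q using dW[OF that] by (simp add: d_def)
  qed
  ultimately show ?thesis using E(2) by (auto simp: W_def)
qed

context par_frame
begin

text \<open>Cramer's rule, which makes the smoothness of the coefficients that of a quotient of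
  determinants.\<close>

definition coef :: "'n \<Rightarrow> 'a \<Rightarrow> real ^ 'n \<Rightarrow> real"
  where "coef l q v = det (\<chi> k i. if i = l then components A c q v $ k else components A c q (E i q) $ k)
    / det (\<chi> k i. components A c q (E i q) $ k)"

lemma coef_unique:
  assumes q: "q \<in> W"
  shows "(v = (\<Sum>i\<in>UNIV. a i *\<^sub>R E i q)) \<longleftrightarrow> (\<forall>i. a i = coef i q v)"
proof -
  have qc: "q \<in> fst c" using q Wc by blast
  note lin = components_linear[OF cA qc]
  let ?m = "(\<chi> k i. components A c q (E i q) $ k) :: real ^ 'n ^ 'n"
  have "v = (\<Sum>i\<in>UNIV. a i *\<^sub>R E i q) \<longleftrightarrow> components A c q (\<Sum>i\<in>UNIV. a i *\<^sub>R E i q) = components A c q v"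
    using components_eq_iff[OF cA qc] by metis
  also have "components A c q (\<Sum>i\<in>UNIV. a i *\<^sub>R E i q) = ?m *v (\<chi> i. a i)"
    by (simp add: linear_sum[OF lin] linear_cmul[OF lin] vec_eq_iff matrix_vector_mult_def mult.commute)
  also have "(?m *v (\<chi> i. a i) = components A c q v) \<longleftrightarrow>
    (\<chi> i. a i) = (\<chi> l. det (\<chi> k i. if i = l then components A c q v $ k else ?m $ k $ i) / det ?m)"
    by (rule cramer[OF indep[OF q]])
  also have "\<dots> \<longleftrightarrow> (\<forall>i. a i = coef i q v)"
    by (simp add: vec_eq_iff coef_def cong: if_cong)
  finally show ?thesis .
qed

lemma coef_expand: "q \<in> W \<Longrightarrow> v = (\<Sum>i\<in>UNIV. coef i q v *\<^sub>R E i q)"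
  using coef_unique[of q v "\<lambda>i. coef i q v"] by blast

lemma coef_sum:
  assumes "q \<in> W"
  shows "coef i q (\<Sum>j\<in>UNIV. a j *\<^sub>R E j q) = a i"
proof -
  have "\<forall>i. a i = coef i q (\<Sum>j\<in>UNIV. a j *\<^sub>R E j q)" by (rule coef_unique[OF assms, THEN iffD1, OF refl])
  then show ?thesis by (rule allE[of _ i]) (erule sym)
qed

lemma coef_E:
  assumes "q \<in> W"
  shows "coef i q (E j q) = (if i = j then 1 else 0)"
proof -
  have "(\<Sum>k\<in>UNIV. (if k = j then 1 else 0) *\<^sub>R E k q) = E j q"
    by (simp add: if_distrib[of "\<lambda>x. x *\<^sub>R _"] cong: if_cong)
  then show ?thesis using coef_sum[OF assms, of i "\<lambda>k. if k = j then 1 else 0"] by simp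
qed

lemma coef_smooth:
  assumes "openin M V" "V \<subseteq> W" "X \<in> vfields A V"
  shows "smooth_fun A V (\<lambda>q. coef i q (X q))"
proof -
  have Vc: "V \<subseteq> fst c" using assms Wc by blast
  have s: "smooth_fun A V (\<lambda>q. components A c q (X q) $ k)" "smooth_fun A V (\<lambda>q. components A c q (E l q) $ k)" for k l
    using component_smooth[OF assms(3) cA assms(1) Vc] component_smooth[OF vfields_subset[OF E assms(2)] cA assms(1) Vc] by blast+
  have "smooth_fun A V (\<lambda>q. if l = i then components A c q (X q) $ k else components A c q (E l q) $ k)" for l k
    using s by (cases "l = i") auto
  then show ?thesis unfolding coef_def divide_inverse using indep assms(2) s
    by (intro smooth_fun_mult smooth_fun_inverse assms(1) smooth_fun_det[OF assms(1), of "\<lambda>k l q. if l = i then components A c q (X q) $ k else components A c q (E l q) $ k"]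
        smooth_fun_det[OF assms(1), of "\<lambda>k l q. components A c q (E l q) $ k"]) blast+
qed

definition d :: "'n \<Rightarrow> ('a \<Rightarrow> real) \<Rightarrow> 'a \<Rightarrow> real"
  where "d i f q = differential A f q (E i q)"

lemma d_smooth: "smooth_fun A W f \<Longrightarrow> smooth_fun A W (d i f)"
  unfolding d_def using differential_field_smooth[OF oW _ E] by blast

lemma d_cong: "q \<in> W \<Longrightarrow> (\<And>r. r \<in> W \<Longrightarrow> f r = g r) \<Longrightarrow> d i f q = d i g q"
  unfolding d_def using differential_cong[OF oW] by blast

lemma d_const [simp]: "q \<in> W \<Longrightarrow> d i (\<lambda>q. k) q = 0"
  unfolding d_def by (rule differential_const[OF oW])

lemma d_add: "q \<in> W \<Longrightarrow> smooth_fun A W f \<Longrightarrow> smooth_fun A W g \<Longrightarrow> d i (\<lambda>q. f q + g q) q = d i f q + d i g q"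
  unfolding d_def by (rule differential_add[OF oW])

lemma d_diff: "q \<in> W \<Longrightarrow> smooth_fun A W f \<Longrightarrow> smooth_fun A W g \<Longrightarrow> d i (\<lambda>q. f q - g q) q = d i f q - d i g q"
  unfolding d_def by (rule differential_diff[OF oW])

lemma d_mult: "q \<in> W \<Longrightarrow> smooth_fun A W f \<Longrightarrow> smooth_fun A W g \<Longrightarrow> d i (\<lambda>q. f q * g q) q = f q * d i g q + d i f q * g q"
  unfolding d_def by (rule differential_mult[OF oW])

lemma d_sum: "q \<in> W \<Longrightarrow> (\<And>j. j \<in> I \<Longrightarrow> smooth_fun A W (f j)) \<Longrightarrow> d i (\<lambda>q. \<Sum>j\<in>I. f j q) q = (\<Sum>j\<in>I. d i (f j) q)"
  unfolding d_def by (rule differential_sum[OF oW])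

lemma differential_d:
  assumes "openin M V" "V \<subseteq> W" "smooth_fun A V f" "q \<in> V"
  shows "differential A f q v = (\<Sum>i\<in>UNIV. coef i q v * d i f q)"
proof -
  note lin = differential_linear[OF assms(1,3,4)]
  have "differential A f q v = differential A f q (\<Sum>i\<in>UNIV. coef i q v *\<^sub>R E i q)"
    using coef_expand[of q v] assms by auto
  then show ?thesis by (simp add: linear_sum[OF lin] linear_cmul[OF lin] d_def)
qed

lemma frame_bracket: "q \<in> W \<Longrightarrow> lie_bracket A (E i) (E j) q = 0"
proof -
  assume q: "q \<in> W"
  have "D (E i) (E j) q - D (E j) (E i) q - lie_bracket A (E i) (E j) q = 0"
    using flat[unfolded flat_connection_def torsion_free_def, THEN conjunct2, THEN conjunct1,
        THEN spec, THEN mp, OF oW, THEN bspec, OF E, THEN bspec, OF E, THEN bspec, OF q] .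
  then show ?thesis using par[OF oW order_refl E q] by simp
qed

text \<open>The frame fields commute, because they are parallel and \<open>D\<close> is torsion
  free. Hence \<open>d i\<close> behaves like the partial derivative in an affine
  coordinate.\<close>

lemma d_commute: "q \<in> W \<Longrightarrow> smooth_fun A W f \<Longrightarrow> d i (d j f) q = d j (d i f) q"
proof -
  assume q: "q \<in> W" and f: "smooth_fun A W f"
  have "d i (d j f) q - d j (d i f) q = differential A f q (lie_bracket A (E i) (E j) q)"
    unfolding d_def by (rule differential_bracket[OF oW f E E q])
  then show ?thesis using linear_0[OF differential_linear[OF oW f q]] frame_bracket[OF q] by simp
qed

lemma D_frame:
  assumes "openin M V" "V \<subseteq> W" "X \<in> vfields A V" "Y \<in> vfields A V" "q \<in> V"
  shows "D X Y q = (\<Sum>j\<in>UNIV. differential A (\<lambda>r. coef j r (Y r)) q (X q) *\<^sub>R E j q)"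
proof -
  have EV: "E j \<in> vfields A V" for j using vfields_subset[OF E assms(2)] .
  have "D X Y q = D X (\<lambda>q. \<Sum>j\<in>UNIV. coef j q (Y q) *\<^sub>R E j q) q"
  proof (rule D_cong[OF assms(1,3) _ assms(5)])
    show "(\<lambda>q. \<Sum>j\<in>UNIV. coef j q (Y q) *\<^sub>R E j q) \<in> vfields A V"
      by (intro vfields_sum vfields_scaleR assms coef_smooth EV) auto
    show "Y r = (\<Sum>j\<in>UNIV. coef j r (Y r) *\<^sub>R E j r)" if "r \<in> V" for r
      using coef_expand[of r "Y r"] that assms(2) by blast
  qed simp
  also have "\<dots> = (\<Sum>j\<in>UNIV. differential A (\<lambda>r. coef j r (Y r)) q (X q) *\<^sub>R E j q + coef j q (Y q) *\<^sub>R D X (E j) q)"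
    by (intro D_sum_right[OF assms(1)] assms coef_smooth EV) auto
  also have "\<dots> = (\<Sum>j\<in>UNIV. differential A (\<lambda>r. coef j r (Y r)) q (X q) *\<^sub>R E j q)"
    using par[OF assms(1,2,3,5)] by simp
  finally show ?thesis .
qed

end

section \<open>Determinants and orthonormal bases\<close>

lemma has_derivative_det_rows:
  fixes m :: "'n::finite \<Rightarrow> 'n \<Rightarrow> 'a::real_normed_vector \<Rightarrow> real"
  assumes m: "\<And>i j. (m i j has_derivative m' i j) (at x)"
  shows "((\<lambda>x. det (\<chi> i j. m i j x)) has_derivative
    (\<lambda>h. \<Sum>l\<in>UNIV. det (\<chi> i j. if i = l then m' i j h else m i j x))) (at x)"
proof -
  let ?P = "{p. p permutes (UNIV :: 'n set)}"
  have "((\<lambda>x. \<Sum>p\<in>?P. of_int (sign p) * (\<Prod>i\<in>UNIV. m i (p i) x)) has_derivative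
    (\<lambda>h. \<Sum>p\<in>?P. of_int (sign p) * (\<Sum>l\<in>UNIV. m' l (p l) h * (\<Prod>i\<in>UNIV - {l}. m i (p i) x)))) (at x)"
    by (intro has_derivative_sum has_derivative_mult_right has_derivative_prod m)
  moreover have "(\<Sum>p\<in>?P. of_int (sign p) * (\<Sum>l\<in>UNIV. m' l (p l) h * (\<Prod>i\<in>UNIV - {l}. m i (p i) x)))
    = (\<Sum>l\<in>UNIV. det (\<chi> i j. if i = l then m' i j h else m i j x))" for h
  proof -
    have "m' l (p l) h * (\<Prod>i\<in>UNIV - {l}. m i (p i) x) = (\<Prod>i\<in>UNIV. if i = l then m' i (p i) h else m i (p i) x)" for p l
      by (subst prod.remove[of UNIV l]) (auto intro!: prod.cong)
    then show ?thesis unfolding det_def by (simp add: sum_distrib_left) (rule sum.swap)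
  qed
  ultimately show ?thesis unfolding det_def by simp
qed

lemma det_swap_indices: "det (\<chi> i j. a j i) = det (\<chi> i j. a i j)" for a :: "'n::finite \<Rightarrow> 'n \<Rightarrow> real"
  using det_transpose[of "\<chi> i j. a i j"] by (simp add: transpose_def)

lemma has_derivative_det:
  fixes m :: "'n::finite \<Rightarrow> 'n \<Rightarrow> 'a::real_normed_vector \<Rightarrow> real"
  assumes m: "\<And>i j. (m i j has_derivative m' i j) (at x)"
  shows "((\<lambda>x. det (\<chi> i j. m i j x)) has_derivative
    (\<lambda>h. \<Sum>l\<in>UNIV. det (\<chi> i j. if j = l then m' i j h else m i j x))) (at x)"
proof -
  have "((\<lambda>x. det (\<chi> i j. m j i x)) has_derivative
    (\<lambda>h. \<Sum>l\<in>UNIV. det (\<chi> i j. if i = l then m' j i h else m j i x))) (at x)"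
    by (rule has_derivative_det_rows) (rule m)
  moreover have "det (\<chi> i j. m j i x) = det (\<chi> i j. m i j x)" for x by (rule det_swap_indices)
  moreover have "det (\<chi> i j. if i = l then m' j i h else m j i x) = det (\<chi> i j. if j = l then m' i j h else m i j x)" for l h
    using det_swap_indices[of "\<lambda>i j. if j = l then m' i j h else m i j x"] by simp
  ultimately show ?thesis by simp
qed

text \<open>Expand the modified column in the standard basis: all terms but the \<open>l\<close>-th
  have two equal columns. Through this determinant the trace of the connection matrix enters the
  derivative of the volume form.\<close>

lemma det_identity_column:
  "det (\<chi> i j. if j = l then a i else if i = j then 1 else 0) = a l" for a :: "'n::finite \<Rightarrow> real"
proof -
  have "det (\<chi> i j. if j = l then a i else if i = j then 1 else 0)
     = det (\<chi> i. if i = l then vec_lambda a else axis i (1 :: real))"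
    by (subst det_swap_indices[symmetric]) (intro arg_cong[of _ _ det], auto simp: vec_eq_iff axis_def)
  also have "(\<chi> i. if i = l then vec_lambda a else axis i (1 :: real)) =
      (\<chi> i. if i = l then \<Sum>j\<in>UNIV. a j *s axis j 1 else axis i 1)"
    by (auto simp: vec_eq_iff axis_def sum.delta if_distrib cong: if_cong)
  also have "det \<dots> = (\<Sum>j\<in>UNIV. det (\<chi> i. if i = l then a j *s axis j 1 else axis i (1 :: real)))"
    by (rule det_linear_row_sum) simp
  also have "\<dots> = (\<Sum>j\<in>UNIV. a j * (if j = l then 1 else 0))"
  proof (rule sum.cong[OF refl])
    fix j :: 'n
    have "det (\<chi> i. if i = l then axis j 1 else axis i (1 :: real)) = (if j = l then 1 else 0)"
    proof (cases "j = l")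
      case True
      then have "(\<chi> i. if i = l then axis j 1 else axis i (1 :: real)) = mat 1"
        by (auto simp: vec_eq_iff axis_def mat_def)
      then show ?thesis using True by simp
    next
      case False
      then show ?thesis
        by (simp, intro det_identical_rows[of j l]) (auto simp: row_def vec_eq_iff)
    qed
    then show "det (\<chi> i. if i = l then a j *s axis j 1 else axis i (1 :: real)) = a j * (if j = l then 1 else 0)"
      using det_row_mul[of l "a j" "\<lambda>_. axis j 1" "\<lambda>i. axis i 1 :: real ^ 'n"] by simp
  qed
  also have "\<dots> = a l" by (simp add: if_distrib cong: if_cong)
  finally show ?thesis .
qed

lemma bilinear_sum_both:
  fixes u :: "'k::finite \<Rightarrow> real ^ 'n" and v :: "'l::finite \<Rightarrow> real ^ 'n" and B :: "real ^ 'n::finite \<Rightarrow> real ^ 'n \<Rightarrow> real"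
  assumes "bilinear B"
  shows "B (\<Sum>i\<in>UNIV. a i *\<^sub>R u i) (\<Sum>j\<in>UNIV. b j *\<^sub>R v j) = (\<Sum>i\<in>UNIV. \<Sum>j\<in>UNIV. a i * b j * B (u i) (v j))"
proof -
  have l: "linear (\<lambda>x. B x y)" "linear (B x)" for x y using assms unfolding bilinear_def by blast+
  show ?thesis
    by (simp add: linear_sum[OF l(1)] linear_cmul[OF l(1)] linear_sum[OF l(2)] linear_cmul[OF l(2)] sum_distrib_left)
      (subst sum.swap, simp add: mult_ac)
qed

lemma det_linear_image:
  fixes f :: "real ^ 'n::finite \<Rightarrow> real ^ 'n"
  assumes "linear f"
  shows "det (\<chi> i j. f (v j) $ i) = det (matrix f) * det (\<chi> i j. v j $ i)"
proof -
  have *: "f x $ k = (\<Sum>a\<in>UNIV. f (axis a 1) $ k * x $ a)" for x k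
  proof -
    have "f x = f (\<Sum>a\<in>UNIV. x $ a *\<^sub>R axis a 1)" by (simp only: basis_expansion_scaleR)
    then show ?thesis by (simp add: linear_sum[OF assms] linear_cmul[OF assms] mult.commute)
  qed
  have "(\<chi> i j. f (v j) $ i) = matrix f ** (\<chi> i j. v j $ i)"
    unfolding vec_eq_iff matrix_matrix_mult_def matrix_def vec_lambda_beta by (intro allI *)
  then show ?thesis by (simp add: det_mul)
qed

text \<open>A new vector is found by counting dimensions instead of projecting: \<open>L\<close>
  records the products with the vectors already chosen and misses the direction \<open>k\<close>, so
  it is not surjective, hence not injective, and a kernel vector is orthogonal to all of them. The
  index \<open>i0\<close> is present in every stage of the induction to preserve
  \<open>u\<close>.\<close>

lemma orthonormal_extension:
  fixes B :: "real ^ 'n::finite \<Rightarrow> real ^ 'n \<Rightarrow> real"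
    and i0 :: 'n
  assumes B: "bilinear B" "\<And>u v. B u v = B v u" "\<And>v. v \<noteq> 0 \<Longrightarrow> B v v > 0" and u: "B u u = 1"
  shows "\<exists>e. e i0 = u \<and> (\<forall>i j. B (e i) (e j) = (if i = j then 1 else 0))"
proof -
  have l: "linear (\<lambda>x. B x y)" "linear (B x)" for x y using B(1) unfolding bilinear_def by blast+
  have "\<exists>e. e i0 = u \<and> (\<forall>i\<in>insert i0 F. \<forall>j\<in>insert i0 F. B (e i) (e j) = (if i = j then 1 else 0))" if "finite F" for F :: "'n set"
    using that
  proof induction
    case empty
    show ?case by (rule exI[of _ "\<lambda>_. u"]) (use u in auto)
  next
    case (insert k F)
    then obtain e where e: "e i0 = u" "\<And>i j. i \<in> insert i0 F \<Longrightarrow> j \<in> insert i0 F \<Longrightarrow> B (e i) (e j) = (if i = j then 1 else 0)" by blast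
    show ?case
    proof (cases "k = i0")
      case True
      then show ?thesis using e by auto
    next
      case False
      define L where "L v = (\<chi> i. if i \<in> insert i0 F then B (e i) v else 0)" for v
      have L: "linear L" unfolding L_def
        by (rule linearI) (auto simp: vec_eq_iff linear_add[OF l(2)] linear_cmul[OF l(2)])
      have "L v \<noteq> axis k 1" for v
      proof
        assume "L v = axis k 1"
        then have "L v $ k = 1" by simp
        then show False using insert.hyps False by (simp add: L_def)
      qed
      then have "\<not> surj L" unfolding surj_def by metis
      then have "\<not> inj L" using linear_injective_imp_surjective[OF L] by blast
      then obtain v where v: "v \<noteq> 0" "L v = 0" using linear_injective_0[OF L] by blast
      define w where "w = (1 / sqrt (B v v)) *\<^sub>R v"
      have ww: "B w w = 1" using B(3)[OF v(1)]
        by (simp add: w_def linear_cmul[OF l(1)] linear_cmul[OF l(2)] power2_eq_square[symmetric])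
      have ew: "B (e i) w = 0" if "i \<in> insert i0 F" for i
      proof -
        have "L v $ i = 0" using v by simp
        then show ?thesis using that by (simp add: L_def w_def linear_cmul[OF l(2)])
      qed
      show ?thesis
        by (rule exI[of _ "e(k := w)"]) (use e ww ew B(2) False insert.hyps in auto)
    qed
  qed
  from this[of UNIV] show ?thesis by auto
qed

text \<open>A change of basis m turns a Gram matrix B into the product of the transpose of m, B and
  m. The square in the result is what makes Gram determinants insensitive to orientation.\<close>

lemma matrix_of_bilinear:
  fixes B :: "real ^ 'n::finite \<Rightarrow> real ^ 'n \<Rightarrow> real"
  assumes "bilinear B"
  shows "det (\<chi> i j. B (\<Sum>k\<in>UNIV. m k i *\<^sub>R u k) (\<Sum>k\<in>UNIV. m k j *\<^sub>R u k)) = (det (\<chi> i j. m i j))\<^sup>2 * det (\<chi> i j. B (u i) (u j))"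
proof -
  have "B (\<Sum>k\<in>UNIV. m k i *\<^sub>R u k) (\<Sum>k\<in>UNIV. m k j *\<^sub>R u k) = (\<Sum>k\<in>UNIV. \<Sum>l\<in>UNIV. m k i * m l j * B (u k) (u l))" for i j
    by (rule bilinear_sum_both[OF assms])
  then have "(\<chi> i j. B (\<Sum>k\<in>UNIV. m k i *\<^sub>R u k) (\<Sum>k\<in>UNIV. m k j *\<^sub>R u k)) =
      transpose (\<chi> i j. m i j) ** ((\<chi> i j. B (u i) (u j)) ** (\<chi> i j. m i j))"
    by (simp add: vec_eq_iff matrix_matrix_mult_def transpose_def sum_distrib_left mult_ac)
  then show ?thesis by (simp add: det_mul det_transpose power2_eq_square)
qed

text \<open>An orthonormal basis has Gram determinant 1, which differs from that of the standard
  basis by a square; so the latter is positive, and with it that of any other basis.\<close>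

lemma gram_det_pos:
  fixes B :: "real ^ 'n::finite \<Rightarrow> real ^ 'n \<Rightarrow> real"
  assumes B: "bilinear B" "\<And>u v. B u v = B v u" "\<And>v. v \<noteq> 0 \<Longrightarrow> B v v > 0"
    and e: "det (\<chi> i j. e j $ i) \<noteq> 0"
  shows "det (\<chi> i j. B (e i) (e j)) > 0"
proof -
  let ?g = "det (\<chi> i j. B (axis i 1) (axis j 1))"
  have *: "det (\<chi> i j. B (f i) (f j)) = (det (\<chi> i j. f j $ i))\<^sup>2 * ?g" for f :: "'n \<Rightarrow> real ^ 'n"
    using matrix_of_bilinear[OF B(1), of "\<lambda>k i. f i $ k" "\<lambda>k. axis k 1"] by (simp add: basis_expansion_scaleR)
  have l: "linear (\<lambda>x. B x y)" "linear (B x)" for x y using B(1) unfolding bilinear_def by blast+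
  let ?v = "axis undefined 1 :: real ^ 'n"
  have unit: "B ((1 / sqrt (B ?v ?v)) *\<^sub>R ?v) ((1 / sqrt (B ?v ?v)) *\<^sub>R ?v) = 1"
    using B(3)[of ?v] by (simp add: linear_cmul[OF l(1)] linear_cmul[OF l(2)] power2_eq_square[symmetric])
  have "\<exists>f. f (undefined :: 'n) = (1 / sqrt (B ?v ?v)) *\<^sub>R ?v \<and> (\<forall>i j. B (f i) (f j) = (if i = j then 1 else 0))"
    by (rule orthonormal_extension[OF B(1,2) _ unit]) (rule B(3))
  then obtain f :: "'n \<Rightarrow> real ^ 'n" where "\<forall>i j. B (f i) (f j) = (if i = j then 1 else 0)" by blast
  then have "(\<chi> i j. B (f i) (f j)) = mat 1" by (simp add: mat_def vec_eq_iff)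
  then have "1 = (det (\<chi> i j. f j $ i))\<^sup>2 * ?g" using *[of f] by simp
  then have "?g > 0" by (metis zero_less_mult_pos zero_less_one zero_le_power2 mult_zero_left order_le_less)
  then show ?thesis using e by (simp add: *[of e])
qed

lemma orthonormal_det_nonzero:
  fixes B :: "real ^ 'n::finite \<Rightarrow> real ^ 'n \<Rightarrow> real"
  assumes "bilinear B" "\<And>i j. B (e i) (e j) = (if i = j then 1 else 0)"
  shows "det (\<chi> i j. e j $ i) \<noteq> 0"
proof -
  have "(\<chi> i j. B (e i) (e j)) = mat 1" using assms(2) by (simp add: mat_def vec_eq_iff)
  then show ?thesis
    using matrix_of_bilinear[OF assms(1), of "\<lambda>k i. e i $ k" "\<lambda>k. axis k 1"] by (auto simp: basis_expansion_scaleR)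
qed

section \<open>Koszul forms in parallel frames\<close>

lemma (in smooth_mfd) differential_det:
  fixes f :: "'m::finite \<Rightarrow> 'm \<Rightarrow> 'a \<Rightarrow> real"
  assumes W: "openin M W" "q \<in> W" and f: "\<And>i j. smooth_fun A W (f i j)"
  shows "differential A (\<lambda>q. det (\<chi> i j. f i j q)) q v =
    (\<Sum>l\<in>UNIV. det (\<chi> i j. if j = l then differential A (f i j) q v else f i j q))"
proof -
  have "differential A (\<lambda>q. det (\<chi> i j. f i j q)) q = (\<lambda>v. \<Sum>l\<in>UNIV. det (\<chi> i j. if j = l then differential A (f i j) q v
      else (f i j \<circ> chart_inv (chart_at A q)) (snd (chart_at A q) q)))"
    by (rule differential_unique[OF W_chart_at[OF W] has_derivative_det[OF differential_works[OF W(1) f W(2)]]])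
      (simp add: inv_chart_at[OF W])
  then show ?thesis by (simp add: q_chart_at[OF W] cong: if_cong)
qed

locale metric_frame = par_frame M A D c W E
  for M :: "'a topology" and A :: "('a, 'n::finite) chart set" and D c W E +
  fixes g :: "('a, 'n) metric"
  assumes riem: "riemannian_metric M A g"
begin

lemma W_top: "q \<in> W \<Longrightarrow> q \<in> topspace M" using oW openin_subset by blast

lemma g_bilinear: "q \<in> topspace M \<Longrightarrow> bilinear (g q)"
  and g_sym: "q \<in> topspace M \<Longrightarrow> g q u v = g q v u"
  and g_pos: "q \<in> topspace M \<Longrightarrow> v \<noteq> 0 \<Longrightarrow> g q v v > 0"
  using riem unfolding riemannian_metric_def by blast+

lemma g_smooth: "openin M V \<Longrightarrow> X \<in> vfields A V \<Longrightarrow> Y \<in> vfields A V \<Longrightarrow> smooth_fun A V (\<lambda>q. g q (X q) (Y q))"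
  using riem unfolding riemannian_metric_def by simp

definition G :: "'n \<Rightarrow> 'n \<Rightarrow> 'a \<Rightarrow> real"
  where "G i j q = g q (E i q) (E j q)"

definition detG :: "'a \<Rightarrow> real" where "detG q = det (\<chi> i j. G i j q)"

text \<open>The inverse matrix of \<open>G\<close> by Cramer's rule, with row \<open>l\<close> and
  column \<open>a\<close>; its smoothness is inherited from determinants.\<close>

definition H :: "'n \<Rightarrow> 'n \<Rightarrow> 'a \<Rightarrow> real"
  where "H l a q = det (\<chi> i j. if j = l then (if i = a then 1 else 0) else G i j q) / detG q"

text \<open>Half the logarithmic derivative of \<open>detG\<close> along \<open>E k\<close>. It
  turns out to be the value of the first Koszul form on \<open>E k\<close>.\<close>

definition al :: "'n \<Rightarrow> 'a \<Rightarrow> real"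
  where "al k q = d k detG q * inverse (2 * detG q)"

lemma G_smooth: "smooth_fun A W (G i j)"
  unfolding G_def using g_smooth[OF oW E E] .

lemma G_sym: "q \<in> W \<Longrightarrow> G i j q = G j i q"
  unfolding G_def using g_sym[OF W_top] .

lemma det_frame: "q \<in> W \<Longrightarrow> det (\<chi> i j. E j q $ i) \<noteq> 0"
proof -
  assume q: "q \<in> W"
  have qc: "q \<in> fst c" using q Wc by blast
  note lin = components_linear[OF cA qc]
  show ?thesis using indep[OF q] det_linear_image[OF lin, of "\<lambda>j. E j q"] by auto
qed

lemma detG_pos: "q \<in> W \<Longrightarrow> detG q > 0"
  unfolding detG_def G_def using gram_det_pos[OF g_bilinear g_sym g_pos det_frame] W_top by blast

lemma detG_smooth: "smooth_fun A W detG"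
  using smooth_fun_det[OF oW, of G] G_smooth by (simp add: detG_def[abs_def])

lemma H_smooth: "smooth_fun A W (H l a)"
proof -
  have s: "smooth_fun A W (\<lambda>q. if j = l then (if i = a then 1 else 0) else G i j q)" for i j
    using smooth_fun_const[OF oW] G_smooth by (cases "j = l") auto
  have "smooth_fun A W (\<lambda>q. det (\<chi> i j. if j = l then (if i = a then 1 else 0) else G i j q) * inverse (detG q))"
    using smooth_fun_det[OF oW s] smooth_fun_inverse[OF oW _ detG_smooth] detG_pos
    by (intro smooth_fun_mult oW) force+
  then show ?thesis by (simp add: H_def[abs_def] divide_inverse)
qed

lemma al_smooth: "smooth_fun A W (al k)"
proof -
  have "smooth_fun A W (\<lambda>q. inverse (2 * detG q))"
    by (intro smooth_fun_inverse smooth_fun_mult oW smooth_fun_const detG_smooth) (use detG_pos in force)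
  then show ?thesis unfolding al_def[abs_def] by (intro smooth_fun_mult oW d_smooth detG_smooth)
qed

lemma G_H: "q \<in> W \<Longrightarrow> (\<Sum>k\<in>UNIV. G a k q * H k b q) = (if a = b then 1 else 0)"
proof -
  assume q: "q \<in> W"
  let ?G = "(\<chi> i j. G i j q) :: real ^ 'n ^ 'n"
  have dG: "det ?G \<noteq> 0" using detG_pos[OF q] by (simp add: detG_def)
  have "?G *v (\<chi> l. det (\<chi> i j. if j = l then (axis b 1 :: real ^ 'n) $ i else ?G $ i $ j) / det ?G) = axis b 1"
    using cramer[OF dG] by blast
  moreover have "det (\<chi> i j. if j = l then (axis b 1 :: real ^ 'n) $ i else ?G $ i $ j) / det ?G = H l b q" for l
    unfolding H_def detG_def by (intro arg_cong2[of _ _ _ _ "(/)"] arg_cong[of _ _ det]) (auto simp: vec_eq_iff axis_def)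
  ultimately have "(?G *v (\<chi> l. H l b q)) $ a = axis b 1 $ a" by simp
  then show ?thesis by (simp add: matrix_vector_mult_def axis_def)
qed

text \<open>Jacobi's formula for the derivative of a determinant. The determinant with column
  \<open>l\<close> replaced is read off from Cramer's rule, the linear system with matrix
  \<open>G\<close> being solved by \<open>H\<close>.\<close>

lemma al_eq:
  assumes q: "q \<in> W"
  shows "al k q = (1 / 2) * (\<Sum>l\<in>UNIV. \<Sum>i\<in>UNIV. H l i q * d k (G i l) q)"
proof -
  let ?G = "(\<chi> i j. G i j q) :: real ^ 'n ^ 'n"
  have dG: "det ?G \<noteq> 0" using detG_pos[OF q] by (simp add: detG_def)
  have *: "det (\<chi> i j. if j = l then d k (G i l) q else G i j q) = detG q * (\<Sum>i\<in>UNIV. H l i q * d k (G i l) q)" for l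
  proof -
    let ?b = "(\<chi> i. d k (G i l) q) :: real ^ 'n" and ?x = "(\<chi> l'. \<Sum>i\<in>UNIV. H l' i q * d k (G i l) q) :: real ^ 'n"
    have "?G *v ?x = ?b"
    proof -
      have "(\<Sum>j\<in>UNIV. G a j q * (\<Sum>i\<in>UNIV. H j i q * d k (G i l) q)) = d k (G a l) q" for a
      proof -
        have "(\<Sum>j\<in>UNIV. G a j q * (\<Sum>i\<in>UNIV. H j i q * d k (G i l) q))
            = (\<Sum>i\<in>UNIV. (\<Sum>j\<in>UNIV. G a j q * H j i q) * d k (G i l) q)"
          unfolding sum_distrib_left sum_distrib_right by (subst sum.swap) (simp add: mult.assoc)
        then show ?thesis by (simp add: G_H[OF q] if_distrib[of "\<lambda>x. x * _"] cong: if_cong)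
      qed
      then show ?thesis by (simp add: matrix_vector_mult_def vec_eq_iff)
    qed
    then have "?x = (\<chi> l'. det (\<chi> i j. if j = l' then ?b $ i else ?G $ i $ j) / det ?G)" using cramer[OF dG] by blast
    from arg_cong[OF this, of "\<lambda>v. v $ l"]
    have "?x $ l = det (\<chi> i j. if j = l then ?b $ i else ?G $ i $ j) / det ?G" by (simp only: vec_lambda_beta)
    then show ?thesis using dG by (simp add: detG_def field_simps cong: if_cong)
  qed
  have "d k detG q = (\<Sum>l\<in>UNIV. det (\<chi> i j. if j = l then d k (G i j) q else G i j q))"
    using differential_det[where f = G and v = "E k q", OF oW q G_smooth]
    by (simp add: d_def detG_def[abs_def] cong: if_cong)
  also have "\<dots> = (\<Sum>l\<in>UNIV. detG q * (\<Sum>i\<in>UNIV. H l i q * d k (G i l) q))"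
    unfolding *[symmetric] by (intro sum.cong refl arg_cong[of _ _ det]) (auto simp: vec_eq_iff)
  finally show ?thesis using detG_pos[OF q] unfolding al_def by (simp add: sum_distrib_left[symmetric] field_simps)
qed

text \<open>Differentiate the identity G H = 1 at a point where both matrices are the
  identity.\<close>

lemma d_H_orthonormal:
  assumes p: "p \<in> W" and on: "\<And>i j. G i j p = (if i = j then 1 else 0)"
  shows "H i j p = (if i = j then 1 else 0)" "d m (H i j) p = - d m (G i j) p"
proof -
  show Hp: "H i j p = (if i = j then 1 else 0)" for i j
    using G_H[OF p, of i j] by (simp add: on if_distrib[of "\<lambda>x. x * _"] cong: if_cong)
  have "d m (\<lambda>q. \<Sum>k\<in>UNIV. G i k q * H k j q) p = d m (\<lambda>q. if i = j then 1 else 0) p"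
    by (rule d_cong[OF p]) (simp add: G_H)
  then have "(\<Sum>k\<in>UNIV. G i k p * d m (H k j) p + d m (G i k) p * H k j p) = 0"
    using p by (simp add: d_sum smooth_fun_mult oW G_smooth H_smooth d_mult)
  then show "d m (H i j) p = - d m (G i j) p"
    by (simp add: on Hp sum.distrib if_distrib[of "\<lambda>x. x * _"] if_distrib[of "\<lambda>x. _ * x"] cong: if_cong)
qed

text \<open>Writing \<open>Y j = \<Sum>\<^sub>i m i j E\<^sub>i\<close>, the volume form is \<open>det m\<close> times its value on the parallel frame, and the
  square of the latter is \<open>det (g (E\<^sub>i, E\<^sub>j))\<close>.\<close>

lemma koszul_equation:
  assumes c': "c' \<in> A" and q: "q \<in> W" "q \<in> fst c'" and X: "X \<in> vfields A (fst c')" and Y: "\<And>i. Y i \<in> vfields A (fst c')"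
  shows "cov_top_form A D (volume_form A g c') X Y q =
    (\<Sum>k\<in>UNIV. coef k q (X q) * al k q) * volume_form A g c' q (\<lambda>i. Y i q)"
proof -
  define V where "V = W \<inter> fst c'"
  have V: "openin M V" "V \<subseteq> W" "V \<subseteq> fst c'" "q \<in> V" using oW chart_openin[OF c'] q by (auto simp: V_def)
  define vol where "vol r = volume_form A g c' r (\<lambda>i. E i r)" for r
  have EV: "E i \<in> vfields A V" for i using vfields_subset[OF E V(2)] .
  have XV: "X \<in> vfields A V" and YV: "Y i \<in> vfields A V" for i using vfields_subset[OF _ V(3)] X Y by blast+
  define m where "m i j r = coef i r (Y j r)" for i j r
  have m: "smooth_fun A V (m i j)" for i j unfolding m_def using coef_smooth[OF V(1,2) YV] .
  have vf: "volume_form A g c' r v = vol r * det (\<chi> i j. coef i r (v j))" if r: "r \<in> V" for r v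
  proof -
    have rc: "r \<in> fst c'" and rW: "r \<in> W" using r V by auto
    note lin = components_linear[OF c' rc]
    have "components A c' r (v j) $ i = (\<Sum>k\<in>UNIV. components A c' r (E k r) $ i * coef k r (v j))" for i j
    proof -
      have "components A c' r (v j) = components A c' r (\<Sum>k\<in>UNIV. coef k r (v j) *\<^sub>R E k r)"
        using coef_expand[OF rW, of "v j"] by simp
      then show ?thesis by (simp add: linear_sum[OF lin] linear_cmul[OF lin] mult.commute)
    qed
    then have "(\<chi> i j. components A c' r (v j) $ i) = (\<chi> i j. components A c' r (E j r) $ i) ** (\<chi> i j. coef i r (v j))"
      by (simp add: vec_eq_iff matrix_matrix_mult_def)
    then show ?thesis by (simp add: volume_form_def vol_def det_mul)
  qed
  define gram where "gram r = det (\<chi> i j. g r (coord_vector A c' i r) (coord_vector A c' j r))" for r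
  \<comment> \<open>The sign of \<open>vol\<close> depends on how chart and frame are oriented; its
    square does not and equals the Gram determinant of the frame.\<close>
  have vol2: "vol r * vol r = detG r" and gram: "gram r > 0" if r: "r \<in> V" for r
  proof -
    have rc: "r \<in> fst c'" and rW: "r \<in> W" using r V by auto
    have "G i j r = g r (\<Sum>k\<in>UNIV. components A c' r (E i r) $ k *\<^sub>R coord_vector A c' k r)
        (\<Sum>k\<in>UNIV. components A c' r (E j r) $ k *\<^sub>R coord_vector A c' k r)" for i j
      unfolding G_def by (rule arg_cong2[of _ _ _ _ "g r"]) (rule coord_expand[OF c' rc])+
    then have *: "detG r = (det (\<chi> i j. components A c' r (E j r) $ i))\<^sup>2 * gram r"
      unfolding detG_def gram_def
      using matrix_of_bilinear[OF g_bilinear[OF W_top[OF rW]], of "\<lambda>k i. components A c' r (E i r) $ k" "\<lambda>k. coord_vector A c' k r"] by simp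
    show gp: "gram r > 0"
      using detG_pos[OF rW] unfolding * by (simp add: zero_less_mult_iff)
    show "vol r * vol r = detG r"
      using gp unfolding * vol_def volume_form_def gram_def[symmetric] by (simp add: power2_eq_square)
  qed
  have cvs: "coord_vector A c' i \<in> vfields A V" for i using coord_vector_vfields[OF c' V(1,3)] .
  have gs: "smooth_fun A V gram" unfolding gram_def
    using smooth_fun_det[OF V(1), of "\<lambda>i j r. g r (coord_vector A c' i r) (coord_vector A c' j r)"] g_smooth[OF V(1) cvs cvs] by blast
  have vs: "smooth_fun A V vol"
    unfolding vol_def volume_form_def gram_def[symmetric]
    using smooth_fun_det[OF V(1), of "\<lambda>i j r. components A c' r (E j r) $ i"] component_smooth[OF EV c' V(1,3)]
    by (intro smooth_fun_mult V smooth_fun_sqrt gs gram) auto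
  define a where "a = (\<Sum>k\<in>UNIV. coef k q (X q) * al k q)"
  \<comment> \<open>Differentiating the square of \<open>vol\<close> gives twice \<open>vol\<close>
    times its derivative; \<open>vol\<close> can be divided out because its square
    \<open>detG\<close> is positive.\<close>
  have dvol: "differential A vol q (X q) = a * vol q"
  proof -
    have "differential A (\<lambda>r. vol r * vol r) q (X q) = differential A detG q (X q)"
      by (rule differential_cong[OF V(1,4)]) (rule vol2)
    then have "2 * vol q * differential A vol q (X q) = differential A detG q (X q)"
      by (simp add: differential_mult[OF V(1,4) vs vs])
    also have "\<dots> = (\<Sum>k\<in>UNIV. coef k q (X q) * d k detG q)" by (rule differential_d[OF oW order_refl detG_smooth q(1)])
    also have "\<dots> = 2 * detG q * a"
      using detG_pos[OF q(1)] by (simp add: a_def al_def sum_distrib_left field_simps)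
    also have "\<dots> = 2 * vol q * (a * vol q)" using vol2[OF V(4)] by (simp add: algebra_simps)
    finally show ?thesis using vol2[OF V(4)] detG_pos[OF q(1)] by auto
  qed
  have dm: "coef i q (D X (Y j) q) = differential A (m i j) q (X q)" for i j
    unfolding D_frame[OF V(1,2) XV YV V(4)] m_def by (rule coef_sum[OF q(1)])
  have "differential A (\<lambda>r. volume_form A g c' r (\<lambda>j. Y j r)) q (X q) = differential A (\<lambda>r. vol r * det (\<chi> i j. m i j r)) q (X q)"
    by (rule differential_cong[OF V(1,4)]) (simp add: vf m_def)
  also have "\<dots> = vol q * (\<Sum>l\<in>UNIV. det (\<chi> i j. if j = l then differential A (m i j) q (X q) else m i j q)) + a * vol q * det (\<chi> i j. m i j q)"
    using differential_mult[OF V(1,4) vs smooth_fun_det[OF V(1), of m, OF m]] differential_det[OF V(1,4), of m, OF m] dvol by simp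
  finally have 1: "differential A (\<lambda>r. volume_form A g c' r (\<lambda>j. Y j r)) q (X q) = \<dots>" .
  have 2: "volume_form A g c' q (\<lambda>j. (Y(l := D X (Y l))) j q) = vol q * det (\<chi> i j. if j = l then differential A (m i j) q (X q) else m i j q)" for l
    unfolding vf[OF V(4)] by (intro arg_cong2[of _ _ _ _ "(*)"] refl arg_cong[of _ _ det]) (auto simp: vec_eq_iff dm m_def)
  show ?thesis unfolding cov_top_form_def 1 2 a_def[symmetric] vf[OF V(4), of "\<lambda>i. Y i q"]
    by (simp add: sum_distrib_left m_def)
qed

lemma coef_linear: "q \<in> W \<Longrightarrow> linear (coef k q)"
proof -
  assume q: "q \<in> W"
  have 1: "coef k q (u + v) = coef k q u + coef k q v" for u v k
    using coef_sum[OF q, of k "\<lambda>i. coef i q u + coef i q v"] coef_expand[OF q, of u] coef_expand[OF q, of v]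
    by (simp add: scaleR_add_left sum.distrib)
  have 2: "coef k q (a *\<^sub>R v) = a * coef k q v" for a v k
    using coef_sum[OF q, of k "\<lambda>i. a * coef i q v"] coef_expand[OF q, of v] by (simp add: scaleR_sum_right[symmetric] flip: scaleR_scaleR)
  show ?thesis by (rule linearI) (simp_all add: 1 2)
qed

text \<open>By \<open>koszul_equation\<close> the sum satisfies the characterization of
  \<open>koszul1\<close> in every chart. It is the only such value, because the equation can be
  tested on the coordinate fields of \<open>c\<close>, on which the volume form is nonzero.\<close>

lemma koszul1_frame:
  assumes q: "q \<in> W"
  shows "koszul1 A D g q u = (\<Sum>k\<in>UNIV. coef k q u * al k q)"
  unfolding koszul1_def
proof (rule the_equality)
  show "\<forall>c\<in>A. q \<in> fst c \<longrightarrow> (\<forall>X Y. X \<in> vfields A (fst c) \<and> X q = u \<and> (\<forall>i. Y i \<in> vfields A (fst c)) \<longrightarrow>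
      cov_top_form A D (volume_form A g c) X Y q = (\<Sum>k\<in>UNIV. coef k q u * al k q) * volume_form A g c q (\<lambda>i. Y i q))"
    using koszul_equation[OF _ q] by blast
next
  fix a assume a: "\<forall>c\<in>A. q \<in> fst c \<longrightarrow> (\<forall>X Y. X \<in> vfields A (fst c) \<and> X q = u \<and> (\<forall>i. Y i \<in> vfields A (fst c)) \<longrightarrow>
      cov_top_form A D (volume_form A g c) X Y q = a * volume_form A g c q (\<lambda>i. Y i q))"
  have qc: "q \<in> fst c" using q Wc by blast
  note W' = chart_openin[OF cA]
  let ?X = "\<lambda>r. tangent_vec A c r (components A c q u)"
  have X: "?X \<in> vfields A (fst c)" "?X q = u" using const_field_vfields[OF cA W'] tangent_vec_components[OF cA qc] by auto
  have Y: "coord_vector A c i \<in> vfields A (fst c)" for i using coord_vector_vfields[OF cA W'] by auto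
  have "cov_top_form A D (volume_form A g c) ?X (coord_vector A c) q = a * volume_form A g c q (\<lambda>i. coord_vector A c i q)"
    using a cA qc X Y by blast
  moreover have "cov_top_form A D (volume_form A g c) ?X (coord_vector A c) q
      = (\<Sum>k\<in>UNIV. coef k q u * al k q) * volume_form A g c q (\<lambda>i. coord_vector A c i q)"
    using koszul_equation[OF cA q qc X(1) Y] X(2) by simp
  moreover have "volume_form A g c q (\<lambda>i. coord_vector A c i q) \<noteq> 0"
  proof -
    have d: "(\<chi> i j. components A c q (coord_vector A c j q) $ i) = mat 1"
      by (simp add: components_coord_vector[OF cA qc] vec_eq_iff mat_def axis_def) 
    have "det (\<chi> i j. coord_vector A c j q $ i) \<noteq> 0"
      using det_linear_image[OF components_linear[OF cA qc], of "\<lambda>j. coord_vector A c j q"] unfolding d by auto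
    then have "det (\<chi> i j. g q (coord_vector A c i q) (coord_vector A c j q)) > 0"
      using W_top[OF q] by (intro gram_det_pos g_bilinear g_sym g_pos)
    then show ?thesis unfolding volume_form_def d by simp
  qed
  ultimately show "a = (\<Sum>k\<in>UNIV. coef k q u * al k q)" by simp
qed

lemma koszul2_frame:
  assumes q: "q \<in> W"
  shows "koszul2 A D g (E i) (E j) q = d i (al j) q"
proof -
  have "differential A (\<lambda>r. koszul1 A D g r (E j r)) q (E i q) = d i (al j) q"
    unfolding d_def by (rule differential_cong[OF oW q])
      (simp add: koszul1_frame coef_E if_distrib[of "\<lambda>x. x * _"] cong: if_cong)
  moreover have "koszul1 A D g q (D (E i) (E j) q) = 0"
    using par[OF oW order_refl E q] by (simp add: koszul1_frame[OF q] linear_0[OF coef_linear[OF q]])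
  ultimately show ?thesis unfolding koszul2_def cov_form_def by simp
qed

end

section \<open>Bump functions\<close>

text \<open>The polynomial parameter makes the family closed under differentiation. For the
  polynomial 1 it is the standard smooth function that is flat at the origin.\<close>

definition flat_exp :: "real poly \<Rightarrow> real \<Rightarrow> real"
  where "flat_exp p t = (if t > 0 then poly p (1 / t) * exp (- (1 / t)) else 0)"

lemma poly_exp_tendsto_0: "((\<lambda>y. poly p y * exp (- y)) \<longlongrightarrow> (0::real)) at_top"
proof -
  have "((\<lambda>y. \<Sum>i\<le>degree p. coeff p i * (y ^ i / exp y)) \<longlongrightarrow> (\<Sum>i\<le>degree p. coeff p i * 0)) at_top"
    by (intro tendsto_sum tendsto_mult tendsto_const tendsto_power_div_exp_0)
  then show ?thesis
    by (simp add: poly_altdef exp_minus divide_inverse sum_distrib_left sum_distrib_right mult_ac)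
qed

text \<open>For positive \<open>t\<close>, differentiation of p(1/t) exp(-1/t) produces (p -
  p')(1/t) / t^2 times the exponential, hence the factor \<open>[:0, 0, 1:]\<close>.\<close>

lemma flat_exp_has_derivative:
  "(flat_exp p has_real_derivative flat_exp ([:0, 0, 1:] * (p - pderiv p)) t) (at t)"
proof -
  consider "t > 0" | "t < 0" | "t = 0" by linarith
  then show ?thesis
  proof cases
    case 1
    have "((\<lambda>t. poly p (1 / t) * exp (- (1 / t))) has_real_derivative
        flat_exp ([:0, 0, 1:] * (p - pderiv p)) t) (at t)"
    proof -
      have i: "((\<lambda>t. 1 / t) has_real_derivative - 1 / t\<^sup>2) (at t)"
        using 1 by (auto intro!: derivative_eq_intros simp: power2_eq_square)
      have e: "((\<lambda>t. exp (- (1 / t))) has_real_derivative exp (- (1 / t)) * - (- 1 / t\<^sup>2)) (at t)"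
        by (rule DERIV_chain2[OF DERIV_exp DERIV_minus[OF i]])
      from DERIV_mult[OF DERIV_chain2[OF poly_DERIV[of p] i] e] show ?thesis
        by (rule DERIV_cong) (use 1 in \<open>simp add: flat_exp_def power2_eq_square algebra_simps\<close>)
    qed
    then show ?thesis
      by (rule has_field_derivative_transform_within_open[of _ _ _ "{0<..}"]) (use 1 in \<open>auto simp: flat_exp_def\<close>)
  next
    case 2
    have "((\<lambda>t. 0) has_real_derivative flat_exp ([:0, 0, 1:] * (p - pderiv p)) t) (at t)"
      using 2 by (simp add: flat_exp_def)
    then show ?thesis
      by (rule has_field_derivative_transform_within_open[of _ _ _ "{..<0}"]) (use 2 in \<open>auto simp: flat_exp_def\<close>)
  next
    case 3
    \<comment> \<open>The factor 1/h of the difference quotient is absorbed by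
      \<open>pCons 0 p\<close>, which multiplies the polynomial by its variable.\<close>
    have "((\<lambda>h. poly (pCons 0 p) (inverse h) * exp (- inverse h)) \<longlongrightarrow> 0) (at_right 0)"
      by (rule filterlim_compose[OF poly_exp_tendsto_0 filterlim_inverse_at_top_right])
    then have "((\<lambda>h. flat_exp p h / h) \<longlongrightarrow> 0) (at_right 0)"
      by (rule Lim_transform_eventually)
        (auto simp: eventually_at_filter flat_exp_def divide_inverse intro!: always_eventually)
    moreover have "((\<lambda>h. flat_exp p h / h) \<longlongrightarrow> 0) (at_left 0)"
      by (rule Lim_transform_eventually[OF tendsto_const])
        (auto simp: eventually_at_filter flat_exp_def intro!: always_eventually)
    ultimately have "((\<lambda>h. flat_exp p h / h) \<longlongrightarrow> 0) (at 0)" using filterlim_split_at by blast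
    then show ?thesis unfolding 3 DERIV_def by (simp add: flat_exp_def)
  qed
qed

lemma Ck_on_flat_exp:
  fixes u :: "real ^ 'n::finite \<Rightarrow> real"
  assumes "open S"
  shows "Ck_on k S u \<Longrightarrow> Ck_on k S (\<lambda>x. flat_exp p (u x))"
proof (induction k arbitrary: p)
  case 0
  have "isCont (flat_exp p) t" for t using flat_exp_has_derivative DERIV_isCont by blast
  then have "continuous_on UNIV (flat_exp p)" by (simp add: continuous_at_imp_continuous_on)
  with 0 show ?case by (auto intro: continuous_on_compose2)
next
  case (Suc k)
  let ?q = "[:0, 0, 1:] * (p - pderiv p)"
  show ?case
  proof (rule Ck_on_SucI[OF assms])
    show "((\<lambda>x. flat_exp p (u x)) has_derivative (\<lambda>h. flat_exp ?q (u x) * frechet_derivative u (at x) h)) (at x)"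
      if "x \<in> S" for x
      using has_derivative_compose[OF Ck_on_has_derivative[OF assms Suc.prems that]
          flat_exp_has_derivative[of p "u x", unfolded has_field_derivative_def]] .
    show "Ck_on k S (\<lambda>x. flat_exp ?q (u x) * frechet_derivative u (at x) (axis i 1))" for i
      unfolding partial_deriv_def[symmetric]
      using Suc.IH[OF Ck_on_Suc_D[OF Suc.prems], of ?q] Suc.prems
      by (intro Ck_on_bilinear[OF bounded_bilinear_mult] assms) auto
  qed
qed

lemma smooth_on_flat_exp:
  fixes u :: "real ^ 'n::finite \<Rightarrow> real"
  shows "open S \<Longrightarrow> smooth_on S u \<Longrightarrow> smooth_on S (\<lambda>x. flat_exp p (u x))"
  unfolding smooth_on_def using Ck_on_flat_exp by blast

context smooth_mfd
begin

lemma vfields_union: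
  assumes "\<And>q. q \<in> W \<Longrightarrow> \<exists>V. openin M V \<and> q \<in> V \<and> X \<in> vfields A V" "openin M W"
  shows "X \<in> vfields A W"
  unfolding vfields_def
proof (intro CollectI ballI)
  fix c assume c: "c \<in> A"
  let ?\<V> = "{snd c ` (fst c \<inter> (W \<inter> V)) | V. openin M V \<and> X \<in> vfields A V}"
  have "smooth_on (\<Union>?\<V>) (local_rep A c X)"
  proof (intro smooth_on_Union ballI)
    fix S assume "S \<in> ?\<V>"
    then obtain V where V: "S = snd c ` (fst c \<inter> (W \<inter> V))" "openin M V" "X \<in> vfields A V" by blast
    show "open S \<and> smooth_on S (local_rep A c X)"
      unfolding V(1) using open_chart_image[OF c openin_Int[OF assms(2) V(2)]]
        vfieldsD[OF vfields_subset[OF V(3)] c, of "W \<inter> V"] by blast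
  qed
  moreover have "\<Union>?\<V> = snd c ` (fst c \<inter> W)" using assms(1) by blast
  ultimately show "smooth_on (snd c ` (fst c \<inter> W)) (local_rep A c X)" by simp
qed

lemma chart_ball_closed:
  assumes c: "c \<in> A" and K: "compact K" "K \<subseteq> snd c ` fst c"
  shows "closedin M {q \<in> fst c. snd c q \<in> K}" "compactin M {q \<in> fst c. snd c q \<in> K}"
proof -
  have hom: "homeomorphic_map (subtopology M (fst c)) (top_of_set (snd c ` fst c)) (snd c)"
    using chart[OF c] by (simp add: is_chart_def)
  let ?K = "{q \<in> fst c. snd c q \<in> K}"
  have im: "snd c ` ?K = K" using K(2) by auto
  have sub: "?K \<subseteq> topspace (subtopology M (fst c))" using chart_subset[OF c] by auto
  have "compactin (top_of_set (snd c ` fst c)) (snd c ` ?K)"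
    unfolding im using K by (simp add: compactin_subtopology)
  then have "compactin (subtopology M (fst c)) ?K" using homeomorphic_map_compactness[OF hom sub] by blast
  then show "compactin M ?K" by (simp add: compactin_subtopology)
  then show "closedin M ?K" using mfd compactin_imp_closedin unfolding smooth_manifold_def by blast
qed

text \<open>The supports of the bump functions are closed in \<open>M\<close> because \<open>M\<close> is Hausdorff, so extending by zero
  is harmless.\<close>

definition bump :: "('a, 'n) chart \<Rightarrow> real ^ 'n \<Rightarrow> real \<Rightarrow> 'a \<Rightarrow> real"
  where "bump c x0 r q = (if q \<in> fst c then flat_exp 1 (r\<^sup>2 - (snd c q - x0) \<bullet> (snd c q - x0)) else 0)"

lemma bump_pos_iff: "0 < r \<Longrightarrow> bump c x0 r q > 0 \<longleftrightarrow> q \<in> fst c \<and> snd c q \<in> ball x0 r"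
  and bump_nonneg: "bump c x0 r q \<ge> 0"
  and bump_eq_0_iff: "0 < r \<Longrightarrow> bump c x0 r q = 0 \<longleftrightarrow> \<not> (q \<in> fst c \<and> snd c q \<in> ball x0 r)"
proof -
  have *: "0 < r \<Longrightarrow> (r\<^sup>2 - (snd c q - x0) \<bullet> (snd c q - x0) > 0) \<longleftrightarrow> snd c q \<in> ball x0 r"
    using abs_less_iff power2_less_imp_less[of "norm (snd c q - x0)" r] power_strict_mono[of "norm (snd c q - x0)" r 2]
    by (auto simp: power2_norm_eq_inner[symmetric] dist_norm norm_minus_commute)
  show "0 < r \<Longrightarrow> bump c x0 r q > 0 \<longleftrightarrow> q \<in> fst c \<and> snd c q \<in> ball x0 r"
    "bump c x0 r q \<ge> 0" "0 < r \<Longrightarrow> bump c x0 r q = 0 \<longleftrightarrow> \<not> (q \<in> fst c \<and> snd c q \<in> ball x0 r)"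
    using * by (auto simp: bump_def flat_exp_def)
qed

lemma bump_smooth:
  assumes c: "c \<in> A" and r: "0 < r" "cball x0 r \<subseteq> snd c ` fst c"
  shows "smooth_fun A (topspace M) (bump c x0 r)"
proof (rule smooth_fun_union)
  fix q assume q: "q \<in> topspace M"
  have o: "open (snd c ` fst c)" using open_chart_image_sub[OF c chart_openin[OF c]] by blast
  show "\<exists>V. openin M V \<and> q \<in> V \<and> smooth_fun A V (bump c x0 r)"
  proof (cases "q \<in> fst c")
    case True
    have "smooth_on (snd c ` fst c) (\<lambda>x. flat_exp 1 (r\<^sup>2 - (x - x0) \<bullet> (x - x0)))"
      unfolding inner_vec_def inner_real_def
      by (intro smooth_on_flat_exp smooth_on_diff smooth_on_const smooth_on_sum smooth_on_mult o
          smooth_on_vec_iff[OF o, THEN iffD1, rule_format] smooth_on_ident)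
    then have "smooth_on (snd c ` fst c) (bump c x0 r \<circ> chart_inv c)"
      by (rule smooth_on_cong[OF o]) (auto simp: bump_def chart_inv_right c)
    then show ?thesis using smooth_fun_chart[OF c chart_openin[OF c]] True chart_openin[OF c] by blast
  next
    case False
    let ?V = "topspace M - {q \<in> fst c. snd c q \<in> cball x0 r}"
    have V: "openin M ?V" using chart_ball_closed(1)[OF c compact_cball r(2)] by blast
    have "smooth_fun A ?V (bump c x0 r)"
    proof (rule smooth_fun_cong[OF V smooth_fun_const[OF V, of 0]])
      fix s assume "s \<in> ?V"
      then have "\<not> (s \<in> fst c \<and> snd c s \<in> ball x0 r)" by auto
      then show "0 = bump c x0 r s" using bump_eq_0_iff[OF r(1)] by auto
    qed
    then show ?thesis using V q False by blast
  qed
qed auto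

text \<open>Turns a field known near a point into a global one. At points outside \<open>W\<close>
  the product is zero on the complement of the coordinate ball, which is open, so smoothness can be
  checked locally in both regions.\<close>

lemma bump_field:
  assumes c: "c \<in> A" and W: "openin M W" "W \<subseteq> fst c" and r: "0 < r" "cball x0 r \<subseteq> snd c ` W" and X: "X \<in> vfields A W"
  shows "(\<lambda>q. bump c x0 r q *\<^sub>R X q) \<in> vfields A (topspace M)"
proof (rule vfields_union)
  have r': "cball x0 r \<subseteq> snd c ` fst c" using r W by blast
  fix q assume q: "q \<in> topspace M"
  show "\<exists>V. openin M V \<and> q \<in> V \<and> (\<lambda>q. bump c x0 r q *\<^sub>R X q) \<in> vfields A V"
  proof (cases "q \<in> W")
    case True
    then show ?thesis
      using vfields_scaleR[OF W(1) smooth_fun_subset[OF bump_smooth[OF c r(1) r']] X] W(1) openin_subset by blast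
  next
    case False
    let ?K = "{q \<in> fst c. snd c q \<in> cball x0 r}"
    let ?V = "topspace M - ?K"
    have V: "openin M ?V" using chart_ball_closed(1)[OF c compact_cball r'] by blast
    have "?K \<subseteq> W"
    proof
      fix s assume s: "s \<in> ?K"
      then obtain s' where "s' \<in> W" "snd c s = snd c s'" using r by blast
      then show "s \<in> W" using s W inj_onD[OF chart_inj[OF c]] by (metis (mono_tags, lifting) mem_Collect_eq subsetD)
    qed
    then have "q \<in> ?V" using q False by blast
    moreover have "(\<lambda>q. bump c x0 r q *\<^sub>R X q) \<in> vfields A ?V"
    proof (rule vfields_cong[OF V vfields_zero[OF V]])
      fix s assume "s \<in> ?V"
      then have "\<not> (s \<in> fst c \<and> snd c s \<in> ball x0 r)" by auto
      then show "0 = bump c x0 r s *\<^sub>R X s" using bump_eq_0_iff[OF r(1)] by auto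
    qed
    ultimately show ?thesis using V by blast
  qed
qed auto

end

section \<open>Hessian manifolds\<close>

text \<open>\<open>pot\<close> is the Hessian condition in the parallel frame and has the same form
  as in affine coordinates.\<close>

locale hess_frame = metric_frame M A D c W E g
  for M :: "'a topology" and A :: "('a, 'n::finite) chart set" and D c W E g +
  fixes \<phi> :: "'a \<Rightarrow> real"
  assumes phi_smooth: "smooth_fun A W \<phi>"
    and pot: "\<And>i j q. q \<in> W \<Longrightarrow> G i j q = d i (d j \<phi>) q"

locale hessian_mfd =
  fixes M :: "'a topology" and A :: "('a, 'n::finite) chart set" and D and g :: "('a, 'n) metric"
  assumes hess: "hessian_manifold M A D g"

sublocale hessian_mfd \<subseteq> flat_mfd M A D
  using hess by unfold_locales (auto simp: hessian_manifold_def)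

context hessian_mfd
begin

text \<open>The definition of a Hessian manifold relates metric and potential through fields that
  are smooth on the whole domain \<open>W0\<close> of the potential, whereas the frame lives on a
  smaller set. At each point \<open>q\<close> the frame is therefore cut off by a bump function,
  which is divided out in the end.\<close>

lemma hess_frame_exists:
  assumes c: "c \<in> A" and p: "p \<in> fst c"
    and u: "\<And>i j. g p (u i) (u j) = (if i = j then 1 else 0)"
  shows "\<exists>W E \<phi>. hess_frame M A D c W E g \<phi> \<and> p \<in> W \<and> (\<forall>i. E i p = u i)"
proof -
  have pM: "p \<in> topspace M" using chart_subset[OF c p] .
  have riem: "riemannian_metric M A g" using hess by (simp add: hessian_manifold_def)
  from hess[unfolded hessian_manifold_def, THEN conjunct2, THEN conjunct2, THEN conjunct2, THEN bspec, OF pM]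
  obtain W0 \<phi> where W0: "openin M W0" "p \<in> W0" and phi: "smooth_fun A W0 \<phi>"
    and pot0: "\<forall>X\<in>vfields A W0. \<forall>Y\<in>vfields A W0. \<forall>q\<in>W0. g q (X q) (Y q) = cov_form A D (differential A \<phi>) X Y q"
    by (elim exE conjE)
  note pot = pot0[THEN bspec, THEN bspec, THEN bspec]
  have bil: "bilinear (g p)" using riem pM unfolding riemannian_metric_def by blast
  have "det (\<chi> k i. components A c p (u i) $ k) = det (matrix (components A c p)) * det (\<chi> i j. u j $ i)"
    by (rule det_linear_image[OF components_linear[OF c p]])
  moreover have "det (matrix (components A c p)) \<noteq> 0"
  proof -
    have "matrix (tangent_vec A c p) ** matrix (components A c p) = mat 1"
    proof -
      have "matrix (tangent_vec A c p \<circ> components A c p) = matrix (tangent_vec A c p) ** matrix (components A c p)"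
        by (rule matrix_compose[OF components_linear[OF c p] tangent_vec_linear[OF c p]])
      moreover have "tangent_vec A c p \<circ> components A c p = id" using tangent_vec_components[OF c p] by auto
      ultimately show ?thesis by (metis matrix_id_mat_1)
    qed
    then have "det (matrix (tangent_vec A c p)) * det (matrix (components A c p)) = 1" by (metis det_I det_mul)
    then show ?thesis by auto
  qed
  ultimately have "det (\<chi> k i. components A c p (u i) $ k) \<noteq> 0" using orthonormal_det_nonzero[OF bil u] by simp
  then obtain W E where fr: "par_frame M A D c W E" and W: "p \<in> W" "W \<subseteq> W0" and Ep: "\<And>i. E i p = u i"
    using par_frame_exists[OF c p W0(2,1)] by blast
  interpret par_frame M A D c W E using fr .
  interpret metric_frame M A D c W E g by unfold_locales (rule riem)
  have phiW: "smooth_fun A W \<phi>" using smooth_fun_subset[OF phi W(2)] .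
  have "hess_frame M A D c W E g \<phi>"
  proof (unfold_locales, rule phiW)
    fix i j q assume q: "q \<in> W"
    have qc: "q \<in> fst c" using q Wc by blast
    have oW': "open (snd c ` W)" using open_chart_image_sub[OF cA oW Wc] .
    obtain r where r: "0 < r" "cball (snd c q) r \<subseteq> snd c ` W"
      using oW' q open_contains_cball by (metis imageI)
    define \<eta> where "\<eta> = bump c (snd c q) r"
    have eta: "\<eta> q > 0" unfolding \<eta>_def using bump_pos_iff[OF r(1)] qc r by auto
    have e0: "smooth_fun A (topspace M) \<eta>" unfolding \<eta>_def by (rule bump_smooth[OF cA r(1)]) (use r Wc in blast)
    have es: "smooth_fun A W \<eta>" using smooth_fun_subset[OF e0] openin_subset[OF oW] by blast
    define X where "X i s = \<eta> s *\<^sub>R E i s" for i s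
    have X0: "X i \<in> vfields A W0" for i unfolding X_def \<eta>_def
      using vfields_subset[OF bump_field[OF cA oW Wc r E]] openin_subset[OF W0(1)] by blast
    have X: "X i \<in> vfields A W" for i using vfields_subset[OF X0 W(2)] .
    have lin: "linear (differential A \<phi> s)" if "s \<in> W" for s using differential_linear[OF oW phiW that] .
    have "g q (X i q) (X j q) = cov_form A D (differential A \<phi>) (X i) (X j) q"
      by (rule pot[OF X0 X0]) (use q W in blast)
    also have "\<dots> = differential A (\<lambda>s. \<eta> s * d j \<phi> s) q (X i q) - differential A \<phi> q (D (X i) (X j) q)"
    proof -
      have "differential A (\<lambda>s. differential A \<phi> s (X j s)) q (X i q) = differential A (\<lambda>s. \<eta> s * d j \<phi> s) q (X i q)"
        by (rule differential_cong[OF oW q]) (simp add: X_def linear_cmul[OF lin] d_def)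
      then show ?thesis by (simp add: cov_form_def)
    qed
    \<comment> \<open>The derivative of the bump function occurs in both terms of
      \<open>cov_form\<close> and cancels; what remains on either side is a factor
      \<open>\<eta> q\<close> squared.\<close>
    also have "D (X i) (X j) q = differential A \<eta> q (X i q) *\<^sub>R E j q"
      using D_scaleR_right[OF oW X E es q] par[OF oW order_refl X q] by (simp add: X_def[abs_def])
    also have "differential A (\<lambda>s. \<eta> s * d j \<phi> s) q (X i q) - differential A \<phi> q (differential A \<eta> q (X i q) *\<^sub>R E j q)
        = \<eta> q * differential A (d j \<phi>) q (X i q)"
      unfolding differential_mult[OF oW q es d_smooth[OF phiW]] linear_cmul[OF lin[OF q]] by (simp add: d_def)
    also have "differential A (d j \<phi>) q (X i q) = \<eta> q * d i (d j \<phi>) q"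
      by (simp add: X_def linear_cmul[OF differential_linear[OF oW d_smooth[OF phiW] q]] d_def)
    finally have "\<eta> q * (\<eta> q * G i j q) = \<eta> q * (\<eta> q * d i (d j \<phi>) q)"
    proof -
      assume *: "g q (X i q) (X j q) = \<eta> q * (\<eta> q * d i (d j \<phi>) q)"
      have l: "linear (\<lambda>x. g q x y)" "linear (g q x)" for x y using g_bilinear[OF W_top[OF q]] unfolding bilinear_def by blast+
      show ?thesis using * by (simp add: X_def G_def linear_cmul[OF l(1)] linear_cmul[OF l(2)])
    qed
    then show "G i j q = d i (d j \<phi>) q" using eta by simp
  qed
  then show ?thesis using W(1) Ep by blast
qed

end

section \<open>The maximum principle for the cubic form\<close>

context par_frame
begin

text \<open>At a minimum the first derivatives vanish, so the derivative of the field
  \<open>E k\<close> does not contribute, and \<open>d k (d k f) p\<close> is the second derivative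
  of \<open>f\<close> along the straight line in the chart with direction
  \<open>E k p\<close>.\<close>

lemma second_derivative_test:
  assumes f: "smooth_fun A W f" and p: "p \<in> W" and min: "\<And>q. q \<in> W \<Longrightarrow> f p \<le> f q"
  shows "d k f p = 0" "d k (d k f) p \<ge> 0"
proof -
  define S where "S = snd c ` W"
  define F where "F = f \<circ> chart_inv c"
  define e where "e = local_rep A c (E k)"
  define x where "x = snd c p"
  define v where "v = e x"
  have pc: "p \<in> fst c" using p Wc by blast
  have o: "open S" unfolding S_def using open_chart_image_sub[OF cA oW Wc] .
  have xS: "x \<in> S" using p by (simp add: x_def S_def)
  have F: "smooth_on S F" unfolding F_def S_def using smooth_funD[OF f cA] Wc by (simp add: Int_absorb1)
  have e: "smooth_on S e" unfolding e_def S_def using vfieldsD[OF E cA] Wc by (simp add: Int_absorb1)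
  have dF: "(F has_derivative frechet_derivative F (at y)) (at y)" if "y \<in> S" for y
    using smooth_on_has_derivative[OF o F that] .
  have Fmin: "F x \<le> F y" if "y \<in> S" for y
    using that min p Wc cA by (auto simp: F_def S_def x_def subset_iff)
  obtain r where r: "r > 0" "ball x r \<subseteq> S" using o xS open_contains_ball by blast
  have DF0: "frechet_derivative F (at x) = (\<lambda>h. 0)"
    by (rule differential_zero_maxmin[OF xS o dF[OF xS]]) (use Fmin in blast)
  have p0: "partial_deriv i F x = 0" for i by (simp add: partial_deriv_def DF0)
  have dk: "d k f q = (\<Sum>i\<in>UNIV. e (snd c q) $ i *\<^sub>R partial_deriv i F (snd c q))" if q: "q \<in> W" for q
  proof -
    have qc: "q \<in> fst c" using q Wc by blast
    have "d k f q = frechet_derivative F (at (snd c q)) (e (snd c q))"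
      using differential_chart[OF cA qc oW q f] local_rep_chart[OF cA qc] by (simp add: d_def F_def e_def)
    then show ?thesis using has_derivative_partial_deriv[OF dF] q by (simp add: S_def)
  qed
  show "d k f p = 0" using dk[OF p] p0 by (simp add: x_def)
  have dp: "(partial_deriv i F has_derivative frechet_derivative (partial_deriv i F) (at x)) (at x)" for i
    using smooth_on_has_derivative[OF o smooth_on_partial_deriv[OF o F] xS] .
  have de: "((\<lambda>y. e y $ i) has_derivative (\<lambda>h. frechet_derivative e (at x) h $ i)) (at x)" for i
    using bounded_linear.has_derivative[OF bounded_linear_vec_nth smooth_on_has_derivative[OF o e xS]] .
  have "((\<lambda>y. \<Sum>i\<in>UNIV. e y $ i *\<^sub>R partial_deriv i F y) has_derivative
      (\<lambda>h. \<Sum>i\<in>UNIV. e x $ i *\<^sub>R frechet_derivative (partial_deriv i F) (at x) h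
        + frechet_derivative e (at x) h $ i *\<^sub>R partial_deriv i F x)) (at (snd c p))"
    unfolding x_def[symmetric] by (intro has_derivative_sum has_derivative_scaleR dp de)
  from differential_in_chart[OF cA pc oW p this, of "d k f" "E k p"]
  have dd: "d k (d k f) p = (\<Sum>i\<in>UNIV. v $ i * frechet_derivative (partial_deriv i F) (at x) v)"
    using dk p0 local_rep_chart[OF cA pc, of "E k"] by (simp add: d_def[of k "d k f"] v_def e_def x_def)
  show "d k (d k f) p \<ge> 0"
  proof (rule ccontr)
    assume neg: "\<not> d k (d k f) p \<ge> 0"
    define u' where "u' t = (\<Sum>i\<in>UNIV. v $ i * partial_deriv i F (x + t *\<^sub>R v))" for t
    have line: "((\<lambda>t. x + t *\<^sub>R v) has_derivative (\<lambda>h. h *\<^sub>R v)) (at t)" for t by (auto intro!: derivative_eq_intros)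
    have dp': "(partial_deriv i F has_derivative frechet_derivative (partial_deriv i F) (at x)) (at (x + 0 *\<^sub>R v))" for i
      using dp by simp
    have lp: "frechet_derivative (partial_deriv i F) (at x) (h *\<^sub>R v) = h * frechet_derivative (partial_deriv i F) (at x) v" for i h
      using linear_cmul[OF has_derivative_linear[OF dp]] by simp
    have "(u' has_derivative (\<lambda>h. \<Sum>i\<in>UNIV. v $ i * frechet_derivative (partial_deriv i F) (at x) (h *\<^sub>R v))) (at 0)"
      unfolding u'_def by (intro has_derivative_sum has_derivative_mult_right has_derivative_compose[OF line dp'])
    moreover have "(\<lambda>h. \<Sum>i\<in>UNIV. v $ i * frechet_derivative (partial_deriv i F) (at x) (h *\<^sub>R v)) = (*) (d k (d k f) p)"
      by (simp add: fun_eq_iff lp dd sum_distrib_left mult_ac)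
    ultimately have u'd: "(u' has_real_derivative d k (d k f) p) (at 0)" by (simp add: has_field_derivative_def)
    have u'0: "u' 0 = 0" by (simp add: u'_def p0)
    obtain \<delta> where \<delta>: "\<delta> > 0" "\<And>h. 0 < h \<Longrightarrow> h < \<delta> \<Longrightarrow> u' h < 0"
      using DERIV_neg_dec_right[OF u'd] neg u'0 by auto
    \<comment> \<open>Small enough for two purposes: \<open>u'\<close> is negative on the interval,
      and the segment from \<open>x\<close> in direction \<open>v\<close> stays in the ball of
      radius \<open>r\<close>. The summand 1 avoids a division by zero.\<close>
    define \<epsilon> where "\<epsilon> = min (\<delta> / 2) (r / (2 * (norm v + 1)))"
    have nv: "0 \<le> norm v" by simp
    then have "0 < norm v + 1" by linarith
    then have "0 < r / (2 * (norm v + 1))" using r(1) by simp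
    then have e: "0 < \<epsilon>" using \<delta> by (simp add: \<epsilon>_def)
    have "\<epsilon> \<le> \<delta> / 2" unfolding \<epsilon>_def by (rule min.cobounded1)
    then have e: "0 < \<epsilon>" "\<epsilon> < \<delta>" using e \<delta>(1) by auto
    have "\<epsilon> * (norm v + 1) \<le> (r / (2 * (norm v + 1))) * (norm v + 1)"
      by (rule mult_right_mono) (auto simp: \<epsilon>_def)
    also have "\<dots> = r / 2"
    proof -
      have "r / (2 * n) * n = r / 2" if "n \<noteq> 0" for n :: real using that by simp
      then show ?thesis using \<open>0 < norm v + 1\<close> by (metis less_irrefl)
    qed
    finally have ev: "\<epsilon> * norm v < r" using r e(1) by (simp add: distrib_left)
    have inS: "x + t *\<^sub>R v \<in> S" if "0 \<le> t" "t \<le> \<epsilon>" for t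
    proof -
      have "t * norm v \<le> \<epsilon> * norm v" using that by (intro mult_right_mono) auto
      then have "x + t *\<^sub>R v \<in> ball x r" using that ev by (simp add: dist_norm)
      then show ?thesis using r by blast
    qed
    have ud: "((\<lambda>t. F (x + t *\<^sub>R v)) has_real_derivative u' t) (at t)" if t: "0 \<le> t" "t \<le> \<epsilon>" for t
    proof -
      note D = dF[OF inS[OF t]]
      have "frechet_derivative F (at (x + t *\<^sub>R v)) (h *\<^sub>R v) = h * u' t" for h
        using linear_cmul[OF has_derivative_linear[OF D]] has_derivative_partial_deriv[OF D, of v] by (simp add: u'_def)
      then have "(\<lambda>h. frechet_derivative F (at (x + t *\<^sub>R v)) (h *\<^sub>R v)) = (*) (u' t)" by (simp add: fun_eq_iff)
      then show ?thesis using has_derivative_compose[OF line D] by (simp add: has_field_derivative_def)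
    qed
    obtain z where z: "0 < z" "z < \<epsilon>" "F (x + \<epsilon> *\<^sub>R v) - F (x + 0 *\<^sub>R v) = (\<epsilon> - 0) * u' z"
      using MVT2[OF e(1) ud] by auto
    have "u' z < 0" using \<delta>(2)[of z] z e by simp
    then have "F (x + \<epsilon> *\<^sub>R v) < F x" using z(3) e(1) mult_pos_neg[of \<epsilon> "u' z"] by simp
    then show False using Fmin[OF inS[of \<epsilon>]] e by simp
  qed
qed

text \<open>A coordinate function, scaled to have derivative 1 along \<open>E k\<close> at
  \<open>p\<close>, need not have second derivative 0, because \<open>E k\<close> is not a
  coordinate field of the chart. Subtracting a multiple of its square corrects this and leaves the
  first derivative unchanged.\<close>

lemma probe_exists:
  assumes p: "p \<in> W"
  shows "\<exists>s. smooth_fun A W s \<and> s p = 0 \<and> d k s p = 1 \<and> d k (d k s) p = 0"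
proof -
  have pc: "p \<in> fst c" using p Wc by blast
  have "E k p \<noteq> 0" using coef_E[OF p, of k k] linear_0 coef_sum[OF p, of k "\<lambda>_. 0"] by auto
  then have "components A c p (E k p) \<noteq> 0" using components_eq_0_iff[OF cA pc] by blast
  then obtain l where l: "components A c p (E k p) $ l \<noteq> 0" by (auto simp: vec_eq_iff)
  define m where "m = components A c p (E k p) $ l"
  define s1 where "s1 q = (snd c q $ l - snd c p $ l) / m" for q
  have o: "open (snd c ` W)" using open_chart_image_sub[OF cA oW Wc] .
  have s1: "smooth_fun A W s1"
  proof (rule smooth_fun_chart[OF cA oW Wc])
    have "smooth_on (snd c ` W) (\<lambda>x. (x $ l - snd c p $ l) * (1 / m))"
      by (intro smooth_on_mult smooth_on_diff smooth_on_const o smooth_on_vec_iff[OF o, THEN iffD1, rule_format] smooth_on_ident)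
    then show "smooth_on (snd c ` W) (s1 \<circ> chart_inv c)"
      by (rule smooth_on_cong[OF o]) (use Wc cA in \<open>auto simp: s1_def subset_iff\<close>)
  qed
  have "((\<lambda>x. (x $ l - snd c p $ l) / m) has_derivative (\<lambda>h. (h $ l - 0) / m)) (at (snd c p))"
    by (intro bounded_linear.has_derivative[OF bounded_linear_divide] has_derivative_diff has_derivative_const
        bounded_linear.has_derivative[OF bounded_linear_vec_nth has_derivative_ident])
  from differential_in_chart[OF cA pc oW p this, of s1 "E k p"]
  have d1: "d k s1 p = 1" using l by (simp add: d_def s1_def m_def)
  \<comment> \<open>The coefficient of the correction: the leading part of the second derivative of
    the square of \<open>s1\<close> at \<open>p\<close> is 2, as \<open>s1\<close> vanishes there
    with derivative 1.\<close>
  define \<sigma> where "\<sigma> = d k (d k s1) p / 2"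
  define s where "s q = s1 q - \<sigma> * (s1 q * s1 q)" for q
  have ss: "smooth_fun A W (\<lambda>q. s1 q * s1 q)" using smooth_fun_mult[OF oW s1 s1] .
  have sss: "smooth_fun A W (\<lambda>q. \<sigma> * (s1 q * s1 q))" using smooth_fun_mult[OF oW smooth_fun_const[OF oW] ss] .
  have s: "smooth_fun A W s" unfolding s_def using smooth_fun_diff[OF oW s1 sss] .
  have ds: "d k s q = d k s1 q - (2 * \<sigma>) * (s1 q * d k s1 q)" if "q \<in> W" for q
    unfolding s_def[abs_def] using that s1 ss sss
    by (simp add: d_diff d_mult smooth_fun_const[OF oW])
  have sd: "smooth_fun A W (\<lambda>q. s1 q * d k s1 q)" using smooth_fun_mult[OF oW s1 d_smooth[OF s1]] .
  have "d k (d k s) p = d k (\<lambda>q. d k s1 q - (2 * \<sigma>) * (s1 q * d k s1 q)) p"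
    by (rule d_cong[OF p ds])
  also have "\<dots> = d k (d k s1) p - (2 * \<sigma>) * (s1 p * d k (d k s1) p + d k s1 p * d k s1 p)"
    using p s1 sd smooth_fun_mult[OF oW smooth_fun_const[OF oW] sd]
    by (simp add: d_diff d_mult smooth_fun_const[OF oW] d_smooth)
  finally have "d k (d k s) p = 0" by (simp add: d1 \<sigma>_def s1_def)
  moreover have "s p = 0" by (simp add: s_def s1_def)
  moreover have "d k s p = 1" using ds[OF p] d1 by (simp add: s1_def)
  ultimately show ?thesis using s by blast
qed

lemma dd_const [simp]: "q \<in> W \<Longrightarrow> d k (d k (\<lambda>q. a)) q = 0"
  using d_cong[of q "d k (\<lambda>q. a)" "\<lambda>q. 0"] by simp

lemma dd_add:
  assumes "q \<in> W" "smooth_fun A W f" "smooth_fun A W h"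
  shows "d k (d k (\<lambda>q. f q + h q)) q = d k (d k f) q + d k (d k h) q"
  using d_cong[OF assms(1), of "d k (\<lambda>q. f q + h q)" "\<lambda>q. d k f q + d k h q"] assms
  by (simp add: d_add d_smooth)

lemma dd_mult:
  assumes "q \<in> W" "smooth_fun A W f" "smooth_fun A W h"
  shows "d k (d k (\<lambda>q. f q * h q)) q = f q * d k (d k h) q + 2 * (d k f q * d k h q) + d k (d k f) q * h q"
  using d_cong[OF assms(1), of "d k (\<lambda>q. f q * h q)" "\<lambda>q. f q * d k h q + d k f q * h q"] assms
  by (simp add: d_add d_mult d_smooth smooth_fun_mult[OF oW])

lemma dd_sum:
  assumes "q \<in> W" "\<And>i. i \<in> I \<Longrightarrow> smooth_fun A W (f i)"
  shows "d k (d k (\<lambda>q. \<Sum>i\<in>I. f i q)) q = (\<Sum>i\<in>I. d k (d k (f i)) q)"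
  using d_cong[OF assms(1), of "d k (\<lambda>q. \<Sum>i\<in>I. f i q)" "\<lambda>q. \<Sum>i\<in>I. d k (f i) q"] assms
  by (simp add: d_sum d_smooth)

text \<open>The second-order condition along a field \<open>E + s w\<close>, whose square length is \<open>q\<^sub>0 + s q\<^sub>1 + s\<^sup>2 q\<^sub>2\<close> and whose
  cubic form is \<open>t\<^sub>0 + \<dots> + s\<^sup>3 t\<^sub>3\<close>. The bound \<open>m x\<^bsup>3/2\<^esup>\<close> is replaced by \<open>m (x + x\<^sup>2) / 2\<close>, which agrees with it to
  first order at \<open>x = 1\<close>.\<close>

lemma polynomial_test:
  assumes p: "p \<in> W" and s: "smooth_fun A W s" "s p = 0" "d k s p = 1" "d k (d k s) p = 0"
    and sm: "smooth_fun A W q0" "smooth_fun A W q1" "smooth_fun A W q2"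
      "smooth_fun A W t0" "smooth_fun A W t1" "smooth_fun A W t2" "smooth_fun A W t3"
    and ge: "\<And>q x. q \<in> W \<Longrightarrow> x = q0 q + s q * (q1 q + s q * q2 q) \<Longrightarrow>
      t0 q + s q * (t1 q + s q * (t2 q + s q * t3 q)) \<le> (m / 2) * (x + x * x)"
    and p0: "q0 p = 1" "t0 p = m" "d k q0 p + q1 p = 0"
  shows "d k (d k t0) p + 2 * d k t1 p + 2 * t2 p \<le> (3 * m / 2) * (d k (d k q0) p + 2 * d k q1 p + 2 * q2 p)"
proof -
  note sms = smooth_fun_add[OF oW] smooth_fun_mult[OF oW] smooth_fun_const[OF oW] s(1) sm d_smooth
  define x where "x q = q0 q + s q * (q1 q + s q * q2 q)" for q
  define y where "y q = t0 q + s q * (t1 q + s q * (t2 q + s q * t3 q))" for q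
  have x: "smooth_fun A W x" unfolding x_def by (intro sms)
  have y: "smooth_fun A W y" unfolding y_def by (intro sms)
  have dx: "x p = 1" "d k x p = 0"
    "d k (d k x) p = d k (d k q0) p + 2 * d k q1 p + 2 * q2 p"
    using p0 s p sm unfolding x_def
    by (simp_all add: dd_add dd_mult d_add d_mult sms)
  have dy: "d k (d k y) p = d k (d k t0) p + 2 * d k t1 p + 2 * t2 p"
    using p0 s p sm unfolding y_def by (simp add: dd_add dd_mult d_add d_mult sms)
  \<comment> \<open>\<open>f\<close> is the difference of the two sides of \<open>ge\<close>:
    nonnegative, and zero at \<open>p\<close>. As \<open>x\<close> has value 1 and derivative 0 at
    \<open>p\<close>, the second derivative of \<open>x + x * x\<close> is three times that of
    \<open>x\<close>; this is the origin of the constant \<open>3 * m / 2\<close>.\<close>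
  define a b where "a = m / 2" and "b = (-1 :: real)"
  define f where "f q = a * (x q + x q * x q) + b * y q" for q
  have f: "smooth_fun A W f" unfolding f_def by (intro sms x y)
  have "f p = 0" using p0 s dx by (simp add: f_def y_def a_def b_def)
  moreover have "0 \<le> f q" if "q \<in> W" for q using ge[OF that x_def] by (simp add: f_def y_def a_def b_def)
  ultimately have "d k (d k f) p \<ge> 0" using second_derivative_test(2)[OF f p] by simp
  moreover have "d k (d k f) p = a * (3 * d k (d k x) p) + b * d k (d k y) p"
    unfolding f_def using p x y dx(1,2) by (simp add: dd_add dd_mult d_add d_mult sms)
  ultimately have "d k (d k y) p \<le> (3 * m / 2) * d k (d k x) p" by (simp add: a_def b_def mult_ac)
  then show ?thesis unfolding dx dy .
qed

end

text \<open>For \<open>a\<close>, divide by \<open>t\<close> and let it tend to 0 from both sides;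
  for \<open>b\<close>, divide once more and approach 0 from the right.\<close>

lemma polynomial_nonneg_coeffs:
  fixes a b c e :: real
  assumes "\<And>t. 0 \<le> t * (a + t * (b + t * (c + t * e)))"
  shows "a = 0" "b \<ge> 0"
proof -
  have lim: "((\<lambda>t. x + t * (y + t * (z + t * w))) \<longlongrightarrow> x + 0 * (y + 0 * (z + 0 * w))) (at_right 0)"
    "((\<lambda>t. x + t * (y + t * (z + t * w))) \<longlongrightarrow> x + 0 * (y + 0 * (z + 0 * w))) (at_left 0)" for x y z w :: real
    by (intro tendsto_intros)+
  have pos: "0 \<le> a + t * (b + t * (c + t * e))" if "t > 0" for t
    using assms[of t] that by (simp add: zero_le_mult_iff)
  have neg: "a + t * (b + t * (c + t * e)) \<le> 0" if "t < 0" for t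
    using assms[of t] that by (simp add: zero_le_mult_iff)
  have "a \<ge> 0"
    using tendsto_lowerbound[OF lim(1)[of a b c e], of 0] pos
    by (auto simp: eventually_at_filter intro!: always_eventually)
  moreover have "a \<le> 0"
    using tendsto_upperbound[OF lim(2)[of a b c e], of 0] neg
    by (auto simp: eventually_at_filter intro!: always_eventually)
  ultimately show a: "a = 0" by simp
  have "0 \<le> b + t * (c + t * e)" if "t > 0" for t
    using pos[OF that] that a by (simp add: zero_le_mult_iff)
  then show "b \<ge> 0"
    using tendsto_lowerbound[OF lim(1)[of b c e 0], of 0]
    by (auto simp: eventually_at_filter intro!: always_eventually)
qed

section \<open>Calabi's argument in a parallel frame\<close>

context hess_frame
begin

text \<open>Third derivatives of the potential are symmetric in all indices. With
  \<open>d_G_sym\<close> this is the total symmetry of D g, the Codazzi equation of Hessian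
  geometry.\<close>

lemma d_G_swap: "q \<in> W \<Longrightarrow> d i (G j k) q = d j (G i k) q"
proof -
  assume q: "q \<in> W"
  have "d i (G j k) q = d i (d j (d k \<phi>)) q" by (rule d_cong[OF q pot])
  also have "\<dots> = d j (d i (d k \<phi>)) q" by (rule d_commute[OF q d_smooth[OF phi_smooth]])
  also have "\<dots> = d j (G i k) q" by (rule d_cong[OF q pot[symmetric]])
  finally show ?thesis .
qed

lemma d_G_sym: "q \<in> W \<Longrightarrow> d i (G j k) q = d i (G k j) q"
  by (rule d_cong) (auto simp: G_sym)

text \<open>The form \<open>(D\<^sub>v g)(v, v)\<close> for \<open>v = \<Sum> a\<^sub>i E\<^sub>i\<close>.\<close>

definition cubic :: "('n \<Rightarrow> real) \<Rightarrow> 'a \<Rightarrow> real"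
  where "cubic a q = (\<Sum>i\<in>UNIV. a i * (\<Sum>j\<in>UNIV. a j * (\<Sum>k\<in>UNIV. a k * d i (G j k) q)))"

definition square :: "('n \<Rightarrow> real) \<Rightarrow> 'a \<Rightarrow> real"
  where "square a q = (\<Sum>i\<in>UNIV. a i * (\<Sum>j\<in>UNIV. a j * G i j q))"

text \<open>Total symmetry of D g merges the mixed terms, which leaves the binomial coefficients of
  a cube and of a square.\<close>

lemma cubic_shift:
  assumes q: "q \<in> W"
  shows "cubic (\<lambda>i. (if i = z then 1 else 0) + s * w i) q =
    d z (G z z) q + s * (3 * (\<Sum>i\<in>UNIV. w i * d z (G z i) q)
      + s * (3 * (\<Sum>i\<in>UNIV. \<Sum>j\<in>UNIV. w i * w j * d z (G i j) q) + s * cubic w q))"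
    and "square (\<lambda>i. (if i = z then 1 else 0) + s * w i) q =
    G z z q + s * (2 * (\<Sum>i\<in>UNIV. w i * G z i q) + s * square w q)"
proof -
  have sh: "(\<Sum>i\<in>UNIV. ((if i = z then 1 else 0) + s * w i) * x i) = x z + s * (\<Sum>i\<in>UNIV. w i * x i)" for x :: "'n \<Rightarrow> real"
    by (simp add: distrib_right sum.distrib sum_distrib_left mult.assoc if_distrib[of "\<lambda>y. y * _"] cong: if_cong)
  define R where "R i j = d z (G i j) q" for i j
  have Rs: "R i j = R j i" for i j unfolding R_def by (rule d_G_sym[OF q])
  have 1: "d i (G z j) q = R i j" "d i (G j z) q = R i j" "d z (G i j) q = R i j" for i j
    unfolding R_def using d_G_swap[OF q, of i z j] d_G_sym[OF q, of i j z] by simp_all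
  have a: "(\<Sum>i\<in>UNIV. w i * R i z) = (\<Sum>i\<in>UNIV. w i * R z i)" using Rs by metis
  have b: "(\<Sum>i\<in>UNIV. \<Sum>j\<in>UNIV. w i * w j * R i j) = (\<Sum>i\<in>UNIV. w i * (\<Sum>j\<in>UNIV. w j * R i j))"
    by (simp add: sum_distrib_left mult.assoc)
  have pull: "(\<Sum>i\<in>UNIV. w i * (s * f i)) = s * (\<Sum>i\<in>UNIV. w i * f i)"
    "(\<Sum>i\<in>UNIV. w i * (2 * (s * f i))) = 2 * (s * (\<Sum>i\<in>UNIV. w i * f i))" for f :: "'n \<Rightarrow> real"
    by (simp_all add: sum_distrib_left mult_ac)
  show "cubic (\<lambda>i. (if i = z then 1 else 0) + s * w i) q =
    d z (G z z) q + s * (3 * (\<Sum>i\<in>UNIV. w i * d z (G z i) q)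
      + s * (3 * (\<Sum>i\<in>UNIV. \<Sum>j\<in>UNIV. w i * w j * d z (G i j) q) + s * cubic w q))"
    unfolding cubic_def sh by (simp add: 1 a b distrib_left sum.distrib pull)
  have "(\<Sum>i\<in>UNIV. w i * G i z q) = (\<Sum>i\<in>UNIV. w i * G z i q)" using G_sym[OF q] by metis
  then show "square (\<lambda>i. (if i = z then 1 else 0) + s * w i) q =
    G z z q + s * (2 * (\<Sum>i\<in>UNIV. w i * G z i q) + s * square w q)"
    unfolding square_def sh by (simp add: distrib_left sum.distrib sum_distrib_left mult_ac)
qed

text \<open>By \<open>al_eq\<close>, vanishing of \<open>al\<close> means that the trace of H times
  the derivative of G is zero in every direction. The two identities are the first and second
  derivatives of this along \<open>E z\<close> at a point where G is the identity; there the inverse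
  has first derivative -G' and second derivative 2 G' G' - G''.\<close>

lemma traces:
  assumes p: "p \<in> W" and on: "\<And>i j. G i j p = (if i = j then 1 else 0)" and al0: "\<And>q k. q \<in> W \<Longrightarrow> al k q = 0"
  shows "(\<Sum>i\<in>UNIV. d z (d z (G i i)) p) = (\<Sum>i\<in>UNIV. \<Sum>j\<in>UNIV. (d z (G i j) p)\<^sup>2)"
    and "(\<Sum>i\<in>UNIV. d z (d z (d z (G i i))) p) = 3 * (\<Sum>i\<in>UNIV. \<Sum>j\<in>UNIV. d z (G i j) p * d z (d z (G i j)) p)
      - 2 * (\<Sum>i\<in>UNIV. \<Sum>j\<in>UNIV. \<Sum>k\<in>UNIV. d z (G i j) p * d z (G j k) p * d z (G k i) p)"
proof -
  note sms = smooth_fun_add[OF oW] smooth_fun_mult[OF oW] smooth_fun_const[OF oW] smooth_fun_sum[OF oW] G_smooth H_smooth d_smooth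
  note delta = if_distrib[of "\<lambda>x. x * _"] if_distrib[of "\<lambda>x. _ * x"]
  have Gs: "d z (G i j) q = d z (G j i) q" if "q \<in> W" for i j q using d_G_sym[OF that] .
  have Hp: "H i j p = (if i = j then 1 else 0)" "d z (H i j) p = - d z (G i j) p" for i j
    using d_H_orthonormal[OF p on] by auto
  have ddH: "d z (d z (H i j)) p = 2 * (\<Sum>k\<in>UNIV. d z (G i k) p * d z (G k j) p) - d z (d z (G i j)) p" for i j
  proof -
    have "d z (d z (\<lambda>q. \<Sum>k\<in>UNIV. G i k q * H k j q)) p = d z (\<lambda>q. 0) p"
    proof (rule d_cong[OF p])
      fix q assume q: "q \<in> W"
      have "d z (\<lambda>q. \<Sum>k\<in>UNIV. G i k q * H k j q) q = d z (\<lambda>q. if i = j then 1 else 0) q"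
        by (rule d_cong[OF q]) (simp add: G_H)
      then show "d z (\<lambda>q. \<Sum>k\<in>UNIV. G i k q * H k j q) q = 0" using q by simp
    qed
    then have "(\<Sum>k\<in>UNIV. G i k p * d z (d z (H k j)) p + 2 * (d z (G i k) p * d z (H k j) p) + d z (d z (G i k)) p * H k j p) = 0"
      using p by (simp add: dd_sum dd_mult sms)
    then show ?thesis
      by (simp add: on Hp sum.distrib sum_subtractf delta sum_negf sum_distrib_left cong: if_cong)
  qed
  have tz: "(\<Sum>l\<in>UNIV. \<Sum>i\<in>UNIV. H l i q * d z (G i l) q) = 0" if "q \<in> W" for q
    using al_eq[OF that, of z] al0[OF that, of z] by simp
  have "d z (\<lambda>q. \<Sum>l\<in>UNIV. \<Sum>i\<in>UNIV. H l i q * d z (G i l) q) p = d z (\<lambda>q. 0) p"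
    by (rule d_cong[OF p tz])
  then have "(\<Sum>l\<in>UNIV. \<Sum>i\<in>UNIV. H l i p * d z (d z (G i l)) p + d z (H l i) p * d z (G i l) p) = 0"
    using p by (simp add: d_sum d_mult sms)
  then show "(\<Sum>i\<in>UNIV. d z (d z (G i i)) p) = (\<Sum>i\<in>UNIV. \<Sum>j\<in>UNIV. (d z (G i j) p)\<^sup>2)"
    by (simp add: Hp sum.distrib sum_subtractf delta sum_negf power2_eq_square Gs[OF p] cong: if_cong)
  have "d z (d z (\<lambda>q. \<Sum>l\<in>UNIV. \<Sum>i\<in>UNIV. H l i q * d z (G i l) q)) p = d z (\<lambda>q. 0) p"
  proof (rule d_cong[OF p])
    fix q assume q: "q \<in> W"
    have "d z (\<lambda>q. \<Sum>l\<in>UNIV. \<Sum>i\<in>UNIV. H l i q * d z (G i l) q) q = d z (\<lambda>q. 0) q" by (rule d_cong[OF q tz])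
    then show "d z (\<lambda>q. \<Sum>l\<in>UNIV. \<Sum>i\<in>UNIV. H l i q * d z (G i l) q) q = 0" using q by simp
  qed
  then have "(\<Sum>l\<in>UNIV. \<Sum>i\<in>UNIV. H l i p * d z (d z (d z (G i l))) p + 2 * (d z (H l i) p * d z (d z (G i l)) p)
      + d z (d z (H l i)) p * d z (G i l) p) = 0"
    using p by (simp add: dd_sum dd_mult sms)
  then have *: "(\<Sum>i\<in>UNIV. d z (d z (d z (G i i))) p) - 2 * (\<Sum>l\<in>UNIV. \<Sum>i\<in>UNIV. d z (G l i) p * d z (d z (G i l)) p)
      + (\<Sum>l\<in>UNIV. \<Sum>i\<in>UNIV. 2 * (\<Sum>k\<in>UNIV. d z (G l k) p * d z (G k i) p) * d z (G i l) p)
      - (\<Sum>l\<in>UNIV. \<Sum>i\<in>UNIV. d z (d z (G l i)) p * d z (G i l) p) = 0"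
    by (simp add: Hp ddH sum.distrib delta sum_negf left_diff_distrib sum_subtractf sum_distrib_left cong: if_cong)
  have Gdd: "d z (d z (G l i)) p = d z (d z (G i l)) p" for i l by (rule d_cong[OF p]) (rule Gs)
  have a: "(\<Sum>l\<in>UNIV. \<Sum>i\<in>UNIV. d z (G l i) p * d z (d z (G i l)) p) = (\<Sum>i\<in>UNIV. \<Sum>j\<in>UNIV. d z (G i j) p * d z (d z (G i j)) p)"
    by (intro sum.cong refl) (simp add: Gdd)
  have b: "(\<Sum>l\<in>UNIV. \<Sum>i\<in>UNIV. d z (d z (G l i)) p * d z (G i l) p) = (\<Sum>i\<in>UNIV. \<Sum>j\<in>UNIV. d z (G i j) p * d z (d z (G i j)) p)"
    by (intro sum.cong refl) (metis Gs p mult.commute)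
  have c: "(\<Sum>l\<in>UNIV. \<Sum>i\<in>UNIV. 2 * (\<Sum>k\<in>UNIV. d z (G l k) p * d z (G k i) p) * d z (G i l) p)
      = 2 * (\<Sum>i\<in>UNIV. \<Sum>j\<in>UNIV. \<Sum>k\<in>UNIV. d z (G i j) p * d z (G j k) p * d z (G k i) p)"
    by (simp add: sum_distrib_left sum_distrib_right mult.assoc) (rule sum.cong[OF refl], rule sum.swap)
  show "(\<Sum>i\<in>UNIV. d z (d z (d z (G i i))) p) = 3 * (\<Sum>i\<in>UNIV. \<Sum>j\<in>UNIV. d z (G i j) p * d z (d z (G i j)) p)
      - 2 * (\<Sum>i\<in>UNIV. \<Sum>j\<in>UNIV. \<Sum>k\<in>UNIV. d z (G i j) p * d z (G j k) p * d z (G k i) p)"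
    using * unfolding a b c by simp
qed

text \<open>Write n for |S|^2 and t3 for tr S^3. The second-order tests, summed over all directions,
  bound t3 from below by a multiple of m n, and the fibre conditions bound it from above by a
  smaller multiple, whence m n is nonpositive. On the other hand n is at least m^2, because m is an
  entry of S.\<close>

lemma cubic_maximum_nonpos:
  assumes p: "p \<in> W" and on: "\<And>i j. G i j p = (if i = j then 1 else 0)" and al0: "\<And>q k. q \<in> W \<Longrightarrow> al k q = 0"
    and m: "d z (G z z) p = m" "0 \<le> m"
    and le: "\<And>q a. q \<in> W \<Longrightarrow> cubic a q \<le> (m / 2) * (square a q + square a q * square a q)"
  shows "m \<le> 0"
proof -
  note sms = smooth_fun_add[OF oW] smooth_fun_mult[OF oW] smooth_fun_const[OF oW] smooth_fun_sum[OF oW] G_smooth H_smooth d_smooth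
  note delta = if_distrib[of "\<lambda>x. x * _"] if_distrib[of "\<lambda>x. _ * x"]
  define S where "S i j = d z (G i j) p" for i j
  define \<psi> where "\<psi> i j = d z (d z (G i j)) p" for i j
  have Szz: "S z z = m" using m(1) by (simp add: S_def)
  have Ssym: "S i j = S j i" for i j unfolding S_def by (rule d_G_sym[OF p])
  have sq: "square w p = (\<Sum>i\<in>UNIV. (w i)\<^sup>2)" for w
    by (simp add: square_def on delta power2_eq_square cong: if_cong)
  \<comment> \<open>The conditions in the fibre over \<open>p\<close>. Along the \<open>z\<close>-th
    basis vector plus \<open>t\<close> times \<open>w\<close>, the difference of the two sides of
    \<open>le\<close> is a nonnegative polynomial in \<open>t\<close> that vanishes at 0; so its
    linear coefficient is zero and its quadratic coefficient nonnegative.\<close>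
  have lin: "(\<Sum>i\<in>UNIV. w i * S z i) = m * w z" and quad: "3 * (\<Sum>i\<in>UNIV. \<Sum>j\<in>UNIV. w i * w j * S i j) \<le> (m / 2) * (4 * (w z)\<^sup>2 + 3 * (\<Sum>i\<in>UNIV. (w i)\<^sup>2))" for w
  proof -
    let ?l = "\<Sum>i\<in>UNIV. w i * S z i" and ?q = "\<Sum>i\<in>UNIV. \<Sum>j\<in>UNIV. w i * w j * S i j" and ?n = "\<Sum>i\<in>UNIV. (w i)\<^sup>2"
    have wo: "(\<Sum>i\<in>UNIV. w i * G z i p) = w z" by (simp add: on delta cong: if_cong)
    have "0 \<le> t * ((3 * m * w z - 3 * ?l) + t * (((m / 2) * (4 * (w z)\<^sup>2 + 3 * ?n) - 3 * ?q)
        + t * ((2 * m * w z * ?n - cubic w p) + t * ((m / 2) * ?n\<^sup>2))))" for t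
      using le[OF p, of "\<lambda>i. (if i = z then 1 else 0) + t * w i"]
      unfolding cubic_shift[OF p] m S_def[symmetric] wo sq
      by (simp add: on Szz power2_eq_square algebra_simps)
    from polynomial_nonneg_coeffs[OF this] show "?l = m * w z"
      "3 * ?q \<le> (m / 2) * (4 * (w z)\<^sup>2 + 3 * ?n)" by auto
  qed
  \<comment> \<open>The first-order condition says that the \<open>z\<close>-th basis vector is an
    eigenvector of \<open>S\<close> with eigenvalue \<open>m\<close>.\<close>
  have So: "S z i = (if i = z then m else 0)" for i
    using lin[of "\<lambda>j. if j = i then 1 else 0"] by (simp add: delta cong: if_cong)
  define n where "n = (\<Sum>i\<in>UNIV. \<Sum>j\<in>UNIV. (S i j)\<^sup>2)"
  define t3 where "t3 = (\<Sum>i\<in>UNIV. \<Sum>j\<in>UNIV. \<Sum>k\<in>UNIV. S i j * S j k * S k i)"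
  define sp where "sp = (\<Sum>i\<in>UNIV. \<Sum>j\<in>UNIV. S i j * \<psi> i j)"
  have tr: "(\<Sum>i\<in>UNIV. \<psi> i i) = n" "(\<Sum>i\<in>UNIV. d z (d z (d z (G i i))) p) = 3 * sp - 2 * t3"
    using traces[OF p on al0, of z] by (simp_all add: S_def \<psi>_def n_def t3_def sp_def)
  \<comment> \<open>The symmetry of D g and the commutation of frame derivatives move the index
    \<open>k\<close> of the direction into \<open>G\<close>, so that sums over \<open>k\<close>
    become the traces computed before.\<close>
  have dk: "d k (G z i) q = d z (G k i) q" if "q \<in> W" for k i q using d_G_swap[OF that] .
  have ddk: "d k (d z (G z i)) q = d z (d z (G k i)) q" if "q \<in> W" for k i q
  proof -
    have "d k (d z (G z i)) q = d z (d k (G z i)) q" by (rule d_commute[OF that G_smooth])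
    also have "\<dots> = d z (d z (G k i)) q" by (rule d_cong[OF that dk])
    finally show ?thesis .
  qed
  have dd1: "d k (d k (G z z)) p = \<psi> k k" for k
  proof -
    have "d k (d k (G z z)) p = d k (d z (G z k)) p" by (rule d_cong[OF p]) (rule trans[OF dk d_G_sym])
    also have "\<dots> = \<psi> k k" unfolding \<psi>_def by (rule ddk[OF p])
    finally show ?thesis .
  qed
  have dd2: "d k (d k (d z (G z z))) p = d z (d z (d z (G k k))) p" for k
  proof -
    have "d k (d k (d z (G z z))) p = d k (d z (d z (G z k))) p"
    proof (rule d_cong[OF p])
      fix q assume q: "q \<in> W"
      have "d k (d z (G z z)) q = d z (d z (G k z)) q" by (rule ddk[OF q])
      also have "\<dots> = d z (d z (G z k)) q" by (rule d_cong[OF q]) (rule d_G_sym)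
      finally show "d k (d z (G z z)) q = d z (d z (G z k)) q" .
    qed
    also have "\<dots> = d z (d k (d z (G z k))) p" by (rule d_commute[OF p]) (intro sms)
    also have "\<dots> = d z (d z (d z (G k k))) p" by (rule d_cong[OF p ddk])
    finally show ?thesis .
  qed
  have test: "d z (d z (d z (G k k))) p - 3 * (\<Sum>i\<in>UNIV. S k i * \<psi> k i) + (3 / 2) * (\<Sum>i\<in>UNIV. \<Sum>j\<in>UNIV. S k i * S k j * S i j)
      \<le> (3 * m / 2) * (\<psi> k k - (3 / 2) * (\<Sum>i\<in>UNIV. (S k i)\<^sup>2))" for k
  proof -
    obtain s where s: "smooth_fun A W s" "s p = 0" "d k s p = 1" "d k (d k s) p = 0"
      using probe_exists[OF p] by blast
    \<comment> \<open>Half of the \<open>k\<close>-th row of \<open>S\<close>, with a sign that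
      cancels the first-order change of length: the derivative of \<open>G z z\<close> in direction
      \<open>k\<close> is \<open>S k z\<close>, and the linear coefficient contributes twice
      \<open>w z\<close>.\<close>
    define w where "w i = - (1 / 2) * S k i" for i
    have sqs: "smooth_fun A W (square w)" and cus: "smooth_fun A W (cubic w)"
      unfolding square_def[abs_def] cubic_def[abs_def] by (intro sms)+
    have "d k (d k (d z (G z z))) p + 2 * d k (\<lambda>q. 3 * (\<Sum>i\<in>UNIV. w i * d z (G z i) q)) p
        + 2 * (3 * (\<Sum>i\<in>UNIV. \<Sum>j\<in>UNIV. w i * w j * d z (G i j) p))
        \<le> (3 * m / 2) * (d k (d k (G z z)) p + 2 * d k (\<lambda>q. 2 * (\<Sum>i\<in>UNIV. w i * G z i q)) p + 2 * square w p)"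
    proof (rule polynomial_test[OF p s G_smooth _ sqs d_smooth[OF G_smooth] _ _ cus])
      show "d z (G z z) q + s q * (3 * (\<Sum>i\<in>UNIV. w i * d z (G z i) q)
          + s q * (3 * (\<Sum>i\<in>UNIV. \<Sum>j\<in>UNIV. w i * w j * d z (G i j) q) + s q * cubic w q)) \<le> (m / 2) * (x + x * x)"
        if "q \<in> W" "x = G z z q + s q * (2 * (\<Sum>i\<in>UNIV. w i * G z i q) + s q * square w q)" for q x
        using le[OF that(1), of "\<lambda>i. (if i = z then 1 else 0) + s q * w i"] that
        unfolding cubic_shift[OF that(1)] by simp
      show "d k (G z z) p + 2 * (\<Sum>i\<in>UNIV. w i * G z i p) = 0"
        using dk[OF p, of k z] by (simp add: on delta w_def S_def cong: if_cong)
      show "G z z p = 1" "d z (G z z) p = m" using on m by simp_all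
    qed (intro sms)+
    moreover have "d k (\<lambda>q. 3 * (\<Sum>i\<in>UNIV. w i * d z (G z i) q)) p = - (3 / 2) * (\<Sum>i\<in>UNIV. S k i * \<psi> k i)"
    proof -
      have "d k (\<lambda>q. 3 * (\<Sum>i\<in>UNIV. w i * d z (G z i) q)) p = 3 * (\<Sum>i\<in>UNIV. w i * \<psi> k i)"
        using p by (simp add: d_mult d_sum sms ddk \<psi>_def)
      then show ?thesis by (simp add: w_def sum_distrib_left sum_negf)
    qed
    moreover have "d k (\<lambda>q. 2 * (\<Sum>i\<in>UNIV. w i * G z i q)) p = - (\<Sum>i\<in>UNIV. (S k i)\<^sup>2)"
    proof -
      have "d k (\<lambda>q. 2 * (\<Sum>i\<in>UNIV. w i * G z i q)) p = 2 * (\<Sum>i\<in>UNIV. w i * S k i)"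
        using p by (simp add: d_mult d_sum sms dk S_def)
      then show ?thesis by (simp add: w_def sum_distrib_left sum_negf power2_eq_square)
    qed
    moreover have "(\<Sum>i\<in>UNIV. \<Sum>j\<in>UNIV. w i * w j * d z (G i j) p) = (1 / 4) * (\<Sum>i\<in>UNIV. \<Sum>j\<in>UNIV. S k i * S k j * S i j)"
      by (simp add: w_def S_def sum_distrib_left)
    moreover have "square w p = (1 / 4) * (\<Sum>i\<in>UNIV. (S k i)\<^sup>2)"
      by (simp add: sq w_def sum_distrib_left power2_eq_square)
    ultimately show ?thesis unfolding dd1 dd2 by (simp add: algebra_simps)
  qed
  have t3': "(\<Sum>k\<in>UNIV. \<Sum>i\<in>UNIV. \<Sum>j\<in>UNIV. S k i * S k j * S i j) = t3"
    unfolding t3_def by (intro sum.cong refl) (metis Ssym mult.assoc mult.commute)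
  have "(\<Sum>k\<in>UNIV. d z (d z (d z (G k k))) p - 3 * (\<Sum>i\<in>UNIV. S k i * \<psi> k i) + (3 / 2) * (\<Sum>i\<in>UNIV. \<Sum>j\<in>UNIV. S k i * S k j * S i j))
      \<le> (\<Sum>k\<in>UNIV. (3 * m / 2) * (\<psi> k k - (3 / 2) * (\<Sum>i\<in>UNIV. (S k i)\<^sup>2)))"
    by (rule sum_mono[OF test])
  moreover have "(\<Sum>k\<in>UNIV. d z (d z (d z (G k k))) p - 3 * (\<Sum>i\<in>UNIV. S k i * \<psi> k i) + (3 / 2) * (\<Sum>i\<in>UNIV. \<Sum>j\<in>UNIV. S k i * S k j * S i j))
      = (3 * sp - 2 * t3) - 3 * sp + (3 / 2) * t3"
    by (simp only: sum.distrib sum_subtractf sum_distrib_left[symmetric] tr t3' sp_def)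
  moreover have "(\<Sum>k\<in>UNIV. (3 * m / 2) * (\<psi> k k - (3 / 2) * (\<Sum>i\<in>UNIV. (S k i)\<^sup>2))) = (3 * m / 2) * (n - (3 / 2) * n)"
    by (simp only: sum_subtractf sum_distrib_left[symmetric] tr n_def)
  \<comment> \<open>The terms \<open>sp\<close> cancel. In front of \<open>t3\<close> there remains
    3/2 - 2 = -1/2, and in front of \<open>m * n\<close> there remains (3/2)(1 - 3/2) =
    -3/4.\<close>
  ultimately have main: "(3 / 4) * (m * n) \<le> (1 / 2) * t3" by (simp add: algebra_simps)
  have "3 * t3 = (\<Sum>k\<in>UNIV. 3 * (\<Sum>i\<in>UNIV. \<Sum>j\<in>UNIV. S k i * S k j * S i j))"
    unfolding t3'[symmetric] by (rule sum_distrib_left)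
  \<comment> \<open>The quadratic fibre condition, applied to each row of \<open>S\<close>. The
    entry in column \<open>z\<close> is estimated crudely by the whole row; the resulting constant
    7/2 is still below the 9/2 that \<open>main\<close> forces.\<close>
  also have "\<dots> \<le> (\<Sum>k\<in>UNIV. (7 * m / 2) * (\<Sum>i\<in>UNIV. (S k i)\<^sup>2))"
  proof (rule sum_mono)
    fix k
    have "(S k z)\<^sup>2 \<le> (\<Sum>i\<in>UNIV. (S k i)\<^sup>2)" by (rule member_le_sum) auto
    then have "(m / 2) * (4 * (S k z)\<^sup>2 + 3 * (\<Sum>i\<in>UNIV. (S k i)\<^sup>2)) \<le> (m / 2) * (7 * (\<Sum>i\<in>UNIV. (S k i)\<^sup>2))"
      using m(2) by (intro mult_left_mono) auto
    then show "3 * (\<Sum>i\<in>UNIV. \<Sum>j\<in>UNIV. S k i * S k j * S i j) \<le> (7 * m / 2) * (\<Sum>i\<in>UNIV. (S k i)\<^sup>2)"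
      using quad[of "S k"] by simp
  qed
  also have "\<dots> = (7 * m / 2) * n" unfolding n_def by (rule sum_distrib_left[symmetric])
  finally have "3 * t3 \<le> (7 / 2) * (m * n)" by simp
  then have mn: "m * n \<le> 0" using main by linarith
  have "m\<^sup>2 \<le> (\<Sum>j\<in>UNIV. (S z j)\<^sup>2)"
    using member_le_sum[of z UNIV "\<lambda>j. (S z j)\<^sup>2"] So[of z] by simp
  also have "\<dots> \<le> n" unfolding n_def by (rule member_le_sum[of z UNIV "\<lambda>i. \<Sum>j\<in>UNIV. (S i j)\<^sup>2"]) (auto intro: sum_nonneg)
  finally have "m * m\<^sup>2 \<le> m * n" using m(2) by (rule mult_left_mono)
  then have "m ^ 3 \<le> 0" using mn by (simp add: power2_eq_square power3_eq_cube mult.assoc)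
  then show ?thesis using m(2) by (metis not_less zero_less_power)
qed

end

section \<open>The divergence of the soliton field\<close>

text \<open>The vector field dual to \<alpha> with respect to g. A definite description at each
  point makes it independent of charts and frames.\<close>

definition raise_koszul ::
    "('a, 'n::finite) chart set \<Rightarrow> ('a, 'n) conn \<Rightarrow> ('a, 'n) metric \<Rightarrow> ('a, 'n) vfield"
  where "raise_koszul A D g p = (THE v. \<forall>w. g p v w = koszul1 A D g p w)"

text \<open>A density rather than a form: a change of chart multiplies it by the absolute value of
  the Jacobian determinant, which is what integration without an orientation requires.\<close>

definition density :: "('a, 'n::finite) chart set \<Rightarrow> ('a, 'n) metric \<Rightarrow> ('a, 'n) chart \<Rightarrow> 'a \<Rightarrow> real"
  where "density A g c p = sqrt (det (\<chi> i j. g p (coord_vector A c i p) (coord_vector A c j p)))"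

section \<open>The divergence in charts and in parallel frames\<close>

context metric_frame
begin

lemma g_frame: "q \<in> W \<Longrightarrow> g q u (E k q) = (\<Sum>i\<in>UNIV. coef i q u * G i k q)"
proof -
  assume q: "q \<in> W"
  have l: "linear (\<lambda>x. g q x y)" for y using g_bilinear[OF W_top[OF q]] unfolding bilinear_def by blast
  have "g q u (E k q) = g q (\<Sum>i\<in>UNIV. coef i q u *\<^sub>R E i q) (E k q)" using coef_expand[OF q, of u] by simp
  then show ?thesis by (simp add: linear_sum[OF l] linear_cmul[OF l] G_def)
qed

lemma raise_koszul_frame:
  assumes q: "q \<in> W"
  shows "raise_koszul A D g q = (\<Sum>i\<in>UNIV. (\<Sum>j\<in>UNIV. H i j q * al j q) *\<^sub>R E i q)"
  unfolding raise_koszul_def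
proof (rule the_equality)
  let ?v = "\<Sum>i\<in>UNIV. (\<Sum>j\<in>UNIV. H i j q * al j q) *\<^sub>R E i q"
  have l: "linear (\<lambda>x. g q x y)" "linear (g q x)" for x y using g_bilinear[OF W_top[OF q]] unfolding bilinear_def by blast+
  have E: "g q ?v (E k q) = al k q" for k
  proof -
    have "g q ?v (E k q) = (\<Sum>i\<in>UNIV. (\<Sum>j\<in>UNIV. H i j q * al j q) * G i k q)"
      by (simp add: g_frame[OF q] coef_sum[OF q])
    also have "\<dots> = (\<Sum>j\<in>UNIV. (\<Sum>i\<in>UNIV. G k i q * H i j q) * al j q)"
      unfolding sum_distrib_right by (subst sum.swap) (simp add: G_sym[OF q, of k] mult_ac)
    finally show ?thesis by (simp add: G_H[OF q] if_distrib[of "\<lambda>x. x * _"] cong: if_cong)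
  qed
  show *: "\<forall>w. g q ?v w = koszul1 A D g q w"
  proof
    fix w
    have "g q ?v w = g q ?v (\<Sum>k\<in>UNIV. coef k q w *\<^sub>R E k q)" using coef_expand[OF q, of w] by simp
    also have "\<dots> = (\<Sum>k\<in>UNIV. coef k q w * g q ?v (E k q))" by (simp only: linear_sum[OF l(2)] linear_cmul[OF l(2)] real_scaleR_def)
    finally show "g q ?v w = koszul1 A D g q w" by (simp only: E koszul1_frame[OF q])
  qed
  fix v assume v: "\<forall>w. g q v w = koszul1 A D g q w"
  have "g q (v - ?v) (v - ?v) = 0"
    using v * linear_diff[OF l(1), of v ?v "v - ?v"] by simp
  then show "v = ?v" using g_pos[OF W_top[OF q], of "v - ?v"] by fastforce
qed

lemma raise_koszul_vfields: "raise_koszul A D g \<in> vfields A W"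
proof (rule vfields_cong[OF oW])
  show "(\<lambda>q. \<Sum>i\<in>UNIV. (\<Sum>j\<in>UNIV. H i j q * al j q) *\<^sub>R E i q) \<in> vfields A W"
    by (intro vfields_sum vfields_scaleR smooth_fun_sum smooth_fun_mult H_smooth al_smooth E oW) auto
qed (simp add: raise_koszul_frame)

text \<open>This is the defining equation of \<alpha> on the coordinate fields of \<open>c\<close>,
  where the volume form takes the value \<open>density\<close>. The terms in which one field is
  replaced by its covariant derivative add up to the trace of the connection matrix.\<close>

lemma density_derivative:
  assumes p: "p \<in> W"
  shows "differential A (density A g c) p (coord_vector A c k p) = density A g c p *
    (koszul1 A D g p (coord_vector A c k p) + (\<Sum>l\<in>UNIV. components A c p (D (coord_vector A c k) (coord_vector A c l) p) $ l))"
proof -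
  have pc: "p \<in> fst c" using p Wc by blast
  note Wc' = chart_openin[OF cA]
  have cv: "coord_vector A c i \<in> vfields A (fst c)" for i using coord_vector_vfields[OF cA Wc'] by auto
  have I: "det (\<chi> i j. components A c q (coord_vector A c j q) $ i) = 1" if "q \<in> fst c" for q
  proof -
    have "(\<chi> i j. components A c q (coord_vector A c j q) $ i) = mat 1"
      by (simp add: components_coord_vector[OF cA that] vec_eq_iff mat_def axis_def)
    then show ?thesis by simp
  qed
  have "differential A (\<lambda>q. volume_form A g c q (\<lambda>j. coord_vector A c j q)) p v = differential A (density A g c) p v" for v
    by (rule differential_cong[OF Wc' pc]) (simp add: volume_form_def I density_def)
  moreover have "volume_form A g c p (\<lambda>j. ((coord_vector A c)(l := D (coord_vector A c k) (coord_vector A c l))) j p)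
      = density A g c p * components A c p (D (coord_vector A c k) (coord_vector A c l) p) $ l" for l
  proof -
    have "(\<chi> i j. components A c p (((coord_vector A c)(l := D (coord_vector A c k) (coord_vector A c l))) j p) $ i)
       = (\<chi> i j. if j = l then components A c p (D (coord_vector A c k) (coord_vector A c l) p) $ i else if i = j then 1 else 0)"
      by (auto simp: vec_eq_iff components_coord_vector[OF cA pc] axis_def)
    then show ?thesis unfolding volume_form_def density_def by (simp only: det_identity_column)
  qed
  moreover have "cov_top_form A D (volume_form A g c) (coord_vector A c k) (coord_vector A c) p
    = koszul1 A D g p (coord_vector A c k p) * density A g c p"
    using koszul_equation[OF cA p pc cv cv] by (simp add: koszul1_frame[OF p] volume_form_def I[OF pc] density_def)
  ultimately show ?thesis unfolding cov_top_form_def by (simp add: sum_distrib_left algebra_simps)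
qed

lemma density_smooth: "smooth_fun A W (density A g c)"
proof -
  have cv: "coord_vector A c i \<in> vfields A W" for i using coord_vector_vfields[OF cA oW Wc] .
  have pos: "det (\<chi> i j. g q (coord_vector A c i q) (coord_vector A c j q)) > 0" if q: "q \<in> W" for q
  proof -
    have qc: "q \<in> fst c" using q Wc by blast
    have "(\<chi> i j. components A c q (coord_vector A c j q) $ i) = mat 1"
      by (simp add: components_coord_vector[OF cA qc] vec_eq_iff mat_def axis_def)
    then have "det (\<chi> i j. coord_vector A c j q $ i) \<noteq> 0"
      using det_linear_image[OF components_linear[OF cA qc], of "\<lambda>j. coord_vector A c j q"] by auto
    then show ?thesis using W_top[OF q] by (intro gram_det_pos g_bilinear g_sym g_pos)
  qed
  show ?thesis unfolding density_def[abs_def]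
    using smooth_fun_det[OF oW, of "\<lambda>i j q. g q (coord_vector A c i q) (coord_vector A c j q)"] g_smooth[OF oW cv cv] pos
    by (intro smooth_fun_sqrt oW) auto
qed

text \<open>The left-hand side is the coordinate expression for the divergence of \<open>Y\<close>
  times the density. Vanishing torsion makes the connection coefficients symmetric, so the
  derivative of the density completes that of the components to the trace of D Y plus \<alpha>(Y);
  the trace is then taken in the parallel frame.\<close>

lemma divergence_in_chart:
  assumes p: "p \<in> W" and Y: "Y \<in> vfields A W"
  shows "(\<Sum>k\<in>UNIV. differential A (\<lambda>q. density A g c q * components A c q (Y q) $ k) p (coord_vector A c k p))
    = density A g c p * ((\<Sum>i\<in>UNIV. d i (\<lambda>q. coef i q (Y q)) p) + koszul1 A D g p (Y p))"
proof -
  have pc: "p \<in> fst c" using p Wc by blast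
  note lin = components_linear[OF cA pc]
  have cv: "coord_vector A c i \<in> vfields A W" for i using coord_vector_vfields[OF cA oW Wc] .
  let ?cv = "\<lambda>k. coord_vector A c k p" and ?\<Gamma> = "\<lambda>k l. D (coord_vector A c k) (coord_vector A c l) p"
  have Ys: "smooth_fun A W (\<lambda>q. components A c q (Y q) $ k)" for k using component_smooth[OF Y cA oW Wc] .
  have cY: "smooth_fun A W (\<lambda>q. coef i q (Y q))" for i using coef_smooth[OF oW order_refl Y] .
  have sym: "?\<Gamma> k l = ?\<Gamma> l k" for k l
  proof -
    have "?\<Gamma> k l - ?\<Gamma> l k - lie_bracket A (coord_vector A c k) (coord_vector A c l) p = 0"
      using flat[unfolded flat_connection_def torsion_free_def, THEN conjunct2, THEN conjunct1,
        THEN spec, THEN mp, OF oW, THEN bspec, OF cv, THEN bspec, OF cv, THEN bspec, OF p] .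
    moreover have "lie_bracket A (coord_vector A c k) (coord_vector A c l) p = 0"
      using const_field_bracket[OF cA pc, of "axis k 1" "axis l 1"] unfolding coord_vector_tangent[symmetric] .
    ultimately show ?thesis by simp
  qed
  have DY: "components A c p (D (coord_vector A c l) Y p) $ l = differential A (\<lambda>q. components A c q (Y q) $ l) p (?cv l)
      + (\<Sum>k\<in>UNIV. components A c p (Y p) $ k * components A c p (?\<Gamma> k l) $ l)" for l
  proof -
    have "D (coord_vector A c l) Y p = D (coord_vector A c l) (\<lambda>q. \<Sum>k\<in>UNIV. components A c q (Y q) $ k *\<^sub>R coord_vector A c k q) p"
    proof (rule D_cong[OF oW cv _ p])
      show "(\<lambda>q. \<Sum>k\<in>UNIV. components A c q (Y q) $ k *\<^sub>R coord_vector A c k q) \<in> vfields A W"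
        by (intro vfields_sum vfields_scaleR oW Ys cv) auto
      show "Y q = (\<Sum>k\<in>UNIV. components A c q (Y q) $ k *\<^sub>R coord_vector A c k q)" if "q \<in> W" for q
        using coord_expand[OF cA, of q "Y q"] Wc that by blast
    qed simp
    also have "\<dots> = (\<Sum>k\<in>UNIV. differential A (\<lambda>q. components A c q (Y q) $ k) p (?cv l) *\<^sub>R ?cv k + components A c p (Y p) $ k *\<^sub>R ?\<Gamma> l k)"
      by (intro D_sum_right[OF oW] Ys cv p) auto
    finally have "components A c p (D (coord_vector A c l) Y p) $ l
      = (\<Sum>k\<in>UNIV. differential A (\<lambda>q. components A c q (Y q) $ k) p (?cv l) * axis k 1 $ l)
        + (\<Sum>k\<in>UNIV. components A c p (Y p) $ k * components A c p (?\<Gamma> k l) $ l)"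
      by (simp add: linear_sum[OF lin] linear_add[OF lin] linear_cmul[OF lin] components_coord_vector[OF cA pc] sym[of l] sum.distrib)
    then show ?thesis by (simp add: axis_def if_distrib[of "\<lambda>x. _ * x"] cong: if_cong)
  qed
  have trace: "(\<Sum>l\<in>UNIV. components A c p (D (coord_vector A c l) Y p) $ l) = (\<Sum>i\<in>UNIV. d i (\<lambda>q. coef i q (Y q)) p)"
  proof -
    have "components A c p (D (coord_vector A c l) Y p) $ l
        = (\<Sum>j\<in>UNIV. \<Sum>a\<in>UNIV. d a (\<lambda>q. coef j q (Y q)) p * (coef a p (?cv l) * components A c p (E j p) $ l))" (is "_ = ?r l") for l
      unfolding D_frame[OF oW order_refl cv Y p]
      by (simp add: differential_d[OF oW order_refl cY p] linear_sum[OF lin] linear_cmul[OF lin] sum_distrib_right sum_distrib_left mult_ac)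
    then have "(\<Sum>l\<in>UNIV. components A c p (D (coord_vector A c l) Y p) $ l) = (\<Sum>l\<in>UNIV. ?r l)"
      by (intro sum.cong refl)
    also have "\<dots> = (\<Sum>j\<in>UNIV. \<Sum>l\<in>UNIV. \<Sum>a\<in>UNIV. d a (\<lambda>q. coef j q (Y q)) p * (coef a p (?cv l) * components A c p (E j p) $ l))"
      by (rule sum.swap)
    also have "\<dots> = (\<Sum>j\<in>UNIV. \<Sum>a\<in>UNIV. \<Sum>l\<in>UNIV. d a (\<lambda>q. coef j q (Y q)) p * (coef a p (?cv l) * components A c p (E j p) $ l))"
      by (rule sum.cong[OF refl], rule sum.swap)
    also have "\<dots> = (\<Sum>j\<in>UNIV. \<Sum>a\<in>UNIV. d a (\<lambda>q. coef j q (Y q)) p * coef a p (E j p))"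
    proof -
      have "(\<Sum>l\<in>UNIV. coef a p (?cv l) * components A c p (E j p) $ l) = coef a p (E j p)" for a j
      proof -
        have "coef a p (E j p) = coef a p (\<Sum>l\<in>UNIV. components A c p (E j p) $ l *\<^sub>R ?cv l)"
          using coord_expand[OF cA pc, of "E j p"] by simp
        then show ?thesis
          by (simp add: linear_sum[OF coef_linear[OF p]] linear_cmul[OF coef_linear[OF p]] mult.commute)
      qed
      then show ?thesis by (simp add: sum_distrib_left[symmetric])
    qed
    also have "\<dots> = (\<Sum>i\<in>UNIV. d i (\<lambda>q. coef i q (Y q)) p)"
      by (simp add: coef_E[OF p] if_distrib[of "\<lambda>x. _ * x"] cong: if_cong)
    finally show ?thesis .
  qed
  have kY: "koszul1 A D g p (Y p) = (\<Sum>k\<in>UNIV. components A c p (Y p) $ k * koszul1 A D g p (?cv k))"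
  proof -
    have k: "linear (koszul1 A D g p)"
      by (rule linearI) (simp_all add: koszul1_frame[OF p] linear_add[OF coef_linear[OF p]] linear_cmul[OF coef_linear[OF p]]
          distrib_right sum.distrib sum_distrib_left mult.assoc)
    have "koszul1 A D g p (Y p) = koszul1 A D g p (\<Sum>k\<in>UNIV. components A c p (Y p) $ k *\<^sub>R ?cv k)"
      using coord_expand[OF cA pc, of "Y p"] by simp
    then show ?thesis by (simp add: linear_sum[OF k] linear_cmul[OF k])
  qed
  have "(\<Sum>k\<in>UNIV. differential A (\<lambda>q. density A g c q * components A c q (Y q) $ k) p (?cv k))
    = density A g c p * ((\<Sum>k\<in>UNIV. differential A (\<lambda>q. components A c q (Y q) $ k) p (?cv k))
      + (\<Sum>k\<in>UNIV. components A c p (Y p) $ k * koszul1 A D g p (?cv k))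
      + (\<Sum>k\<in>UNIV. \<Sum>l\<in>UNIV. components A c p (Y p) $ k * components A c p (?\<Gamma> k l) $ l))"
    by (simp add: differential_mult[OF oW p density_smooth Ys] density_derivative[OF p] sum.distrib sum_distrib_left algebra_simps)
  also have "(\<Sum>k\<in>UNIV. \<Sum>l\<in>UNIV. components A c p (Y p) $ k * components A c p (?\<Gamma> k l) $ l)
      = (\<Sum>l\<in>UNIV. \<Sum>k\<in>UNIV. components A c p (Y p) $ k * components A c p (?\<Gamma> k l) $ l)" by (rule sum.swap)
  finally show ?thesis unfolding trace[symmetric] kY DY by (simp add: sum.distrib algebra_simps)
qed

end

context hess_frame
begin

text \<open>The soliton equation is traced in a frame that is orthonormal at \<open>p\<close>. The
  derivative of g in the Lie derivative contributes 2 \<alpha>(X), the derivative of the inverse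
  metric in the dual field contributes -2 |\<alpha>|^2, and the \<alpha>-term of the divergence
  gives |\<alpha>|^2 - \<alpha>(X).\<close>

lemma soliton_divergence:
  assumes p: "p \<in> W" and on: "\<And>i j. G i j p = (if i = j then 1 else 0)"
    and X: "X \<in> vfields A W"
    and sol: "\<And>i. koszul2 A D g (E i) (E i) p - 1 / 2 * lie_deriv_metric A X g (E i) (E i) p = l * g p (E i p) (E i p)"
  shows "(\<Sum>i\<in>UNIV. d i (\<lambda>q. coef i q (raise_koszul A D g q - X q)) p) + koszul1 A D g p (raise_koszul A D g p - X p)
    = l * real CARD('n) - koszul1 A D g p (raise_koszul A D g p)"
    and "koszul1 A D g p (raise_koszul A D g p) = (\<Sum>i\<in>UNIV. (al i p)\<^sup>2)"
proof -
  note delta = if_distrib[of "\<lambda>x. x * _"] if_distrib[of "\<lambda>x. _ * x"]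
  have cX: "smooth_fun A W (\<lambda>q. coef i q (X q))" for i using coef_smooth[OF oW order_refl X] .
  have Hp: "H i j p = (if i = j then 1 else 0)" "d m (H i j) p = - d m (G i j) p" for i j m
    using d_H_orthonormal[OF p on] by auto
  have al2: "2 * al k p = (\<Sum>i\<in>UNIV. d k (G i i) p)" for k
    using al_eq[OF p, of k] by (simp add: Hp delta cong: if_cong)
  have lie: "lie_deriv_metric A X g (E i) (E i) p = (\<Sum>k\<in>UNIV. coef k p (X p) * d k (G i i) p) + 2 * d i (\<lambda>q. coef i q (X q)) p" for i
  proof -
    \<comment> \<open>Torsion freeness and parallelity of \<open>E i\<close> turn the bracket in the
      Lie derivative into a covariant derivative of \<open>X\<close>.\<close>
    have "D X (E i) p - D (E i) X p - lie_bracket A X (E i) p = 0"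
      using flat[unfolded flat_connection_def torsion_free_def, THEN conjunct2, THEN conjunct1,
        THEN spec, THEN mp, OF oW, THEN bspec, OF X, THEN bspec, OF E, THEN bspec, OF p] .
    then have br: "lie_bracket A X (E i) p = - D (E i) X p" using par[OF oW order_refl X p, of i] by simp
    have l: "linear (\<lambda>x. g p x y)" "linear (g p x)" for x y using g_bilinear[OF W_top[OF p]] unfolding bilinear_def by blast+
    have "g p (D (E i) X p) (E i p) = d i (\<lambda>q. coef i q (X q)) p"
      unfolding D_frame[OF oW order_refl E X p] g_frame[OF p] coef_sum[OF p]
      by (simp add: on d_def delta cong: if_cong)
    then have "g p (lie_bracket A X (E i) p) (E i p) = - d i (\<lambda>q. coef i q (X q)) p" unfolding br linear_neg[OF l(1)] by simp
    moreover have "g p (E i p) (lie_bracket A X (E i) p) = g p (lie_bracket A X (E i) p) (E i p)" by (rule g_sym[OF W_top[OF p]])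
    moreover have "differential A (\<lambda>q. g q (E i q) (E i q)) p (X p) = (\<Sum>k\<in>UNIV. coef k p (X p) * d k (G i i) p)"
      using differential_d[OF oW order_refl G_smooth p, of i i "X p"] by (simp add: G_def[abs_def])
    ultimately show ?thesis unfolding lie_deriv_metric_def by simp
  qed
  have "(\<Sum>i\<in>UNIV. koszul2 A D g (E i) (E i) p - 1 / 2 * lie_deriv_metric A X g (E i) (E i) p) = (\<Sum>i\<in>(UNIV::'n set). l)"
    using sol on by (simp add: G_def)
  then have "(\<Sum>i\<in>UNIV. d i (al i) p) - 1 / 2 * ((\<Sum>i\<in>UNIV. \<Sum>k\<in>UNIV. coef k p (X p) * d k (G i i) p)
      + 2 * (\<Sum>i\<in>UNIV. d i (\<lambda>q. coef i q (X q)) p)) = l * real CARD('n)"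
    unfolding koszul2_frame[OF p] lie by (simp add: sum_subtractf sum.distrib sum_distrib_left[symmetric] sum_divide_distrib[symmetric])
  moreover have "(\<Sum>i\<in>UNIV. \<Sum>k\<in>UNIV. coef k p (X p) * d k (G i i) p) = 2 * (\<Sum>k\<in>UNIV. coef k p (X p) * al k p)"
    by (subst sum.swap) (simp add: sum_distrib_left[symmetric] al2[symmetric], simp add: sum_distrib_left mult_ac)
  moreover have "x - 1 / 2 * (y + 2 * z) = t \<Longrightarrow> y = 2 * s \<Longrightarrow> x = s + z + t" for x y z s t :: real by (simp add: field_simps)
  ultimately have tr: "(\<Sum>i\<in>UNIV. d i (al i) p) = (\<Sum>k\<in>UNIV. coef k p (X p) * al k p)
      + (\<Sum>i\<in>UNIV. d i (\<lambda>q. coef i q (X q)) p) + l * real CARD('n)" by blast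
  have ck: "coef i q (raise_koszul A D g q) = (\<Sum>j\<in>UNIV. H i j q * al j q)" if "q \<in> W" for i q
    unfolding raise_koszul_frame[OF that] by (rule coef_sum[OF that])
  have ckp: "coef i p (raise_koszul A D g p) = al i p" for i
    by (simp add: ck[OF p] Hp delta cong: if_cong)
  show nrm: "koszul1 A D g p (raise_koszul A D g p) = (\<Sum>i\<in>UNIV. (al i p)\<^sup>2)"
    by (simp add: koszul1_frame[OF p] ckp power2_eq_square)
  have sHa: "smooth_fun A W (\<lambda>q. \<Sum>j\<in>UNIV. H i j q * al j q)" for i
    by (intro smooth_fun_sum smooth_fun_mult oW H_smooth al_smooth)
  have di: "d i (\<lambda>q. coef i q (raise_koszul A D g q - X q)) p = d i (al i) p - (\<Sum>j\<in>UNIV. d i (G i j) p * al j p)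
      - d i (\<lambda>q. coef i q (X q)) p" for i
  proof -
    have "d i (\<lambda>q. coef i q (raise_koszul A D g q - X q)) p = d i (\<lambda>q. (\<Sum>j\<in>UNIV. H i j q * al j q) - coef i q (X q)) p"
      by (rule d_cong[OF p]) (simp add: linear_diff[OF coef_linear] ck)
    also have "\<dots> = (\<Sum>j\<in>UNIV. H i j p * d i (al j) p + d i (H i j) p * al j p) - d i (\<lambda>q. coef i q (X q)) p"
      using p sHa cX by (simp add: d_diff d_sum d_mult smooth_fun_mult[OF oW] H_smooth al_smooth)
    finally show ?thesis by (simp add: Hp sum.distrib sum_subtractf delta sum_negf cong: if_cong)
  qed
  \<comment> \<open>Total symmetry of D g interchanges the indices, so that the contraction over
    \<open>i\<close> becomes the trace \<open>2 * al j p\<close>.\<close>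
  have "(\<Sum>i\<in>UNIV. \<Sum>j\<in>UNIV. d i (G i j) p * al j p) = (\<Sum>j\<in>UNIV. (\<Sum>i\<in>UNIV. d j (G i i) p) * al j p)"
    unfolding sum_distrib_right by (subst sum.swap) (intro sum.cong refl, metis d_G_swap d_G_sym p)
  also have "\<dots> = 2 * (\<Sum>i\<in>UNIV. (al i p)\<^sup>2)"
    by (simp add: al2[symmetric] sum_distrib_left power2_eq_square mult.assoc)
  finally have "(\<Sum>i\<in>UNIV. d i (\<lambda>q. coef i q (raise_koszul A D g q - X q)) p)
      = (\<Sum>i\<in>UNIV. d i (al i) p) - 2 * (\<Sum>i\<in>UNIV. (al i p)\<^sup>2) - (\<Sum>i\<in>UNIV. d i (\<lambda>q. coef i q (X q)) p)"
    unfolding di by (simp add: sum_subtractf)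
  moreover have "koszul1 A D g p (raise_koszul A D g p - X p) = (\<Sum>i\<in>UNIV. (al i p)\<^sup>2) - (\<Sum>k\<in>UNIV. coef k p (X p) * al k p)"
    by (simp add: koszul1_frame[OF p] linear_diff[OF coef_linear[OF p]] ckp left_diff_distrib sum_subtractf power2_eq_square)
  ultimately show "(\<Sum>i\<in>UNIV. d i (\<lambda>q. coef i q (raise_koszul A D g q - X q)) p) + koszul1 A D g p (raise_koszul A D g p - X p)
    = l * real CARD('n) - koszul1 A D g p (raise_koszul A D g p)" using tr nrm by simp
qed

end

section \<open>Integration in coordinates\<close>

text \<open>The change of variables theorem of the library needs a well-ordered index type, so integrals are
  computed in \<open>real ^ 'n ordered_index\<close>, where \<open>'n ordered_index\<close> is a copy of \<open>'n\<close>.\<close>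

typedef 'a ordered_index = "UNIV :: 'a set" by auto

lemma ordered_index_inverse [simp]:
  "Abs_ordered_index (Rep_ordered_index x) = x" "Rep_ordered_index (Abs_ordered_index y) = y"
  by (simp_all add: Rep_ordered_index_inverse Abs_ordered_index_inverse)

instance ordered_index :: (finite) finite
proof
  have "(UNIV :: 'a ordered_index set) = range Abs_ordered_index"
    by (metis UNIV_I ordered_index_inverse(1) surjI)
  then show "finite (UNIV :: 'a ordered_index set)" by (metis finite finite_imageI)
qed

definition index_rank :: "'a::finite \<Rightarrow> nat" where "index_rank = (SOME f. inj f)"

lemma inj_index_rank: "inj (index_rank :: 'a::finite \<Rightarrow> nat)"
proof -
  have "\<exists>f :: 'a \<Rightarrow> nat. inj f" using finite_imp_inj_to_nat_seg[of "UNIV :: 'a set"] by auto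
  then show ?thesis unfolding index_rank_def by (rule someI_ex)
qed

instantiation ordered_index :: (finite) wellorder
begin

definition less_eq_ordered_index :: "'a ordered_index \<Rightarrow> 'a ordered_index \<Rightarrow> bool"
  where "x \<le> y \<longleftrightarrow> index_rank (Rep_ordered_index x) \<le> index_rank (Rep_ordered_index y)"

definition less_ordered_index :: "'a ordered_index \<Rightarrow> 'a ordered_index \<Rightarrow> bool"
  where "x < y \<longleftrightarrow> index_rank (Rep_ordered_index x) < index_rank (Rep_ordered_index y)"

instance
proof
  fix x y z :: "'a ordered_index" and P and a :: "'a ordered_index"
  show "x < y \<longleftrightarrow> x \<le> y \<and> \<not> y \<le> x" "x \<le> x" "x \<le> y \<Longrightarrow> y \<le> z \<Longrightarrow> x \<le> z" "x \<le> y \<or> y \<le> x"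
    by (auto simp: less_eq_ordered_index_def less_ordered_index_def)
  show "x \<le> y \<Longrightarrow> y \<le> x \<Longrightarrow> x = y"
    unfolding less_eq_ordered_index_def
    by (metis inj_index_rank injD le_antisym ordered_index_inverse(1))
  show "P a" if ih: "\<And>x. (\<And>y. y < x \<Longrightarrow> P y) \<Longrightarrow> P x"
  proof (induction a rule: measure_induct_rule[of "\<lambda>x. index_rank (Rep_ordered_index x)"])
    case (less x)
    show ?case by (rule ih, rule less) (simp add: less_ordered_index_def)
  qed
qed

end

definition reindex :: "real ^ ('n::finite) ordered_index \<Rightarrow> real ^ 'n"
  where "reindex y = (\<chi> i. y $ Abs_ordered_index i)"

definition unindex :: "real ^ 'n::finite \<Rightarrow> real ^ 'n ordered_index"
  where "unindex x = (\<chi> i. x $ Rep_ordered_index i)"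

lemma reindex_unindex [simp]: "reindex (unindex x) = x" "unindex (reindex y) = y"
  by (simp_all add: reindex_def unindex_def vec_eq_iff)

lemma linear_reindex: "linear reindex" "linear unindex"
  by (rule linearI; simp add: reindex_def unindex_def vec_eq_iff)+

lemma bounded_linear_reindex: "bounded_linear reindex" "bounded_linear unindex"
  using linear_reindex linear_conv_bounded_linear by blast+

text \<open>Conjugation by the bijection of index types maps permutations bijectively to
  permutations and preserves their signs.\<close>

lemma det_reindex:
  fixes a :: "'n::finite \<Rightarrow> 'n \<Rightarrow> real"
  shows "det (\<chi> i j. a (Rep_ordered_index i) (Rep_ordered_index j)) = det (\<chi> i j. a i j)"
proof -
  let ?R = "Rep_ordered_index :: 'n ordered_index \<Rightarrow> 'n" and ?A = "Abs_ordered_index :: 'n \<Rightarrow> 'n ordered_index"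
  have bR: "bij ?R" and bA: "bij ?A"
    by (auto intro!: bijI' ) (metis ordered_index_inverse)+
  have "inv ?R = ?A" "inv ?A = ?R" by (rule inv_equality; simp)+
  then have mR: "map_permutation UNIV ?R p = ?R \<circ> p \<circ> ?A" and mA: "map_permutation UNIV ?A q = ?A \<circ> q \<circ> ?R" for p q
    using bR bA by (simp_all add: map_permutation_def restrict_id_def bij_is_surj fun_eq_iff)
  have pR: "?R \<circ> p \<circ> ?A permutes UNIV" "sign (?R \<circ> p \<circ> ?A) = sign p" if "p permutes UNIV" for p
    using map_permutation_permutes[OF bR that] sign_map_permutation[OF bij_is_inj[OF bR] that] unfolding mR by simp_all
  have pA: "?A \<circ> q \<circ> ?R permutes UNIV" if "q permutes UNIV" for q
    using map_permutation_permutes[OF bA that] unfolding mA by simp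
  show ?thesis
    unfolding det_def
  proof (rule sum.reindex_bij_witness[where i = "\<lambda>q. ?A \<circ> q \<circ> ?R" and j = "\<lambda>p. ?R \<circ> p \<circ> ?A"])
    fix p assume "p \<in> {p. p permutes (UNIV :: 'n ordered_index set)}"
    then have p: "p permutes UNIV" by simp
    show "?A \<circ> (?R \<circ> p \<circ> ?A) \<circ> ?R = p" by (simp add: fun_eq_iff)
    show "?R \<circ> p \<circ> ?A \<in> {p. p permutes UNIV}" using pR(1)[OF p] by simp
    have "(\<Prod>i\<in>UNIV. a i ((?R \<circ> p \<circ> ?A) i)) = (\<Prod>i\<in>UNIV. a (?R i) (?R (p i)))"
      using prod.reindex_bij_betw[OF bR, of "\<lambda>i. a i ((?R \<circ> p \<circ> ?A) i)"] by simp
    then show "of_int (sign (?R \<circ> p \<circ> ?A)) * (\<Prod>i\<in>UNIV. (\<chi> i j. a i j) $ i $ (?R \<circ> p \<circ> ?A) i)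
      = of_int (sign p) * (\<Prod>i\<in>UNIV. (\<chi> i j. a (?R i) (?R j)) $ i $ p i)"
      using pR(2)[OF p] by simp
  next
    fix q assume "q \<in> {q. q permutes (UNIV :: 'n set)}"
    then show "?A \<circ> q \<circ> ?R \<in> {p. p permutes UNIV}" using pA by simp
    show "?R \<circ> (?A \<circ> q \<circ> ?R) \<circ> ?A = q" by (simp add: fun_eq_iff)
  qed
qed

lemma det_conjugate_reindex:
  assumes "linear f"
  shows "det (matrix (\<lambda>y. unindex (f (reindex y)))) = det (matrix f)"
proof -
  have "reindex (axis j 1) = axis (Rep_ordered_index j) (1::real)" for j :: "'a ordered_index"
    by (auto simp: reindex_def vec_eq_iff axis_def)
  then have "matrix (\<lambda>y. unindex (f (reindex y))) = (\<chi> i j. f (axis (Rep_ordered_index j) 1) $ Rep_ordered_index i)"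
    by (simp add: matrix_def unindex_def)
  then show ?thesis
    using det_reindex[of "\<lambda>i j. f (axis j 1) $ i"] by (simp add: matrix_def)
qed

text \<open>The theorem applied here is about vector-valued integrands, so the scalar one is wrapped
  by \<open>vec\<close> and read off as a component. The integrals run over preimages under
  \<open>reindex\<close>, and the Jacobian determinant is unaffected by the relabelling.\<close>

lemma change_of_variables:
  fixes \<tau> \<sigma> :: "real ^ 'n::finite \<Rightarrow> real ^ 'n" and F :: "real ^ 'n \<Rightarrow> real"
  assumes \<tau>: "\<And>x. x \<in> S \<Longrightarrow> (\<tau> has_derivative \<tau>' x) (at x)" and \<sigma>: "\<And>x. x \<in> S \<Longrightarrow> \<sigma> (\<tau> x) = x"
    and c: "continuous_on (\<tau> ` S) \<sigma>"
    and int: "(\<lambda>y. \<bar>det (matrix (\<tau>' (reindex y)))\<bar> * F (\<tau> (reindex y))) absolutely_integrable_on (reindex -` S)"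
  shows "integral (reindex -` S) (\<lambda>y. \<bar>det (matrix (\<tau>' (reindex y)))\<bar> * F (\<tau> (reindex y)))
    = integral (reindex -` (\<tau> ` S)) (\<lambda>y. F (reindex y))"
proof -
  let ?S = "reindex -` S" and ?g = "\<lambda>y. unindex (\<tau> (reindex y))" and ?h = "\<lambda>y. unindex (\<sigma> (reindex y))"
  let ?f = "\<lambda>y. vec (F (reindex y)) :: real ^ 1"
  let ?G = "\<lambda>y. \<bar>det (matrix (\<tau>' (reindex y)))\<bar> * F (\<tau> (reindex y))"
  have im: "?g ` ?S = reindex -` (\<tau> ` S)"
  proof
    show "reindex -` (\<tau> ` S) \<subseteq> ?g ` ?S"
    proof
      fix y assume "y \<in> reindex -` (\<tau> ` S)"
      then obtain x where "x \<in> S" "reindex y = \<tau> x" by auto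
      then have "y = ?g (unindex x)" "unindex x \<in> ?S" by (metis reindex_unindex, simp)
      then show "y \<in> ?g ` ?S" by blast
    qed
  qed auto
  have dg: "(?g has_derivative (\<lambda>y'. unindex (\<tau>' (reindex y) (reindex y')))) (at y within ?S)" if "y \<in> ?S" for y
  proof -
    have "(reindex has_derivative reindex) (at y within ?S)" by (rule bounded_linear_imp_has_derivative[OF bounded_linear_reindex(1)])
    from has_derivative_compose[OF this \<tau>[of "reindex y"]] that
    have "((\<lambda>y. \<tau> (reindex y)) has_derivative (\<lambda>y'. \<tau>' (reindex y) (reindex y'))) (at y within ?S)" by simp
    then show ?thesis by (rule bounded_linear.has_derivative[OF bounded_linear_reindex(2)])
  qed
  have det: "det (matrix (\<lambda>y'. unindex (\<tau>' (reindex y) (reindex y')))) = det (matrix (\<tau>' (reindex y)))" if "y \<in> ?S" for y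
    using det_conjugate_reindex[OF has_derivative_linear[OF \<tau>]] that by simp
  have ch: "continuous_on (?g ` ?S) ?h"
    unfolding im
    by (intro continuous_on_compose2[OF linear_continuous_on[OF bounded_linear_reindex(2)]] continuous_on_compose2[OF c]
        linear_continuous_on[OF bounded_linear_reindex(1)]) auto
  have vG: "(\<lambda>y. \<bar>det (matrix (\<lambda>y'. unindex (\<tau>' (reindex y) (reindex y'))))\<bar> *\<^sub>R ?f (?g y)) y = vec (?G y)" if "y \<in> ?S" for y
    using det[OF that] by (simp add: vec_eq_iff)
  have lv: "bounded_linear (vec :: real \<Rightarrow> real ^ 1)"
    by (rule linear_conv_bounded_linear[THEN iffD1], rule linearI) (simp_all add: vec_eq_iff)
  have ivec: "integral T (\<lambda>y. vec (u y) :: real ^ 1) $ 1 = integral T u" if "(\<lambda>y. vec (u y) :: real ^ 1) integrable_on T"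
    for T and u :: "real ^ 'n ordered_index \<Rightarrow> real"
    using integral_component_eq_cart[OF that, of 1] by simp
  have aG: "(\<lambda>y. vec (?G y) :: real ^ 1) absolutely_integrable_on ?S"
    using absolutely_integrable_linear[OF int lv] by (simp add: o_def)
  then have aG': "(\<lambda>y. \<bar>det (matrix (\<lambda>y'. unindex (\<tau>' (reindex y) (reindex y'))))\<bar> *\<^sub>R ?f (?g y)) absolutely_integrable_on ?S"
    by (rule absolutely_integrable_spike[of _ _ "{}"]) (use vG in auto)
  define b where "b = integral ?S (\<lambda>y. \<bar>det (matrix (\<lambda>y'. unindex (\<tau>' (reindex y) (reindex y'))))\<bar> *\<^sub>R ?f (?g y))"
  have "?f absolutely_integrable_on (?g ` ?S) \<and> integral (?g ` ?S) ?f = b"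
    using has_absolute_integral_change_of_variables_invertible[where f = ?f and b = b and h = ?h, OF dg _ ch] \<sigma> aG' b_def by auto
  then have "?f absolutely_integrable_on (reindex -` (\<tau> ` S))" and I: "integral (reindex -` (\<tau> ` S)) ?f = b"
    unfolding im by blast+
  from ivec[OF set_lebesgue_integral_eq_integral(1)[OF this(1)]] I
  have "integral (reindex -` (\<tau> ` S)) (\<lambda>y. F (reindex y)) = b $ 1" by simp
  also have "b = integral ?S (\<lambda>y. vec (?G y))" unfolding b_def by (rule integral_cong) (rule vG)
  also have "\<dots> $ 1 = integral ?S ?G" by (rule ivec[OF set_lebesgue_integral_eq_integral(1)[OF aG]])
  finally show ?thesis by simp
qed

text \<open>The box is so large that it and its translates by \<open>t *\<^sub>R h\<close> with |t|
  < 1 all contain the open ball of radius \<open>R\<close>. The translation argument below compares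
  integrals over these boxes.\<close>

lemma cbox_superset_obtain:
  fixes h :: "'m::euclidean_space"
  obtains a where "\<And>y. y \<notin> cbox (- a) a \<Longrightarrow> R \<le> norm y" "\<And>y t. \<bar>t\<bar> < 1 \<Longrightarrow> y \<notin> cbox (- a + t *\<^sub>R h) (a + t *\<^sub>R h) \<Longrightarrow> R \<le> norm y"
    "box (- a) a \<noteq> {}"
proof -
  obtain a :: 'm where a: "ball 0 (\<bar>R\<bar> + norm h + 1) \<subseteq> box (- a) a"
    using bounded_subset_box_symmetric[OF bounded_ball] by blast
  show thesis
  proof (rule that[of a])
    show "R \<le> norm y" if "y \<notin> cbox (- a) a" for y
    proof (rule ccontr)
      assume "\<not> R \<le> norm y"
      then have "norm y < \<bar>R\<bar> + norm h + 1" using norm_ge_zero[of h] abs_ge_self[of R] by linarith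
      then have "y \<in> ball 0 (\<bar>R\<bar> + norm h + 1)" by simp
      then show False using a that box_subset_cbox by blast
    qed
    show "R \<le> norm y" if t: "\<bar>t\<bar> < 1" and y: "y \<notin> cbox (- a + t *\<^sub>R h) (a + t *\<^sub>R h)" for y t
    proof (rule ccontr)
      assume n: "\<not> R \<le> norm y"
      have "norm (y - t *\<^sub>R h) \<le> norm y + \<bar>t\<bar> * norm h" using norm_triangle_ineq4[of y "t *\<^sub>R h"] by simp
      also have "\<dots> \<le> norm y + 1 * norm h" using t by (intro add_left_mono mult_right_mono) auto
      finally have "norm (y - t *\<^sub>R h) < \<bar>R\<bar> + norm h + 1" using n abs_ge_self[of R] by linarith
      then have "y - t *\<^sub>R h \<in> ball 0 (\<bar>R\<bar> + norm h + 1)" by simp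
      then have "y - t *\<^sub>R h \<in> cbox (- a) a" using a box_subset_cbox by blast
      then have "y \<in> cbox (- a + t *\<^sub>R h) (a + t *\<^sub>R h)"
        by (simp add: mem_box inner_diff_left inner_add_left) (smt (verit))
      then show False using y by simp
    qed
    have "0 < \<bar>R\<bar> + norm h + 1" using norm_ge_zero[of h] abs_ge_zero[of R] by linarith
    then have "(0::'m) \<in> ball 0 (\<bar>R\<bar> + norm h + 1)" by simp
    then show "box (- a) a \<noteq> {}" using a by blast
  qed
qed

section \<open>Integrals of compactly supported functions\<close>

lemma compact_support_integrable:
  fixes w :: "'m::euclidean_space \<Rightarrow> real"
  assumes "continuous_on UNIV w" "\<And>y. R \<le> norm y \<Longrightarrow> w y = 0"
  shows "w absolutely_integrable_on UNIV" "(\<And>y. w y \<ge> 0) \<Longrightarrow> integral UNIV w = 0 \<Longrightarrow> w y = 0"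
proof -
  obtain a :: 'm where a: "\<And>y. y \<notin> cbox (- a) a \<Longrightarrow> R \<le> norm y" "box (- a) a \<noteq> {}"
    using cbox_superset_obtain[of R 0] by metis
  have c: "continuous_on (cbox (- a) a) w" using assms(1) continuous_on_subset by blast
  have eq: "(\<lambda>x. if x \<in> cbox (- a) a then w x else 0) = w" using a assms(2) by auto
  show "w absolutely_integrable_on UNIV"
    using absolutely_integrable_continuous[OF c] absolutely_integrable_restrict_UNIV[of "cbox (- a) a" w] unfolding eq by blast
  assume pos: "\<And>y. w y \<ge> 0" and z: "integral UNIV w = 0"
  have "integral (cbox (- a) a) w = 0"
    using Henstock_Kurzweil_Integration.integral_restrict_UNIV[of "cbox (- a) a" w] z unfolding eq by simp
  then have "\<forall>x\<in>cbox (- a) a. w x = 0" using integral_cbox_eq_0_iff[OF c a(2)] pos by blast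
  then show "w y = 0" using a(1) assms(2) by blast
qed

text \<open>Translation invariance takes the place of iterated integrals: the integral of
  \<open>v (y + t *\<^sub>R h)\<close> does not depend on \<open>t\<close>, and differentiating it
  under the integral sign at 0 yields the claim.\<close>

lemma integral_derivative_zero:
  fixes v :: "'m::euclidean_space \<Rightarrow> real"
  assumes v: "\<And>y. (v has_derivative v' y) (at y)" and c: "continuous_on UNIV (\<lambda>y. v' y h)"
    and z: "\<And>y. R \<le> norm y \<Longrightarrow> v y = 0"
  shows "integral UNIV (\<lambda>y. v' y h) = 0"
proof -
  \<comment> \<open>The margin 1 puts the points outside the box into the open exterior of the ball
    of radius \<open>R\<close>, where \<open>v\<close> vanishes in a neighbourhood and so does its
    derivative.\<close>
  obtain a :: 'm where a: "\<And>y. y \<notin> cbox (- a) a \<Longrightarrow> R + 1 \<le> norm y"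
    "\<And>y t. \<bar>t\<bar> < 1 \<Longrightarrow> y \<notin> cbox (- a + t *\<^sub>R h) (a + t *\<^sub>R h) \<Longrightarrow> R + 1 \<le> norm y"
    using cbox_superset_obtain[of "R + 1" h] by metis
  have cv: "continuous_on UNIV v"
    using v by (meson continuous_at_imp_continuous_on has_derivative_continuous)
  have U: "integral (cbox b d) v = integral UNIV v" if "\<And>y. y \<notin> cbox b d \<Longrightarrow> v y = 0" for b d
  proof -
    have "(\<lambda>x. if x \<in> cbox b d then v x else 0) = v" using that by auto
    then show ?thesis using Henstock_Kurzweil_Integration.integral_restrict_UNIV[of "cbox b d" v] by simp
  qed
  have const: "integral (cbox (- a) a) (\<lambda>y. v (y + t *\<^sub>R h)) = integral UNIV v" if "\<bar>t\<bar> < 1" for t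
  proof -
    have "integral (cbox (- a) a) (\<lambda>y. v (y + t *\<^sub>R h)) = integral (cbox (- a + t *\<^sub>R h) (a + t *\<^sub>R h)) v"
      using integral_shift_cbox_plus[where a = "- a" and b = a and c = "t *\<^sub>R h" and f = v]
      by (simp add: o_def add.commute)
    also have "\<dots> = integral UNIV v" by (rule U) (use a(2)[OF that] z in force)
    finally show ?thesis .
  qed
  have line: "((\<lambda>t. y + t *\<^sub>R h) has_derivative (\<lambda>s. s *\<^sub>R h)) (at t within T)" for y t T
    by (auto intro!: derivative_eq_intros)
  have dl: "((\<lambda>t. v (y + t *\<^sub>R h)) has_field_derivative v' (y + t *\<^sub>R h) h) (at t within T)" for y t T
    using has_derivative_compose[OF line[of y t T] v] linear_cmul[OF has_derivative_linear[OF v]]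
    by (simp add: has_field_derivative_def mult_commute_abs)
  have "((\<lambda>t. integral (cbox (- a) a) (\<lambda>y. v (y + t *\<^sub>R h))) has_field_derivative
      integral (cbox (- a) a) (\<lambda>y. v' (y + 0 *\<^sub>R h) h)) (at 0 within ball 0 1)"
  proof (rule leibniz_rule_field_derivative)
    show "(\<lambda>y. v (y + t *\<^sub>R h)) integrable_on cbox (- a) a" for t
      by (intro integrable_continuous continuous_on_compose2[OF cv] continuous_intros) auto
    show "continuous_on (ball 0 1 \<times> cbox (- a) a) (\<lambda>(t, y). v' (y + t *\<^sub>R h) h)"
      unfolding case_prod_unfold by (intro continuous_on_compose2[OF c] continuous_intros) auto
  qed (use dl in auto)
  then have d1: "((\<lambda>t. integral (cbox (- a) a) (\<lambda>y. v (y + t *\<^sub>R h))) has_field_derivative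
      integral (cbox (- a) a) (\<lambda>y. v' (y + 0 *\<^sub>R h) h)) (at 0)"
    unfolding at_within_open[of "0::real" "ball 0 1", OF centre_in_ball[THEN iffD2, OF zero_less_one] open_ball] .
  have "((\<lambda>t. integral (cbox (- a) a) (\<lambda>y. v (y + t *\<^sub>R h))) has_field_derivative 0) (at 0)"
    by (rule has_field_derivative_transform_within_open[where S = "ball 0 1", OF DERIV_const[of "integral UNIV v"]])
      (use const in auto)
  from DERIV_unique[OF d1 this] have b: "integral (cbox (- a) a) (\<lambda>y. v' y h) = 0" by simp
  have "v' y h = 0" if "y \<notin> cbox (- a) a" for y
  proof -
    have y: "y \<in> - cball 0 R" using a(1)[OF that] by simp
    have "((\<lambda>y. 0) has_derivative (\<lambda>h. 0)) (at y)" by simp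
    then have "(v has_derivative (\<lambda>h. 0)) (at y)"
      by (rule has_derivative_transform_within_open[of _ _ _ _ "- cball 0 R"]) (use y z in \<open>auto simp: open_Compl\<close>)
    from has_derivative_unique[OF v this] show ?thesis by metis
  qed
  then have "(\<lambda>x. if x \<in> cbox (- a) a then v' x h else 0) = (\<lambda>y. v' y h)" by auto
  then show ?thesis using Henstock_Kurzweil_Integration.integral_restrict_UNIV[of "cbox (- a) a" "\<lambda>y. v' y h"] b by simp
qed

section \<open>A divergence theorem\<close>

lemma zero_extension_smooth:
  fixes F :: "real ^ 'n::finite \<Rightarrow> real"
  assumes "open S" "smooth_on S F" "cball x0 r \<subseteq> S" "\<And>x. x \<in> S \<Longrightarrow> x \<notin> cball x0 r \<Longrightarrow> F x = 0"
  shows "smooth_on UNIV (\<lambda>x. if x \<in> S then F x else 0)"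
proof -
  let ?F = "\<lambda>x. if x \<in> S then F x else 0"
  have o: "open (- cball x0 r)" by (simp add: open_Compl)
  have "smooth_on S ?F" by (rule smooth_on_cong[OF assms(1,2)]) auto
  moreover have "smooth_on (- cball x0 r) ?F"
    by (rule smooth_on_cong[OF o smooth_on_const[OF o, of 0]]) (use assms(4) in auto)
  ultimately have "smooth_on (\<Union>{S, - cball x0 r}) ?F" using assms(1) o by (intro smooth_on_Union) auto
  moreover have "\<Union>{S, - cball x0 r} = UNIV" using assms(3) by auto
  ultimately show ?thesis by simp
qed

lemma reindex_support:
  obtains R where "\<And>y :: real ^ ('n::finite) ordered_index. R \<le> norm y \<Longrightarrow> reindex y \<notin> cball x0 r"
proof -
  obtain B where B: "B > 0" "\<And>x :: real ^ 'n. norm (unindex x) \<le> norm x * B"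
    using bounded_linear.pos_bounded[OF bounded_linear_reindex(2)] by blast
  have "reindex y \<notin> cball x0 r" if "(norm x0 + \<bar>r\<bar>) * B + 1 \<le> norm y" for y :: "real ^ 'n ordered_index"
  proof
    assume "reindex y \<in> cball x0 r"
    then have "norm (reindex y) \<le> norm x0 + \<bar>r\<bar>"
      using norm_triangle_ineq2[of "reindex y" x0] by (auto simp: dist_norm norm_minus_commute)
    then have "norm (reindex y) * B \<le> (norm x0 + \<bar>r\<bar>) * B" using B by (intro mult_right_mono) auto
    then show False using B(2)[of "reindex y"] that by simp
  qed
  then show thesis using that by blast
qed

text \<open>The open balls form the cover, while the closed balls, still inside the chart images,
  will carry the supports of bump functions.\<close>

lemma (in smooth_mfd) finite_chart_cover:
  assumes compact: "compact_space M"
  shows "\<exists>I. finite I \<and> (\<forall>(c, x0, r)\<in>I. c \<in> A \<and> 0 < r \<and> cball x0 r \<subseteq> snd c ` fst c) \<and>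
    topspace M \<subseteq> (\<Union>(c, x0, r)\<in>I. {q \<in> fst c. snd c q \<in> ball x0 r})"
proof -
  define good where "good = {(c, x0, r). c \<in> A \<and> (0::real) < r \<and> cball x0 r \<subseteq> snd c ` fst c}"
  define B where "B = (\<lambda>(c :: ('a, 'n) chart, x0, r). {q \<in> fst c. snd c q \<in> ball x0 r})"
  have oB: "openin M (B i)" if "i \<in> good" for i
    using that chart_preimage_open[OF _ open_ball] by (auto simp: B_def good_def)
  have cover: "topspace M \<subseteq> \<Union> (B ` good)"
  proof
    fix q assume q: "q \<in> topspace M"
    let ?c = "chart_at A q"
    note cA = chart_at(1)[OF q]
    have "open (snd ?c ` fst ?c)" using open_chart_image_sub[OF cA chart_openin[OF cA]] by blast
    then obtain r where r: "0 < r" "cball (snd ?c q) r \<subseteq> snd ?c ` fst ?c"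
      using chart_at(2)[OF q] open_contains_cball by (metis imageI)
    then have "(?c, snd ?c q, r) \<in> good" "q \<in> B (?c, snd ?c q, r)" using cA chart_at(2)[OF q] by (auto simp: good_def B_def)
    then show "q \<in> \<Union> (B ` good)" by blast
  qed
  have "\<exists>\<F>. finite \<F> \<and> \<F> \<subseteq> B ` good \<and> topspace M \<subseteq> \<Union>\<F>"
    using compact oB cover unfolding compact_space_alt by auto
  then obtain I where I: "finite I" "I \<subseteq> good" "topspace M \<subseteq> \<Union> (B ` I)"
    by (metis finite_subset_image)
  have "\<forall>(c, x0, r)\<in>I. c \<in> A \<and> 0 < r \<and> cball x0 r \<subseteq> snd c ` fst c" using I(2) by (auto simp: good_def)
  then show ?thesis using I(1,3) unfolding B_def by blast
qed

text \<open>What the divergence theorem has to know of the geometry: a positive density with the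
  transformation law of a measure, and a field whose coordinate divergences come from one function
  \<open>f\<close>.\<close>

locale compact_density = smooth_mfd M A for M :: "'a topology" and A :: "('a, 'n::finite) chart set" +
  fixes dens :: "('a, 'n) chart \<Rightarrow> 'a \<Rightarrow> real" and Y :: "('a, 'n) vfield" and f :: "'a \<Rightarrow> real"
  assumes compact: "compact_space M"
    and dens_pos: "\<And>c q. c \<in> A \<Longrightarrow> q \<in> fst c \<Longrightarrow> dens c q > 0"
    and dens_smooth: "\<And>c. c \<in> A \<Longrightarrow> smooth_fun A (fst c) (dens c)"
    and dens_trans: "\<And>c d q. c \<in> A \<Longrightarrow> d \<in> A \<Longrightarrow> q \<in> fst c \<Longrightarrow> q \<in> fst d \<Longrightarrow>
      dens c q = \<bar>det (matrix (transition_deriv c d q))\<bar> * dens d q"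
    and Y: "Y \<in> vfields A (topspace M)"
    and div: "\<And>c q. c \<in> A \<Longrightarrow> q \<in> fst c \<Longrightarrow>
      (\<Sum>k\<in>UNIV. differential A (\<lambda>q. dens c q * components A c q (Y q) $ k) q (coord_vector A c k q)) = dens c q * f q"
begin

definition chart_ball :: "('a, 'n) chart \<times> (real ^ 'n) \<times> real \<Rightarrow> 'a set"
  where "chart_ball i = (case i of (c, x0, r) \<Rightarrow> {q \<in> fst c. snd c q \<in> cball x0 r})"

definition good :: "('a, 'n) chart \<times> (real ^ 'n) \<times> real \<Rightarrow> bool"
  where "good i = (case i of (c, x0, r) \<Rightarrow> c \<in> A \<and> 0 < r \<and> cball x0 r \<subseteq> snd c ` fst c)"

definition supported :: "('a, 'n) chart \<times> (real ^ 'n) \<times> real \<Rightarrow> ('a \<Rightarrow> real) \<Rightarrow> bool"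
  where "supported i u \<longleftrightarrow> smooth_fun A (topspace M) u \<and> (\<forall>q\<in>topspace M. q \<notin> chart_ball i \<longrightarrow> u q = 0)"

text \<open>The integrand of \<open>u\<close> in the coordinates of the chart, extended by zero. It
  is smooth on the whole space if \<open>u\<close> is supported in the coordinate ball.\<close>

definition coord_fun :: "('a, 'n) chart \<times> (real ^ 'n) \<times> real \<Rightarrow> ('a \<Rightarrow> real) \<Rightarrow> real ^ 'n \<Rightarrow> real"
  where "coord_fun i u x = (if x \<in> snd (fst i) ` fst (fst i) then dens (fst i) (chart_inv (fst i) x) * u (chart_inv (fst i) x) else 0)"

text \<open>For \<open>u\<close> supported in the coordinate ball this is its integral over the
  manifold. Only such local integrals occur in the argument; a global integral is not
  introduced.\<close>

definition J :: "('a, 'n) chart \<times> (real ^ 'n) \<times> real \<Rightarrow> ('a \<Rightarrow> real) \<Rightarrow> real"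
  where "J i u = integral UNIV (\<lambda>y. coord_fun i u (reindex y))"

lemma goodD: "good (c, x0, r) \<Longrightarrow> c \<in> A" "good (c, x0, r) \<Longrightarrow> 0 < r" "good (c, x0, r) \<Longrightarrow> cball x0 r \<subseteq> snd c ` fst c"
  by (simp_all add: good_def)

lemma top_open: "openin M (topspace M)" by simp

lemma chart_sub: "c \<in> A \<Longrightarrow> fst c \<subseteq> topspace M" using openin_subset[OF chart_openin] .

lemma extension_smooth:
  assumes i: "good (c, x0, r)" and u: "smooth_fun A (fst c) u" and z: "\<And>q. q \<in> fst c \<Longrightarrow> snd c q \<notin> cball x0 r \<Longrightarrow> u q = 0"
  shows "smooth_on UNIV (\<lambda>x. if x \<in> snd c ` fst c then u (chart_inv c x) else 0)"
proof (rule zero_extension_smooth)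
  note cA = goodD(1)[OF i]
  show "open (snd c ` fst c)" using open_chart_image_sub[OF cA chart_openin[OF cA]] by blast
  show "smooth_on (snd c ` fst c) (\<lambda>x. u (chart_inv c x))" using smooth_funD[OF u cA] by (simp add: o_def)
  show "cball x0 r \<subseteq> snd c ` fst c" using goodD(3)[OF i] .
  show "u (chart_inv c x) = 0" if "x \<in> snd c ` fst c" "x \<notin> cball x0 r" for x
    using z[of "chart_inv c x"] that by (auto simp: chart_inv_right cA)
qed

lemma coord_fun_smooth:
  assumes i: "good (c, x0, r)" and u: "supported (c, x0, r) u"
  shows "smooth_on UNIV (coord_fun (c, x0, r) u)" "x \<notin> cball x0 r \<Longrightarrow> coord_fun (c, x0, r) u x = 0"
proof -
  note cA = goodD(1)[OF i]
  have s: "smooth_fun A (fst c) (\<lambda>q. dens c q * u q)"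
    using smooth_fun_mult[OF chart_openin[OF cA] dens_smooth[OF cA] smooth_fun_subset[OF _ chart_sub[OF cA]]] u
    by (simp add: supported_def)
  have z: "u q = 0" if "q \<in> fst c" "snd c q \<notin> cball x0 r" for q
    using u that chart_sub[OF cA] by (auto simp: supported_def chart_ball_def)
  show "smooth_on UNIV (coord_fun (c, x0, r) u)"
    using extension_smooth[OF i s] z by (simp add: coord_fun_def[abs_def] cong: if_cong)
  show "coord_fun (c, x0, r) u x = 0" if "x \<notin> cball x0 r"
    using z[of "chart_inv c x"] that by (auto simp: coord_fun_def chart_inv_right cA)
qed

lemma compactly_supported_integrable:
  fixes F :: "real ^ 'n \<Rightarrow> real"
  assumes "continuous_on UNIV F" "\<And>x. x \<notin> cball x0 r \<Longrightarrow> F x = 0"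
  shows "(\<lambda>y. F (reindex y)) absolutely_integrable_on UNIV"
    "(\<And>x. F x \<ge> 0) \<Longrightarrow> integral UNIV (\<lambda>y. F (reindex y)) = 0 \<Longrightarrow> F x = 0"
proof -
  obtain R where R: "\<And>y :: real ^ 'n ordered_index. R \<le> norm y \<Longrightarrow> reindex y \<notin> cball x0 r" using reindex_support by blast
  have c: "continuous_on UNIV (\<lambda>y. F (reindex y))"
    by (intro continuous_on_compose2[OF assms(1)] linear_continuous_on bounded_linear_reindex) auto
  show "(\<lambda>y. F (reindex y)) absolutely_integrable_on UNIV"
    by (rule compact_support_integrable(1)[OF c]) (use R assms(2) in blast)
  assume "\<And>x. F x \<ge> 0" "integral UNIV (\<lambda>y. F (reindex y)) = 0"
  then have "F (reindex (unindex x)) = 0"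
    using compact_support_integrable(2)[OF c, of R "unindex x"] R assms(2) by blast
  then show "F x = 0" by simp
qed

lemma coord_fun_integrable:
  assumes "good i" "supported i u"
  shows "(\<lambda>y. coord_fun i u (reindex y)) absolutely_integrable_on UNIV"
proof -
  obtain c x0 r where i: "i = (c, x0, r)" by (metis prod_cases3)
  show ?thesis unfolding i
    by (rule compactly_supported_integrable(1)[OF smooth_on_imp_continuous_on[OF coord_fun_smooth(1)] coord_fun_smooth(2)])
      (use assms i in auto)
qed

lemma J_sum:
  assumes "good i" "finite K" "\<And>k. k \<in> K \<Longrightarrow> supported i (u k)" "\<And>q. q \<in> topspace M \<Longrightarrow> w q = (\<Sum>k\<in>K. u k q)"
  shows "J i w = (\<Sum>k\<in>K. J i (u k))"
proof -
  obtain c x0 r where i: "i = (c, x0, r)" by (metis prod_cases3)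
  have cA: "c \<in> A" using assms(1) i goodD by blast
  have "coord_fun i w x = (\<Sum>k\<in>K. coord_fun i (u k) x)" for x
    using assms(4) chart_sub[OF cA] chart_inv_right(2)[of x c] by (auto simp: coord_fun_def i sum_distrib_left)
  then have "J i w = integral UNIV (\<lambda>y. \<Sum>k\<in>K. coord_fun i (u k) (reindex y))" by (simp add: J_def)
  also have "\<dots> = (\<Sum>k\<in>K. J i (u k))" unfolding J_def
    by (intro integral_sum set_lebesgue_integral_eq_integral(1)[OF coord_fun_integrable] assms)
  finally show ?thesis .
qed

text \<open>The support of \<open>u\<close> lies in both coordinate balls, so both integrands vanish
  outside the image of the overlap. There the transformation law of the density supplies the
  Jacobian factor.\<close>

lemma J_chart_independent:
  assumes i: "good i" "supported i u" and j: "good j" "supported j u"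
  shows "J i u = J j u"
proof -
  obtain c x0 r where ic: "i = (c, x0, r)" by (metis prod_cases3)
  obtain d x1 s where jd: "j = (d, x1, s)" by (metis prod_cases3)
  have cA: "c \<in> A" and dA: "d \<in> A" using i j goodD ic jd by blast+
  let ?S = "snd c ` (fst c \<inter> fst d)" and ?\<tau> = "snd d \<circ> chart_inv c" and ?\<sigma> = "snd c \<circ> chart_inv d"
  let ?\<tau>' = "\<lambda>x. frechet_derivative ?\<tau> (at x)"
  have im: "?\<tau> ` ?S = snd d ` (fst c \<inter> fst d)" using cA by (force simp: image_iff)
  have zi: "coord_fun i u x = 0" if "x \<notin> ?S" for x
  proof (cases "x \<in> snd c ` fst c")
    case True
    then obtain q where q: "q \<in> fst c" "x = snd c q" by blast
    then have "q \<notin> chart_ball j" using that by (auto simp: chart_ball_def jd)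
    then have "u q = 0" using j(2) q chart_sub[OF cA] by (auto simp: supported_def)
    then show ?thesis using q cA by (simp add: coord_fun_def ic)
  qed (simp add: coord_fun_def ic)
  have zj: "coord_fun j u x = 0" if "x \<notin> ?\<tau> ` ?S" for x
  proof (cases "x \<in> snd d ` fst d")
    case True
    then obtain q where q: "q \<in> fst d" "x = snd d q" by blast
    then have "q \<notin> chart_ball i" using that unfolding im by (auto simp: chart_ball_def ic)
    then have "u q = 0" using i(2) q chart_sub[OF dA] by (auto simp: supported_def)
    then show ?thesis using q dA by (simp add: coord_fun_def jd)
  qed (simp add: coord_fun_def jd)
  have eq: "\<bar>det (matrix (?\<tau>' x))\<bar> * coord_fun j u (?\<tau> x) = coord_fun i u x" if "x \<in> ?S" for x
  proof -
    obtain q where q: "q \<in> fst c" "q \<in> fst d" "x = snd c q" using \<open>x \<in> ?S\<close> by blast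
    show ?thesis
      using dens_trans[OF cA dA q(1,2)] q cA dA by (simp add: coord_fun_def ic jd transition_deriv_def)
  qed
  have r: "(\<lambda>y. if y \<in> reindex -` ?S then coord_fun i u (reindex y) else 0) = (\<lambda>y. coord_fun i u (reindex y))"
    "(\<lambda>y. if y \<in> reindex -` (?\<tau> ` ?S) then coord_fun j u (reindex y) else 0) = (\<lambda>y. coord_fun j u (reindex y))"
    using zi zj by (auto simp: fun_eq_iff)
  have ai: "(\<lambda>y. coord_fun i u (reindex y)) absolutely_integrable_on (reindex -` ?S)"
    using coord_fun_integrable[OF i] absolutely_integrable_restrict_UNIV[of "reindex -` ?S" "\<lambda>y. coord_fun i u (reindex y)"]
    unfolding r by blast
  have "integral (reindex -` ?S) (\<lambda>y. \<bar>det (matrix (?\<tau>' (reindex y)))\<bar> * coord_fun j u (?\<tau> (reindex y)))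
    = integral (reindex -` (?\<tau> ` ?S)) (\<lambda>y. coord_fun j u (reindex y))"
  proof (rule change_of_variables[where \<sigma> = ?\<sigma>])
    fix x assume "x \<in> ?S"
    then obtain q where q: "q \<in> fst c" "q \<in> fst d" "x = snd c q" by blast
    show "(?\<tau> has_derivative ?\<tau>' x) (at x)" using transition_deriv[OF cA dA q(1,2)] q by (simp add: transition_deriv_def)
    show "?\<sigma> (?\<tau> x) = x" using q cA dA by simp
  next
    show "continuous_on (?\<tau> ` ?S) ?\<sigma>"
      unfolding im using smooth_on_imp_continuous_on[OF transition_smooth[OF dA cA]] by (simp add: Int_commute)
    show "(\<lambda>y. \<bar>det (matrix (?\<tau>' (reindex y)))\<bar> * coord_fun j u (?\<tau> (reindex y))) absolutely_integrable_on (reindex -` ?S)"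
      by (rule absolutely_integrable_spike[OF ai, of "{}"]) (use eq in auto)
  qed
  moreover have "integral (reindex -` ?S) (\<lambda>y. \<bar>det (matrix (?\<tau>' (reindex y)))\<bar> * coord_fun j u (?\<tau> (reindex y)))
     = integral (reindex -` ?S) (\<lambda>y. coord_fun i u (reindex y))"
    by (rule integral_cong) (use eq in auto)
  moreover have "integral (reindex -` ?S) (\<lambda>y. coord_fun i u (reindex y)) = J i u"
    unfolding J_def using Henstock_Kurzweil_Integration.integral_restrict_UNIV[of "reindex -` ?S" "\<lambda>y. coord_fun i u (reindex y)"]
    unfolding r by simp
  moreover have "integral (reindex -` (?\<tau> ` ?S)) (\<lambda>y. coord_fun j u (reindex y)) = J j u"
    unfolding J_def using Henstock_Kurzweil_Integration.integral_restrict_UNIV[of "reindex -` (?\<tau> ` ?S)" "\<lambda>y. coord_fun j u (reindex y)"]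
    unfolding r by simp
  ultimately show ?thesis by simp
qed

text \<open>The integrand is the divergence of \<open>\<rho>\<close> times \<open>Y\<close>. In
  coordinates it is a sum of partial derivatives of the compactly supported functions
  \<open>v k\<close>, each of which integrates to zero.\<close>

lemma J_divergence:
  assumes i: "good i" and chi: "supported i \<rho>"
  shows "J i (\<lambda>q. \<rho> q * f q + differential A \<rho> q (Y q)) = 0"
proof -
  obtain c x0 r where ic: "i = (c, x0, r)" by (metis prod_cases3)
  note i = i[unfolded ic] and chi = chi[unfolded ic]
  note cA = goodD(1)[OF i] and oc = chart_openin[OF goodD(1)[OF i]]
  have chis: "smooth_fun A (fst c) \<rho>"
    using chi smooth_fun_subset[OF _ chart_sub[OF cA]] by (simp add: supported_def)
  have Yc: "Y \<in> vfields A (fst c)" using vfields_subset[OF Y chart_sub[OF cA]] .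
  define w where "w k q = dens c q * components A c q (Y q) $ k" for k q
  have ws: "smooth_fun A (fst c) (w k)" for k
    unfolding w_def by (intro smooth_fun_mult oc dens_smooth cA component_smooth[OF Yc cA oc]) auto
  have chiw: "smooth_fun A (fst c) (\<lambda>q. \<rho> q * w k q)" for k using smooth_fun_mult[OF oc chis ws] .
  define v where "v k x = (if x \<in> snd c ` fst c then \<rho> (chart_inv c x) * w k (chart_inv c x) else 0)" for k x
  have chi0: "\<rho> q = 0" if "q \<in> fst c" "snd c q \<notin> cball x0 r" for q
    using chi that chart_sub[OF cA] by (auto simp: supported_def chart_ball_def)
  have vs: "smooth_on UNIV (v k)" for k
    unfolding v_def using extension_smooth[OF i chiw] chi0 by simp
  have dv: "(v k has_derivative frechet_derivative (v k) (at x)) (at x)" for k x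
    using smooth_on_has_derivative[OF open_UNIV vs] by simp
  have v0: "v k x = 0" if "x \<notin> cball x0 r" for k x
    using chi0[of "chart_inv c x"] that by (auto simp: v_def chart_inv_right cA)
  have dv0: "partial_deriv k (v k) x = 0" if x: "x \<notin> cball x0 r" for k x
  proof -
    have "((\<lambda>x. 0) has_derivative (\<lambda>h. 0)) (at x)" by simp
    then have "(v k has_derivative (\<lambda>h. 0)) (at x)"
      by (rule has_derivative_transform_within_open[of _ _ _ _ "- cball x0 r"]) (use x v0 in \<open>auto simp: open_Compl\<close>)
    from has_derivative_unique[OF dv this] show ?thesis by (simp add: partial_deriv_def)
  qed
  have sum: "(\<Sum>k\<in>UNIV. partial_deriv k (v k) x) = coord_fun i (\<lambda>q. \<rho> q * f q + differential A \<rho> q (Y q)) x" for x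
  proof (cases "x \<in> snd c ` fst c")
    case True
    then obtain q where q: "q \<in> fst c" "x = snd c q" by blast
    have "partial_deriv k (v k) x = \<rho> q * differential A (w k) q (coord_vector A c k q) + differential A \<rho> q (coord_vector A c k q) * w k q" for k
    proof -
      have "differential A (\<lambda>q. \<rho> q * w k q) q (coord_vector A c k q) = frechet_derivative (v k) (at (snd c q)) (components A c q (coord_vector A c k q))"
        by (rule differential_in_chart[OF cA q(1) oc q(1) dv]) (simp add: v_def cA)
      then show ?thesis
        using differential_mult[OF oc q(1) chis ws] by (simp add: components_coord_vector[OF cA q(1)] partial_deriv_def q)
    qed
    then have "(\<Sum>k\<in>UNIV. partial_deriv k (v k) x) = \<rho> q * (\<Sum>k\<in>UNIV. differential A (w k) q (coord_vector A c k q))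
        + (\<Sum>k\<in>UNIV. differential A \<rho> q (coord_vector A c k q) * w k q)"
      by (simp add: sum.distrib sum_distrib_left)
    also have "(\<Sum>k\<in>UNIV. differential A (w k) q (coord_vector A c k q)) = dens c q * f q"
      using div[OF cA q(1)] by (simp add: w_def[abs_def])
    also have "(\<Sum>k\<in>UNIV. differential A \<rho> q (coord_vector A c k q) * w k q) = dens c q * differential A \<rho> q (Y q)"
    proof -
      note lin = differential_linear[OF oc chis q(1)]
      have "differential A \<rho> q (Y q) = differential A \<rho> q (\<Sum>k\<in>UNIV. components A c q (Y q) $ k *\<^sub>R coord_vector A c k q)"
        using coord_expand[OF cA q(1), of "Y q"] by simp
      then show ?thesis by (simp add: linear_sum[OF lin] linear_cmul[OF lin] w_def sum_distrib_left mult_ac)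
    qed
    finally show ?thesis using q cA by (simp add: coord_fun_def ic algebra_simps)
  next
    case False
    then have "x \<notin> cball x0 r" using goodD(3)[OF i] by blast
    then show ?thesis using False dv0 by (simp add: coord_fun_def ic)
  qed
  obtain R where R: "\<And>y :: real ^ 'n ordered_index. R \<le> norm y \<Longrightarrow> reindex y \<notin> cball x0 r" using reindex_support by blast
  have pc: "continuous_on UNIV (partial_deriv k (v k))" for k
    using smooth_on_imp_continuous_on[OF smooth_on_partial_deriv[OF open_UNIV vs]] .
  have "integral UNIV (\<lambda>y. partial_deriv k (v k) (reindex y)) = 0" for k
  proof -
    have "integral UNIV (\<lambda>y. (\<lambda>h. frechet_derivative (v k) (at (reindex y)) (reindex h)) (unindex (axis k 1))) = 0"
    proof (rule integral_derivative_zero)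
      show "((\<lambda>y. v k (reindex y)) has_derivative (\<lambda>h. frechet_derivative (v k) (at (reindex y)) (reindex h))) (at y)" for y
        using has_derivative_compose[OF bounded_linear_imp_has_derivative[OF bounded_linear_reindex(1)] dv] .
      show "v k (reindex y) = 0" if "R \<le> norm y" for y using v0 R that by blast
      show "continuous_on UNIV (\<lambda>y. frechet_derivative (v k) (at (reindex y)) (reindex (unindex (axis k 1))))"
        using continuous_on_compose2[OF pc[of k] linear_continuous_on[OF bounded_linear_reindex(1)], of UNIV]
        by (simp add: partial_deriv_def)
    qed
    then show ?thesis by (simp add: partial_deriv_def)
  qed
  moreover have "J i (\<lambda>q. \<rho> q * f q + differential A \<rho> q (Y q)) = (\<Sum>k\<in>UNIV. integral UNIV (\<lambda>y. partial_deriv k (v k) (reindex y)))"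
    unfolding J_def sum[symmetric]
    by (intro integral_sum set_lebesgue_integral_eq_integral(1)[OF compactly_supported_integrable(1)[OF pc dv0]]) auto
  ultimately show ?thesis by simp
qed

lemma f_smooth: "smooth_fun A (topspace M) f"
proof (rule smooth_fun_union[OF _ top_open])
  fix q assume q: "q \<in> topspace M"
  let ?c = "chart_at A q"
  note cA = chart_at(1)[OF q] and oc = chart_openin[OF chart_at(1)[OF q]]
  have Yc: "Y \<in> vfields A (fst ?c)" using vfields_subset[OF Y chart_sub[OF cA]] .
  have ws: "smooth_fun A (fst ?c) (\<lambda>q. dens ?c q * components A ?c q (Y q) $ k)" for k
    by (intro smooth_fun_mult oc dens_smooth cA component_smooth[OF Yc cA oc]) auto
  have "smooth_fun A (fst ?c) (\<lambda>s. inverse (dens ?c s) *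
      (\<Sum>k\<in>UNIV. differential A (\<lambda>q. dens ?c q * components A ?c q (Y q) $ k) s (coord_vector A ?c k s)))"
    using dens_pos[OF cA] by (intro smooth_fun_mult smooth_fun_inverse smooth_fun_sum oc dens_smooth cA
        differential_field_smooth ws coord_vector_vfields) force+
  then have "smooth_fun A (fst ?c) f"
    by (rule smooth_fun_cong[OF oc]) (use div[OF cA] dens_pos[OF cA] in \<open>force simp: field_simps\<close>)
  then show "\<exists>V. openin M V \<and> q \<in> V \<and> smooth_fun A V f" using oc chart_at(2)[OF q] by blast
qed

text \<open>With a partition of unity \<open>\<rho>\<close>, the integrals of \<open>f\<close>
  against the \<open>\<rho> i\<close> add up to minus those of the derivatives of the
  \<open>\<rho> i\<close> along \<open>Y\<close>. The latter are redistributed among the balls and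
  cancel, because the derivatives of the \<open>\<rho> i\<close> have sum zero. A nonnegative
  continuous integrand with integral zero then vanishes.\<close>

theorem divergence_nonneg_imp_zero:
  assumes f: "\<And>q. q \<in> topspace M \<Longrightarrow> f q \<ge> 0" and p: "p \<in> topspace M"
  shows "f p = 0"
proof -
  define B where "B = (\<lambda>(c :: ('a, 'n) chart, x0, r). {q \<in> fst c. snd c q \<in> ball x0 r})"
  obtain I where fin: "finite I" and balls: "\<forall>(c, x0, r)\<in>I. c \<in> A \<and> 0 < r \<and> cball x0 r \<subseteq> snd c ` fst c"
    and cover: "topspace M \<subseteq> (\<Union>(c, x0, r)\<in>I. {q \<in> fst c. snd c q \<in> ball x0 r})"
    using finite_chart_cover[OF compact] by (elim exE conjE) rule
  have I: "finite I" "I \<subseteq> Collect good" "topspace M \<subseteq> \<Union> (B ` I)"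
    using fin cover by (simp_all only: B_def) (use balls in \<open>auto simp: good_def\<close>)
  define \<eta> where "\<eta> i = (case i of (c, x0, r) \<Rightarrow> bump c x0 r)" for i :: "('a, 'n) chart \<times> (real ^ 'n) \<times> real"
  have good: "good i" if "i \<in> I" for i using I that by blast
  have eta: "smooth_fun A (topspace M) (\<eta> i)" "\<eta> i q \<ge> 0" "q \<notin> chart_ball i \<Longrightarrow> \<eta> i q = 0" "q \<in> B i \<Longrightarrow> \<eta> i q > 0"
    if "i \<in> I" for i q
  proof -
    obtain c x0 r where ic: "i = (c, x0, r)" by (metis prod_cases3)
    note g = goodD[OF good[OF that, unfolded ic]]
    show "smooth_fun A (topspace M) (\<eta> i)" using bump_smooth[OF g] by (simp add: \<eta>_def ic)
    show "\<eta> i q \<ge> 0" using bump_nonneg by (simp add: \<eta>_def ic)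
    show "\<eta> i q = 0" if "q \<notin> chart_ball i" using bump_eq_0_iff[OF g(2)] that by (auto simp: \<eta>_def ic chart_ball_def)
    show "\<eta> i q > 0" if "q \<in> B i" using bump_pos_iff[OF g(2)] that by (auto simp: \<eta>_def ic B_def)
  qed
  define s where "s q = (\<Sum>i\<in>I. \<eta> i q)" for q
  have s_pos: "s q > 0" if q: "q \<in> topspace M" for q
  proof -
    obtain i where "i \<in> I" "q \<in> B i" using I q by blast
    then show ?thesis unfolding s_def using I(1) eta(2,4) by (intro sum_pos2[of _ i]) blast+
  qed
  have ss: "smooth_fun A (topspace M) s" unfolding s_def by (intro smooth_fun_sum top_open eta)
  define \<rho> where "\<rho> i q = \<eta> i q * inverse (s q)" for i q
  have chis: "smooth_fun A (topspace M) (\<rho> i)" if "i \<in> I" for i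
    unfolding \<rho>_def using s_pos that by (intro smooth_fun_mult smooth_fun_inverse top_open eta ss) force+
  have chi: "supported i (\<rho> i)" if "i \<in> I" for i
    using chis[OF that] eta(3)[OF that] by (auto simp: supported_def \<rho>_def)
  have one: "(\<Sum>i\<in>I. \<rho> i q) = 1" if "q \<in> topspace M" for q
    unfolding \<rho>_def using s_pos[OF that] by (simp add: sum_distrib_right[symmetric] s_def)
  have mult_supp: "supported i (\<lambda>q. u q * w q)" "supported i (\<lambda>q. w q * u q)" if "supported i u" "smooth_fun A (topspace M) w" for i u w
    using that smooth_fun_mult[OF top_open] by (auto simp: supported_def)
  define w where "w i q = differential A (\<rho> i) q (Y q)" for i q
  have ws: "smooth_fun A (topspace M) (w i)" if "i \<in> I" for i
    unfolding w_def by (rule differential_field_smooth[OF top_open chis[OF that] Y])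
  have w: "supported i (w i)" if i: "i \<in> I" for i
    unfolding supported_def
  proof (intro conjI ballI impI ws i)
    fix q assume q: "q \<in> topspace M" "q \<notin> chart_ball i"
    obtain c x0 r where ic: "i = (c, x0, r)" by (metis prod_cases3)
    note g = goodD[OF good[OF i, unfolded ic]]
    have "openin M (topspace M - chart_ball i)"
      using chart_ball_closed(1)[OF g(1) compact_cball g(3)] by (auto simp: chart_ball_def ic)
    moreover have "\<rho> i s = 0" if "s \<in> topspace M - chart_ball i" for s using chi[OF i] that by (auto simp: supported_def)
    ultimately have "differential A (\<rho> i) q (Y q) = differential A (\<lambda>q. 0) q (Y q)" 
      using q by (intro differential_cong[of "topspace M - chart_ball i"]) auto
    then show "w i q = 0" using differential_const[OF top_open q(1)] by (simp add: w_def)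
  qed
  have wsum: "(\<Sum>i\<in>I. w i q) = 0" if q: "q \<in> topspace M" for q
  proof -
    have "(\<Sum>i\<in>I. w i q) = differential A (\<lambda>q. \<Sum>i\<in>I. \<rho> i q) q (Y q)"
      unfolding w_def by (rule differential_sum[OF top_open q chis, symmetric])
    also have "\<dots> = differential A (\<lambda>q. 1) q (Y q)" by (rule differential_cong[OF top_open q one])
    finally show ?thesis using differential_const[OF top_open q] by simp
  qed
  \<comment> \<open>The additional factor \<open>\<rho> a\<close> makes the integrand supported in
    the balls \<open>i\<close> and \<open>a\<close> alike, so that it may be integrated in the chart
    of \<open>a\<close>, where the sum over \<open>i\<close> can be carried out.\<close>
  have eq: "J i (\<lambda>q. \<rho> i q * f q) + (\<Sum>a\<in>I. J a (\<lambda>q. \<rho> a q * w i q)) = 0" if i: "i \<in> I" for i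
  proof -
    have u1: "supported i (\<lambda>q. \<rho> i q * f q)" using mult_supp(1)[OF chi[OF i] f_smooth] .
    have u2: "supported i (\<lambda>q. \<rho> a q * w i q)" if "a \<in> I" for a using mult_supp(2)[OF w[OF i] chis[OF that]] .
    \<comment> \<open>Additivity as the case of \<open>J_sum\<close> with two summands, indexed by
      the truth values.\<close>
    have "J i (\<lambda>q. \<rho> i q * f q + w i q) = (\<Sum>b\<in>{True, False}. J i (if b then (\<lambda>q. \<rho> i q * f q) else w i))"
      by (rule J_sum[OF good[OF i]]) (use u1 w[OF i] in auto)
    moreover have "J i (w i) = (\<Sum>a\<in>I. J i (\<lambda>q. \<rho> a q * w i q))"
      by (rule J_sum[OF good[OF i] I(1) u2]) (simp_all add: sum_distrib_right[symmetric] one)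
    moreover have "J i (\<lambda>q. \<rho> a q * w i q) = J a (\<lambda>q. \<rho> a q * w i q)" if a: "a \<in> I" for a
      by (rule J_chart_independent[OF good[OF i] u2[OF a] good[OF a] mult_supp(1)[OF chi[OF a] ws[OF i]]])
    ultimately show ?thesis using J_divergence[OF good[OF i] chi[OF i]] by (simp add: w_def[of i])
  qed
  have "(\<Sum>i\<in>I. J i (\<lambda>q. \<rho> i q * f q)) + (\<Sum>i\<in>I. \<Sum>a\<in>I. J a (\<lambda>q. \<rho> a q * w i q)) = 0"
    using eq by (simp add: sum.distrib[symmetric])
  moreover have "(\<Sum>i\<in>I. \<Sum>a\<in>I. J a (\<lambda>q. \<rho> a q * w i q)) = (\<Sum>a\<in>I. \<Sum>i\<in>I. J a (\<lambda>q. \<rho> a q * w i q))"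
    by (rule sum.swap)
  moreover have "(\<Sum>i\<in>I. J a (\<lambda>q. \<rho> a q * w i q)) = 0" if a: "a \<in> I" for a
  proof -
    have "(\<Sum>i\<in>I. J a (\<lambda>q. \<rho> a q * w i q)) = J a (\<lambda>q. 0)"
      by (rule J_sum[OF good[OF a] I(1), symmetric])
        (use mult_supp(1)[OF chi[OF a] ws] wsum in \<open>auto simp: sum_distrib_left[symmetric]\<close>)
    moreover have "coord_fun a (\<lambda>q. 0) = (\<lambda>x. 0)" by (auto simp: coord_fun_def)
    ultimately show ?thesis by (simp add: J_def)
  qed
  ultimately have total: "(\<Sum>i\<in>I. J i (\<lambda>q. \<rho> i q * f q)) = 0" by simp
  have cf_nonneg: "coord_fun i (\<lambda>q. \<rho> i q * f q) x \<ge> 0" if i: "i \<in> I" for i x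
  proof -
    obtain c x0 r where ic: "i = (c, x0, r)" by (metis prod_cases3)
    note cA = goodD(1)[OF good[OF i, unfolded ic]]
    have "0 \<le> dens c q * (\<rho> i q * f q)" if q: "q \<in> fst c" for q
      using dens_pos[OF cA q] eta(2)[OF i, of q] s_pos[of q] f[of q] chart_sub[OF cA] q
      by (intro mult_nonneg_nonneg) (auto simp: \<rho>_def intro!: mult_nonneg_nonneg)
    then show ?thesis by (auto simp: coord_fun_def ic chart_inv_right)
  qed
  have Jnn: "J i (\<lambda>q. \<rho> i q * f q) \<ge> 0" if "i \<in> I" for i
    unfolding J_def using coord_fun_integrable[OF good[OF that] mult_supp(1)[OF chi[OF that] f_smooth]] cf_nonneg[OF that]
    by (intro Henstock_Kurzweil_Integration.integral_nonneg set_lebesgue_integral_eq_integral(1)) auto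
  have "\<rho> i p * f p = 0" if i: "i \<in> I" for i
  proof -
    obtain c x0 r where ic: "i = (c, x0, r)" by (metis prod_cases3)
    note cA = goodD(1)[OF good[OF i, unfolded ic]]
    have sup: "supported i (\<lambda>q. \<rho> i q * f q)" using mult_supp(1)[OF chi[OF i] f_smooth] .
    have "J i (\<lambda>q. \<rho> i q * f q) = 0" by (rule sum_nonneg_0[OF I(1) Jnn total i])
    then have J0: "integral UNIV (\<lambda>y. coord_fun i (\<lambda>q. \<rho> i q * f q) (reindex y)) = 0" by (simp add: J_def)
    note gi = good[OF i, unfolded ic] and sp = sup[unfolded ic]
    have z: "coord_fun i (\<lambda>q. \<rho> i q * f q) x = 0" for x
    proof (rule compactly_supported_integrable(2)[OF _ _ cf_nonneg[OF i] J0])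
      show "continuous_on UNIV (coord_fun i (\<lambda>q. \<rho> i q * f q))"
        using smooth_on_imp_continuous_on[OF coord_fun_smooth(1)[OF gi sp]] by (simp only: ic)
      show "coord_fun i (\<lambda>q. \<rho> i q * f q) x = 0" if "x \<notin> cball x0 r" for x
        using coord_fun_smooth(2)[OF gi sp that] by (simp only: ic)
    qed
    show ?thesis
    proof (cases "p \<in> fst c")
      case True
      then show ?thesis using z[of "snd c p"] cA dens_pos[OF cA True] by (simp add: coord_fun_def ic)
    next
      case False
      then show ?thesis using chi[OF i] p by (auto simp: supported_def chart_ball_def ic)
    qed
  qed
  then have "(\<Sum>i\<in>I. \<rho> i p * f p) = 0" by (simp add: sum.neutral)
  then show ?thesis using one[OF p] by (simp add: sum_distrib_right[symmetric])
qed

end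

section \<open>Compact Hesse solitons\<close>

text \<open>\<open>(D\<^sub>U g)(V, Z)\<close>.\<close>

definition cov_metric ::
    "('a, 'n::finite) chart set \<Rightarrow> ('a, 'n) conn \<Rightarrow> ('a, 'n) metric \<Rightarrow> ('a, 'n) vfield \<Rightarrow> ('a, 'n) vfield \<Rightarrow>
      ('a, 'n) vfield \<Rightarrow> 'a \<Rightarrow> real"
  where "cov_metric A D g U V Z q =
    differential A (\<lambda>r. g r (V r) (Z r)) q (U q) - g q (D U V q) (Z q) - g q (V q) (D U Z q)"

text \<open>The value of D g on three copies of the vector with components \<open>h\<close>. As a
  polynomial in \<open>h\<close> with coefficients smooth in \<open>q\<close> it is visibly
  continuous in both, as the existence of a maximum requires.\<close>

definition chart_cubic ::
    "('a, 'n::finite) chart set \<Rightarrow> ('a, 'n) conn \<Rightarrow> ('a, 'n) metric \<Rightarrow> ('a, 'n) chart \<Rightarrow> 'a \<Rightarrow> real ^ 'n \<Rightarrow> real"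
  where "chart_cubic A D g c q h = (\<Sum>i\<in>UNIV. h $ i * (\<Sum>j\<in>UNIV. h $ j * (\<Sum>k\<in>UNIV. h $ k *
    cov_metric A D g (coord_vector A c i) (coord_vector A c j) (coord_vector A c k) q)))"

definition chart_square ::
    "('a, 'n::finite) chart set \<Rightarrow> ('a, 'n) metric \<Rightarrow> ('a, 'n) chart \<Rightarrow> 'a \<Rightarrow> real ^ 'n \<Rightarrow> real"
  where "chart_square A g c q h =
    (\<Sum>i\<in>UNIV. h $ i * (\<Sum>j\<in>UNIV. h $ j * g q (coord_vector A c i q) (coord_vector A c j q)))"

lemma (in smooth_mfd) coord_vector_det:
  assumes "c \<in> A" "q \<in> fst c"
  shows "det (\<chi> i j. coord_vector A c j q $ i) \<noteq> 0"
proof -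
  have "(\<chi> i j. components A c q (coord_vector A c j q) $ i) = mat 1"
    by (simp add: components_coord_vector[OF assms] vec_eq_iff mat_def axis_def)
  then show ?thesis
    using det_linear_image[OF components_linear[OF assms], of "\<lambda>j. coord_vector A c j q"] by auto
qed

context metric_frame
begin

text \<open>D g at a single point, expressed in the parallel frame; it takes vectors where
  \<open>cov_metric\<close> takes fields.\<close>

definition trilinear :: "'a \<Rightarrow> real ^ 'n \<Rightarrow> real ^ 'n \<Rightarrow> real ^ 'n \<Rightarrow> real"
  where "trilinear q u v w = (\<Sum>a\<in>UNIV. coef a q u * (\<Sum>b\<in>UNIV. coef b q v * (\<Sum>e\<in>UNIV. coef e q w * d a (G b e) q)))"

lemma g_coef: "q \<in> W \<Longrightarrow> g q u v = (\<Sum>b\<in>UNIV. \<Sum>e\<in>UNIV. coef b q u * coef e q v * G b e q)"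
proof -
  assume q: "q \<in> W"
  have "g q u v = g q (\<Sum>b\<in>UNIV. coef b q u *\<^sub>R E b q) (\<Sum>e\<in>UNIV. coef e q v *\<^sub>R E e q)"
    using coef_expand[OF q, of u] coef_expand[OF q, of v] by simp
  also have "\<dots> = (\<Sum>b\<in>UNIV. \<Sum>e\<in>UNIV. coef b q u * coef e q v * g q (E b q) (E e q))"
    by (rule bilinear_sum_both[OF g_bilinear[OF W_top[OF q]]])
  finally show ?thesis by (simp add: G_def)
qed

text \<open>Tensoriality: the derivatives of the coefficients of \<open>Y\<close> and
  \<open>Z\<close> cancel against the two terms with \<open>D\<close>, and derivatives of
  \<open>G\<close> remain.\<close>

lemma cov_metric_frame:
  assumes V: "openin M V" "V \<subseteq> W" "q \<in> V" and X: "X \<in> vfields A V" and Y: "Y \<in> vfields A V" and Z: "Z \<in> vfields A V"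
  shows "cov_metric A D g X Y Z q = trilinear q (X q) (Y q) (Z q)"
proof -
  have qW: "q \<in> W" using V by blast
  have y: "smooth_fun A V (\<lambda>r. coef b r (Y r))" and z: "smooth_fun A V (\<lambda>r. coef b r (Z r))" for b
    using coef_smooth[OF V(1,2)] Y Z by blast+
  have G: "smooth_fun A V (G b e)" for b e using smooth_fun_subset[OF G_smooth V(2)] .
  have yz: "smooth_fun A V (\<lambda>r. coef b r (Y r) * coef e r (Z r))" for b e using smooth_fun_mult[OF V(1) y z] .
  have yzG: "smooth_fun A V (\<lambda>r. coef b r (Y r) * coef e r (Z r) * G b e r)" for b e using smooth_fun_mult[OF V(1) yz G] .
  have s: "smooth_fun A V (\<lambda>r. \<Sum>e\<in>UNIV. coef b r (Y r) * coef e r (Z r) * G b e r)" for b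
    by (rule smooth_fun_sum[OF V(1) yzG])
  define dy where "dy b = differential A (\<lambda>r. coef b r (Y r)) q (X q)" for b
  define dz where "dz b = differential A (\<lambda>r. coef b r (Z r)) q (X q)" for b
  define dG where "dG b e = (\<Sum>a\<in>UNIV. coef a q (X q) * d a (G b e) q)" for b e
  let ?y = "\<lambda>b. coef b q (Y q)" and ?z = "\<lambda>b. coef b q (Z q)"
  have "differential A (\<lambda>r. g r (Y r) (Z r)) q (X q)
      = differential A (\<lambda>r. \<Sum>b\<in>UNIV. \<Sum>e\<in>UNIV. coef b r (Y r) * coef e r (Z r) * G b e r) q (X q)"
    by (rule differential_cong[OF V(1,3)]) (use V(2) in \<open>auto intro: g_coef\<close>)
  also have "\<dots> = (\<Sum>b\<in>UNIV. \<Sum>e\<in>UNIV. differential A (\<lambda>r. coef b r (Y r) * coef e r (Z r) * G b e r) q (X q))"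
    by (simp add: differential_sum[OF V(1,3)] s yzG)
  also have "\<dots> = (\<Sum>b\<in>UNIV. \<Sum>e\<in>UNIV. ?y b * ?z e * dG b e + (?y b * dz e + dy b * ?z e) * G b e q)"
    using differential_mult[OF V(1,3) yz G] differential_mult[OF V(1,3) y z] differential_d[OF V(1,2) G V(3)]
    by (simp add: dy_def dz_def dG_def)
  finally have 1: "differential A (\<lambda>r. g r (Y r) (Z r)) q (X q) = \<dots>" .
  have 2: "g q (D X Y q) (Z q) = (\<Sum>b\<in>UNIV. \<Sum>e\<in>UNIV. dy b * ?z e * G b e q)"
    "g q (Y q) (D X Z q) = (\<Sum>b\<in>UNIV. \<Sum>e\<in>UNIV. ?y b * dz e * G b e q)"
    unfolding g_coef[OF qW] D_frame[OF V(1,2) X Y V(3)] D_frame[OF V(1,2) X Z V(3)] coef_sum[OF qW]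
    by (simp_all add: dy_def dz_def)
  have "cov_metric A D g X Y Z q = (\<Sum>b\<in>UNIV. \<Sum>e\<in>UNIV. ?y b * ?z e * dG b e)"
    unfolding cov_metric_def 1 2 by (simp add: sum_subtractf[symmetric] algebra_simps)
  also have "\<dots> = (\<Sum>b\<in>UNIV. \<Sum>e\<in>UNIV. \<Sum>a\<in>UNIV. coef a q (X q) * (?y b * (?z e * d a (G b e) q)))"
    by (simp add: dG_def sum_distrib_left mult_ac)
  also have "\<dots> = (\<Sum>b\<in>UNIV. \<Sum>a\<in>UNIV. \<Sum>e\<in>UNIV. coef a q (X q) * (?y b * (?z e * d a (G b e) q)))"
    by (rule sum.cong[OF refl], rule sum.swap)
  also have "\<dots> = trilinear q (X q) (Y q) (Z q)"
    unfolding trilinear_def sum_distrib_left by (rule sum.swap)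
  finally show ?thesis .
qed

lemma trilinear_linear:
  assumes q: "q \<in> W"
  shows "linear (\<lambda>u. trilinear q u v w)" "linear (\<lambda>v. trilinear q u v w)" "linear (\<lambda>w. trilinear q u v w)"
  by (rule linearI; simp add: trilinear_def linear_add[OF coef_linear[OF q]] linear_cmul[OF coef_linear[OF q]]
      distrib_left distrib_right sum.distrib sum_distrib_left mult_ac)+

lemma chart_cubic_frame:
  assumes c': "c' \<in> A" "q \<in> fst c'" and q: "q \<in> W"
  shows "chart_cubic A D g c' q (components A c' q v) = trilinear q v v v"
proof -
  define V where "V = W \<inter> fst c'"
  have V: "openin M V" "V \<subseteq> W" "V \<subseteq> fst c'" "q \<in> V" using oW chart_openin[OF c'(1)] q c' by (auto simp: V_def)
  have cv: "coord_vector A c' i \<in> vfields A V" for i using coord_vector_vfields[OF c'(1) V(1,3)] .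
  let ?h = "\<lambda>i. components A c' q v $ i" and ?e = "\<lambda>i. coord_vector A c' i q"
  note l = trilinear_linear[OF q]
  have ex: "v = (\<Sum>i\<in>UNIV. ?h i *\<^sub>R ?e i)" by (rule coord_expand[OF c'])
  have 3: "trilinear q u w v = (\<Sum>i\<in>UNIV. ?h i * trilinear q u w (?e i))" for u w
    using arg_cong[OF ex, of "trilinear q u w"] by (simp add: linear_sum[OF l(3)] linear_cmul[OF l(3)])
  have 2: "trilinear q u v w = (\<Sum>i\<in>UNIV. ?h i * trilinear q u (?e i) w)" for u w
    using arg_cong[OF ex, of "\<lambda>v. trilinear q u v w"] by (simp add: linear_sum[OF l(2)] linear_cmul[OF l(2)])
  have 1: "trilinear q v u w = (\<Sum>i\<in>UNIV. ?h i * trilinear q (?e i) u w)" for u w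
    using arg_cong[OF ex, of "\<lambda>v. trilinear q v u w"] by (simp add: linear_sum[OF l(1)] linear_cmul[OF l(1)])
  show ?thesis
    unfolding chart_cubic_def cov_metric_frame[OF V(1,2,4) cv cv cv]
    by (subst 1, subst 2, subst 3) (rule refl)
qed

end

context hess_frame
begin

lemma cubic_trilinear: "cubic (\<lambda>i. coef i q v) q = trilinear q v v v"
  by (simp add: cubic_def trilinear_def)

lemma square_g: "q \<in> W \<Longrightarrow> square (\<lambda>i. coef i q v) q = g q v v"
  by (simp add: square_def g_coef sum_distrib_left mult.assoc)

text \<open>Polarization of a totally symmetric cubic form: shifts by \<open>w\<close> and by its
  negative isolate the quadratic part, and a sum of two basis vectors isolates the mixed
  entries.\<close>

lemma cubic_zero_imp:
  assumes q: "q \<in> W" and z: "\<And>a. cubic a q = 0"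
  shows "d k (G i j) q = 0"
proof -
  note delta = if_distrib[of "\<lambda>x. x * _"] if_distrib[of "\<lambda>x. _ * x"]
  have k0: "d k (G k k) q = 0"
    using z[of "\<lambda>i. (if i = k then 1 else 0) + 0 * 0"] unfolding cubic_shift[OF q] by simp
  have Q: "(\<Sum>i\<in>UNIV. \<Sum>j\<in>UNIV. w i * w j * d k (G i j) q) = 0" for w
    using z[of "\<lambda>i. (if i = k then 1 else 0) + 1 * w i"] z[of "\<lambda>i. (if i = k then 1 else 0) + (-1) * w i"]
    unfolding cubic_shift[OF q] k0 z by simp
  have diag: "d k (G i i) q = 0" for i
    using Q[of "\<lambda>l. if l = i then 1 else 0"] by (simp add: delta cong: if_cong)
  show ?thesis
  proof (cases "i = j")
    case False
    have "(\<Sum>a\<in>UNIV. \<Sum>b\<in>UNIV. ((if a = i then 1 else 0) + (if a = j then 1 else 0)) * ((if b = i then 1 else 0) + (if b = j then 1 else 0)) * d k (G a b) q) = 0"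
      by (rule Q)
    then have "d k (G i i) q + d k (G i j) q + (d k (G j i) q + d k (G j j) q) = 0"
      by (simp add: distrib_right distrib_left sum.distrib delta cong: if_cong)
    then show ?thesis using diag d_G_sym[OF q, of k i j] by simp
  qed (simp add: diag)
qed

end

section \<open>Vanishing of the first Koszul form\<close>

context hessian_mfd
begin

lemma riem: "riemannian_metric M A g" using hess by (simp add: hessian_manifold_def)

lemma g_props: "q \<in> topspace M \<Longrightarrow> bilinear (g q)" "q \<in> topspace M \<Longrightarrow> g q u v = g q v u"
  "q \<in> topspace M \<Longrightarrow> v \<noteq> 0 \<Longrightarrow> g q v v > 0"
  using riem unfolding riemannian_metric_def by blast+

lemma g_smooth_fun: "openin M V \<Longrightarrow> X \<in> vfields A V \<Longrightarrow> Y \<in> vfields A V \<Longrightarrow> smooth_fun A V (\<lambda>q. g q (X q) (Y q))"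
  using riem unfolding riemannian_metric_def by simp

lemma unit_frame_exists:
  assumes c: "c \<in> A" "p \<in> fst c" and u: "g p u u = 1"
  shows "\<exists>W E \<phi>. hess_frame M A D c W E g \<phi> \<and> p \<in> W \<and> E z p = u \<and> (\<forall>i j. g p (E i p) (E j p) = (if i = j then 1 else 0))"
proof -
  have pM: "p \<in> topspace M" using chart_subset[OF c] .
  obtain e where e: "e z = u" "\<forall>i j. g p (e i) (e j) = (if i = j then 1 else 0)"
    using orthonormal_extension[of "g p" u z] g_props[OF pM] u by blast
  obtain W E \<phi> where fr: "hess_frame M A D c W E g \<phi>" "p \<in> W" "\<forall>i. E i p = e i"
    using hess_frame_exists[OF c, of e] e(2) by blast
  then have "\<forall>i j. g p (E i p) (E j p) = (if i = j then 1 else 0)" "E z p = u" using e by simp_all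
  with fr(1,2) show ?thesis by blast
qed

lemma normalize:
  assumes p: "p \<in> topspace M" and v: "v \<noteq> 0"
  shows "g p ((1 / sqrt (g p v v)) *\<^sub>R v) ((1 / sqrt (g p v v)) *\<^sub>R v) = 1"
proof -
  have l: "linear (\<lambda>x. g p x y)" "linear (g p x)" for x y using g_props(1)[OF p] unfolding bilinear_def by blast+
  show ?thesis using g_props(3)[OF p v]
    by (simp add: linear_cmul[OF l(1)] linear_cmul[OF l(2)] power2_eq_square[symmetric])
qed

lemma frame_exists:
  assumes c: "c \<in> A" "p \<in> fst c"
  shows "\<exists>W E \<phi>. hess_frame M A D c W E g \<phi> \<and> p \<in> W \<and> (\<forall>i j. g p (E i p) (E j p) = (if i = j then 1 else 0))"
proof -
  have "(axis undefined 1 :: real ^ 'n) \<noteq> 0" by simp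
  from unit_frame_exists[OF c normalize[OF chart_subset[OF c] this], of undefined] show ?thesis by blast
qed

lemma density_pos: "c \<in> A \<Longrightarrow> q \<in> fst c \<Longrightarrow> density A g c q > 0"
  unfolding density_def using gram_det_pos[OF g_props(1,2) _ coord_vector_det, of q] g_props(3) chart_subset by simp

lemma density_smooth_fun:
  assumes c: "c \<in> A"
  shows "smooth_fun A (fst c) (density A g c)"
proof -
  note oc = chart_openin[OF c]
  have cv: "coord_vector A c i \<in> vfields A (fst c)" for i using coord_vector_vfields[OF c oc] by blast
  show ?thesis unfolding density_def[abs_def]
    using smooth_fun_det[OF oc, of "\<lambda>i j q. g q (coord_vector A c i q) (coord_vector A c j q)"] g_smooth_fun[OF oc cv cv]
      density_pos[OF c] unfolding density_def real_sqrt_gt_0_iff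
    by (intro smooth_fun_sqrt oc) auto
qed

lemma density_transition:
  assumes c: "c \<in> A" "q \<in> fst c" and d: "d \<in> A" "q \<in> fst d"
  shows "density A g c q = \<bar>det (matrix (transition_deriv c d q))\<bar> * density A g d q"
proof -
  have "coord_vector A c i q = (\<Sum>k\<in>UNIV. transition_deriv c d q (axis i 1) $ k *\<^sub>R coord_vector A d k q)" for i
    using coord_expand[OF d, of "coord_vector A c i q"] components_change[OF c d] components_coord_vector[OF c] by simp
  then have "det (\<chi> i j. g q (coord_vector A c i q) (coord_vector A c j q))
      = (det (\<chi> i j. transition_deriv c d q (axis j 1) $ i))\<^sup>2 * det (\<chi> i j. g q (coord_vector A d i q) (coord_vector A d j q))"
    using matrix_of_bilinear[OF g_props(1)[OF chart_subset[OF c]], of "\<lambda>k i. transition_deriv c d q (axis i 1) $ k" "\<lambda>k. coord_vector A d k q"]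
    by simp
  then show ?thesis by (simp add: density_def matrix_def real_sqrt_mult)
qed

text \<open>The divergence \<open>f\<close> of \<open>Y\<close> is |\<alpha>|^2 minus
  \<open>l\<close> times the dimension. For nonpositive \<open>l\<close> it is a sum of two
  nonnegative terms, so the divergence theorem makes both vanish.\<close>

lemma koszul1_vanishes:
  assumes compact: "compact_space M" and sol: "hesse_soliton M A D g X l" and l: "l \<le> 0" and p: "p \<in> topspace M"
  shows "l = 0" "koszul1 A D g p u = 0"
proof -
  have X: "X \<in> vfields A (topspace M)" using sol by (simp add: hesse_soliton_def)
  \<comment> \<open>The sign is opposite to that in \<open>soliton_divergence\<close>, so that the
    divergence becomes nonnegative.\<close>
  define Y where "Y q = X q - raise_koszul A D g q" for q
  define f where "f q = koszul1 A D g q (raise_koszul A D g q) - l * real CARD('n)" for q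
  \<comment> \<open>The pointwise facts are collected in one statement because all of them are
    proved in a frame chosen near the given point; none of them mentions the frame.\<close>
  have local: "(\<exists>W. openin M W \<and> q \<in> W \<and> Y \<in> vfields A W) \<and> f q \<ge> - (l * real CARD('n)) \<and>
      (\<Sum>k\<in>UNIV. differential A (\<lambda>q. density A g c q * components A c q (Y q) $ k) q (coord_vector A c k q)) = density A g c q * f q \<and>
      (koszul1 A D g q (raise_koszul A D g q) = 0 \<longrightarrow> koszul1 A D g q v = 0)"
    if c: "c \<in> A" and q: "q \<in> fst c" for c q v
  proof -
    obtain W E \<phi> where fr: "hess_frame M A D c W E g \<phi>" and qW: "q \<in> W"
      and on: "\<And>i j. g q (E i q) (E j q) = (if i = j then 1 else 0)"
      using frame_exists[OF c q] by blast
    interpret F: hess_frame M A D c W E g \<phi> by (rule fr)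
    have XW: "X \<in> vfields A W" using vfields_subset[OF X openin_subset[OF F.oW]] .
    have sub: "(\<lambda>q. V q + (-1) *\<^sub>R V' q) \<in> vfields A W" if "V \<in> vfields A W" "V' \<in> vfields A W" for V V'
      using that by (intro vfields_add vfields_scaleR smooth_fun_const F.oW)
    have YW: "Y \<in> vfields A W"
      using sub[OF XW F.raise_koszul_vfields] by (simp add: Y_def[abs_def])
    have YW': "(\<lambda>q. raise_koszul A D g q - X q) \<in> vfields A W"
      using sub[OF F.raise_koszul_vfields XW] by simp
    have on': "F.G i j q = (if i = j then 1 else 0)" for i j using on by (simp add: F.G_def)
    have "koszul2 A D g (E i) (E i) q - 1 / 2 * lie_deriv_metric A X g (E i) (E i) q = l * g q (E i q) (E i q)" for i
      using sol F.oW F.E qW unfolding hesse_soliton_def by blast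
    note S = F.soliton_divergence[OF qW on' XW this]
    have "F.d i (\<lambda>r. F.coef i r (Y r)) q = - F.d i (\<lambda>r. F.coef i r (raise_koszul A D g r - X r)) q" for i
    proof -
      have "F.d i (\<lambda>r. F.coef i r (Y r)) q = F.d i (\<lambda>r. 0 - F.coef i r (raise_koszul A D g r - X r)) q"
        by (rule F.d_cong[OF qW]) (simp add: Y_def linear_diff[OF F.coef_linear])
      also have "\<dots> = - F.d i (\<lambda>r. F.coef i r (raise_koszul A D g r - X r)) q"
        using F.d_diff[OF qW smooth_fun_const[OF F.oW] F.coef_smooth[OF F.oW order_refl YW'], of i 0 i] qW by simp
      finally show ?thesis .
    qed
    moreover have "koszul1 A D g q (Y q) = - koszul1 A D g q (raise_koszul A D g q - X q)"
      by (simp add: F.koszul1_frame[OF qW] Y_def linear_diff[OF F.coef_linear[OF qW]] sum_negf[symmetric] algebra_simps)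
    ultimately have "(\<Sum>i\<in>UNIV. F.d i (\<lambda>r. F.coef i r (Y r)) q) + koszul1 A D g q (Y q) = f q"
      using S(1) by (simp add: sum_negf f_def)
    moreover have "koszul1 A D g q (raise_koszul A D g q) \<ge> 0" unfolding S(2) by (intro sum_nonneg) auto
    moreover have "koszul1 A D g q v = 0" if "koszul1 A D g q (raise_koszul A D g q) = 0"
    proof -
      have "(\<Sum>i\<in>UNIV. (F.al i q)\<^sup>2) = 0" using that S(2) by simp
      then have "F.al i q = 0" for i by (simp add: sum_nonneg_eq_0_iff)
      then show ?thesis by (simp add: F.koszul1_frame[OF qW])
    qed
    ultimately show ?thesis using F.divergence_in_chart[OF qW YW] F.oW qW YW by (auto simp: f_def)
  qed
  have fpos: "f q \<ge> 0" if q: "q \<in> topspace M" for q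
    using local[OF chart_at[OF q]] l mult_nonpos_nonneg[of l "real CARD('n)"] by (metis neg_0_le_iff_le of_nat_0_le_iff order_trans)
  interpret compact_density M A "density A g" Y f
  proof
    show "Y \<in> vfields A (topspace M)" using local chart_at by (intro vfields_union) blast+
  qed (use compact density_pos density_smooth_fun density_transition local in blast)+
  have f0: "f q = 0" if "q \<in> topspace M" for q using divergence_nonneg_imp_zero[OF fpos that] .
  \<comment> \<open>As \<open>f\<close> is zero and |\<alpha>|^2 is nonnegative, \<open>l\<close>
    times the dimension cannot be negative.\<close>
  have "l * real CARD('n) \<ge> 0" using local[OF chart_at[OF p]] f0[OF p] by force
  then show l0: "l = 0" using l by (simp add: zero_le_mult_iff)
  show "koszul1 A D g p u = 0" using local[OF chart_at[OF p]] f0[OF p] l0 by (simp add: f_def)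
qed

end

text \<open>The preferred chart makes this a function of all tangent vectors at once;
  \<open>cubic_form_chart\<close> shows that any other chart gives the same value.\<close>

definition cubic_form ::
    "('a, 'n::finite) chart set \<Rightarrow> ('a, 'n) conn \<Rightarrow> ('a, 'n) metric \<Rightarrow> 'a \<Rightarrow> real ^ 'n \<Rightarrow> real"
  where "cubic_form A D g q v = chart_cubic A D g (chart_at A q) q (components A (chart_at A q) q v)"

context metric_frame
begin

lemma cubic_form_frame: "q \<in> W \<Longrightarrow> cubic_form A D g q v = trilinear q v v v"
  unfolding cubic_form_def using chart_cubic_frame chart_at W_top by blast

end

context hess_frame
begin

lemma cubic_eq_cubic_form:
  assumes q: "q \<in> W"
  shows "cubic a q = cubic_form A D g q (\<Sum>i\<in>UNIV. a i *\<^sub>R E i q)" "square a q = g q (\<Sum>i\<in>UNIV. a i *\<^sub>R E i q) (\<Sum>i\<in>UNIV. a i *\<^sub>R E i q)"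
proof -
  have a: "(\<lambda>i. coef i q (\<Sum>i\<in>UNIV. a i *\<^sub>R E i q)) = a" by (simp add: coef_sum[OF q])
  show "cubic a q = cubic_form A D g q (\<Sum>i\<in>UNIV. a i *\<^sub>R E i q)"
    using cubic_trilinear[of q "\<Sum>i\<in>UNIV. a i *\<^sub>R E i q"] cubic_form_frame[OF q] unfolding a by simp
  show "square a q = g q (\<Sum>i\<in>UNIV. a i *\<^sub>R E i q) (\<Sum>i\<in>UNIV. a i *\<^sub>R E i q)"
    using square_g[OF q, of "\<Sum>i\<in>UNIV. a i *\<^sub>R E i q"] unfolding a by simp
qed

end

section \<open>The maximum of the cubic form over the unit vectors\<close>

context hessian_mfd
begin

lemma cubic_form_chart:
  assumes c: "c \<in> A" "q \<in> fst c"
  shows "chart_cubic A D g c q (components A c q v) = cubic_form A D g q v"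
proof -
  obtain W E \<phi> where fr: "hess_frame M A D c W E g \<phi>" and q: "q \<in> W"
    using frame_exists[OF c] by blast
  interpret F: hess_frame M A D c W E g \<phi> by (rule fr)
  show ?thesis using F.chart_cubic_frame[OF c q] F.cubic_form_frame[OF q] by simp
qed

lemma cubic_form_scale:
  assumes p: "q \<in> topspace M"
  shows "cubic_form A D g q (t *\<^sub>R v) = t ^ 3 * cubic_form A D g q v"
proof -
  obtain W E \<phi> where fr: "hess_frame M A D (chart_at A q) W E g \<phi>" and q: "q \<in> W"
    using frame_exists[OF chart_at[OF p]] by blast
  interpret F: hess_frame M A D "chart_at A q" W E g \<phi> by (rule fr)
  show ?thesis
    by (simp add: F.cubic_form_frame[OF q] linear_cmul[OF F.trilinear_linear(1)[OF q]]
      linear_cmul[OF F.trilinear_linear(2)[OF q]] linear_cmul[OF F.trilinear_linear(3)[OF q]] power3_eq_cube)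
qed

lemma g_scale:
  assumes q: "q \<in> topspace M"
  shows "g q (t *\<^sub>R v) (t *\<^sub>R v) = t\<^sup>2 * g q v v"
proof -
  have l: "linear (\<lambda>x. g q x y)" "linear (g q x)" for x y using g_props(1)[OF q] unfolding bilinear_def by blast+
  show ?thesis by (simp add: linear_cmul[OF l(1)] linear_cmul[OF l(2)] power2_eq_square)
qed

lemma chart_square_components:
  assumes c: "c \<in> A" "q \<in> fst c"
  shows "chart_square A g c q (components A c q v) = g q v v"
proof -
  have "g q v v = g q (\<Sum>i\<in>UNIV. components A c q v $ i *\<^sub>R coord_vector A c i q) (\<Sum>i\<in>UNIV. components A c q v $ i *\<^sub>R coord_vector A c i q)"
    using coord_expand[OF c, of v] by simp
  then show ?thesis
    unfolding bilinear_sum_both[OF g_props(1)[OF chart_subset[OF c]]] chart_square_def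
    by (simp add: sum_distrib_left mult.assoc)
qed

text \<open>The quotient \<open>F\<close> of the cubic form by the 3/2 power of the square length is
  invariant under positive scaling. Its maximum over vectors of unit length for g is therefore found
  over the compact product of a coordinate ball with the Euclidean unit sphere.\<close>

lemma cubic_ratio_maximum_on_ball:
  assumes c: "c \<in> A" and r: "0 < r" "cball x0 r \<subseteq> snd c ` fst c"
  shows "\<exists>p u. p \<in> topspace M \<and> g p u u = 1 \<and>
    (\<forall>q v. q \<in> fst c \<longrightarrow> snd c q \<in> ball x0 r \<longrightarrow> g q v v = 1 \<longrightarrow> cubic_form A D g q v \<le> cubic_form A D g p u)"
proof -
  define K where "K = cball x0 r \<times> sphere (0 :: real ^ 'n) 1"
  define P where "P z = chart_cubic A D g c (chart_inv c (fst z)) (snd z)" for z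
  define Q where "Q z = chart_square A g c (chart_inv c (fst z)) (snd z)" for z
  define F where "F z = P z / (Q z * sqrt (Q z))" for z
  note oc = chart_openin[OF c]
  have cv: "coord_vector A c i \<in> vfields A (fst c)" for i using coord_vector_vfields[OF c oc] by blast
  have cov: "smooth_fun A (fst c) (cov_metric A D g (coord_vector A c i) (coord_vector A c j) (coord_vector A c k))" for i j k
  proof -
    have "smooth_fun A (fst c) (\<lambda>q. differential A (\<lambda>r. g r (coord_vector A c j r) (coord_vector A c k r)) q (coord_vector A c i q) -
        g q (D (coord_vector A c i) (coord_vector A c j) q) (coord_vector A c k q) - g q (coord_vector A c j q) (D (coord_vector A c i) (coord_vector A c k) q))"
      by (intro smooth_fun_diff oc differential_field_smooth g_smooth_fun D_vfields cv)
    then show ?thesis by (simp add: cov_metric_def[abs_def])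
  qed
  have cont: "continuous_on K (\<lambda>z. f (chart_inv c (fst z)))" if f: "smooth_fun A (fst c) f" for f
  proof (rule continuous_on_compose2[of "snd c ` fst c" "\<lambda>x. f (chart_inv c x)"])
    show "continuous_on (snd c ` fst c) (\<lambda>x. f (chart_inv c x))"
      using smooth_on_imp_continuous_on[OF smooth_funD[OF f c]] by (simp add: comp_def)
    show "continuous_on K fst" by (rule continuous_on_fst[OF continuous_on_id])
    show "fst ` K \<subseteq> snd c ` fst c" using r(2) by (auto simp: K_def)
  qed
  have PK: "continuous_on K P" unfolding P_def chart_cubic_def by (intro continuous_intros cont cov)
  have QK: "continuous_on K Q" unfolding Q_def chart_square_def by (intro continuous_intros cont g_smooth_fun oc cv)
  have val: "P (snd c q, components A c q v) = cubic_form A D g q v" "Q (snd c q, components A c q v) = g q v v"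
    if q: "q \<in> fst c" for q v
    using cubic_form_chart[OF c q] chart_square_components[OF c q] by (simp_all add: P_def Q_def chart_inv_left[OF c q])
  have rep: "\<exists>q v. q \<in> fst c \<and> v \<noteq> 0 \<and> z = (snd c q, components A c q v)" if z: "z \<in> K" for z
  proof -
    have x: "fst z \<in> snd c ` fst c" and h: "snd z \<noteq> 0" using z r(2) by (auto simp: K_def)
    let ?q = "chart_inv c (fst z)"
    have q: "?q \<in> fst c" "snd c ?q = fst z" using chart_inv_right[OF x] by simp_all
    have "components A c ?q (\<Sum>i\<in>UNIV. snd z $ i *\<^sub>R coord_vector A c i ?q) = (\<Sum>i\<in>UNIV. snd z $ i *\<^sub>R axis i 1)"
      by (simp add: linear_sum[OF components_linear[OF c q(1)]] linear_cmul[OF components_linear[OF c q(1)]] components_coord_vector[OF c q(1)])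
    also have "\<dots> = snd z" using basis_expansion[of "snd z"] by (simp add: scalar_mult_eq_scaleR)
    finally have v: "components A c ?q (\<Sum>i\<in>UNIV. snd z $ i *\<^sub>R coord_vector A c i ?q) = snd z" .
    then have "(\<Sum>i\<in>UNIV. snd z $ i *\<^sub>R coord_vector A c i ?q) \<noteq> 0" using h components_eq_0_iff[OF c q(1)] by metis
    then show ?thesis using q v by (metis prod.collapse)
  qed
  have Qpos: "Q z > 0" if "z \<in> K" for z
    using rep[OF that] val(2) g_props(3) chart_subset[OF c] by metis
  have FK: "continuous_on K F" unfolding F_def
  proof (intro continuous_intros PK QK ballI)
    fix z assume "z \<in> K"
    then show "Q z * sqrt (Q z) \<noteq> 0" using Qpos by fastforce
  qed
  obtain e :: "real ^ 'n" where "norm e = 1" using vector_choose_size[of 1] by auto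
  then have "(x0, e) \<in> K" using r by (simp add: K_def)
  then have "K \<noteq> {}" by blast
  moreover have "compact K" unfolding K_def by (intro compact_Times compact_cball compact_sphere)
  ultimately obtain z where z: "z \<in> K" and max: "\<And>y. y \<in> K \<Longrightarrow> F y \<le> F z"
    using continuous_attains_sup[OF _ _ FK] by blast
  obtain p w where p: "p \<in> fst c" "w \<noteq> 0" "z = (snd c p, components A c p w)" using rep[OF z] by blast
  have pM: "p \<in> topspace M" using chart_subset[OF c p(1)] .
  define u where "u = (1 / sqrt (g p w w)) *\<^sub>R w"
  have u1: "g p u u = 1" unfolding u_def by (rule normalize[OF pM p(2)])
  have gw: "g p w w > 0" using g_props(3)[OF pM p(2)] .
  have Fz: "F z = cubic_form A D g p u"
    using gw by (simp add: F_def p(3) val[OF p(1)] u_def cubic_form_scale[OF pM] power3_eq_cube)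
  have "cubic_form A D g q v \<le> cubic_form A D g p u" if q: "q \<in> fst c" "snd c q \<in> ball x0 r" and v: "g q v v = 1" for q v
  proof -
    have qM: "q \<in> topspace M" using chart_subset[OF c q(1)] .
    have "v \<noteq> 0" using v g_scale[OF qM, of 0 v] by auto
    then have h: "components A c q v \<noteq> 0" using components_eq_0_iff[OF c q(1)] by simp
    define t where "t = 1 / norm (components A c q v)"
    have t: "t > 0" using h by (simp add: t_def)
    have "norm (components A c q (t *\<^sub>R v)) = 1" using h by (simp add: linear_cmul[OF components_linear[OF c q(1)]] t_def)
    then have "(snd c q, components A c q (t *\<^sub>R v)) \<in> K" using q(2) by (simp add: K_def)
    from max[OF this] have "F (snd c q, components A c q (t *\<^sub>R v)) \<le> cubic_form A D g p u" using Fz by simp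
    moreover have "F (snd c q, components A c q (t *\<^sub>R v)) = cubic_form A D g q v"
      using t v by (simp add: F_def val[OF q(1)] cubic_form_scale[OF qM] g_scale[OF qM] real_sqrt_mult power3_eq_cube power2_eq_square)
    ultimately show ?thesis by simp
  qed
  then show ?thesis using pM u1 by blast
qed

text \<open>The largest of the finitely many local maxima will do, since the coordinate balls cover
  M. That M is nonempty guarantees at least one ball.\<close>

lemma cubic_form_maximum:
  assumes compact: "compact_space M"
  shows "\<exists>p u. p \<in> topspace M \<and> g p u u = 1 \<and>
    (\<forall>q v. q \<in> topspace M \<longrightarrow> g q v v = 1 \<longrightarrow> cubic_form A D g q v \<le> cubic_form A D g p u)"
proof -
  obtain I where I: "finite I" "\<forall>(c, x0, r)\<in>I. c \<in> A \<and> 0 < r \<and> cball x0 r \<subseteq> snd c ` fst c"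
    and cover: "topspace M \<subseteq> (\<Union>(c, x0, r)\<in>I. {q \<in> fst c. snd c q \<in> ball x0 r})"
    using finite_chart_cover[OF compact] by blast
  have "\<forall>i\<in>I. \<exists>p u. p \<in> topspace M \<and> g p u u = 1 \<and>
      (\<forall>q v. q \<in> fst (fst i) \<longrightarrow> snd (fst i) q \<in> ball (fst (snd i)) (snd (snd i)) \<longrightarrow> g q v v = 1 \<longrightarrow> cubic_form A D g q v \<le> cubic_form A D g p u)"
    using I(2) cubic_ratio_maximum_on_ball by auto
  then obtain P U where PU: "\<And>i. i \<in> I \<Longrightarrow> P i \<in> topspace M" "\<And>i. i \<in> I \<Longrightarrow> g (P i) (U i) (U i) = 1"
    "\<And>i q v. i \<in> I \<Longrightarrow> q \<in> fst (fst i) \<Longrightarrow> snd (fst i) q \<in> ball (fst (snd i)) (snd (snd i)) \<Longrightarrow> g q v v = 1 \<Longrightarrow>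
      cubic_form A D g q v \<le> cubic_form A D g (P i) (U i)"
    by metis
  have top: "topspace M \<noteq> {}" using hess by (simp add: hessian_manifold_def smooth_manifold_def)
  have ne: "I \<noteq> {}" using cover top by blast
  let ?val = "\<lambda>i. cubic_form A D g (P i) (U i)"
  obtain a where a: "a \<in> I" "?val a = Max (?val ` I)" using Max_in[of "?val ` I"] I(1) ne by fastforce
  have "cubic_form A D g q v \<le> ?val a" if q: "q \<in> topspace M" and v: "g q v v = 1" for q v
  proof -
    obtain i where i: "i \<in> I" "q \<in> fst (fst i)" "snd (fst i) q \<in> ball (fst (snd i)) (snd (snd i))" using cover q by force
    have "cubic_form A D g q v \<le> ?val i" by (rule PU(3)[OF i v])
    also have "\<dots> \<le> ?val a" unfolding a(2) by (rule Max_ge) (use I(1) i(1) in auto)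
    finally show ?thesis .
  qed
  then show ?thesis using PU(1,2)[OF a(1)] by blast
qed

section \<open>Consequences of a vanishing first Koszul form\<close>

context
  assumes compact: "compact_space M"
    and koszul0: "\<And>q u. q \<in> topspace M \<Longrightarrow> koszul1 A D g q u = 0"
begin

text \<open>The maximum \<open>m\<close> is nonnegative because the cubic form is odd. By
  homogeneity the bound at unit vectors extends to all vectors in the form that
  \<open>cubic_maximum_nonpos\<close> asks for; once \<open>m\<close> is 0 this bound makes the form
  nonpositive, and oddness makes it zero.\<close>

lemma cubic_form_zero:
  assumes qM: "q \<in> topspace M"
  shows "cubic_form A D g q v = 0"
proof -
  obtain p u where p: "p \<in> topspace M" and u: "g p u u = 1"
    and max: "\<And>q v. q \<in> topspace M \<Longrightarrow> g q v v = 1 \<Longrightarrow> cubic_form A D g q v \<le> cubic_form A D g p u"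
    using cubic_form_maximum[OF compact] by blast
  define m where "m = cubic_form A D g p u"
  have neg: "cubic_form A D g q (- v) = - cubic_form A D g q v" "g q (- v) (- v) = g q v v" if "q \<in> topspace M" for q v
    using cubic_form_scale[OF that, of "-1" v] g_scale[OF that, of "-1" v] by simp_all
  have m0: "0 \<le> m" using max[OF p, of "- u"] u by (simp add: neg[OF p] m_def)
  have le: "cubic_form A D g q v \<le> (m / 2) * (g q v v + g q v v * g q v v)" if q: "q \<in> topspace M" for q v
  proof (cases "v = 0")
    case True
    then show ?thesis using cubic_form_scale[OF q, of 0 v] g_scale[OF q, of 0 v] by simp
  next
    case False
    define t where "t = sqrt (g q v v)"
    have t: "t > 0" "t\<^sup>2 = g q v v" using g_props(3)[OF q False] by (simp_all add: t_def)
    have "cubic_form A D g q v = cubic_form A D g q (t *\<^sub>R ((1 / t) *\<^sub>R v))" using t by simp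
    also have "\<dots> = t ^ 3 * cubic_form A D g q ((1 / t) *\<^sub>R v)" by (rule cubic_form_scale[OF q])
    also have "\<dots> \<le> t ^ 3 * m"
      using max[OF q normalize[OF q False]] t by (intro mult_left_mono) (simp_all add: m_def t_def)
    \<comment> \<open>The inequality between the geometric and the arithmetic mean of
      \<open>t\<^sup>2\<close> and its square; it is an equality at \<open>t = 1\<close>, where the
      maximum is attained.\<close>
    also have "\<dots> \<le> (m / 2) * (t\<^sup>2 + t\<^sup>2 * t\<^sup>2)"
    proof -
      have "(m / 2) * (t\<^sup>2 + t\<^sup>2 * t\<^sup>2) - t ^ 3 * m = (m / 2) * (t * (t - 1))\<^sup>2"
        by (simp add: power2_eq_square power3_eq_cube algebra_simps)
      also have "\<dots> \<ge> 0" using m0 by simp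
      finally show ?thesis by simp
    qed
    finally show ?thesis by (simp add: t)
  qed
  \<comment> \<open>An arbitrary index; the frame is then chosen so that \<open>E z\<close> extends
    the maximizing vector.\<close>
  define z where "z = (undefined :: 'n)"
  obtain W E \<phi> where fr: "hess_frame M A D (chart_at A p) W E g \<phi>" and pW: "p \<in> W" and Ez: "E z p = u"
    and on: "\<And>i j. g p (E i p) (E j p) = (if i = j then 1 else 0)"
    using unit_frame_exists[OF chart_at[OF p] u, of z] by blast
  interpret F: hess_frame M A D "chart_at A p" W E g \<phi> by (rule fr)
  have al0: "F.al k q = 0" if q: "q \<in> W" for k q
    using koszul0[OF F.W_top[OF q], of "E k q"]
    by (simp add: F.koszul1_frame[OF q] F.coef_E[OF q] if_distrib[of "\<lambda>x. x * _"] cong: if_cong)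
  have mz: "F.d z (F.G z z) p = m"
    by (simp add: m_def F.cubic_form_frame[OF pW] Ez[symmetric] F.trilinear_def F.coef_E[OF pW] if_distrib[of "\<lambda>x. x * _"] cong: if_cong)
  have "m \<le> 0"
    by (rule F.cubic_maximum_nonpos[OF pW _ al0 mz m0])
      (simp_all only: F.G_def on F.cubic_eq_cubic_form le F.W_top)
  then have "cubic_form A D g q v \<le> 0" for v using le[OF qM, of v] m0 by simp
  from this[of v] this[of "- v"] show ?thesis by (simp add: neg[OF qM])
qed

text \<open>Polarization turns the vanishing of the cubic form at \<open>p\<close> into that of all
  frame derivatives of \<open>G\<close>, and these determine D g at \<open>p\<close>.\<close>

lemma cov_metric_zero:
  assumes V: "openin M V" "p \<in> V" and X: "X \<in> vfields A V" and Y: "Y \<in> vfields A V" and Z: "Z \<in> vfields A V"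
  shows "cov_metric A D g X Y Z p = 0"
proof -
  have p: "p \<in> topspace M" using V openin_subset by blast
  obtain W E \<phi> where fr: "hess_frame M A D (chart_at A p) W E g \<phi>" and pW: "p \<in> W"
    using frame_exists[OF chart_at[OF p]] by blast
  interpret F: hess_frame M A D "chart_at A p" W E g \<phi> by (rule fr)
  have "F.d k (F.G i j) p = 0" for i j k
    by (rule F.cubic_zero_imp[OF pW]) (simp add: F.cubic_eq_cubic_form[OF pW] cubic_form_zero[OF p])
  then have "F.trilinear p u v w = 0" for u v w by (simp add: F.trilinear_def)
  moreover have "openin M (V \<inter> W)" using V(1) F.oW by blast
  ultimately show ?thesis
    using F.cov_metric_frame[of "V \<inter> W" p X Y Z] vfields_subset[OF X] vfields_subset[OF Y] vfields_subset[OF Z] V(2) pW by simp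
qed

text \<open>Since D g = 0, the torsion free connection \<open>D\<close> is compatible with g, and
  \<open>D\<close> itself can be taken as the Levi-Civita connection in
  \<open>non_proper\<close>.\<close>

lemma koszul1_zero_imp_non_proper: "non_proper M A D g"
  unfolding non_proper_def
proof (intro exI conjI)
  have "differential A (\<lambda>q. g q (Y q) (Z q)) p (X p) = g p (D X Y p) (Z p) + g p (Y p) (D X Z p)"
    if "openin M W" "X \<in> vfields A W" "Y \<in> vfields A W" "Z \<in> vfields A W" "p \<in> W" for W X Y Z p
    using cov_metric_zero[OF that(1,5,2,3,4)] by (simp add: cov_metric_def)
  then show "levi_civita M A g D"
    using hess unfolding levi_civita_def hessian_manifold_def flat_connection_def by simp
  show "same_connection M A D D" by (simp add: same_connection_def)
qed

text \<open>The Einstein constant is 0, since the second Koszul form is a covariant derivative of a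
  form that vanishes identically.\<close>

lemma koszul1_zero_imp_hesse_einstein: "hesse_einstein M A D g"
  unfolding hesse_einstein_def
proof (intro conjI exI[of _ 0] allI impI ballI hess)
  fix W X Y p assume W: "openin M W" "p \<in> W"
  have M: "q \<in> topspace M" if "q \<in> W" for q using W openin_subset that by blast
  have "differential A (\<lambda>q. koszul1 A D g q (Y q)) p (X p) = differential A (\<lambda>q. 0) p (X p)"
    by (rule differential_cong[OF W]) (simp add: koszul0 M)
  then show "koszul2 A D g X Y p = 0 * g p (X p) (Y p)"
    using differential_const[OF W] by (simp add: koszul2_def cov_form_def koszul0 M W(2))
qed

end

end

theorem theorem4p1:
  fixes M :: "'a topology"
    and A :: "('a, 'n::finite) chart set"
    and D :: "('a, 'n) conn"
    and g :: "('a, 'n) metric"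
    and X :: "('a, 'n) vfield"
    and l :: real
  assumes "compact_space M"
    and "hesse_soliton M A D g X l"
  shows "\<not> l < 0 \<and> (l = 0 \<longrightarrow> non_proper M A D g \<and> hesse_einstein M A D g)"
proof -
  have hess: "hessian_manifold M A D g" using assms(2) by (simp add: hesse_soliton_def)
  interpret hessian_mfd M A D g
    by unfold_locales (use hess in \<open>simp_all add: hessian_manifold_def\<close>)
  have "topspace M \<noteq> {}" using hess unfolding hessian_manifold_def smooth_manifold_def by (elim conjE)
  then obtain p where p: "p \<in> topspace M" by blast
  \<comment> \<open>A negative \<open>l\<close> satisfies the hypothesis of the divergence argument,
    whose conclusion is \<open>l = 0\<close>.\<close>
  have "\<not> l < 0" using koszul1_vanishes(1)[OF assms _ p] by force
  moreover have "non_proper M A D g \<and> hesse_einstein M A D g" if "l = 0"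
    using koszul1_vanishes(2)[OF assms] koszul1_zero_imp_non_proper koszul1_zero_imp_hesse_einstein assms(1) that by blast
  ultimately show ?thesis by blast
qed

end
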